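(* Let $(u_0,u_1)\in\mathcal H(B^c)$ and let $u(t)=\mathscr S_N(t)(u_0,u_1)$ be the solution of the defocusing equation $\partial_t^2u-\Delta u+u^5=0$ on $B^c$ with Neumann boundary condition $\partial_ru=0$ at $r=1$ and data $(u_0,u_1)$. Assume that $u$ is global and that $K=\{\vec u(t):t\in\mathbb R\}$ has compact closure in $\mathcal H(B^c)$. Then $u=0$.
   Context: $B^c=\mathbb R^3\setminus B(0,1)$; $\mathcal H(B^c)$ is the space of radial pairs $(f,g)$ with $f\in L^6(B^c)$, $\nabla f\in L^2(B^c)$, $g\in L^2(B^c)$, normed by $(\int_{B^c}|\nabla f|^2+g^2)^{1/2}$. $\vec u=(u,\partial_tu)$. *)

theory Defs
  imports "HOL-Analysis.Analysis"
begin

type_synonym R3 = "real^3"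

text \<open>The exterior domain.  B is the open unit ball, so the closed exterior is
  B^c = {x. norm x >= 1}; its interior (where weak derivatives are taken) is
  {x. norm x > 1}.  The two differ by a null set, so all integrals agree.\<close>
definition Bc :: "R3 set" where "Bc = {x. 1 \<le> norm x}"
definition Bc_int :: "R3 set" where "Bc_int = {x. 1 < norm x}"

definition test_fun :: "R3 set \<Rightarrow> (R3 \<Rightarrow> real) \<Rightarrow> (R3 \<Rightarrow> R3) \<Rightarrow> bool" where
  "test_fun U phi dphi \<longleftrightarrow>
     (\<forall>x. (phi has_derivative (\<lambda>h. dphi x \<bullet> h)) (at x)) \<and> continuous_on UNIV dphi \<and>
     (\<exists>C. compact C \<and> C \<subseteq> U \<and> (\<forall>x. x \<notin> C \<longrightarrow> phi x = 0))"

definition weak_grad :: "R3 set \<Rightarrow> (R3 \<Rightarrow> real) \<Rightarrow> (R3 \<Rightarrow> R3) \<Rightarrow> bool" where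
  "weak_grad U f G \<longleftrightarrow>
     f \<in> borel_measurable (lebesgue_on U) \<and> G \<in> borel_measurable (lebesgue_on U) \<and>
     (\<forall>K. compact K \<longrightarrow> K \<subseteq> U \<longrightarrow>
          integrable (lebesgue_on K) f \<and> integrable (lebesgue_on K) (\<lambda>x. norm (G x))) \<and>
     (\<forall>phi dphi. test_fun U phi dphi \<longrightarrow>
        (\<forall>i. (\<integral>x. f x * (dphi x $ i) \<partial>lebesgue_on U)
              = - (\<integral>x. (G x $ i) * phi x \<partial>lebesgue_on U)))"

definition radial :: "(R3 \<Rightarrow> real) \<Rightarrow> bool" where
  "radial f \<longleftrightarrow> (\<forall>x y. x \<in> Bc \<longrightarrow> y \<in> Bc \<longrightarrow> norm x = norm y \<longrightarrow> f x = f y)"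

definition in_H :: "(R3 \<Rightarrow> real) \<Rightarrow> (R3 \<Rightarrow> R3) \<Rightarrow> (R3 \<Rightarrow> real) \<Rightarrow> bool" where
  "in_H f G g \<longleftrightarrow>
     radial f \<and> radial g \<and>
     weak_grad Bc_int f G \<and>
     integrable (lebesgue_on Bc) (\<lambda>x. \<bar>f x\<bar> ^ 6) \<and>
     integrable (lebesgue_on Bc) (\<lambda>x. norm (G x) ^ 2) \<and>
     g \<in> borel_measurable (lebesgue_on Bc) \<and>
     integrable (lebesgue_on Bc) (\<lambda>x. (g x) ^ 2)"

definition H_dist2 :: "(R3 \<Rightarrow> R3) \<Rightarrow> (R3 \<Rightarrow> real) \<Rightarrow> (R3 \<Rightarrow> R3) \<Rightarrow> (R3 \<Rightarrow> real) \<Rightarrow> real" where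
  "H_dist2 G1 g1 G2 g2 =
     (\<integral>x. norm (G1 x - G2 x) ^ 2 + (g1 x - g2 x) ^ 2 \<partial>lebesgue_on Bc)"

text \<open>Space-time test function for the Neumann problem: C^1 on R x R^3 with compact
  support, NOT required to vanish near the sphere |x| = 1 (this encodes the Neumann
  condition dr u = 0 at r = 1 in the weak formulation).\<close>
definition st_test :: "(real \<Rightarrow> R3 \<Rightarrow> real) \<Rightarrow> (real \<Rightarrow> R3 \<Rightarrow> real) \<Rightarrow> (real \<Rightarrow> R3 \<Rightarrow> R3) \<Rightarrow> bool" where
  "st_test psi pt px \<longleftrightarrow>
     (\<forall>t x. ((\<lambda>(s,y). psi s y) has_derivative (\<lambda>(ds,dy). pt t x * ds + px t x \<bullet> dy)) (at (t,x))) \<and>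
     continuous_on UNIV (\<lambda>(t,x). pt t x) \<and> continuous_on UNIV (\<lambda>(t,x). px t x) \<and>
     (\<exists>T R. \<forall>t x. (\<bar>t\<bar> > T \<or> norm x > R) \<longrightarrow> psi t x = 0)"

text \<open>Local-in-time Strichartz bound u in L^5([-T,T]; L^10(B^c)) for every T.
  N t plays the role of the L^10 norm to the fifth power.\<close>
definition strichartz_loc :: "(real \<Rightarrow> R3 \<Rightarrow> real) \<Rightarrow> bool" where
  "strichartz_loc u \<longleftrightarrow>
     (\<forall>T. \<exists>N. N \<in> borel_measurable lborel \<and>
        (AE t in lborel. t \<in> {-T..T} \<longrightarrow>
           (\<integral>\<^sup>+x. ennreal (\<bar>u t x\<bar> ^ 10) \<partial>lebesgue_on Bc) \<le> ennreal ((N t)\<^sup>2)) \<and>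
        (\<integral>\<^sup>+t\<in>{-T..T}. ennreal \<bar>N t\<bar> \<partial>lborel) < \<infinity>)"

definition global_neumann_sol ::
  "(real \<Rightarrow> R3 \<Rightarrow> real) \<Rightarrow> (real \<Rightarrow> R3 \<Rightarrow> real) \<Rightarrow> (real \<Rightarrow> R3 \<Rightarrow> R3)
   \<Rightarrow> (R3 \<Rightarrow> real) \<Rightarrow> (R3 \<Rightarrow> real) \<Rightarrow> bool" where
  "global_neumann_sol u ut Du u0 u1 \<longleftrightarrow>
     (\<lambda>p. u (fst p) (snd p)) \<in> borel_measurable (lebesgue_on (UNIV \<times> Bc)) \<and>
     (\<lambda>p. ut (fst p) (snd p)) \<in> borel_measurable (lebesgue_on (UNIV \<times> Bc)) \<and>
     (\<lambda>p. Du (fst p) (snd p)) \<in> borel_measurable (lebesgue_on (UNIV \<times> Bc)) \<and>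
     (\<forall>t. in_H (u t) (Du t) (ut t)) \<and>
     (\<forall>t. ((\<lambda>s. H_dist2 (Du s) (ut s) (Du t) (ut t)) \<longlongrightarrow> 0) (at t)) \<and>
     (AE x in lebesgue_on Bc. u 0 x = u0 x) \<and>
     (AE x in lebesgue_on Bc. ut 0 x = u1 x) \<and>
     strichartz_loc u \<and>
     (\<forall>psi pt px. st_test psi pt px \<longrightarrow>
        (\<integral>t. (\<integral>x. u t x * pt t x + ut t x * psi t x \<partial>lebesgue_on Bc) \<partial>lborel) = 0) \<and>
     (\<forall>psi pt px. st_test psi pt px \<longrightarrow>
        (\<integral>t. (\<integral>x. - ut t x * pt t x + Du t x \<bullet> px t x + (u t x) ^ 5 * psi t x
                \<partial>lebesgue_on Bc) \<partial>lborel) = 0)"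

definition precompact_traj :: "(real \<Rightarrow> R3 \<Rightarrow> real) \<Rightarrow> (real \<Rightarrow> R3 \<Rightarrow> real) \<Rightarrow> (real \<Rightarrow> R3 \<Rightarrow> R3) \<Rightarrow> bool" where
  "precompact_traj u ut Du \<longleftrightarrow>
     (\<forall>s :: nat \<Rightarrow> real. \<exists>r f G g. strict_mono r \<and> in_H f G g \<and>
        (\<lambda>n. H_dist2 (Du (s (r n))) (ut (s (r n))) G g) \<longlonglongrightarrow> 0)"

end

theory Submission
  imports Defs "HOL-Real_Asymp.Real_Asymp"
begin

text \<open>
  A radial function \<open>f\<close> with \<open>\<nabla>f \<in> L\<^sup>2\<close> and \<open>f \<in> L\<^sup>6\<close> is recovered from the flux of its gradient,
  \<open>v(r) = - (1 / \<kappa>) \<integral>\<^bsub>|x| > r\<^esub> \<nabla>f \<cdot> x / |x|\<^sup>3\<close>, so \<open>w(t, r) = r v(t, r)\<close> is jointly continuous and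
  \<open>w / \<surd>r\<close> is controlled by the energy outside the ball of radius \<open>r\<close>.  Weakly
  \<open>\<partial>\<^sub>t\<^sup>2 w - \<partial>\<^sub>r\<^sup>2 w = - w\<^sup>5 / r\<^sup>4\<close>, and testing with functions of \<open>t - r\<close> times functions of \<open>t + r\<close>
  shows that the second difference of \<open>w\<close> over a characteristic rectangle is the integral of
  \<open>w\<^sup>5 / r\<^sup>4\<close> over it.  Precompactness makes the energy outside large balls small uniformly in time,
  so that pushing a corner of the rectangle to infinity (no radiation reaches infinity) expresses
  increments of \<open>w\<close> through \<open>w\<^sup>5 / r\<^sup>4\<close> at larger radii only.  A weighted sup norm then improves
  \<open>w = o(\<surd>r)\<close> to \<open>w = O(r\<^bsup>1/4\<^esup>)\<close>, and with the weight \<open>exp (A / r)\<close> the same argument applied to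
  \<open>w(t + h, r) - w(t, r)\<close> shows that \<open>w\<close> does not depend on time.  A stationary \<open>w\<close> satisfies
  \<open>w'' = w\<^sup>5 / r\<^sup>4\<close> and, by the Neumann condition, \<open>w'(1) = w(1)\<close>; then \<open>w\<^sup>2\<close> is convex, sublinear and
  has nonnegative slope at \<open>1\<close>, which forces \<open>w = 0\<close>.
\<close>

section \<open>The reduced equation on the half-line\<close>

text \<open>The solution has only energy regularity: \<open>w\<close> is continuous, but no
  derivative of it is available pointwise. The rectangle identity is the form of the equation that
  involves values of \<open>w\<close> alone. Scaling dictates the order of the argument. From w =
  O(sqrt r) the factor w^4 / r^4 is only O(1 / r^2), the borderline for two integrations in
  \<open>r\<close>, so a small constant is needed, and uniform tails supply it far out. Once w =
  O(r^(1/4)), the factor is O(1 / r^3) and two integrations from infinity converge whatever the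
  constant. The exponent 1/4 is a convenience: its fourth power is exactly \<open>r\<close>, and any
  exponent below 1/2 would leave a convergent integral. Decay of \<open>w\<close> itself is not
  known at the growth step, only smallness of its increments over bounded distances. Hence the two
  far corners are used there as a pair, and corners are discarded singly only for the difference of
  two time translates, which does tend to 0. All rectangles stay in r \<ge> 1, so no reflection at
  the sphere has to be followed. The boundary condition acts on the stationary profile, where the
  defocusing sign gives the convexity.\<close>

text \<open>\<open>a\<close> runs along the outgoing characteristic through \<open>(t, r)\<close> forward in time and \<open>b\<close> along the one
  backward in time, so the rectangle lies in \<open>{r..}\<close> and is unbounded only towards large radii.\<close>
definition diamond_identity :: "(real \<Rightarrow> real \<Rightarrow> real) \<Rightarrow> (real \<Rightarrow> real \<Rightarrow> real) \<Rightarrow> bool" where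
  "diamond_identity w F \<longleftrightarrow> (\<forall>t r \<sigma> \<delta>. 1 \<le> r \<longrightarrow> 0 \<le> \<sigma> \<longrightarrow> 0 \<le> \<delta> \<longrightarrow>
     w t r - w (t + \<sigma>) (r + \<sigma>) - w (t - \<delta>) (r + \<delta>) + w (t + \<sigma> - \<delta>) (r + \<sigma> + \<delta>) =
     integral {0..\<delta>} (\<lambda>b. integral {0..\<sigma>} (\<lambda>a. F (t + a - b) (r + a + b))))"

lemma continuous_on_diamond:
  fixes F :: "real \<Rightarrow> real \<Rightarrow> real"
  assumes "continuous_on (UNIV \<times> {1..}) (\<lambda>(t, r). F t r)" "1 \<le> r" "0 \<le> \<delta>" "0 \<le> \<sigma>"
  shows "continuous_on ({0..\<delta>} \<times> {0..\<sigma>}) (\<lambda>(b, a). F (t + a - b) (r + a + b))"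
proof -
  have "continuous_on ({0..\<delta>} \<times> {0..\<sigma>}) (\<lambda>p. (\<lambda>(t, r). F t r) (t + snd p - fst p, r + snd p + fst p))"
    by (rule continuous_on_compose2[OF assms(1)]) (use assms in \<open>auto intro!: continuous_intros\<close>)
  then show ?thesis by (simp add: case_prod_unfold)
qed

lemma continuous_on_diamond_inner:
  fixes F :: "real \<Rightarrow> real \<Rightarrow> real"
  assumes "continuous_on (UNIV \<times> {1..}) (\<lambda>(t, r). F t r)" "1 \<le> r" "0 \<le> \<delta>" "0 \<le> \<sigma>"
  shows "continuous_on {0..\<delta>} (\<lambda>b. integral {0..\<sigma>} (\<lambda>a. F (t + a - b) (r + a + b)))"
    and "\<And>b. b \<in> {0..\<delta>} \<Longrightarrow> continuous_on {0..\<sigma>} (\<lambda>a. F (t + a - b) (r + a + b))"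
proof -
  note c = continuous_on_diamond[OF assms, of t]
  have "continuous_on {0..\<delta>} (\<lambda>b. integral (cbox 0 \<sigma>) (\<lambda>a. F (t + a - b) (r + a + b)))"
    by (rule integral_continuous_on_param) (use c in simp)
  then show "continuous_on {0..\<delta>} (\<lambda>b. integral {0..\<sigma>} (\<lambda>a. F (t + a - b) (r + a + b)))" by simp
  fix b assume b: "b \<in> {0..\<delta>}"
  have "continuous_on {0..\<sigma>} (\<lambda>a. (\<lambda>(b, a). F (t + a - b) (r + a + b)) (b, a))"
    by (rule continuous_on_compose2[OF c]) (use b in \<open>auto intro!: continuous_intros\<close>)
  then show "continuous_on {0..\<sigma>} (\<lambda>a. F (t + a - b) (r + a + b))" by simp
qed

text \<open>The identity is linear in the pair of function and source; continuity of the sources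
  serves to split the iterated integral. It is needed for the difference of a solution and its time
  translate, whose equation has the same form.\<close>

lemma diamond_identity_diff:
  assumes "diamond_identity w1 F1" "diamond_identity w2 F2"
    and c1: "continuous_on (UNIV \<times> {1..}) (\<lambda>(t, r). F1 t r)"
    and c2: "continuous_on (UNIV \<times> {1..}) (\<lambda>(t, r). F2 t r)"
  shows "diamond_identity (\<lambda>t r. w1 t r - w2 t r) (\<lambda>t r. F1 t r - F2 t r)"
  unfolding diamond_identity_def
proof (intro allI impI)
  fix t r \<sigma> \<delta> :: real assume h: "1 \<le> r" "0 \<le> \<sigma>" "0 \<le> \<delta>"
  note i1 = continuous_on_diamond_inner[OF c1 h(1,3,2), where t = t]
  note i2 = continuous_on_diamond_inner[OF c2 h(1,3,2), where t = t]
  have "integral {0..\<delta>} (\<lambda>b. integral {0..\<sigma>} (\<lambda>a. F1 (t + a - b) (r + a + b) - F2 (t + a - b) (r + a + b)))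
     = integral {0..\<delta>} (\<lambda>b. integral {0..\<sigma>} (\<lambda>a. F1 (t + a - b) (r + a + b)) - integral {0..\<sigma>} (\<lambda>a. F2 (t + a - b) (r + a + b)))"
    by (intro Henstock_Kurzweil_Integration.integral_cong Henstock_Kurzweil_Integration.integral_diff integrable_continuous_real i1(2) i2(2))
  also have "\<dots> = integral {0..\<delta>} (\<lambda>b. integral {0..\<sigma>} (\<lambda>a. F1 (t + a - b) (r + a + b))) - integral {0..\<delta>} (\<lambda>b. integral {0..\<sigma>} (\<lambda>a. F2 (t + a - b) (r + a + b)))"
    by (intro Henstock_Kurzweil_Integration.integral_diff integrable_continuous_real i1 i2)
  finally have e: "integral {0..\<delta>} (\<lambda>b. integral {0..\<sigma>} (\<lambda>a. F1 (t + a - b) (r + a + b) - F2 (t + a - b) (r + a + b))) = \<dots>" .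
  have "integral {0..\<delta>} (\<lambda>b. integral {0..\<sigma>} (\<lambda>a. F1 (t + a - b) (r + a + b))) =
     w1 t r - w1 (t + \<sigma>) (r + \<sigma>) - w1 (t - \<delta>) (r + \<delta>) + w1 (t + \<sigma> - \<delta>) (r + \<sigma> + \<delta>)"
    "integral {0..\<delta>} (\<lambda>b. integral {0..\<sigma>} (\<lambda>a. F2 (t + a - b) (r + a + b))) =
     w2 t r - w2 (t + \<sigma>) (r + \<sigma>) - w2 (t - \<delta>) (r + \<delta>) + w2 (t + \<sigma> - \<delta>) (r + \<sigma> + \<delta>)"
    using assms(1,2) h unfolding diamond_identity_def by simp_all
  with e show "w1 t r - w2 t r - (w1 (t + \<sigma>) (r + \<sigma>) - w2 (t + \<sigma>) (r + \<sigma>)) -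
       (w1 (t - \<delta>) (r + \<delta>) - w2 (t - \<delta>) (r + \<delta>)) +
       (w1 (t + \<sigma> - \<delta>) (r + \<sigma> + \<delta>) - w2 (t + \<sigma> - \<delta>) (r + \<sigma> + \<delta>)) =
       integral {0..\<delta>} (\<lambda>b. integral {0..\<sigma>} (\<lambda>a. F1 (t + a - b) (r + a + b) - F2 (t + a - b) (r + a + b)))"
    by simp
qed

text \<open>On the rectangle \<open>m2\<close> depends only on \<open>r + a + b\<close>, so
  integrating in \<open>a\<close> and then in \<open>b\<close> turns a second derivative into a
  second difference of \<open>m\<close>. A source dominated by a function of the radius is thus
  handled by an ordinary differential equation. The second difference ignores affine terms, so
  \<open>m\<close> can be normalised to suit each application.\<close>

lemma diamond_majorant:
  fixes F :: "real \<Rightarrow> real \<Rightarrow> real" and m m1 m2 :: "real \<Rightarrow> real"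
  assumes c: "continuous_on (UNIV \<times> {1..}) (\<lambda>(t, r). F t r)" and h: "1 \<le> r" "0 \<le> \<delta>" "0 \<le> \<sigma>"
    and d1: "\<And>x. r \<le> x \<Longrightarrow> (m has_real_derivative m1 x) (at x)"
    and d2: "\<And>x. r \<le> x \<Longrightarrow> (m1 has_real_derivative m2 x) (at x)"
    and le: "\<And>s x. r \<le> x \<Longrightarrow> \<bar>F s x\<bar> \<le> m2 x"
  shows "\<bar>integral {0..\<delta>} (\<lambda>b. integral {0..\<sigma>} (\<lambda>a. F (t + a - b) (r + a + b)))\<bar>
       \<le> m r - m (r + \<delta>) - m (r + \<sigma>) + m (r + \<sigma> + \<delta>)"
proof -
  note i = continuous_on_diamond_inner[OF c h, where t = t]
  have inner: "\<bar>integral {0..\<sigma>} (\<lambda>a. F (t + a - b) (r + a + b))\<bar> \<le> m1 (r + \<sigma> + b) - m1 (r + b)"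
    if b: "b \<in> {0..\<delta>}" for b
  proof -
    have hi: "((\<lambda>a. m2 (r + a + b)) has_integral m1 (r + \<sigma> + b) - m1 (r + 0 + b)) {0..\<sigma>}"
      by (rule fundamental_theorem_of_calculus)
        (use h b in \<open>auto intro!: derivative_eq_intros DERIV_chain2[OF d2, THEN DERIV_cong] simp flip: has_real_derivative_iff_has_vector_derivative\<close>)
    have "norm (integral {0..\<sigma>} (\<lambda>a. F (t + a - b) (r + a + b))) \<le> integral {0..\<sigma>} (\<lambda>a. m2 (r + a + b))"
      by (rule integral_norm_bound_integral)
        (use h b hi in \<open>auto intro!: integrable_continuous_real i le simp: has_integral_integrable\<close>)
    then show ?thesis using integral_unique[OF hi] by simp
  qed
  have hi: "((\<lambda>b. m1 (r + \<sigma> + b) - m1 (r + b)) has_integral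
      (m (r + \<sigma> + \<delta>) - m (r + \<delta>)) - (m (r + \<sigma> + 0) - m (r + 0))) {0..\<delta>}"
    by (rule fundamental_theorem_of_calculus)
      (use h in \<open>auto intro!: derivative_eq_intros DERIV_chain2[OF d1, THEN DERIV_cong] simp flip: has_real_derivative_iff_has_vector_derivative\<close>)
  have "norm (integral {0..\<delta>} (\<lambda>b. integral {0..\<sigma>} (\<lambda>a. F (t + a - b) (r + a + b))))
     \<le> integral {0..\<delta>} (\<lambda>b. m1 (r + \<sigma> + b) - m1 (r + b))"
    by (rule integral_norm_bound_integral)
      (use inner hi in \<open>auto intro!: integrable_continuous_real i simp: has_integral_integrable\<close>)
  then show ?thesis using integral_unique[OF hi] by simp
qed

text \<open>Absorbs half of an unknown bound without forming a supremum. The map taking K to C + K /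
  2 contracts towards its fixed point 2 C; iterating it from the finite a priori constant
  \<open>K0\<close> produces bounds that converge to the claim.\<close>

lemma bound_from_halving:
  fixes f m :: "'a \<Rightarrow> real"
  assumes m: "\<And>x. x \<in> A \<Longrightarrow> 0 < m x" and C: "0 \<le> C"
    and fin: "0 \<le> K0" "\<And>x. x \<in> A \<Longrightarrow> f x \<le> K0 * m x"
    and step: "\<And>K. 0 \<le> K \<Longrightarrow> (\<And>x. x \<in> A \<Longrightarrow> f x \<le> K * m x) \<Longrightarrow> (\<And>x. x \<in> A \<Longrightarrow> f x \<le> (C + K / 2) * m x)"
    and x: "x \<in> A"
  shows "f x \<le> 2 * C * m x"
proof -
  define Q where "Q = (\<lambda>n. ((\<lambda>K. C + K / 2) ^^ n) K0)"
  have Q: "0 \<le> Q n \<and> (\<forall>x\<in>A. f x \<le> Q n * m x)" for n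
  proof (induction n)
    case 0
    then show ?case using fin by (simp add: Q_def)
  next
    case (Suc n)
    then have "0 \<le> Q n" and "\<And>x. x \<in> A \<Longrightarrow> f x \<le> Q n * m x" by auto
    note step[OF this]
    then show ?case using C Suc by (auto simp: Q_def)
  qed
  \<comment> \<open>Closed form of the iterates: the deviation from the fixed point is halved each
    time.\<close>
  have Qe: "Q n = 2 * C + (K0 - 2 * C) * (1 / 2) ^ n" for n
    by (induction n) (auto simp: Q_def field_simps)
  have "Q \<longlonglongrightarrow> 2 * C + (K0 - 2 * C) * 0"
    unfolding Qe by (intro tendsto_intros LIMSEQ_power_zero) simp
  then have "(\<lambda>n. Q n * m x) \<longlonglongrightarrow> (2 * C) * m x"
    by (intro tendsto_intros) simp
  then show ?thesis
    by (rule LIMSEQ_le_const) (use Q x in auto)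
qed

text \<open>A point at radius \<rho> is linked to the fixed radius \<open>R\<close> by a
  characteristic; the other two corners of the rectangle are pushed outwards, where
  \<open>dec\<close> makes their difference negligible. Far out the source is at most the unknown
  bound divided by 16 x^2, and x^(1/4) and x^(1/2) are eigenfunctions of x^2 d^2/dx^2 with nonzero
  eigenvalues, so integrating twice returns a fraction of the weight itself.\<close>

lemma growth_quarter:
  fixes w :: "real \<Rightarrow> real \<Rightarrow> real"
  assumes c: "continuous_on (UNIV \<times> {1..}) (\<lambda>(t, r). w t r)"
    and dia: "diamond_identity w (\<lambda>t r. w t r ^ 5 / r ^ 4)"
    and bd: "\<And>t r. 1 \<le> r \<Longrightarrow> \<bar>w t r\<bar> \<le> M * sqrt r"
    and small: "\<And>e. 0 < e \<Longrightarrow> \<exists>R. \<forall>t r. R \<le> r \<longrightarrow> \<bar>w t r\<bar> \<le> e * sqrt r"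
    and dec: "\<And>\<delta> e. 0 \<le> \<delta> \<Longrightarrow> 0 < e \<Longrightarrow> \<exists>R. \<forall>t r. R \<le> r \<longrightarrow> \<bar>w t r - w (t - \<delta>) (r + \<delta>)\<bar> \<le> e"
  shows "\<exists>C\<ge>0. \<forall>t r. 1 \<le> r \<longrightarrow> \<bar>w t r\<bar> \<le> C * r powr (1/4)"
proof -
  have cf: "continuous_on (UNIV \<times> {1..}) (\<lambda>(t, r). w t r ^ 5 / r ^ 4)"
    using c by (auto simp: case_prod_unfold intro!: continuous_intros)
  have M0: "0 \<le> M" using bd[of 1 0] abs_ge_zero[of "w 0 1"] by simp
  \<comment> \<open>With 1/2 the factor w^4 / x^4 is at most 1 / (16 x^2). The majorant below then
    carries the fractions 1/3 and 1/4, both under the 1/2 that the absorption allows.\<close>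
  obtain R0 where R0: "\<And>t r. R0 \<le> r \<Longrightarrow> \<bar>w t r\<bar> \<le> 1/2 * sqrt r" using small[of "1/2"] by auto
  define R where "R = max 1 R0"
  have R1: "1 \<le> R" by (simp add: R_def)
  have half: "\<bar>w t r\<bar> \<le> 1/2 * sqrt r" if "R \<le> r" for t r using R0[of r t] that by (simp add: R_def)
  \<comment> \<open>Bounds \<open>w\<close> at radius \<open>R\<close>, where every point further
    out is anchored, and also on \<open>{1..R}\<close>, which is needed at the end.\<close>
  define C0 where "C0 = M * sqrt R"
  have C0: "0 \<le> C0" using M0 R1 by (simp add: C0_def)
  txt \<open>The term with \<open>\<eta>\<close> makes the weighted supremum finite a priori; \<open>\<eta>\<close> tends to \<open>0\<close> afterwards.\<close>
  have main: "\<bar>w t r\<bar> \<le> 2 * C0 * (r powr (1/4) + \<eta> * sqrt r)" if \<eta>: "0 < \<eta>" and r: "R \<le> r" for \<eta> t r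
  proof -
    define m where "m = (\<lambda>x::real. x powr (1/4) + \<eta> * sqrt x)"
    have m1: "1 \<le> m x" if "R \<le> x" for x
    proof -
      have "1 \<le> x powr (1/4)" using that R1 by (intro ge_one_powr_ge_zero) auto
      then show ?thesis using \<eta> that R1 by (simp add: m_def add_increasing2)
    qed
    have "\<bar>w (fst p) (snd p)\<bar> \<le> 2 * C0 * m (snd p)" if "p \<in> UNIV \<times> {R..}" for p
    proof (rule bound_from_halving[where A = "UNIV \<times> {R..}" and f = "\<lambda>p. \<bar>w (fst p) (snd p)\<bar>" and m = "\<lambda>p. m (snd p)" and ?K0.0 = "M / \<eta>"])
      show "0 < m (snd p)" if "p \<in> UNIV \<times> {R..}" for p :: "real \<times> real"
        using m1[of "snd p"] that by auto
      show "0 \<le> C0" "0 \<le> M / \<eta>" using C0 M0 \<eta> by auto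
      show "p \<in> UNIV \<times> {R..}" by fact
      show "\<bar>w (fst p) (snd p)\<bar> \<le> M / \<eta> * m (snd p)" if "p \<in> UNIV \<times> {R..}" for p
      proof -
        have "\<bar>w (fst p) (snd p)\<bar> \<le> M * sqrt (snd p)" using bd that R1 by auto
        also have "\<dots> = M / \<eta> * (0 + \<eta> * sqrt (snd p))" using \<eta> by simp
        also have "\<dots> \<le> M / \<eta> * m (snd p)" unfolding m_def using M0 \<eta> by (intro mult_left_mono add_mono) auto
        finally show ?thesis .
      qed
    next
      fix S :: real and p :: "real \<times> real" assume S: "0 \<le> S" and ub: "\<And>p. p \<in> UNIV \<times> {R..} \<Longrightarrow> \<bar>w (fst p) (snd p)\<bar> \<le> S * m (snd p)"
        and p: "p \<in> UNIV \<times> {R..}"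
      have ub': "\<bar>w s x\<bar> \<le> S * m x" if "R \<le> x" for s x using ub[of "(s, x)"] that by simp
      define s \<rho> where "s = fst p" and "\<rho> = snd p"
      have \<rho>: "R \<le> \<rho>" using p by (auto simp: \<rho>_def)
      \<comment> \<open>With this length and t = s + \<delta>, the corner (t - \<delta>, R +
        \<delta>) is the point to be estimated, while the corner (t, R) lies at the anchoring
        radius.\<close>
      define \<delta> where "\<delta> = \<rho> - R"
      have \<delta>: "0 \<le> \<delta>" using \<rho> by (simp add: \<delta>_def)
      \<comment> \<open>Chosen so that H'' = S m / (16 x^2). The second derivative of x^q is q (q -
        1) x^(q - 2), with q (q - 1) equal to -3/16 and -1/4 for the two powers, whence the divisors
        3 and 4. The overall sign makes \<open>H\<close> nonpositive and decreasing.\<close>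
      define H where "H = (\<lambda>x::real. - S * (x powr (1/4) / 3 + \<eta> * x powr (1/2) / 4))"
      define H1 where "H1 = (\<lambda>x::real. - S * (x powr (-3/4) / 12 + \<eta> * x powr (-1/2) / 8))"
      define H2 where "H2 = (\<lambda>x::real. S * (x powr (-7/4) / 16 + \<eta> * x powr (-3/2) / 16))"
      have Hd: "(H has_real_derivative H1 x) (at x)" "(H1 has_real_derivative H2 x) (at x)" if "R \<le> x" for x
      proof -
        have x: "0 < x" using that R1 by simp
        show "(H has_real_derivative H1 x) (at x)" "(H1 has_real_derivative H2 x) (at x)"
          unfolding H_def H1_def H2_def using x
          by (auto intro!: derivative_eq_intros simp: field_simps)
      qed
      have Fle: "\<bar>w s x ^ 5 / x ^ 4\<bar> \<le> H2 x" if x: "R \<le> x" for s x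
      proof -
        have x0: "0 < x" using x R1 by simp
        have "\<bar>w s x ^ 5\<bar> = \<bar>w s x\<bar> ^ 4 * \<bar>w s x\<bar>" by (simp add: power_abs abs_mult eval_nat_numeral)
        also have "\<dots> \<le> (1/2 * sqrt x) ^ 4 * (S * m x)"
          using half[OF x] ub'[OF x] x0 by (intro mult_mono power_mono) auto
        also have "(1/2 * sqrt x) ^ 4 = x ^ 2 / 16"
        proof -
          have "sqrt x ^ 4 = (sqrt x ^ 2) ^ 2" by (simp only: flip: power_mult) simp
          then show ?thesis using x0 by (simp add: power_mult_distrib power_divide)
        qed
        finally have "\<bar>w s x ^ 5 / x ^ 4\<bar> \<le> (x ^ 2 / 16 * (S * m x)) / x ^ 4"
          using x0 divide_right_mono[of "\<bar>w s x ^ 5\<bar>" "x ^ 2 / 16 * (S * m x)" "x ^ 4"] by simp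
        also have "\<dots> = S * (m x / x ^ 2) / 16" using x0 by (simp add: field_simps eval_nat_numeral)
        also have "m x / x ^ 2 = x powr (-7/4) + \<eta> * x powr (-3/2)"
        proof -
          have "x powr (-7/4) = x powr (1/4) / x powr 2" "x powr (-3/2) = x powr (1/2) / x powr 2"
            by (simp_all flip: powr_diff)
          then show ?thesis using x0 by (simp add: m_def powr_half_sqrt add_divide_distrib)
        qed
        finally show ?thesis by (simp add: H2_def field_simps)
      qed
      have "\<bar>w s \<rho>\<bar> \<le> (C0 + S / 2) * m \<rho> + e" if e: "0 < e" for e :: real
      proof -
        \<comment> \<open>\<open>R'\<close> depends on \<delta>, hence on the point. This is
          harmless because the bound on \<open>J\<close> below does not involve \<sigma>.\<close>
        obtain R' where R': "\<And>t r. R' \<le> r \<Longrightarrow> \<bar>w t r - w (t - \<delta>) (r + \<delta>)\<bar> \<le> e" using dec[OF \<delta> e] by auto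
        define \<sigma> where "\<sigma> = max 0 R'"
        have \<sigma>: "0 \<le> \<sigma>" "R' \<le> R + \<sigma>" using R1 by (auto simp: \<sigma>_def)
        define t where "t = s + \<delta>"
        define J where "J = integral {0..\<delta>} (\<lambda>b. integral {0..\<sigma>} (\<lambda>a. w (t + a - b) (R + a + b) ^ 5 / (R + a + b) ^ 4))"
        have id: "w t R - w (t + \<sigma>) (R + \<sigma>) - w (t - \<delta>) (R + \<delta>) + w (t + \<sigma> - \<delta>) (R + \<sigma> + \<delta>) = J"
          using dia R1 \<sigma> \<delta> unfolding diamond_identity_def J_def by simp
        have "\<bar>J\<bar> \<le> H R - H (R + \<delta>) - H (R + \<sigma>) + H (R + \<sigma> + \<delta>)"
          unfolding J_def by (rule diamond_majorant[OF cf R1 \<delta> \<sigma>(1) Hd]) (use Fle in auto)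
        \<comment> \<open>\<open>H\<close> is nonpositive and decreasing, so of the four terms only
          the one at the target radius survives.\<close>
        also have "\<dots> \<le> - H (R + \<delta>)"
        proof -
          have "H R \<le> 0" using S R1 \<eta> by (auto simp: H_def intro!: mult_nonneg_nonneg add_nonneg_nonneg)
          moreover have "H (R + \<sigma> + \<delta>) \<le> H (R + \<sigma>)"
          proof -
            have "(R + \<sigma>) powr q \<le> (R + \<sigma> + \<delta>) powr q" if "0 \<le> q" for q
              using that R1 \<sigma> \<delta> by (intro powr_mono2) auto
            then show ?thesis
              unfolding H_def mult_minus_left neg_le_iff_le using S \<eta>
              by (intro mult_left_mono add_mono divide_right_mono) auto
          qed
          ultimately show ?thesis by linarith
        qed
        also have "\<dots> \<le> S / 2 * m \<rho>"
        proof -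
          have "- H \<rho> = S * (\<rho> powr (1/4) / 3 + \<eta> * sqrt \<rho> / 4)" using \<rho> R1 by (simp add: H_def powr_half_sqrt)
          also have "\<dots> \<le> S * (m \<rho> / 2)" unfolding m_def using S \<eta> \<rho> R1
            by (intro mult_left_mono) (auto simp: field_simps)
          finally show ?thesis by (simp add: \<delta>_def)
        qed
        finally have J: "\<bar>J\<bar> \<le> S / 2 * m \<rho>" .
        have "\<bar>w t R\<bar> \<le> C0 * m \<rho>"
        proof -
          have "\<bar>w t R\<bar> \<le> C0 * 1" using bd[OF R1] by (simp add: C0_def)
          also have "\<dots> \<le> C0 * m \<rho>" using m1[OF \<rho>] C0 by (intro mult_left_mono)
          finally show ?thesis .
        qed
        moreover have "\<bar>w (t + \<sigma>) (R + \<sigma>) - w (t + \<sigma> - \<delta>) (R + \<sigma> + \<delta>)\<bar> \<le> e" using R'[OF \<sigma>(2)] by simp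
        moreover have "w (t - \<delta>) (R + \<delta>) = w s \<rho>" by (simp add: t_def \<delta>_def)
        ultimately show ?thesis using id J unfolding distrib_right by linarith
      qed
      then have "\<bar>w s \<rho>\<bar> \<le> (C0 + S / 2) * m \<rho>" by (rule field_le_epsilon)
      then show "\<bar>w (fst p) (snd p)\<bar> \<le> (C0 + S / 2) * m (snd p)" by (simp add: s_def \<rho>_def)
    qed
    from this[of "(t, r)"] r show ?thesis by (simp add: m_def)
  qed
  have far: "\<bar>w t r\<bar> \<le> 2 * C0 * r powr (1/4)" if r: "R \<le> r" for t r
  proof (rule field_le_epsilon)
    fix e :: real assume e: "0 < e"
    \<comment> \<open>The constant in \<open>main\<close> does not depend on \<eta>, so at a fixed
      radius the auxiliary term can be made smaller than any \<open>e\<close>.\<close>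
    define \<eta> where "\<eta> = e / ((2 * C0 + 1) * sqrt r)"
    have s: "0 < sqrt r" using r R1 by simp
    have \<eta>: "0 < \<eta>" using e C0 s by (simp add: \<eta>_def)
    have "2 * C0 * (\<eta> * sqrt r) = (2 * C0 / (2 * C0 + 1)) * e" using s by (simp add: \<eta>_def)
    also have "\<dots> \<le> 1 * e" using C0 e by (intro mult_right_mono) auto
    finally show "\<bar>w t r\<bar> \<le> 2 * C0 * r powr (1/4) + e" using main[OF \<eta> r, of t] by (simp add: distrib_left)
  qed
  show ?thesis
  proof (intro exI[of _ "2 * C0"] conjI allI impI)
    show "0 \<le> 2 * C0" using C0 by simp
    fix t r :: real assume r: "1 \<le> r"
    show "\<bar>w t r\<bar> \<le> 2 * C0 * r powr (1/4)"
    proof (cases "R \<le> r")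
      case False
      have p1: "1 \<le> r powr (1/4)" using r by (intro ge_one_powr_ge_zero) auto
      have "\<bar>w t r\<bar> \<le> M * sqrt r" using bd[OF r] .
      also have "\<dots> \<le> C0 * 1" unfolding C0_def using M0 False by (simp add: mult_left_mono)
      also have "\<dots> \<le> 2 * C0 * r powr (1/4)" using p1 C0 by (intro mult_mono) auto
      finally show ?thesis .
    qed (rule far)
  qed
qed

section \<open>Independence of time\<close>

lemma abs_power5_diff_le:
  fixes x y B :: real
  assumes "\<bar>x\<bar> \<le> B" "\<bar>y\<bar> \<le> B"
  shows "\<bar>x ^ 5 - y ^ 5\<bar> \<le> 5 * B ^ 4 * \<bar>x - y\<bar>"
proof -
  have B: "0 \<le> B" using assms(1) by linarith
  have "x ^ 5 - y ^ 5 = (x - y) * (x ^ 4 + x ^ 3 * y + x ^ 2 * y ^ 2 + x * y ^ 3 + y ^ 4)"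
    by (simp add: algebra_simps eval_nat_numeral)
  then have "\<bar>x ^ 5 - y ^ 5\<bar> = \<bar>x - y\<bar> * \<bar>x ^ 4 + x ^ 3 * y + x ^ 2 * y ^ 2 + x * y ^ 3 + y ^ 4\<bar>"
    by (simp add: abs_mult)
  also have "\<dots> \<le> \<bar>x - y\<bar> * (\<bar>x\<bar> ^ 4 + \<bar>x\<bar> ^ 3 * \<bar>y\<bar> + \<bar>x\<bar> ^ 2 * \<bar>y\<bar> ^ 2 + \<bar>x\<bar> * \<bar>y\<bar> ^ 3 + \<bar>y\<bar> ^ 4)"
    by (intro mult_left_mono order_trans[OF abs_triangle_ineq] add_mono) (auto simp: abs_mult power_abs)
  also have "\<dots> \<le> \<bar>x - y\<bar> * (B ^ 4 + B ^ 3 * B + B ^ 2 * B ^ 2 + B * B ^ 3 + B ^ 4)"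
    using assms B by (intro mult_left_mono add_mono mult_mono power_mono) auto
  also have "\<dots> = 5 * B ^ 4 * \<bar>x - y\<bar>" by (simp add: algebra_simps eval_nat_numeral)
  finally show ?thesis .
qed

text \<open>For the difference \<open>d\<close> of two time translates the source is at most A / x^3
  times |d|. Three corners of the rectangle can be sent to infinity, where \<open>d\<close> tends to
  0 by \<open>dec\<close>, so no inhomogeneous term remains: the absorption runs with constant 0 and
  returns d = 0.\<close>

lemma stationary:
  fixes w :: "real \<Rightarrow> real \<Rightarrow> real"
  assumes c: "continuous_on (UNIV \<times> {1..}) (\<lambda>(t, r). w t r)"
    and dia: "diamond_identity w (\<lambda>t r. w t r ^ 5 / r ^ 4)"
    and C: "0 \<le> C" and bd: "\<And>t r. 1 \<le> r \<Longrightarrow> \<bar>w t r\<bar> \<le> C * r powr (1/4)"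
    and dec: "\<And>h e. 0 < e \<Longrightarrow> \<exists>R. \<forall>t r. R \<le> r \<longrightarrow> \<bar>w (t + h) r - w t r\<bar> \<le> e"
    and r: "1 \<le> r"
  shows "w t r = w 0 r"
proof -
  have cf: "continuous_on (UNIV \<times> {1..}) (\<lambda>(t, r). w t r ^ 5 / r ^ 4)"
    using c by (auto simp: case_prod_unfold intro!: continuous_intros)
  \<comment> \<open>The shift is the time of the claim; evaluating the difference at time 0 then
    gives the statement.\<close>
  define h where "h = t"
  define d where "d = (\<lambda>t r. w (t + h) r - w t r)"
  define F where "F = (\<lambda>t r. w (t + h) r ^ 5 / r ^ 4 - w t r ^ 5 / r ^ 4)"
  have csh: "continuous_on (UNIV \<times> {1..}) (\<lambda>(t, r). w (t + h) r)"
  proof -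
    have "continuous_on (UNIV \<times> {1..}) (\<lambda>p. (\<lambda>(t, r). w t r) (fst p + h, snd p))"
      by (rule continuous_on_compose2[OF c]) (auto intro!: continuous_intros)
    then show ?thesis by (simp add: case_prod_unfold)
  qed
  then have cfsh: "continuous_on (UNIV \<times> {1..}) (\<lambda>(t, r). w (t + h) r ^ 5 / r ^ 4)"
    by (auto simp: case_prod_unfold intro!: continuous_intros)
  have dsh: "diamond_identity (\<lambda>t r. w (t + h) r) (\<lambda>t r. w (t + h) r ^ 5 / r ^ 4)"
    unfolding diamond_identity_def
  proof (intro allI impI)
    fix t r \<sigma> \<delta> :: real assume a: "1 \<le> r" "0 \<le> \<sigma>" "0 \<le> \<delta>"
    from dia[unfolded diamond_identity_def, rule_format, OF a, of "t + h"]
    show "w (t + h) r - w (t + \<sigma> + h) (r + \<sigma>) - w (t - \<delta> + h) (r + \<delta>) + w (t + \<sigma> - \<delta> + h) (r + \<sigma> + \<delta>) =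
      integral {0..\<delta>} (\<lambda>b. integral {0..\<sigma>} (\<lambda>a. w (t + a - b + h) (r + a + b) ^ 5 / (r + a + b) ^ 4))"
      by (simp add: algebra_simps)
  qed
  have dd: "diamond_identity d F"
    unfolding d_def F_def by (rule diamond_identity_diff[OF dsh dia cfsh cf])
  have cF: "continuous_on (UNIV \<times> {1..}) (\<lambda>(t, r). F t r)"
    unfolding F_def using continuous_on_diff[OF cfsh cf] by (simp add: case_prod_unfold)
  define A where "A = 5 * C ^ 4"
  have A: "0 \<le> A" using C by (simp add: A_def)
  txt \<open>This weight satisfies \<open>m'' \<ge> 2 A m / x\<^sup>3\<close>, so every bound \<open>K m\<close> on the difference improves to \<open>K m / 2\<close>.\<close>
  define m where "m = (\<lambda>x::real. exp (A / x))"
  define m1 where "m1 = (\<lambda>x::real. - A / x ^ 2 * exp (A / x))"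
  define m2 where "m2 = (\<lambda>x::real. (A ^ 2 / x ^ 4 + 2 * A / x ^ 3) * exp (A / x))"
  have md: "(m has_real_derivative m1 x) (at x)" "(m1 has_real_derivative m2 x) (at x)" if "1 \<le> x" for x
    unfolding m_def m1_def m2_def using that
    by (auto intro!: derivative_eq_intros simp: divide_simps) (auto simp: algebra_simps eval_nat_numeral)
  have mdec: "m y \<le> m x" if "1 \<le> x" "x \<le> y" for x y
    unfolding m_def using A that by (auto intro!: divide_left_mono)
  have F: "\<bar>F s x\<bar> \<le> A / x ^ 3 * \<bar>d s x\<bar>" if x: "1 \<le> x" for s x
  proof -
    have "\<bar>w (s + h) x ^ 5 - w s x ^ 5\<bar> \<le> 5 * (C * x powr (1/4)) ^ 4 * \<bar>w (s + h) x - w s x\<bar>"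
      by (rule abs_power5_diff_le) (use bd x in auto)
    also have "(C * x powr (1/4)) ^ 4 = C ^ 4 * x"
      using x by (simp add: power_mult_distrib powr_power)
    finally have "\<bar>w (s + h) x ^ 5 - w s x ^ 5\<bar> / x ^ 4 \<le> (A * x * \<bar>d s x\<bar>) / x ^ 4"
      using x by (intro divide_right_mono) (auto simp: A_def d_def)
    moreover have "(A * x * \<bar>d s x\<bar>) / x ^ 4 = A / x ^ 3 * \<bar>d s x\<bar>" using x by (simp add: divide_simps eval_nat_numeral)
    moreover have "\<bar>F s x\<bar> = \<bar>w (s + h) x ^ 5 - w s x ^ 5\<bar> / x ^ 4"
      by (simp add: F_def flip: diff_divide_distrib)
    ultimately show ?thesis by simp
  qed
  obtain R0 where R0: "\<And>t r. R0 \<le> r \<Longrightarrow> \<bar>d t r\<bar> \<le> 1" using dec[of 1 h] by (auto simp: d_def)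
  \<comment> \<open>The finite starting constant: the difference is at most 1 beyond
    \<open>R0\<close>, and the growth bound covers the bounded range of radii before it. The weight
    \<open>m\<close> is at least 1.\<close>
  define K0 where "K0 = max 1 (2 * C * max 1 R0 powr (1/4))"
  have "\<bar>d (fst p) (snd p)\<bar> \<le> 2 * 0 * m (snd p)" if "p \<in> UNIV \<times> {1..}" for p
  proof (rule bound_from_halving[where A = "UNIV \<times> {1..}" and f = "\<lambda>p. \<bar>d (fst p) (snd p)\<bar>" and m = "\<lambda>p. m (snd p)" and ?K0.0 = K0])
    show "0 < m (snd p)" for p :: "real \<times> real" by (simp add: m_def)
    show "0 \<le> K0" by (simp add: K0_def)
    show "p \<in> UNIV \<times> {1..}" by fact
    show "\<bar>d (fst p) (snd p)\<bar> \<le> K0 * m (snd p)" if p: "p \<in> UNIV \<times> {1..}" for p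
    proof -
      have x: "1 \<le> snd p" using p by auto
      have "\<bar>d (fst p) (snd p)\<bar> \<le> K0 * 1"
      proof (cases "R0 \<le> snd p")
        case True
        then show ?thesis using R0[OF True, of "fst p"] by (simp add: K0_def)
      next
        case False
        have "\<bar>d (fst p) (snd p)\<bar> \<le> C * snd p powr (1/4) + C * snd p powr (1/4)"
          unfolding d_def using bd[OF x] by (intro order_trans[OF abs_triangle_ineq4] add_mono)
        also have "\<dots> \<le> 2 * C * max 1 R0 powr (1/4)"
        proof -
          have "C * snd p powr (1/4) \<le> C * max 1 R0 powr (1/4)"
            using C x False by (intro mult_left_mono powr_mono2) auto
          then show ?thesis by simp
        qed
        finally show ?thesis by (simp add: K0_def)
      qed
      also have "\<dots> \<le> K0 * m (snd p)" using A x by (intro mult_left_mono) (auto simp: m_def K0_def)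
      finally show ?thesis .
    qed
  next
    fix K :: real and p :: "real \<times> real" assume K: "0 \<le> K" and ub: "\<And>p. p \<in> UNIV \<times> {1..} \<Longrightarrow> \<bar>d (fst p) (snd p)\<bar> \<le> K * m (snd p)"
      and p: "p \<in> UNIV \<times> {1..}"
    have ub': "\<bar>d s x\<bar> \<le> K * m x" if "1 \<le> x" for s x using ub[of "(s, x)"] that by simp
    define s \<rho> where "s = fst p" and "\<rho> = snd p"
    have \<rho>: "1 \<le> \<rho>" using p by (auto simp: \<rho>_def)
    have Fle: "\<bar>F u x\<bar> \<le> K / 2 * m2 x" if x: "1 \<le> x" for u x
    proof -
      have "\<bar>F u x\<bar> \<le> A / x ^ 3 * (K * m x)"
        by (rule order_trans[OF F[OF x]], rule mult_left_mono[OF ub'[OF x]]) (use A x in auto)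
      also have "\<dots> = K / 2 * ((0 + 2 * A / x ^ 3) * exp (A / x))" by (simp add: m_def)
      also have "\<dots> \<le> K / 2 * m2 x" unfolding m2_def using K x
        by (intro mult_left_mono mult_right_mono add_mono) auto
      finally show ?thesis .
    qed
    have "\<bar>d s \<rho>\<bar> \<le> K / 2 * m \<rho> + e" if e: "0 < e" for e :: real
    proof -
      obtain R' where R': "\<And>t r. R' \<le> r \<Longrightarrow> \<bar>d t r\<bar> \<le> e / 3" using dec[of "e / 3" h] e by (auto simp: d_def)
      \<comment> \<open>Both sides have length \<open>L\<close>, so the corners other than (s,
        \<rho>) lie at radii \<rho> + L, \<rho> + L and \<rho> + 2 L, all beyond \<open>R'\<close>;
        each of them contributes at most e / 3.\<close>
      define L where "L = max 0 R'"
      have L: "0 \<le> L" "R' \<le> \<rho> + L" "R' \<le> \<rho> + L + L" using \<rho> by (auto simp: L_def)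
      define J where "J = integral {0..L} (\<lambda>b. integral {0..L} (\<lambda>a. F (s + a - b) (\<rho> + a + b)))"
      have id: "d s \<rho> - d (s + L) (\<rho> + L) - d (s - L) (\<rho> + L) + d (s + L - L) (\<rho> + L + L) = J"
        using dd \<rho> L unfolding diamond_identity_def J_def by blast
      have "\<bar>J\<bar> \<le> K / 2 * m \<rho> - K / 2 * m (\<rho> + L) - K / 2 * m (\<rho> + L) + K / 2 * m (\<rho> + L + L)"
        unfolding J_def
        by (rule diamond_majorant[OF cF \<rho> L(1) L(1), where ?m1.0 = "\<lambda>x. K / 2 * m1 x" and ?m2.0 = "\<lambda>x. K / 2 * m2 x"])
          (use Fle \<rho> in \<open>simp_all only: DERIV_cmult[OF md(1)] DERIV_cmult[OF md(2)] order_trans[OF \<rho>]\<close>)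
      also have "\<dots> \<le> K / 2 * m \<rho>"
      proof -
        have "K / 2 * m (\<rho> + L + L) \<le> K / 2 * m (\<rho> + L)" using K \<rho> L by (intro mult_left_mono mdec) auto
        moreover have "0 \<le> K / 2 * m (\<rho> + L)" using K by (simp add: m_def)
        ultimately show ?thesis by linarith
      qed
      finally show ?thesis using id R'[OF L(2), of "s + L"] R'[OF L(2), of "s - L"] R'[OF L(3), of "s + L - L"] by linarith
    qed
    then have "\<bar>d s \<rho>\<bar> \<le> K / 2 * m \<rho>" by (rule field_le_epsilon)
    then show "\<bar>d (fst p) (snd p)\<bar> \<le> (0 + K / 2) * m (snd p)" by (simp add: s_def \<rho>_def)
  qed auto
  from this[of "(0, r)"] r show ?thesis by (simp add: d_def h_def)
qed

section \<open>Stationary profiles\<close>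

lemma continuous_antiderivative:
  fixes g :: "real \<Rightarrow> real"
  assumes "continuous_on UNIV g"
  shows "\<exists>G. \<forall>x. (G has_real_derivative g x) (at x)"
proof -
  have "\<exists>F. \<forall>x::real. -\<infinity> < ereal x \<longrightarrow> ereal x < \<infinity> \<longrightarrow> (F has_vector_derivative g x) (at x)"
    by (rule einterval_antiderivative) (use assms in \<open>auto simp: continuous_on_eq_continuous_at\<close>)
  then show ?thesis by (simp add: has_real_derivative_iff_has_vector_derivative)
qed

lemma integral_FTC:
  fixes G g :: "real \<Rightarrow> real"
  assumes "a \<le> b" "\<And>x. a \<le> x \<Longrightarrow> x \<le> b \<Longrightarrow> (G has_real_derivative g x) (at x)"
  shows "(g has_integral (G b - G a)) {a..b}"
  by (rule fundamental_theorem_of_calculus)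
    (use assms in \<open>auto intro: DERIV_subset simp flip: has_real_derivative_iff_has_vector_derivative\<close>)

text \<open>A continuous function with vanishing rectangle differences is affine. Subtracting a
  second antiderivative of \<open>g\<close> from \<open>y\<close> reduces the claim to this case,
  where averaging the functional equation over a unit interval expresses the remainder through its
  own antiderivative and so makes it differentiable. A separate function \<open>Y\<close> is
  returned because \<open>y\<close> is controlled only on \<open>{1..}\<close>, while two-sided
  derivatives are wanted at 1 as well.\<close>

lemma stationary_twice_differentiable:
  fixes y g :: "real \<Rightarrow> real"
  assumes y: "continuous_on {1..} y" and g: "continuous_on {1..} g"
    and dia: "diamond_identity (\<lambda>_. y) (\<lambda>_. g)"
  obtains Y Y1 where "\<And>x. 1 \<le> x \<Longrightarrow> Y x = y x" "\<And>x. 1 \<le> x \<Longrightarrow> (Y has_real_derivative Y1 x) (at x)"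
    "\<And>x. 1 \<le> x \<Longrightarrow> (Y1 has_real_derivative g x) (at x)"
proof -
  have ext: "continuous_on UNIV (\<lambda>x. h (max 1 x))" if "continuous_on {1..} h" for h :: "real \<Rightarrow> real"
    by (rule continuous_on_compose2[OF that]) (auto intro!: continuous_intros)
  obtain F1 where F1: "\<And>x. (F1 has_real_derivative g (max 1 x)) (at x)"
    using continuous_antiderivative[OF ext[OF g]] by blast
  then have "continuous_on UNIV F1" by (meson DERIV_isCont continuous_at_imp_continuous_on)
  from continuous_antiderivative[OF this] obtain F2 where F2: "\<And>x. (F2 has_real_derivative F1 x) (at x)" by blast
  then have cF2: "continuous_on UNIV F2" by (meson DERIV_isCont continuous_at_imp_continuous_on)
  define z where "z = (\<lambda>x. y (max 1 x) - F2 x)"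
  have "continuous_on UNIV z" unfolding z_def by (intro continuous_intros ext y cF2)
  from continuous_antiderivative[OF this] obtain Z where Z: "\<And>x. (Z has_real_derivative z x) (at x)" by blast
  have zz: "z r + z (r + \<sigma> + \<delta>) = z (r + \<sigma>) + z (r + \<delta>)" if h: "1 \<le> r" "0 \<le> \<sigma>" "0 \<le> \<delta>" for r \<sigma> \<delta>
  proof -
    have inner: "integral {0..\<sigma>} (\<lambda>a. g (r + a + b)) = F1 (r + \<sigma> + b) - F1 (r + b)" if b: "b \<in> {0..\<delta>}" for b
    proof -
      have "((\<lambda>a. g (r + a + b)) has_integral F1 (r + \<sigma> + b) - F1 (r + 0 + b)) {0..\<sigma>}"
      proof (rule integral_FTC[OF h(2)])
        fix x :: real assume "0 \<le> x"
        then have "max 1 (r + x + b) = r + x + b" using h b by auto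
        then show "((\<lambda>x. F1 (r + x + b)) has_real_derivative g (r + x + b)) (at x)"
          by (auto intro!: derivative_eq_intros DERIV_chain2[OF F1, THEN DERIV_cong])
      qed
      then show ?thesis by (simp add: integral_unique)
    qed
    have "((\<lambda>b. F1 (r + \<sigma> + b) - F1 (r + b)) has_integral
        (F2 (r + \<sigma> + \<delta>) - F2 (r + \<delta>)) - (F2 (r + \<sigma> + 0) - F2 (r + 0))) {0..\<delta>}"
      by (rule integral_FTC[OF h(3)]) (auto intro!: derivative_eq_intros DERIV_chain2[OF F2, THEN DERIV_cong])
    then have "integral {0..\<delta>} (\<lambda>b. F1 (r + \<sigma> + b) - F1 (r + b)) = F2 (r + \<sigma> + \<delta>) - F2 (r + \<delta>) - F2 (r + \<sigma>) + F2 r"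
      by (simp add: integral_unique)
    moreover have "integral {0..\<delta>} (\<lambda>b. integral {0..\<sigma>} (\<lambda>a. g (r + a + b))) = integral {0..\<delta>} (\<lambda>b. F1 (r + \<sigma> + b) - F1 (r + b))"
      by (intro Henstock_Kurzweil_Integration.integral_cong inner)
    moreover have "y r - y (r + \<sigma>) - y (r + \<delta>) + y (r + \<sigma> + \<delta>) = integral {0..\<delta>} (\<lambda>b. integral {0..\<sigma>} (\<lambda>a. g (r + a + b)))"
      using dia h unfolding diamond_identity_def by blast
    ultimately show ?thesis using h by (simp add: z_def)
  qed
  have zq: "z x = z 1 + Z (x + 1) - Z x - Z 2 + Z 1" if x: "1 \<le> x" for x
  proof -
    \<comment> \<open>Integrating z 1 + z (x + s) = z (1 + s) + z x over s in \<open>{0..1}\<close>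
      writes z x as a combination of values of the differentiable function \<open>Z\<close>.\<close>
    have i1: "((\<lambda>s. z 1 + z (x + s)) has_integral (z 1 * 1 + Z (x + 1)) - (z 1 * 0 + Z (x + 0))) {0..1}"
      by (rule integral_FTC) (auto intro!: derivative_eq_intros DERIV_chain2[OF Z, THEN DERIV_cong])
    have i2: "((\<lambda>s. z (1 + s) + z x) has_integral (Z (1 + 1) + z x * 1) - (Z (1 + 0) + z x * 0)) {0..1}"
      by (rule integral_FTC) (auto intro!: derivative_eq_intros DERIV_chain2[OF Z, THEN DERIV_cong])
    have "z 1 + z (x + s) = z (1 + s) + z x" if "0 \<le> s" for s
      using zz[of 1 s "x - 1"] that x by (simp add: algebra_simps)
    then have "integral {0..1} (\<lambda>s. z 1 + z (x + s)) = integral {0..1} (\<lambda>s. z (1 + s) + z x)"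
      by (intro Henstock_Kurzweil_Integration.integral_cong) auto
    then show ?thesis using integral_unique[OF i1] integral_unique[OF i2] by simp
  qed
  define c where "c = z 2 - z 1"
  define Y where "Y = (\<lambda>x. F2 x + (z 1 + Z (x + 1) - Z x - Z 2 + Z 1))"
  show ?thesis
  proof (rule that[of Y "\<lambda>x. F1 x + c"])
    fix x :: real assume x: "1 \<le> x"
    show "Y x = y x" using zq[OF x] x by (simp add: Y_def z_def)
    show "((\<lambda>x. F1 x + c) has_real_derivative g x) (at x)"
      using x by (auto intro!: derivative_eq_intros F1[THEN DERIV_cong] simp: max_def)
    \<comment> \<open>This difference is the derivative of Z (x + 1) - Z x; the functional equation
      shows it to be constant.\<close>
    have "z (x + 1) - z x = c" using zz[of 1 1 "x - 1"] x by (simp add: c_def algebra_simps)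
    then show "(Y has_real_derivative F1 x + c) (at x)" unfolding Y_def
      by (auto intro!: derivative_eq_intros F2[THEN DERIV_cong] Z[THEN DERIV_cong] DERIV_chain2[OF Z, THEN DERIV_cong])
  qed
qed

text \<open>The Neumann condition for \<open>u\<close> reads \<open>y' = y\<close> at \<open>1\<close> for \<open>y = r u\<close>.\<close>
lemma stationary_neumann_zero:
  fixes Y Y1 :: "real \<Rightarrow> real"
  assumes dY: "\<And>x. 1 \<le> x \<Longrightarrow> (Y has_real_derivative Y1 x) (at x)"
    and dY1: "\<And>x. 1 \<le> x \<Longrightarrow> (Y1 has_real_derivative Y x ^ 5 / x ^ 4) (at x)"
    and neumann: "Y1 1 = Y 1"
    and bd: "\<And>x. 1 \<le> x \<Longrightarrow> \<bar>Y x\<bar> \<le> C * x powr (1/4)"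
    and x: "1 \<le> x"
  shows "Y x = 0"
proof -
  define p where "p = (\<lambda>x. Y x ^ 2)"
  define p1 where "p1 = (\<lambda>x. 2 * (Y x * Y1 x))"
  \<comment> \<open>Uses Y Y'' = Y^6 / x^4; the defocusing sign makes both summands
    nonnegative.\<close>
  define p2 where "p2 = (\<lambda>x. 2 * (Y1 x ^ 2 + Y x ^ 6 / x ^ 4))"
  have dp: "(p has_real_derivative p1 x) (at x)" if "1 \<le> x" for x
    unfolding p_def p1_def using that by (auto intro!: derivative_eq_intros dY)
  have dp1: "(p1 has_real_derivative p2 x) (at x)" if "1 \<le> x" for x
    unfolding p1_def p2_def using that
    by (auto intro!: derivative_eq_intros dY dY1 simp: power2_eq_square eval_nat_numeral)
  have p2: "0 \<le> p2 x" for x by (simp add: p2_def)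
  have mono1: "p1 x \<le> p1 y" if "1 \<le> x" "x \<le> y" for x y
  proof (rule DERIV_nonneg_imp_nondecreasing[OF that(2)])
    fix u assume "x \<le> u"
    then show "\<exists>y. (p1 has_real_derivative y) (at u) \<and> 0 \<le> y" using dp1[of u] p2[of u] that by auto
  qed
  \<comment> \<open>The Neumann condition turns the slope of \<open>p\<close> at 1 into 2
    Y(1)^2.\<close>
  have p11: "0 \<le> p1 1" by (simp add: p1_def neumann)
  have p1_le: "p1 a \<le> 0" if a: "1 \<le> a" for a
  proof (rule ccontr)
    assume "\<not> p1 a \<le> 0"
    then have s: "0 < p1 a" by simp
    \<comment> \<open>By convexity a positive slope at \<open>a\<close> persists, so
      \<open>p\<close> would grow at least linearly, against the bound C^2 sqrt x.\<close>
    have lin: "p1 a * (x - a) \<le> C ^ 2 * sqrt x" if x: "a \<le> x" for x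
    proof -
      have "p a - p1 a * a \<le> p x - p1 a * x"
      proof (rule DERIV_nonneg_imp_nondecreasing[OF x])
        fix u assume "a \<le> u" "u \<le> x"
        then show "\<exists>y. ((\<lambda>x. p x - p1 a * x) has_real_derivative y) (at u) \<and> 0 \<le> y"
          using a mono1[of a u] by (intro exI[of _ "p1 u - p1 a"]) (auto intro!: derivative_eq_intros dp)
      qed
      moreover have "0 \<le> p a" by (simp add: p_def)
      moreover have "p x \<le> (C * x powr (1/4)) ^ 2"
        using power_mono[of "\<bar>Y x\<bar>" _ 2] bd[of x] a x by (simp add: p_def)
      moreover have "(C * x powr (1/4)) ^ 2 = C ^ 2 * sqrt x"
        using a x by (simp add: power_mult_distrib powr_power powr_half_sqrt)
      ultimately show ?thesis unfolding right_diff_distrib by linarith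
    qed
    have "((\<lambda>x. C ^ 2 * sqrt x / (x - a)) \<longlongrightarrow> 0) at_top" by real_asymp
    moreover have "\<forall>\<^sub>F x in at_top. p1 a \<le> C ^ 2 * sqrt x / (x - a)"
      using eventually_gt_at_top[of a]
    proof eventually_elim
      case (elim x)
      then show ?case using lin[of x] by (simp add: pos_le_divide_eq)
    qed
    ultimately have "p1 a \<le> 0" by (intro tendsto_lowerbound[where F = at_top]) auto
    with s show False by simp
  qed
  have p1_0: "p1 a = 0" if "1 \<le> a" for a
    using p1_le[OF that] mono1[OF order_refl that] p11 by simp
  have const: "p a = p 1" if a: "1 \<le> a" for a
  proof (cases "a = 1")
    case False
    then have "1 < a" using a by simp
    from MVT2[OF this, of p p1] dp show ?thesis using p1_0 by force
  qed simp
  \<comment> \<open>\<open>p1\<close> vanishes throughout, so its derivative vanishes at some point.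
    There Y^6 / x^4 is zero, and since \<open>p\<close> is constant one zero is enough.\<close>
  obtain \<xi> where \<xi>: "1 < \<xi>" "p1 2 - p1 1 = (2 - 1) * p2 \<xi>"
    using MVT2[of 1 2 p1 p2] dp1 by (meson le_less one_less_numeral_iff semiring_norm(76))
  then have "p2 \<xi> = 0" using p1_0 by simp
  moreover have "0 \<le> Y \<xi> ^ 6 / \<xi> ^ 4" "0 \<le> Y1 \<xi> ^ 2" by simp_all
  ultimately have "Y \<xi> ^ 6 / \<xi> ^ 4 = 0" unfolding p2_def by (simp add: add_nonneg_eq_0_iff)
  then have "p \<xi> = 0" using \<xi> by (simp add: p_def)
  then have "p x = 0" using const[of \<xi>] const[OF x] \<xi> by simp
  then show ?thesis by (simp add: p_def)
qed

text \<open>Green's identity: Y' \<phi> - Y \<phi>' has derivative g \<phi> - Y \<phi>''. The test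
  function vanishes to first order at \<open>b\<close>, so only the boundary term at 1 remains. The
  values \<phi>(1) = \<phi>'(1) = 1 are those of \<open>r\<close> times a cut-off that is flat at
  the sphere.\<close>

lemma neumann_from_test:
  fixes Y Y1 g \<phi> \<phi>1 \<phi>2 :: "real \<Rightarrow> real"
  assumes "1 \<le> b" and dY: "\<And>x. 1 \<le> x \<Longrightarrow> (Y has_real_derivative Y1 x) (at x)"
    and dY1: "\<And>x. 1 \<le> x \<Longrightarrow> (Y1 has_real_derivative g x) (at x)"
    and d\<phi>: "\<And>x. 1 \<le> x \<Longrightarrow> (\<phi> has_real_derivative \<phi>1 x) (at x)"
    and d\<phi>1: "\<And>x. 1 \<le> x \<Longrightarrow> (\<phi>1 has_real_derivative \<phi>2 x) (at x)"
    and bc: "\<phi> 1 = 1" "\<phi>1 1 = 1" "\<phi> b = 0" "\<phi>1 b = 0"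
    and int: "integral {1..b} (\<lambda>x. g x * \<phi> x - Y x * \<phi>2 x) = 0"
  shows "Y1 1 = Y 1"
proof -
  have "((\<lambda>x. g x * \<phi> x - Y x * \<phi>2 x) has_integral (Y1 b * \<phi> b - Y b * \<phi>1 b) - (Y1 1 * \<phi> 1 - Y 1 * \<phi>1 1)) {1..b}"
    by (rule integral_FTC[OF assms(1)]) (auto intro!: derivative_eq_intros dY dY1 d\<phi> d\<phi>1)
  from integral_unique[OF this] int bc show ?thesis by simp
qed

section \<open>Radial integrals over the exterior domain\<close>

lemma Cauchy_Schwarz_integral:
  fixes f g :: "'a \<Rightarrow> real"
  assumes [measurable]: "f \<in> borel_measurable M" "g \<in> borel_measurable M"
    and f: "integrable M (\<lambda>x. f x ^ 2)" and g: "integrable M (\<lambda>x. g x ^ 2)"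
  shows "integrable M (\<lambda>x. f x * g x)"
    and "(\<integral>x. \<bar>f x * g x\<bar> \<partial>M) \<le> sqrt (\<integral>x. f x ^ 2 \<partial>M) * sqrt (\<integral>x. g x ^ 2 \<partial>M)"
proof -
  show i: "integrable M (\<lambda>x. f x * g x)"
  proof (rule Bochner_Integration.integrable_bound)
    show "integrable M (\<lambda>x. f x ^ 2 + g x ^ 2)" using f g by simp
    show "AE x in M. norm (f x * g x) \<le> norm (f x ^ 2 + g x ^ 2)"
    proof (intro AE_I2)
      fix x
      have "2 * (\<bar>f x\<bar> * \<bar>g x\<bar>) \<le> f x ^ 2 + g x ^ 2"
        using zero_le_power2[of "\<bar>f x\<bar> - \<bar>g x\<bar>"] by (simp add: power2_diff)
      moreover have "0 \<le> f x ^ 2 + g x ^ 2" by simp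
      ultimately have "\<bar>f x\<bar> * \<bar>g x\<bar> \<le> f x ^ 2 + g x ^ 2" by linarith
      then show "norm (f x * g x) \<le> norm (f x ^ 2 + g x ^ 2)" by (simp add: abs_mult)
    qed
  qed simp
  have "ennreal (\<integral>x. \<bar>f x * g x\<bar> \<partial>M) ^ 2 = (\<integral>\<^sup>+x. ennreal \<bar>f x\<bar> * ennreal \<bar>g x\<bar> \<partial>M) ^ 2"
    using integrable_abs[OF i]
    by (subst nn_integral_eq_integral[symmetric]) (auto simp: abs_mult ennreal_mult)
  also have "\<dots> \<le> (\<integral>\<^sup>+x. ennreal \<bar>f x\<bar> ^ 2 \<partial>M) * (\<integral>\<^sup>+x. ennreal \<bar>g x\<bar> ^ 2 \<partial>M)"
    by (rule Cauchy_Schwarz_nn_integral) auto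
  also have "\<dots> = ennreal (\<integral>x. f x ^ 2 \<partial>M) * ennreal (\<integral>x. g x ^ 2 \<partial>M)"
    using f g by (subst (1 2) nn_integral_eq_integral[symmetric]) (auto simp: ennreal_power)
  finally have "(\<integral>x. \<bar>f x * g x\<bar> \<partial>M) ^ 2 \<le> (\<integral>x. f x ^ 2 \<partial>M) * (\<integral>x. g x ^ 2 \<partial>M)"
    by (simp add: ennreal_power flip: ennreal_mult)
  then have "sqrt ((\<integral>x. \<bar>f x * g x\<bar> \<partial>M) ^ 2) \<le> sqrt ((\<integral>x. f x ^ 2 \<partial>M) * (\<integral>x. g x ^ 2 \<partial>M))"
    by (rule real_sqrt_le_mono)
  then show "(\<integral>x. \<bar>f x * g x\<bar> \<partial>M) \<le> sqrt (\<integral>x. f x ^ 2 \<partial>M) * sqrt (\<integral>x. g x ^ 2 \<partial>M)"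
    by (simp add: real_sqrt_mult)
qed

text \<open>The area \<open>4 \<pi>\<close> of the unit sphere.\<close>
definition \<kappa> :: real where "\<kappa> = 3 * unit_ball_vol 3"

lemma \<kappa>_pos: "0 < \<kappa>"
  by (simp add: \<kappa>_def)

abbreviation MB :: "R3 measure" where "MB \<equiv> lebesgue_on Bc"

lemma closed_Bc: "closed Bc"
  unfolding Bc_def by (intro closed_Collect_le continuous_intros)

lemma Bc_lebesgue [measurable]: "Bc \<in> sets lebesgue"
  using closed_Bc by (intro sets_completionI_sets) (simp add: borel_closed)

lemma Bc_int_lebesgue [measurable]: "Bc_int \<in> sets lebesgue"
  unfolding Bc_int_def
  by (intro sets_completionI_sets) (simp add: borel_open open_Collect_less continuous_intros)

lemma space_MB [simp]: "space MB = Bc"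
  by simp

lemma borel_measurable_MB:
  assumes "h \<in> borel_measurable borel"
  shows "h \<in> borel_measurable MB"
  using assms by (intro measurable_restrict_space1 measurable_completion) simp

lemma norm_measurable_MB [measurable]: "norm \<in> borel_measurable MB"
  by (rule borel_measurable_MB) simp

text \<open>Polar coordinates are needed for radial integrands only, so the image of the measure
  under the norm suffices. Half-lines form an intersection-stable generator; on them the left side
  is a difference of ball volumes and the right side the integral of 3 r^2 times the volume of the
  unit ball.\<close>

lemma norm_distr_MB: "distr MB borel norm = density lborel (\<lambda>r. ennreal (\<kappa> * r ^ 2 * indicator {1..} r))"
proof (rule measure_eqI_generator_eq[where E = "range (\<lambda>a::real. {..a})" and \<Omega> = UNIV and A = "\<lambda>n. {..real n}"])
  show "Int_stable (range (\<lambda>a::real. {..a}))" by (auto simp: Int_stable_def)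
  show "sets (distr MB borel norm) = sigma_sets UNIV (range (\<lambda>a::real. {..a}))"
    by (simp add: borel_eq_atMost)
  show "sets (density lborel (\<lambda>r. ennreal (\<kappa> * r ^ 2 * indicator {1..} r))) = sigma_sets UNIV (range (\<lambda>a::real. {..a}))"
    by (simp add: borel_eq_atMost)
  show "(\<Union>i. {..real i}) = UNIV" by (auto simp: real_arch_simple)
  have lhs: "emeasure (distr MB borel norm) {..a} = emeasure lborel (cball (0::R3) a - ball 0 1)" for a
  proof -
    have "emeasure (distr MB borel norm) {..a} = emeasure MB (norm -` {..a} \<inter> Bc)"
      by (simp add: emeasure_distr)
    also have "\<dots> = emeasure lebesgue (norm -` {..a} \<inter> Bc)"
      by (intro emeasure_restrict_space) auto
    also have "norm -` {..a} \<inter> Bc = cball (0::R3) a - ball 0 1"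
      by (auto simp: Bc_def)
    also have "emeasure lebesgue (cball (0::R3) a - ball 0 1) = emeasure lborel (cball (0::R3) a - ball 0 1)"
      by simp
    finally show ?thesis .
  qed
  show "emeasure (distr MB borel norm) {..real i} \<noteq> \<infinity>" for i
  proof -
    have "emeasure lborel (cball (0::R3) (real i) - ball 0 1) \<le> emeasure lborel (cball (0::R3) (real i))"
      by (intro emeasure_mono) auto
    also have "\<dots> < \<infinity>" by (simp add: emeasure_cball ennreal_mult_less_top)
    finally show ?thesis unfolding lhs by simp
  qed
  fix X assume "X \<in> range (\<lambda>a::real. {..a})"
  then obtain a where X: "X = {..a}" by auto
  have rhs: "emeasure (density lborel (\<lambda>r. ennreal (\<kappa> * r ^ 2 * indicator {1..} r))) {..a} =
     (\<integral>\<^sup>+r. ennreal (\<kappa> * r ^ 2) * indicator {1..a} r \<partial>lborel)"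
    by (subst emeasure_density) (auto intro!: nn_integral_cong split: split_indicator)
  show "emeasure (distr MB borel norm) X = emeasure (density lborel (\<lambda>r. ennreal (\<kappa> * r ^ 2 * indicator {1..} r))) X"
  proof (cases "1 \<le> a")
    case True
    have "(\<integral>\<^sup>+r. ennreal (\<kappa> * r ^ 2) * indicator {1..a} r \<partial>lborel) = ennreal (unit_ball_vol 3 * a ^ 3 - unit_ball_vol 3 * 1 ^ 3)"
      by (rule nn_integral_FTC_Icc[where F = "\<lambda>r. unit_ball_vol 3 * r ^ 3"])
        (use True in \<open>auto intro!: derivative_eq_intros simp: \<kappa>_def\<close>)
    moreover have "emeasure lborel (cball (0::R3) a - ball 0 1) = ennreal (unit_ball_vol 3 * a ^ 3) - ennreal (unit_ball_vol 3 * 1 ^ 3)"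
    proof (subst emeasure_Diff)
      show "ball (0::R3) 1 \<subseteq> cball 0 a" using True by auto
    qed (use True in \<open>auto simp: emeasure_cball emeasure_ball\<close>)
    ultimately show ?thesis unfolding X lhs rhs by (simp add: ennreal_minus)
  next
    case False
    then have e: "cball (0::R3) a - ball 0 1 = {}" "{1..a} = {}" by auto
    show ?thesis unfolding X lhs rhs e by simp
  qed
qed auto

lemma integral_MB_radial:
  fixes h :: "real \<Rightarrow> real"
  assumes [measurable]: "h \<in> borel_measurable borel"
  shows "(\<integral>x. h (norm x) \<partial>MB) = \<kappa> * (\<integral>r. indicator {1..} r * (r ^ 2 * h r) \<partial>lborel)"
    and "integrable MB (\<lambda>x. h (norm x)) \<longleftrightarrow> integrable lborel (\<lambda>r. indicator {1..} r * (r ^ 2 * h r))"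
proof -
  have "(\<integral>x. h (norm x) \<partial>MB) = (\<integral>r. h r \<partial>distr MB borel norm)" by (simp add: integral_distr)
  also have "\<dots> = (\<integral>r. (\<kappa> * r ^ 2 * indicator {1..} r) *\<^sub>R h r \<partial>lborel)"
    unfolding norm_distr_MB using \<kappa>_pos by (intro integral_density) auto
  also have "\<dots> = (\<integral>r. \<kappa> * (indicator {1..} r * (r ^ 2 * h r)) \<partial>lborel)" by (simp add: mult_ac)
  finally show "(\<integral>x. h (norm x) \<partial>MB) = \<kappa> * (\<integral>r. indicator {1..} r * (r ^ 2 * h r) \<partial>lborel)" by simp
  have "integrable MB (\<lambda>x. h (norm x)) \<longleftrightarrow> integrable (distr MB borel norm) h" by (simp add: integrable_distr_eq)
  also have "\<dots> \<longleftrightarrow> integrable lborel (\<lambda>r. (\<kappa> * r ^ 2 * indicator {1..} r) *\<^sub>R h r)"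
    unfolding norm_distr_MB using \<kappa>_pos by (intro integrable_density) auto
  also have "\<dots> \<longleftrightarrow> integrable lborel (\<lambda>r. \<kappa> * (indicator {1..} r * (r ^ 2 * h r)))" by (simp add: mult_ac)
  also have "\<dots> \<longleftrightarrow> integrable lborel (\<lambda>r. indicator {1..} r * (r ^ 2 * h r))" using \<kappa>_pos by simp
  finally show "integrable MB (\<lambda>x. h (norm x)) \<longleftrightarrow> integrable lborel (\<lambda>r. indicator {1..} r * (r ^ 2 * h r))" .
qed

text \<open>The flux kernel x / |x|^3 has length |x|^(-2). This is its squared L^2 norm outside
  radius \<open>r\<close>, the origin of the factor 1 / sqrt r in the profile bounds.\<close>

lemma integral_MB_norm_power_minus4:
  assumes r: "1 \<le> r"
  shows "integrable MB (\<lambda>x. indicator {r<..} (norm x) / norm x ^ 4)"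
    and "(\<integral>x. indicator {r<..} (norm x) / norm x ^ 4 \<partial>MB) = \<kappa> / r"
proof -
  have lim: "((\<lambda>x. - 1 / x :: real) \<longlongrightarrow> 0) at_top" by real_asymp
  have d: "((\<lambda>x. - 1 / x) has_real_derivative 1 / x ^ 2) (at x)" if "r < x" for x :: real
    using that r by (auto intro!: derivative_eq_intros simp: power2_eq_square)
  have lr: "((\<lambda>x. - 1 / x :: real) \<longlongrightarrow> - 1 / r) (at_right r)"
    using r by (intro tendsto_intros) auto
  have si: "set_integrable lborel (einterval r \<infinity>) (\<lambda>x. 1 / x ^ 2)" and se: "(LBINT x=r..\<infinity>. 1 / x ^ 2) = 0 - (- 1 / r)"
    by (rule interval_integral_FTC_nonneg[where F = "\<lambda>x. - 1 / x" and A = "- 1 / r" and B = 0];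
        use r d lr lim in \<open>auto intro!: continuous_intros simp: ereal_tendsto_simps\<close>)+
  have eq: "indicator {1..} x * (x ^ 2 * (indicator {r<..} x / x ^ 4)) = indicator (einterval r \<infinity>) x *\<^sub>R (1 / x ^ 2)" for x :: real
    using r by (auto simp: einterval_def indicator_def divide_simps eval_nat_numeral)
  have m: "(\<lambda>x::real. indicator {r<..} x / x ^ 4 :: real) \<in> borel_measurable borel" by measurable
  show "integrable MB (\<lambda>x. indicator {r<..} (norm x) / norm x ^ 4)"
    using integral_MB_radial(2)[OF m] si unfolding eq set_integrable_def by simp
  show "(\<integral>x. indicator {r<..} (norm x) / norm x ^ 4 \<partial>MB) = \<kappa> / r"
    using integral_MB_radial(1)[OF m] se
    unfolding eq interval_lebesgue_integral_def set_lebesgue_integral_def by simp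
qed

section \<open>Profiles recovered from the flux, and their modulus of continuity\<close>

definition L2v :: "(R3 \<Rightarrow> R3) \<Rightarrow> bool" where
  "L2v G \<longleftrightarrow> G \<in> borel_measurable MB \<and> integrable MB (\<lambda>x. norm (G x) ^ 2)"

definition tail :: "(R3 \<Rightarrow> R3) \<Rightarrow> real \<Rightarrow> real" where
  "tail G r = (\<integral>x. indicator {r<..} (norm x) * norm (G x) ^ 2 \<partial>MB)"

text \<open>The maximum continues the profile by its boundary value to \<open>r < 1\<close>, so that it is continuous on the
  whole line.\<close>
definition rprofile :: "(R3 \<Rightarrow> R3) \<Rightarrow> real \<Rightarrow> real" where
  "rprofile G r = - (\<integral>x. indicator {max 1 r<..} (norm x) * (G x \<bullet> x / norm x ^ 3) \<partial>MB) / \<kappa>"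

lemma AE_MB_norm_gt_1: "AE x in MB. 1 < norm x"
proof -
  have "sphere (0::R3) 1 \<in> null_sets lebesgue"
    by (simp add: negligible_iff_null_sets[symmetric] negligible_sphere)
  then have "AE x in lebesgue. x \<notin> sphere (0::R3) 1" by (rule AE_not_in)
  then show ?thesis by (subst AE_restrict_space_iff) (auto simp: Bc_def elim!: eventually_mono)
qed

text \<open>Cauchy-Schwarz with both factors restricted to radii in \<open>S\<close>. Half-lines
  give the decay of the profile, intervals its modulus of continuity.\<close>

lemma flux_bound:
  assumes G: "L2v G" and S: "S \<in> sets borel" "S \<subseteq> {1<..}"
  shows "integrable MB (\<lambda>x. indicator S (norm x) * (G x \<bullet> x / norm x ^ 3))"
    and "\<bar>\<integral>x. indicator S (norm x) * (G x \<bullet> x / norm x ^ 3) \<partial>MB\<bar> \<le>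
      sqrt (\<integral>x. indicator S (norm x) * norm (G x) ^ 2 \<partial>MB) * sqrt (\<integral>x. indicator S (norm x) / norm x ^ 4 \<partial>MB)"
proof -
  have [measurable]: "G \<in> borel_measurable MB" using G by (simp add: L2v_def)
  have [measurable]: "(\<lambda>x. x) \<in> borel_measurable MB" by (rule borel_measurable_MB) simp
  have [measurable]: "S \<in> sets borel" by fact
  define a where "a = (\<lambda>x. indicator S (norm x) * norm (G x))"
  define b where "b = (\<lambda>x::R3. indicator S (norm x) / norm x ^ 2 :: real)"
  have [measurable]: "a \<in> borel_measurable MB" "b \<in> borel_measurable MB" unfolding a_def b_def by measurable
  have a2: "a x ^ 2 = indicator S (norm x) * norm (G x) ^ 2" for x
    by (simp add: a_def power_mult_distrib indicator_def)
  have b2: "b x ^ 2 = indicator S (norm x) / norm x ^ 4" for x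
    by (simp add: b_def power_divide indicator_def flip: power_mult)
  have ia: "integrable MB (\<lambda>x. a x ^ 2)" unfolding a2
    by (rule Bochner_Integration.integrable_bound[of _ "\<lambda>x. norm (G x) ^ 2"])
      (use G in \<open>auto simp: L2v_def indicator_def\<close>)
  have ib: "integrable MB (\<lambda>x. b x ^ 2)" unfolding b2
    by (rule Bochner_Integration.integrable_bound[OF integral_MB_norm_power_minus4(1)[of 1]])
      (use S in \<open>auto simp: indicator_def\<close>)
  note CS = Cauchy_Schwarz_integral[of a MB b, OF _ _ ia ib]
  have le: "\<bar>indicator S (norm x) * (G x \<bullet> x / norm x ^ 3)\<bar> \<le> \<bar>a x * b x\<bar>" for x
  proof (cases "norm x \<in> S")
    case True
    then have n: "1 < norm x" using S by auto
    have "\<bar>G x \<bullet> x\<bar> / norm x ^ 3 \<le> (norm (G x) * norm x) / norm x ^ 3"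
      by (intro divide_right_mono Cauchy_Schwarz_ineq2) auto
    also have "\<dots> = norm (G x) / norm x ^ 2" using n by (simp add: field_simps eval_nat_numeral)
    finally show ?thesis using True by (simp add: a_def b_def abs_mult)
  qed simp
  show i: "integrable MB (\<lambda>x. indicator S (norm x) * (G x \<bullet> x / norm x ^ 3))"
    by (rule Bochner_Integration.integrable_bound[OF CS(1)]) (use le in auto)
  have "\<bar>\<integral>x. indicator S (norm x) * (G x \<bullet> x / norm x ^ 3) \<partial>MB\<bar> \<le> (\<integral>x. \<bar>indicator S (norm x) * (G x \<bullet> x / norm x ^ 3)\<bar> \<partial>MB)"
    by (rule integral_abs_bound)
  also have "\<dots> \<le> (\<integral>x. \<bar>a x * b x\<bar> \<partial>MB)"
    by (intro integral_mono integrable_abs i CS(1) le) auto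
  also have "\<dots> \<le> sqrt (\<integral>x. a x ^ 2 \<partial>MB) * sqrt (\<integral>x. b x ^ 2 \<partial>MB)" by (rule CS(2)) auto
  finally show "\<bar>\<integral>x. indicator S (norm x) * (G x \<bullet> x / norm x ^ 3) \<partial>MB\<bar> \<le>
      sqrt (\<integral>x. indicator S (norm x) * norm (G x) ^ 2 \<partial>MB) * sqrt (\<integral>x. indicator S (norm x) / norm x ^ 4 \<partial>MB)"
    unfolding a2 b2 .
qed

lemma tail_integrable:
  assumes G: "L2v G"
  shows "integrable MB (\<lambda>x. indicator {r<..} (norm x) * norm (G x) ^ 2)"
proof -
  have [measurable]: "G \<in> borel_measurable MB" using G by (simp add: L2v_def)
  show ?thesis
    by (rule Bochner_Integration.integrable_bound[of _ "\<lambda>x. norm (G x) ^ 2"])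
      (use G in \<open>auto simp: L2v_def indicator_def\<close>)
qed

lemma tail_nonneg: "0 \<le> tail G r"
  unfolding tail_def by (intro integral_nonneg_AE) auto

lemma tail_mono: "L2v G \<Longrightarrow> r \<le> s \<Longrightarrow> tail G s \<le> tail G r"
  unfolding tail_def by (intro integral_mono tail_integrable) (auto simp: indicator_def)

lemma tail_le: "L2v G \<Longrightarrow> tail G r \<le> (\<integral>x. norm (G x) ^ 2 \<partial>MB)"
  unfolding tail_def by (intro integral_mono tail_integrable) (auto simp: indicator_def L2v_def)

text \<open>Only the energy outside radius \<open>r\<close> enters, not the full norm; after
  multiplication by \<open>r\<close> the right side is sqrt r times a quantity that vanishes with
  the tail.\<close>

lemma rprofile_bound:
  assumes G: "L2v G" and r: "1 \<le> r"
  shows "\<bar>rprofile G r\<bar> \<le> sqrt (tail G r) / sqrt (\<kappa> * r)"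
proof -
  have "\<bar>rprofile G r\<bar> = \<bar>\<integral>x. indicator {r<..} (norm x) * (G x \<bullet> x / norm x ^ 3) \<partial>MB\<bar> / \<kappa>"
    using r \<kappa>_pos by (simp add: rprofile_def max_def)
  also have "\<dots> \<le> sqrt (tail G r) * sqrt (\<integral>x. indicator {r<..} (norm x) / norm x ^ 4 \<partial>MB) / \<kappa>"
    unfolding tail_def using \<kappa>_pos r by (intro divide_right_mono flux_bound(2)[OF G]) auto
  also have "\<dots> = sqrt (tail G r) * (sqrt (\<kappa> / r) / \<kappa>)"
    using integral_MB_norm_power_minus4(2)[OF r] by simp
  also have "sqrt (\<kappa> / r) / \<kappa> = 1 / sqrt (\<kappa> * r)"
    using \<kappa>_pos r by (simp add: real_sqrt_divide real_sqrt_mult field_simps)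
  finally show ?thesis by simp
qed

text \<open>Flux through a shell. The kernel contributes 1/a - 1/b, at most (b - a) / a^2. The
  resulting factor 1 / a compensates the multiplication by the radius in \<open>w\<close>, so
  increments of \<open>w\<close> over bounded distances are governed by the tail too.\<close>

lemma rprofile_diff_bound:
  assumes G: "L2v G" and r: "1 \<le> a" "a \<le> b"
  shows "\<bar>rprofile G a - rprofile G b\<bar> \<le> sqrt (tail G a) * (sqrt (b - a) / (sqrt \<kappa> * a))"
proof -
  let ?k = "\<lambda>x. G x \<bullet> x / norm x ^ 3"
  have [measurable]: "G \<in> borel_measurable MB" using G by (simp add: L2v_def)
  have ind: "indicator {a<..b} u = indicator {a<..} u - (indicator {b<..} u :: real)" for u
    using r by (auto simp: indicator_def)
  have ia: "integrable MB (\<lambda>x. indicator {a<..} (norm x) * ?k x)" by (rule flux_bound(1)[OF G]) (use r in auto)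
  have ib: "integrable MB (\<lambda>x. indicator {b<..} (norm x) * ?k x)" by (rule flux_bound(1)[OF G]) (use r in auto)
  have "(\<integral>x. indicator {a<..b} (norm x) * ?k x \<partial>MB)
     = (\<integral>x. indicator {a<..} (norm x) * ?k x \<partial>MB) - (\<integral>x. indicator {b<..} (norm x) * ?k x \<partial>MB)"
    unfolding ind left_diff_distrib using ia ib by (rule Bochner_Integration.integral_diff)
  then have "\<bar>rprofile G a - rprofile G b\<bar> = \<bar>\<integral>x. indicator {a<..b} (norm x) * ?k x \<partial>MB\<bar> / \<kappa>"
    using r \<kappa>_pos by (simp add: rprofile_def max_def field_simps)
  also have "\<dots> \<le> sqrt (\<integral>x. indicator {a<..b} (norm x) * norm (G x) ^ 2 \<partial>MB) * sqrt (\<integral>x. indicator {a<..b} (norm x) / norm x ^ 4 \<partial>MB) / \<kappa>"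
    using \<kappa>_pos r by (intro divide_right_mono flux_bound(2)[OF G]) auto
  also have "\<dots> \<le> sqrt (tail G a) * sqrt (\<kappa> / a - \<kappa> / b) / \<kappa>"
  proof (intro divide_right_mono mult_mono real_sqrt_le_mono)
    show "(\<integral>x. indicator {a<..b} (norm x) * norm (G x) ^ 2 \<partial>MB) \<le> tail G a"
      unfolding tail_def
    proof (rule integral_mono)
      show "integrable MB (\<lambda>x. indicator {a<..b} (norm x) * norm (G x) ^ 2)"
        unfolding ind left_diff_distrib by (intro Bochner_Integration.integrable_diff tail_integrable G)
      show "integrable MB (\<lambda>x. indicator {a<..} (norm x) * norm (G x) ^ 2)" by (rule tail_integrable[OF G])
    qed (auto simp: indicator_def)
    have "(\<integral>x. indicator {a<..b} (norm x) / norm x ^ 4 \<partial>MB) = \<kappa> / a - \<kappa> / b"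
      unfolding ind diff_divide_distrib using r integral_MB_norm_power_minus4[of a] integral_MB_norm_power_minus4[of b]
      by (subst Bochner_Integration.integral_diff) auto
    then show "(\<integral>x. indicator {a<..b} (norm x) / norm x ^ 4 \<partial>MB) \<le> \<kappa> / a - \<kappa> / b" by simp
  qed (use \<kappa>_pos tail_nonneg in \<open>auto intro!: integral_nonneg_AE\<close>)
  also have "\<dots> \<le> sqrt (tail G a) * (sqrt (b - a) / (sqrt \<kappa> * a))"
  proof -
    have "\<kappa> / a - \<kappa> / b = \<kappa> * (b - a) / (a * b)" using r by (simp add: field_simps)
    also have "\<dots> \<le> \<kappa> * (b - a) / (a * a)" using r \<kappa>_pos by (intro divide_left_mono mult_left_mono) auto
    finally have "sqrt (\<kappa> / a - \<kappa> / b) \<le> sqrt (\<kappa> * (b - a) / (a * a))" by (rule real_sqrt_le_mono)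
    also have "\<dots> = sqrt \<kappa> * (sqrt (b - a) / a)"
      using r by (simp only: real_sqrt_divide real_sqrt_mult) simp
    also have "\<dots> = (\<kappa> / sqrt \<kappa>) * (sqrt (b - a) / a)"
      using \<kappa>_pos by (simp add: real_div_sqrt)
    also have "\<dots> = \<kappa> * (sqrt (b - a) / (sqrt \<kappa> * a))" by simp
    finally have "sqrt (\<kappa> / a - \<kappa> / b) / \<kappa> \<le> sqrt (b - a) / (sqrt \<kappa> * a)"
      using \<kappa>_pos by (simp add: pos_divide_le_eq mult.commute)
    from mult_left_mono[OF this, of "sqrt (tail G a)"] tail_nonneg show ?thesis by simp
  qed
  finally show ?thesis .
qed

lemma rprofile_diff:
  assumes "L2v G1" "L2v G2"
  shows "rprofile (\<lambda>x. G1 x - G2 x) r = rprofile G1 r - rprofile G2 r"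
proof -
  let ?S = "{max 1 r<..}"
  have "(\<integral>x. indicator ?S (norm x) * ((G1 x - G2 x) \<bullet> x / norm x ^ 3) \<partial>MB)
      = (\<integral>x. indicator ?S (norm x) * (G1 x \<bullet> x / norm x ^ 3) - indicator ?S (norm x) * (G2 x \<bullet> x / norm x ^ 3) \<partial>MB)"
    by (simp add: inner_diff_left diff_divide_distrib right_diff_distrib)
  also have "\<dots> = (\<integral>x. indicator ?S (norm x) * (G1 x \<bullet> x / norm x ^ 3) \<partial>MB) - (\<integral>x. indicator ?S (norm x) * (G2 x \<bullet> x / norm x ^ 3) \<partial>MB)"
    by (intro Bochner_Integration.integral_diff flux_bound(1) assms) auto
  finally show ?thesis by (simp add: rprofile_def diff_divide_distrib)
qed

lemma rprofile_max: "rprofile G (max 1 r) = rprofile G r"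
  by (simp add: rprofile_def)

lemma L2v_diff:
  assumes "L2v G1" "L2v G2"
  shows "L2v (\<lambda>x. G1 x - G2 x)"
proof -
  have [measurable]: "G1 \<in> borel_measurable MB" "G2 \<in> borel_measurable MB" using assms by (auto simp: L2v_def)
  have le: "norm (a - b) ^ 2 \<le> 2 * norm a ^ 2 + 2 * norm b ^ 2" for a b :: R3
  proof -
    have "norm (a - b) ^ 2 \<le> (norm a + norm b) ^ 2" by (intro power_mono norm_triangle_ineq4) auto
    also have "\<dots> \<le> 2 * norm a ^ 2 + 2 * norm b ^ 2"
      using zero_le_power2[of "norm a - norm b"] by (simp add: power2_diff power2_sum)
    finally show ?thesis .
  qed
  have "integrable MB (\<lambda>x. norm (G1 x - G2 x) ^ 2)"
    by (rule Bochner_Integration.integrable_bound[of _ "\<lambda>x. 2 * norm (G1 x) ^ 2 + 2 * norm (G2 x) ^ 2"])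
      (use assms le in \<open>auto simp: L2v_def\<close>)
  then show ?thesis by (simp add: L2v_def)
qed

text \<open>Hoelder continuity of order 1/2 with one constant for the whole line; radii below 1 are
  moved to 1, which does not increase distances.\<close>

lemma continuous_rprofile:
  assumes "L2v G"
  shows "continuous_on UNIV (rprofile G)"
proof -
  define K where "K = sqrt (\<integral>x. norm (G x) ^ 2 \<partial>MB) / sqrt \<kappa>"
  have K0: "0 \<le> K" unfolding K_def using \<kappa>_pos by (intro divide_nonneg_nonneg real_sqrt_ge_zero integral_nonneg_AE) auto
  have le: "\<bar>rprofile G a - rprofile G b\<bar> \<le> K * sqrt \<bar>b - a\<bar>" if "1 \<le> a" "a \<le> b" for a b
  proof -
    have "\<bar>rprofile G a - rprofile G b\<bar> \<le> sqrt (tail G a) * (sqrt (b - a) / (sqrt \<kappa> * a))"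
      by (rule rprofile_diff_bound) fact+
    also have "\<dots> \<le> sqrt (\<integral>x. norm (G x) ^ 2 \<partial>MB) * (sqrt (b - a) / (sqrt \<kappa> * 1))"
      using that \<kappa>_pos tail_nonneg tail_le[OF assms]
      by (intro mult_mono real_sqrt_le_mono divide_left_mono mult_left_mono) auto
    finally show ?thesis using that by (simp add: K_def)
  qed
  have le1: "\<bar>rprofile G a - rprofile G b\<bar> \<le> K * sqrt \<bar>b - a\<bar>" if "1 \<le> a" "1 \<le> b" for a b
    using le[of a b] le[of b a] that by (cases "a \<le> b") (auto simp: abs_minus_commute)
  have le2: "\<bar>rprofile G a - rprofile G b\<bar> \<le> K * sqrt \<bar>b - a\<bar>" for a b
  proof -
    have "\<bar>rprofile G a - rprofile G b\<bar> \<le> K * sqrt \<bar>max 1 b - max 1 a\<bar>"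
      using le1[of "max 1 a" "max 1 b"] by (simp add: rprofile_max)
    also have "\<dots> \<le> K * sqrt \<bar>b - a\<bar>" using K0 by (intro mult_left_mono real_sqrt_le_mono) auto
    finally show ?thesis .
  qed
  show ?thesis
  proof (rule continuous_at_imp_continuous_on, rule ballI)
    fix a
    have "((\<lambda>b. K * sqrt \<bar>b - a\<bar>) \<longlongrightarrow> K * sqrt \<bar>a - a\<bar>) (at a)" by (intro tendsto_intros)
    then have "((\<lambda>b. K * sqrt \<bar>b - a\<bar>) \<longlongrightarrow> 0) (at a)" by simp
    then have "((\<lambda>b. rprofile G b - rprofile G a) \<longlongrightarrow> 0) (at a)"
      by (rule Lim_null_comparison[rotated]) (use le2 in \<open>auto simp: abs_minus_commute\<close>)
    then show "isCont (rprofile G) a" unfolding isCont_def using LIM_zero_iff by blast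
  qed
qed

section \<open>Integration by parts against the flux\<close>

lemma sigma_finite_MB: "sigma_finite_measure MB"
proof
  show "\<exists>A. countable A \<and> A \<subseteq> sets MB \<and> \<Union> A = space MB \<and> (\<forall>a\<in>A. emeasure MB a \<noteq> \<infinity>)"
  proof (intro exI[of _ "range (\<lambda>n. cball 0 (real n) \<inter> Bc)"] conjI ballI)
    show "countable (range (\<lambda>n. cball (0::R3) (real n) \<inter> Bc))" by simp
    show "range (\<lambda>n. cball 0 (real n) \<inter> Bc) \<subseteq> sets MB"
      by (auto simp: sets_restrict_space Bc_lebesgue)
    show "(\<Union>n. cball 0 (real n) \<inter> Bc) = space MB"
      by (auto simp: real_arch_simple)
    fix a assume "a \<in> range (\<lambda>n. cball (0::R3) (real n) \<inter> Bc)"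
    then obtain n where a: "a = cball 0 (real n) \<inter> Bc" by auto
    have "emeasure MB a = emeasure lebesgue a" unfolding a by (intro emeasure_restrict_space) auto
    also have "\<dots> \<le> emeasure lebesgue (cball (0::R3) (real n))" unfolding a by (intro emeasure_mono) auto
    also have "\<dots> < \<infinity>" by (simp add: emeasure_cball)
    finally show "emeasure MB a \<noteq> \<infinity>" by simp
  qed
qed

lemma integral_Icc_FTC:
  fixes F f :: "real \<Rightarrow> real"
  assumes "a \<le> b" "\<And>x. (F has_real_derivative f x) (at x)" "continuous_on UNIV f"
  shows "(\<integral>x. f x * indicator {a..b} x \<partial>lborel) = F b - F a"
    and "integrable lborel (\<lambda>x. f x * indicator {a..b} x)"
proof -
  have c: "isCont f x" for x using assms(3) by (simp add: continuous_on_eq_continuous_at)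
  show "(\<integral>x. f x * indicator {a..b} x \<partial>lborel) = F b - F a"
    by (rule integral_FTC_Icc_real) (use assms c in auto)
  have "has_bochner_integral lborel (\<lambda>x. f x * indicator {a..b} x) (F b - F a)"
    by (rule has_bochner_integral_FTC_Icc_real) (use assms c in auto)
  then show "integrable lborel (\<lambda>x. f x * indicator {a..b} x)" by (rule integrable.intros)
qed

lemma continuous_bounded_Icc:
  fixes f :: "real \<Rightarrow> real"
  assumes "continuous_on UNIV f"
  shows "\<exists>B. \<forall>r\<in>{a..b}. \<bar>f r\<bar> \<le> B"
proof -
  have "compact (f ` {a..b})" by (intro compact_continuous_image continuous_on_subset[OF assms]) auto
  then have "bounded (f ` {a..b})" by (rule compact_imp_bounded)
  then show ?thesis unfolding bounded_iff by (auto simp: real_norm_def)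
qed

text \<open>\<gamma>(|x|) is \<gamma>(1) plus the integral of \<gamma>' from 1 to |x|. Fubini turns
  the inner integral over |x| > r into -\<kappa> times the profile. The boundary term is kept
  because \<gamma> need not vanish at the sphere.\<close>

lemma flux_test:
  assumes G: "L2v G" and d: "\<And>r. (\<gamma> has_real_derivative \<gamma>' r) (at r)" and c: "continuous_on UNIV \<gamma>'"
    and z: "\<And>r. R \<le> r \<Longrightarrow> \<gamma> r = 0" and R: "1 \<le> R"
  shows "(\<integral>x. (G x \<bullet> x / norm x ^ 3) * \<gamma> (norm x) \<partial>MB) =
    - \<kappa> * (\<gamma> 1 * rprofile G 1 + (\<integral>r. indicator {1..R} r * (\<gamma>' r * rprofile G r) \<partial>lborel))"
    and "integrable MB (\<lambda>x. (G x \<bullet> x / norm x ^ 3) * \<gamma> (norm x))"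
proof -
  define k where "k = (\<lambda>x. G x \<bullet> x / norm x ^ 3)"
  have [measurable]: "G \<in> borel_measurable MB" using G by (simp add: L2v_def)
  have [measurable]: "(\<lambda>x. x) \<in> borel_measurable MB" by (rule borel_measurable_MB) simp
  have [measurable]: "k \<in> borel_measurable MB" unfolding k_def by measurable
  have [measurable]: "\<gamma>' \<in> borel_measurable borel" using c by (rule borel_measurable_continuous_onI)
  have c\<gamma>: "continuous_on UNIV \<gamma>" using d by (meson DERIV_isCont continuous_at_imp_continuous_on)
  have [measurable]: "\<gamma> \<in> borel_measurable borel" using c\<gamma> by (rule borel_measurable_continuous_onI)
  have ik1: "integrable MB (\<lambda>x. indicator {r<..} (norm x) * k x)" if "1 \<le> r" for r
    unfolding k_def by (rule flux_bound(1)[OF G]) (use that in auto)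
  have AE1: "AE x in MB. indicator {1<..} (norm x) * k x = k x"
    using AE_MB_norm_gt_1 by eventually_elim simp
  have ik: "integrable MB k"
    using ik1[of 1] by (rule integrable_cong_AE_imp) (use AE1 in \<open>auto elim!: eventually_mono\<close>)
  have vr: "(\<integral>x. indicator {r<..} (norm x) * k x \<partial>MB) = - \<kappa> * rprofile G r" if "1 \<le> r" for r
    using that \<kappa>_pos by (simp add: rprofile_def k_def max_def)
  have k1: "(\<integral>x. k x \<partial>MB) = - \<kappa> * rprofile G 1"
    using vr[of 1] integral_cong_AE[OF _ _ AE1] by simp
  interpret MB: sigma_finite_measure MB by (rule sigma_finite_MB)
  interpret P: pair_sigma_finite MB lborel ..
  obtain B where B: "\<And>r. r \<in> {1..R} \<Longrightarrow> \<bar>\<gamma>' r\<bar> \<le> B"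
    using continuous_bounded_Icc[OF c] by blast
  \<comment> \<open>The cut-off at \<open>R\<close> costs nothing since \<gamma> is zero from there
    on, and it makes the kernel dominated by an integrable product.\<close>
  define K where "K = (\<lambda>x r. k x * ((indicator {1..R} r * \<gamma>' r) * (if r < norm x then 1 else 0)))"
  have Km [measurable]: "case_prod K \<in> borel_measurable (MB \<Otimes>\<^sub>M lborel)"
    unfolding K_def by measurable
  have Kb: "\<bar>K x r\<bar> \<le> \<bar>k x\<bar> * (B * indicator {1..R} r)" for x r
    using B[of r] unfolding K_def abs_mult by (intro mult_left_mono) (auto simp: indicator_def)
  have iB: "integrable lborel (\<lambda>r::real. B * indicator {1..R} r)"
    using R by (intro integrable_mult_right integrable_real_indicator) auto
  have iK: "integrable (MB \<Otimes>\<^sub>M lborel) (case_prod K)"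
  proof (rule P.Fubini_integrable)
    have ir: "integrable lborel (\<lambda>r. K x r)" for x
    proof (rule Bochner_Integration.integrable_bound[OF integrable_mult_right[OF iB, of "\<bar>k x\<bar>"]])
      show "K x \<in> borel_measurable lborel" unfolding K_def by measurable
      show "AE r in lborel. norm (K x r) \<le> norm (\<bar>k x\<bar> * (B * indicator {1..R} r))"
        unfolding real_norm_def by (intro AE_I2 order_trans[OF Kb abs_ge_self])
    qed
    then show "AE x in MB. integrable lborel (\<lambda>r. case_prod K (x, r))" by simp
    show "integrable MB (\<lambda>x. \<integral>r. norm (case_prod K (x, r)) \<partial>lborel)"
    proof (rule Bochner_Integration.integrable_bound)
      show "integrable MB (\<lambda>x. \<bar>k x\<bar> * (\<integral>r. B * indicator {1..R} r \<partial>lborel))"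
        using integrable_abs[OF ik] by simp
      show "AE x in MB. norm (\<integral>r. norm (case_prod K (x, r)) \<partial>lborel) \<le> norm (\<bar>k x\<bar> * (\<integral>r. B * indicator {1..R} r \<partial>lborel))"
      proof (rule AE_I2)
        fix x
        have "(\<integral>r. norm (K x r) \<partial>lborel) \<le> (\<integral>r. \<bar>k x\<bar> * (B * indicator {1..R} r) \<partial>lborel)"
          using Kb[of x] by (intro integral_mono integrable_norm ir integrable_mult_right iB) auto
        moreover have "0 \<le> (\<integral>r. norm (K x r) \<partial>lborel)" by (intro integral_nonneg_AE) auto
        ultimately show "norm (\<integral>r. norm (case_prod K (x, r)) \<partial>lborel) \<le> norm (\<bar>k x\<bar> * (\<integral>r. B * indicator {1..R} r \<partial>lborel))"
          by simp
      qed
    qed measurable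
  qed measurable
  have F: "(\<integral>r. (\<integral>x. K x r \<partial>MB) \<partial>lborel) = (\<integral>x. (\<integral>r. K x r \<partial>lborel) \<partial>MB)"
    by (rule P.Fubini_integral[OF iK])
  have L: "(\<integral>x. K x r \<partial>MB) = - \<kappa> * (indicator {1..R} r * (\<gamma>' r * rprofile G r))" for r
  proof (cases "r \<in> {1..R}")
    case True
    have "(\<integral>x. K x r \<partial>MB) = (\<integral>x. \<gamma>' r * (indicator {r<..} (norm x) * k x) \<partial>MB)"
      unfolding K_def using True by (intro Bochner_Integration.integral_cong) (auto simp: indicator_def)
    also have "\<dots> = \<gamma>' r * (- \<kappa> * rprofile G r)" using True vr[of r] by simp
    finally show ?thesis using True by simp
  qed (simp add: K_def)
  have Rr: "(\<integral>r. K x r \<partial>lborel) = k x * (\<gamma> (norm x) - \<gamma> 1)" if x: "x \<in> Bc" for x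
  proof -
    define s where "s = min R (norm x)"
    have s: "1 \<le> s" using x R by (auto simp: s_def Bc_def)
    \<comment> \<open>\<open>K\<close> has the strict inequality r < |x| while the interval is
      closed; they differ at most in the single radius r = |x|.\<close>
    have "AE r in lborel. K x r = k x * (\<gamma>' r * indicator {1..s} r)"
      using AE_lborel_singleton[of "norm x"] by eventually_elim (auto simp: K_def s_def indicator_def)
    then have "(\<integral>r. K x r \<partial>lborel) = (\<integral>r. k x * (\<gamma>' r * indicator {1..s} r) \<partial>lborel)"
      by (intro integral_cong_AE) (auto simp: K_def)
    also have "\<dots> = k x * (\<gamma> s - \<gamma> 1)" using integral_Icc_FTC[OF s d c] by simp
    also have "\<gamma> s = \<gamma> (norm x)" using z[of R] z[of "norm x"] by (auto simp: s_def min_def)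
    finally show ?thesis .
  qed
  have e1: "- \<kappa> * (\<integral>r. indicator {1..R} r * (\<gamma>' r * rprofile G r) \<partial>lborel) = (\<integral>x. k x * (\<gamma> (norm x) - \<gamma> 1) \<partial>MB)"
  proof -
    have "(\<integral>x. (\<integral>r. K x r \<partial>lborel) \<partial>MB) = (\<integral>x. k x * (\<gamma> (norm x) - \<gamma> 1) \<partial>MB)"
      by (intro Bochner_Integration.integral_cong) (auto simp: Rr)
    with F show ?thesis unfolding L by simp
  qed
  obtain D where D: "\<And>r. r \<in> {1..R} \<Longrightarrow> \<bar>\<gamma> r\<bar> \<le> D"
    using continuous_bounded_Icc[OF c\<gamma>] by blast
  have D': "\<bar>\<gamma> r\<bar> \<le> \<bar>D\<bar>" if "1 \<le> r" for r
    using D[of r] z[of r] that by (cases "r \<le> R") auto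
  have i\<gamma>: "integrable MB (\<lambda>x. k x * \<gamma> (norm x))"
  proof (rule Bochner_Integration.integrable_bound[OF integrable_mult_right[OF ik, of "\<bar>D\<bar>"]])
    show "AE x in MB. norm (k x * \<gamma> (norm x)) \<le> norm (\<bar>D\<bar> * k x)"
      using AE_MB_norm_gt_1
    proof eventually_elim
      case (elim x)
      then show ?case using mult_right_mono[OF D'[of "norm x"], of "\<bar>k x\<bar>"] by (simp add: abs_mult mult.commute)
    qed
  qed measurable
  then show "integrable MB (\<lambda>x. (G x \<bullet> x / norm x ^ 3) * \<gamma> (norm x))" by (simp add: k_def)
  have "(\<integral>x. k x * (\<gamma> (norm x) - \<gamma> 1) \<partial>MB) = (\<integral>x. k x * \<gamma> (norm x) - k x * \<gamma> 1 \<partial>MB)"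
    by (simp add: right_diff_distrib)
  also have "\<dots> = (\<integral>x. k x * \<gamma> (norm x) \<partial>MB) - (\<integral>x. k x * \<gamma> 1 \<partial>MB)"
    using i\<gamma> ik by (intro Bochner_Integration.integral_diff) auto
  finally have "(\<integral>x. k x * \<gamma> (norm x) \<partial>MB) = (\<integral>x. k x * (\<gamma> (norm x) - \<gamma> 1) \<partial>MB) - \<kappa> * rprofile G 1 * \<gamma> 1"
    using k1 by simp
  then show "(\<integral>x. (G x \<bullet> x / norm x ^ 3) * \<gamma> (norm x) \<partial>MB) =
    - \<kappa> * (\<gamma> 1 * rprofile G 1 + (\<integral>r. indicator {1..R} r * (\<gamma>' r * rprofile G r) \<partial>lborel))"
    unfolding e1[symmetric] by (simp add: k_def algebra_simps)
qed

section \<open>Radial profiles of elements of the energy space\<close>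

definition loc_int :: "(R3 \<Rightarrow> real) \<Rightarrow> bool" where
  "loc_int f \<longleftrightarrow> (\<forall>K. compact K \<longrightarrow> K \<subseteq> Bc_int \<longrightarrow> integrable (lebesgue_on K) f)"

text \<open>The weak gradient lives on the open exterior, the energy on the closed one. A factor
  supported in a compact subset of the open set makes both integrals equal to the one over the whole
  space.\<close>

lemma loc_int_mult:
  assumes f: "loc_int f" and K: "compact K" "K \<subseteq> Bc_int"
    and \<psi>: "\<psi> \<in> borel_measurable borel" "\<And>x. x \<notin> K \<Longrightarrow> \<psi> x = 0" "\<And>x. \<bar>\<psi> x\<bar> \<le> B"
  shows "integrable MB (\<lambda>x. f x * \<psi> x)"
    and "integrable (lebesgue_on Bc_int) (\<lambda>x. f x * \<psi> x)"
    and "(\<integral>x. f x * \<psi> x \<partial>lebesgue_on Bc_int) = (\<integral>x. f x * \<psi> x \<partial>MB)"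
proof -
  have KL: "K \<in> sets lebesgue" using K by (intro sets_completionI_sets) (simp add: borel_closed compact_imp_closed)
  have "integrable (lebesgue_on K) f" using f K by (simp add: loc_int_def)
  then have i: "integrable lebesgue (\<lambda>x. indicator K x *\<^sub>R f x)"
    by (subst (asm) integrable_restrict_space) (use KL in auto)
  have [measurable]: "\<psi> \<in> borel_measurable lebesgue" using \<psi>(1) by (intro measurable_completion) simp
  have eq: "f x * \<psi> x = (indicator K x *\<^sub>R f x) * \<psi> x" for x using \<psi>(2)[of x] by (auto simp: indicator_def)
  have j: "integrable lebesgue (\<lambda>x. f x * \<psi> x)"
  proof (rule Bochner_Integration.integrable_bound[OF integrable_mult_right[OF i, of B]])
    show "(\<lambda>x. f x * \<psi> x) \<in> borel_measurable lebesgue"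
      unfolding eq using borel_measurable_integrable[OF i] by measurable
    show "AE x in lebesgue. norm (f x * \<psi> x) \<le> norm (B * indicator K x *\<^sub>R f x)"
    proof (rule AE_I2)
      fix x
      have "\<bar>\<psi> x\<bar> \<le> \<bar>B\<bar>" using \<psi>(3)[of x] by linarith
      then show "norm (f x * \<psi> x) \<le> norm (B * indicator K x *\<^sub>R f x)"
        unfolding eq using mult_left_mono[of "\<bar>\<psi> x\<bar>" "\<bar>B\<bar>" "\<bar>indicator K x *\<^sub>R f x\<bar>"]
        by (simp add: abs_mult mult_ac)
    qed
  qed
  have S: "indicator S x *\<^sub>R (f x * \<psi> x) = f x * \<psi> x" if "Bc_int \<subseteq> S" for S x
    using that K(2) \<psi>(2)[of x] by (auto simp: indicator_def)
  have B: "Bc_int \<subseteq> Bc" by (auto simp: Bc_def Bc_int_def)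
  have r: "Bc \<inter> space lebesgue \<in> sets lebesgue" "Bc_int \<inter> space lebesgue \<in> sets lebesgue"
    using Bc_lebesgue Bc_int_lebesgue by simp_all
  show "integrable MB (\<lambda>x. f x * \<psi> x)" "integrable (lebesgue_on Bc_int) (\<lambda>x. f x * \<psi> x)"
    using j by (simp_all only: integrable_restrict_space[OF r(1)] integrable_restrict_space[OF r(2)] S[OF B] S[OF order_refl])
  show "(\<integral>x. f x * \<psi> x \<partial>lebesgue_on Bc_int) = (\<integral>x. f x * \<psi> x \<partial>MB)"
    by (simp only: integral_restrict_space[OF r(1)] integral_restrict_space[OF r(2)] S[OF B] S[OF order_refl])
qed

lemma shell_compact: "compact {x::R3. a \<le> norm x \<and> norm x \<le> b}"
proof -
  have "{x::R3. a \<le> norm x \<and> norm x \<le> b} = cball 0 b - ball 0 a" by auto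
  then show ?thesis by (simp add: compact_diff)
qed

text \<open>The vector field \<gamma>(|x|) x / |x|^3 has divergence \<gamma>'(|x|) / |x|^2. Weak
  gradients are tested with scalar functions, so the field is inserted one component at a time and
  the three identities are added.\<close>

lemma weak_grad_radial:
  assumes wg: "weak_grad Bc_int f G"
    and d: "\<And>r. (\<gamma> has_real_derivative \<gamma>' r) (at r)" and c: "continuous_on UNIV \<gamma>'"
    and z: "\<And>r. r \<notin> {a..b} \<Longrightarrow> \<gamma> r = 0" "\<And>r. r \<notin> {a..b} \<Longrightarrow> \<gamma>' r = 0" and a: "1 < a"
  shows "(\<integral>x. f x * (\<gamma>' (norm x) / norm x ^ 2) \<partial>MB) = - (\<integral>x. (G x \<bullet> x / norm x ^ 3) * \<gamma> (norm x) \<partial>MB)"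
proof -
  define K where "K = {x::R3. a \<le> norm x \<and> norm x \<le> b}"
  have K: "compact K" "K \<subseteq> Bc_int" using a by (auto simp: K_def shell_compact Bc_int_def)
  have c\<gamma>: "continuous_on UNIV \<gamma>" using d by (meson DERIV_isCont continuous_at_imp_continuous_on)
  \<comment> \<open>\<open>max 1 r\<close> changes nothing on the support of \<gamma>, which lies in
    radii at least a > 1, and removes the singularity at the origin.\<close>
  define q where "q = (\<lambda>r. \<gamma> r / (max 1 r) ^ 3)"
  define q' where "q' = (\<lambda>r. \<gamma>' r / (max 1 r) ^ 3 - 3 * \<gamma> r / (max 1 r) ^ 4)"
  have cq: "continuous_on UNIV q" unfolding q_def by (intro continuous_intros c\<gamma>) auto
  have cq': "continuous_on UNIV q'" unfolding q'_def by (intro continuous_intros c\<gamma> c) auto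
  have dq: "(q has_real_derivative q' r) (at r)" if r: "1 < r" for r
  proof -
    have "((\<lambda>r. \<gamma> r / r ^ 3) has_real_derivative q' r) (at r)"
      unfolding q'_def using r by (auto intro!: derivative_eq_intros d simp: max_def divide_simps) (simp add: algebra_simps eval_nat_numeral)
    then show ?thesis
      by (rule has_field_derivative_transform_within_open[where S = "{1<..}"]) (use r in \<open>auto simp: q_def max_def\<close>)
  qed
  have q0: "q r = 0" "q' r = 0" if "r \<notin> {a..b}" for r using z that by (auto simp: q_def q'_def)
  define phi where "phi = (\<lambda>i (x::R3). x $ i * q (norm x))"
  define dphi where "dphi = (\<lambda>i (x::R3). q (norm x) *\<^sub>R axis i 1 + (x $ i * (q' (norm x) / max 1 (norm x))) *\<^sub>R x)"
  have cdphi: "continuous_on UNIV (dphi i)" for i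
    unfolding dphi_def
    by (intro continuous_intros continuous_on_compose2[OF cq] continuous_on_compose2[OF cq']) auto
  have cphi: "continuous_on UNIV (phi i)" for i
    unfolding phi_def by (intro continuous_intros continuous_on_compose2[OF cq]) auto
  have out: "phi i x = 0" "dphi i x = 0" if "x \<notin> K" for i x
    using q0[of "norm x"] that by (auto simp: phi_def dphi_def K_def)
  have tf: "test_fun Bc_int (phi i) (dphi i)" for i
    unfolding test_fun_def
  proof (intro conjI allI exI[of _ K] K cdphi)
    fix x
    show "(phi i has_derivative (\<bullet>) (dphi i x)) (at x)"
    proof (cases "1 < norm x")
      case True
      then have "x \<noteq> 0" by auto
      have "((\<lambda>x. q (norm x)) has_derivative (\<lambda>h. (sgn x \<bullet> h) * q' (norm x))) (at x)"
        using DERIV_compose_FDERIV[OF dq[OF True] has_derivative_norm[OF \<open>x \<noteq> 0\<close>]]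
        by (simp add: inner_commute)
      moreover have "((\<lambda>x::R3. x $ i) has_derivative (\<lambda>h. h $ i)) (at x)"
        by (rule bounded_linear.has_derivative[OF bounded_linear_vec_nth]) (rule has_derivative_ident)
      ultimately have "(phi i has_derivative (\<lambda>h. x $ i * ((sgn x \<bullet> h) * q' (norm x)) + h $ i * q (norm x))) (at x)"
        unfolding phi_def by (rule has_derivative_mult[rotated])
      moreover have "(\<lambda>h. x $ i * ((sgn x \<bullet> h) * q' (norm x)) + h $ i * q (norm x)) = (\<bullet>) (dphi i x)"
        using True by (auto simp: dphi_def fun_eq_iff inner_add_left inner_axis' sgn_div_norm max_def divide_simps)
      ultimately show ?thesis by simp
    next
      case False
      have "x \<notin> K" using False a by (auto simp: K_def)
      then have "dphi i x = 0" by (rule out)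
      moreover have "(phi i has_derivative (\<lambda>h. 0)) (at x)"
        by (rule has_derivative_transform_within_open[where f = "\<lambda>x. 0" and s = "ball 0 a"])
          (use False a in \<open>auto simp: out K_def\<close>)
      moreover have "(\<bullet>) (0::R3) = (\<lambda>h. 0)" by auto
      ultimately show ?thesis by simp
    qed
  qed (use out in auto)
  have lf: "loc_int f" using wg by (auto simp: weak_grad_def loc_int_def)
  have Gm: "G \<in> borel_measurable (lebesgue_on Bc_int)" using wg by (simp add: weak_grad_def)
  have lG: "loc_int (\<lambda>x. G x $ i)" for i
    unfolding loc_int_def
  proof (intro allI impI)
    fix K assume K: "compact K" "K \<subseteq> Bc_int"
    have "G \<in> borel_measurable (lebesgue_on K)" using Gm K(2) by (rule measurable_restrict_mono)
    then have "(\<lambda>x. G x \<bullet> axis i 1) \<in> borel_measurable (lebesgue_on K)" by simp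
    then have m: "(\<lambda>x. G x $ i) \<in> borel_measurable (lebesgue_on K)" by (simp add: inner_axis)
    have "integrable (lebesgue_on K) (\<lambda>x. norm (G x))" using wg K by (simp add: weak_grad_def)
    then show "integrable (lebesgue_on K) (\<lambda>x. G x $ i)"
      by (rule Bochner_Integration.integrable_bound) (use m component_le_norm_cart in auto)
  qed
  have bdd: "\<exists>B. \<forall>x. \<bar>\<psi> x\<bar> \<le> B" if "continuous_on UNIV \<psi>" "\<And>x. x \<notin> K \<Longrightarrow> \<psi> x = 0" for \<psi> :: "R3 \<Rightarrow> real"
  proof -
    have "bounded (\<psi> ` K)" by (intro compact_imp_bounded compact_continuous_image continuous_on_subset[OF that(1)] K) auto
    then obtain B where "\<And>x. x \<in> K \<Longrightarrow> \<bar>\<psi> x\<bar> \<le> B" unfolding bounded_iff by auto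
    then have "\<bar>\<psi> x\<bar> \<le> max 0 B" for x using that(2)[of x] by (cases "x \<in> K") (auto simp: le_max_iff_disj)
    then show ?thesis by blast
  qed
  have cdi: "continuous_on UNIV (\<lambda>x. dphi i x $ i)" for i by (intro continuous_intros cdphi)
  obtain B where B: "\<And>i x. \<bar>dphi i x $ i\<bar> \<le> B i" using bdd[OF cdi] out by (metis zero_index)
  obtain C where C: "\<And>i x. \<bar>phi i x\<bar> \<le> C i" using bdd[OF cphi] out by metis
  note f1 = loc_int_mult[OF lf K borel_measurable_continuous_onI[OF cdi] _ B]
  note G1 = loc_int_mult[OF lG K borel_measurable_continuous_onI[OF cphi] _ C]
  have each: "(\<integral>x. f x * (dphi i x $ i) \<partial>MB) = - (\<integral>x. (G x $ i) * phi i x \<partial>MB)" for i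
  proof -
    have "(\<integral>x. f x * (dphi i x $ i) \<partial>lebesgue_on Bc_int) = - (\<integral>x. (G x $ i) * phi i x \<partial>lebesgue_on Bc_int)"
      using wg tf[of i] by (simp add: weak_grad_def)
    then show ?thesis using f1(3)[of i] G1(3)[of i i] out by simp
  qed
  have "(\<integral>x. f x * (\<gamma>' (norm x) / norm x ^ 2) \<partial>MB) = (\<integral>x. (\<Sum>i\<in>UNIV. f x * (dphi i x $ i)) \<partial>MB)"
  proof (rule Bochner_Integration.integral_cong[OF refl])
    fix x assume "x \<in> space MB"
    then have x: "1 \<le> norm x" by (simp add: Bc_def)
    \<comment> \<open>The divergence of q(|x|) x in three dimensions is 3 q + r q'; for q = \<gamma>
      / r^3 the terms without \<gamma>' cancel.\<close>
    have "(\<Sum>i\<in>UNIV. dphi i x $ i) = 3 * q (norm x) + (\<Sum>i\<in>UNIV. x $ i * x $ i) * (q' (norm x) / norm x)"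
      using x by (simp add: dphi_def sum.distrib sum_distrib_right sum_distrib_left sum_divide_distrib axis_def max_def mult_ac)
    also have "(\<Sum>i\<in>UNIV. x $ i * x $ i) = norm x ^ 2" by (simp add: power2_norm_eq_inner inner_vec_def)
    also have "3 * q (norm x) + norm x ^ 2 * (q' (norm x) / norm x) = \<gamma>' (norm x) / norm x ^ 2"
      using x by (simp add: q_def q'_def max_def divide_simps) (simp add: algebra_simps eval_nat_numeral)
    finally show "f x * (\<gamma>' (norm x) / norm x ^ 2) = (\<Sum>i\<in>UNIV. f x * (dphi i x $ i))"
      by (simp only: sum_distrib_left[symmetric])
  qed
  also have "\<dots> = (\<Sum>i\<in>UNIV. \<integral>x. f x * (dphi i x $ i) \<partial>MB)"
    by (rule Bochner_Integration.integral_sum) (use f1(1) out in auto)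
  also have "\<dots> = - (\<Sum>i\<in>UNIV. \<integral>x. (G x $ i) * phi i x \<partial>MB)" unfolding each by (simp add: sum_negf)
  also have "(\<Sum>i\<in>UNIV. \<integral>x. (G x $ i) * phi i x \<partial>MB) = (\<integral>x. (\<Sum>i\<in>UNIV. (G x $ i) * phi i x) \<partial>MB)"
    by (rule Bochner_Integration.integral_sum[symmetric]) (use G1(1) out in auto)
  also have "\<dots> = (\<integral>x. (G x \<bullet> x / norm x ^ 3) * \<gamma> (norm x) \<partial>MB)"
  proof (rule Bochner_Integration.integral_cong[OF refl])
    fix x assume "x \<in> space MB"
    then have x: "1 \<le> norm x" by (simp add: Bc_def)
    have "(\<Sum>i\<in>UNIV. (G x $ i) * phi i x) = (G x \<bullet> x) * q (norm x)"
      by (simp add: phi_def inner_vec_def sum_distrib_left sum_distrib_right mult_ac)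
    then show "(\<Sum>i\<in>UNIV. (G x $ i) * phi i x) = (G x \<bullet> x / norm x ^ 3) * \<gamma> (norm x)"
      using x by (simp add: q_def max_def)
  qed
  finally show ?thesis .
qed

lemma loc_int_radial_weight:
  assumes f: "loc_int e" and g: "continuous_on UNIV g" "\<And>r. r \<notin> {a<..<b} \<Longrightarrow> g r = 0" "1 < a"
  shows "integrable MB (\<lambda>x. e x * (g (norm x) / norm x ^ 2))"
proof -
  define K where "K = {x::R3. a \<le> norm x \<and> norm x \<le> b}"
  have K: "compact K" "K \<subseteq> Bc_int" using g(3) by (auto simp: K_def shell_compact Bc_int_def)
  have [measurable]: "g \<in> borel_measurable borel" using g(1) by (rule borel_measurable_continuous_onI)
  obtain B where B: "\<forall>r\<in>{a..b}. \<bar>g r\<bar> \<le> B" using continuous_bounded_Icc[OF g(1)] by blast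
  show ?thesis
  proof (rule loc_int_mult(1)[OF f K, of _ "\<bar>B\<bar>"])
    show "(\<lambda>x::R3. g (norm x) / norm x ^ 2) \<in> borel_measurable borel" by measurable
    show "g (norm x) / norm x ^ 2 = 0" if "x \<notin> K" for x using that g(2)[of "norm x"] by (auto simp: K_def)
    show "\<bar>g (norm x) / norm x ^ 2\<bar> \<le> \<bar>B\<bar>" for x :: R3
    proof (cases "norm x \<in> {a<..<b}")
      case True
      then have n: "1 < norm x" "\<bar>g (norm x)\<bar> \<le> B" using g(3) B by auto
      have "\<bar>g (norm x)\<bar> / norm x ^ 2 \<le> \<bar>g (norm x)\<bar> / 1"
        using n by (intro divide_left_mono) (auto simp: one_le_power)
      then show ?thesis using n by (simp add: abs_divide)
    qed (simp add: g(2))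
  qed
qed

text \<open>A radial set of positive measure contains the full preimage under the norm of a compact set of
  radii, again of positive measure.  This avoids any discussion of measurability of the radial profile.\<close>
lemma radial_nonpos:
  assumes rad: "radial e" and m: "e \<in> borel_measurable MB" and li: "loc_int e"
    and test: "\<And>g a b. continuous_on UNIV g \<Longrightarrow> (\<And>r. r \<notin> {a<..<b} \<Longrightarrow> g r = 0) \<Longrightarrow> 1 < a \<Longrightarrow>
       (\<integral>x. e x * (g (norm x) / norm x ^ 2) \<partial>MB) = 0"
  shows "AE x in MB. e x \<le> 0"
proof (rule ccontr)
  assume neg: "\<not> (AE x in MB. e x \<le> 0)"
  have setsMB: "A \<in> sets lebesgue" if "A \<in> sets MB" for A
    using that Bc_lebesgue by (auto simp: sets_restrict_space)
  define S where "S = {x\<in>space MB. 0 < e x} \<inter> Bc_int"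
  have S: "S \<in> sets lebesgue"
    unfolding S_def by (intro sets.Int setsMB Bc_int_lebesgue borel_measurable_less m) auto
  have "\<exists>n. S \<inter> cball 0 (real n) \<notin> null_sets lebesgue"
  proof (rule ccontr)
    assume "\<nexists>n. S \<inter> cball 0 (real n) \<notin> null_sets lebesgue"
    then have "(\<Union>n. S \<inter> cball 0 (real n)) \<in> null_sets lebesgue" by (intro null_sets_UN) auto
    moreover have "(\<Union>n. S \<inter> cball 0 (real n)) = S" by (auto simp: real_arch_simple)
    ultimately have "AE x in lebesgue. x \<notin> S" by (simp add: AE_not_in)
    then have "AE x in MB. x \<notin> S" by (subst AE_restrict_space_iff) (auto simp: Bc_lebesgue)
    with AE_MB_norm_gt_1 have "AE x in MB. e x \<le> 0"
      using AE_space[of MB] by eventually_elim (auto simp: S_def Bc_int_def)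
    with neg show False by simp
  qed
  then obtain n where n: "S \<inter> cball 0 (real n) \<notin> null_sets lebesgue" by blast
  define S' where "S' = S \<inter> cball 0 (real n)"
  have S': "S' \<in> sets lebesgue" unfolding S'_def using S by auto
  have "emeasure lebesgue S' \<le> emeasure lebesgue (cball (0::R3) (real n))"
    unfolding S'_def by (intro emeasure_mono) auto
  also have "\<dots> < \<infinity>" by (simp add: emeasure_cball)
  finally have fin: "emeasure lebesgue S' < \<infinity>" .
  have nz: "emeasure lebesgue S' \<noteq> 0" using n S' by (auto simp: S'_def)
  define \<mu> where "\<mu> = measure lebesgue S'"
  have \<mu>: "emeasure lebesgue S' = ennreal \<mu>" "0 < \<mu>"
    using fin nz by (auto simp: \<mu>_def emeasure_eq_ennreal_measure less_top measure_nonneg zero_less_measure_iff)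
  \<comment> \<open>Inner regularity: less than the whole measure is removed, so a closed set of
    positive measure is left, and it is compact because S' is bounded. Its set of radii is then
    compact, hence Borel.\<close>
  obtain T where T: "closed T" "T \<subseteq> S'" "S' - T \<in> lmeasurable" "emeasure lebesgue (S' - T) < ennreal \<mu>"
    using sets_lebesgue_inner_closed[OF S' \<mu>(2)] .
  have TL: "T \<in> sets lebesgue" using T(1) by (intro sets_completionI_sets) (simp add: borel_closed)
  have Tnz: "T \<notin> null_sets lebesgue"
  proof
    assume "T \<in> null_sets lebesgue"
    then have "emeasure lebesgue (S' - T) = emeasure lebesgue S'"
      using S' by (simp add: emeasure_Diff_null_set)
    with T(4) \<mu> show False by simp
  qed
  have cT: "compact T"
    using T(1,2) by (intro compact_eq_bounded_closed[THEN iffD2] conjI bounded_subset[OF bounded_cball[of 0 "real n"]]) (auto simp: S'_def)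
  define B where "B = norm ` T"
  have cB: "compact B" unfolding B_def by (intro compact_continuous_image cT continuous_intros)
  have "T \<noteq> {}" using Tnz by auto
  then have Bne: "B \<noteq> {}" by (simp add: B_def)
  \<comment> \<open>Radiality spreads the positivity of \<open>e\<close> from \<open>T\<close> to
    the full preimage of its radii.\<close>
  have Bpos: "0 < e x" "1 < norm x" "norm x \<le> real n" if x: "norm x \<in> B" for x
  proof -
    obtain t where t: "t \<in> T" "norm x = norm t" using x by (auto simp: B_def)
    then have ts: "0 < e t" "t \<in> Bc" "1 < norm t" "norm t \<le> real n" using T(2) by (auto simp: S'_def S_def Bc_int_def)
    then show "1 < norm x" "norm x \<le> real n" using t by auto
    then have "x \<in> Bc" by (simp add: Bc_def)
    then have "e x = e t" using rad ts(2) t(2) unfolding radial_def by blast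
    then show "0 < e x" using ts by simp
  qed
  obtain b0 where b0: "b0 \<in> B" "\<And>b. b \<in> B \<Longrightarrow> b0 \<le> b" using compact_attains_inf[OF cB Bne] by blast
  have b01: "1 < b0" using b0(1) Bpos by (auto simp: B_def)
  have Bn: "b \<le> real n" if "b \<in> B" for b using that Bpos(3) by (auto simp: B_def)
  define a where "a = (1 + b0) / 2"
  have a: "1 < a" using b01 by (simp add: a_def)
  \<comment> \<open>Slope that makes each tent below vanish outside
    \<open>{a<..<real n + 1}\<close>: 1 / N is at most (b0 - 1) / 2, the distance from
    \<open>a\<close> to the least radius b0, and at most 1, the distance from n + 1 to the largest
    radius allowed in \<open>B\<close>.\<close>
  define N where "N = 2 / (b0 - 1) + 1"
  define g where "g = (\<lambda>k r. max 0 (1 - (real k + N) * infdist r B))"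
  have N1: "1 \<le> N" using b01 by (simp add: N_def)
  have gc: "continuous_on UNIV (g k)" for k unfolding g_def by (intro continuous_intros)
  have g0: "g k r = 0" if r: "r \<notin> {a<..<real n + 1}" for k r
  proof -
    have "1 \<le> (real k + N) * infdist r B"
    proof -
      obtain b where b: "b \<in> B" "infdist r B = dist r b"
        using infdist_attains_inf[OF compact_imp_closed[OF cB] Bne] by blast
      have "1 / N \<le> dist r b"
      proof (cases "r \<le> a")
        case True
        have "1 / N \<le> 1 / (2 / (b0 - 1))" unfolding N_def using b01
          by (intro divide_left_mono mult_pos_pos add_pos_pos) auto
        also have "\<dots> = (b0 - 1) / 2" by simp
        also have "\<dots> \<le> b - r" using b0(2)[OF b(1)] True by (simp add: a_def field_simps)
        finally show ?thesis by (simp add: dist_real_def)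
      next
        case False
        then have "1 \<le> r - b" using r Bn[OF b(1)] by auto
        moreover have "1 / N \<le> 1" using N1 by simp
        ultimately show ?thesis by (simp add: dist_real_def)
      qed
      then have "1 \<le> N * infdist r B" using N1 b by (simp add: field_simps)
      also have "\<dots> \<le> (real k + N) * infdist r B" by (intro mult_right_mono) (auto simp: infdist_nonneg)
      finally show ?thesis .
    qed
    then show ?thesis by (simp add: g_def)
  qed
  have glim: "(\<lambda>k. g k r) \<longlonglongrightarrow> indicator B r" for r
  proof (cases "r \<in> B")
    case True
    then show ?thesis by (simp add: g_def)
  next
    case False
    then have pos: "0 < infdist r B"
      using infdist_pos_not_in_closed[OF compact_imp_closed[OF cB] Bne] by simp
    obtain k0 where k0: "1 / infdist r B \<le> real k0" using real_arch_simple by blast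
    have "\<forall>\<^sub>F k in sequentially. g k r = 0"
      using eventually_ge_at_top[of k0]
    proof eventually_elim
      case (elim k)
      have "1 \<le> real k0 * infdist r B" using k0 pos by (simp add: pos_divide_le_eq)
      also have "\<dots> \<le> (real k + N) * infdist r B" using elim N1 pos by (intro mult_right_mono) auto
      finally show ?case by (simp add: g_def)
    qed
    then show ?thesis using False by (simp add: tendsto_eventually)
  qed
  have [measurable]: "B \<in> sets borel" using cB by (simp add: borel_compact)
  have gm [measurable]: "g k \<in> borel_measurable borel" for k using gc by (rule borel_measurable_continuous_onI)
  note m[measurable]
  define K where "K = {x::R3. a \<le> norm x \<and> norm x \<le> real n + 1}"
  have K: "compact K" "K \<subseteq> Bc_int" using a by (auto simp: K_def shell_compact Bc_int_def)
  have Kb: "K \<in> sets borel" using K(1) by (simp add: borel_compact)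
  have iK: "integrable MB (\<lambda>x. e x * indicator K x)"
    by (rule loc_int_mult(1)[OF li K, of _ 1]) (use Kb in auto)
  have [measurable]: "(\<lambda>x. x) \<in> borel_measurable MB" by (rule borel_measurable_MB) simp
  have m1: "(\<lambda>x. e x * (indicator B (norm x) / norm x ^ 2)) \<in> borel_measurable MB" by measurable
  have m2: "(\<lambda>x. e x * (g k (norm x) / norm x ^ 2)) \<in> borel_measurable MB" for k by measurable
  have c1: "AE x in MB. (\<lambda>k. e x * (g k (norm x) / norm x ^ 2)) \<longlonglongrightarrow> e x * (indicator B (norm x) / norm x ^ 2)"
      using AE_MB_norm_gt_1 by eventually_elim (auto intro!: tendsto_intros glim)
  have c2: "AE x in MB. norm (e x * (g k (norm x) / norm x ^ 2)) \<le> \<bar>e x * indicator K x\<bar>" for k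
      using AE_MB_norm_gt_1
    proof eventually_elim
      case (elim x)
      have g1: "0 \<le> g k (norm x)" "g k (norm x) \<le> 1" using N1 by (auto simp: g_def infdist_nonneg)
      have "g k (norm x) / norm x ^ 2 \<le> indicator K x"
      proof (cases "norm x \<in> {a<..<real n + 1}")
        case True
        then have "x \<in> K" by (auto simp: K_def)
        have "g k (norm x) / norm x ^ 2 \<le> 1 / 1" using g1 elim by (intro frac_le) (auto simp: one_le_power)
        then show ?thesis using \<open>x \<in> K\<close> by simp
      qed (simp add: g0)
      moreover have "0 \<le> g k (norm x) / norm x ^ 2" using g1 by simp
      ultimately have "\<bar>e x\<bar> * \<bar>g k (norm x) / norm x ^ 2\<bar> \<le> \<bar>e x\<bar> * indicator K x"
        by (intro mult_left_mono) auto
      then show ?case by (simp only: real_norm_def abs_mult abs_indicator)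
    qed
  note iB = integrable_dominated_convergence[OF m1 m2 integrable_abs[OF iK] c1 c2]
  note lim = integral_dominated_convergence[OF m1 m2 integrable_abs[OF iK] c1 c2]
  have "(\<integral>x. e x * (g k (norm x) / norm x ^ 2) \<partial>MB) = 0" for k
    by (rule test[OF gc g0 a])
  then have z: "(\<integral>x. e x * (indicator B (norm x) / norm x ^ 2) \<partial>MB) = 0"
    using lim by (simp add: LIMSEQ_const_iff)
  have "AE x in MB. e x * (indicator B (norm x) / norm x ^ 2) = 0"
    using z by (subst (asm) integral_nonneg_eq_0_iff_AE[OF iB])
      (auto simp: indicator_def intro!: AE_I2 divide_nonneg_nonneg dest: Bpos(1))
  then have "AE x in MB. x \<notin> T"
  proof eventually_elim
    case (elim x)
    show ?case
    proof
      assume "x \<in> T"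
      then have "norm x \<in> B" by (simp add: B_def)
      with elim Bpos[OF this] show False by simp
    qed
  qed
  then have "AE x in lebesgue. x \<in> Bc \<longrightarrow> x \<notin> T" by (subst (asm) AE_restrict_space_iff) (auto simp: Bc_lebesgue)
  then have "AE x in lebesgue. x \<notin> T"
    by eventually_elim (use T(2) in \<open>auto simp: S'_def S_def\<close>)
  then have "T \<in> null_sets lebesgue" using TL by (simp add: AE_iff_null_sets)
  with Tnz show False by simp
qed

text \<open>The unit sphere is a null set, and completeness of Lebesgue measure makes any
  modification there harmless.\<close>

lemma measurable_MB_from_interior:
  fixes h :: "R3 \<Rightarrow> 'b::euclidean_space"
  assumes "h \<in> borel_measurable (lebesgue_on Bc_int)"
  shows "h \<in> borel_measurable MB"
proof -
  have 1: "(\<lambda>x. if x \<in> Bc_int then h x else 0) \<in> borel_measurable lebesgue"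
    using assms Bc_int_lebesgue by (rule borel_measurable_if_I)
  have "sphere (0::R3) 1 \<in> null_sets lebesgue"
    by (simp add: negligible_iff_null_sets[symmetric] negligible_sphere)
  then have "AE x in lebesgue. x \<notin> sphere (0::R3) 1" by (rule AE_not_in)
  then have "AE x in lebesgue. (if x \<in> Bc_int then h x else 0) = (if x \<in> Bc then h x else 0)"
    by eventually_elim (auto simp: Bc_def Bc_int_def)
  with 1 have "(\<lambda>x. if x \<in> Bc then h x else 0) \<in> borel_measurable lebesgue" by (rule borel_measurable_AE)
  then show ?thesis by (rule borel_measurable_if_D)
qed

lemma in_H_D:
  assumes "in_H f G g"
  shows "L2v G" "f \<in> borel_measurable MB" "loc_int f" "radial f"
    "g \<in> borel_measurable MB" "integrable MB (\<lambda>x. g x ^ 2)" "integrable MB (\<lambda>x. \<bar>f x\<bar> ^ 6)"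
  using assms by (auto simp: in_H_def L2v_def weak_grad_def loc_int_def intro!: measurable_MB_from_interior)

lemma weighted_profile:
  assumes g: "continuous_on UNIV g" "\<And>r. r \<notin> {a<..<b} \<Longrightarrow> g r = 0" "1 < a" and v: "continuous_on UNIV v"
  shows "(\<integral>x. v (norm x) * (g (norm x) / norm x ^ 2) \<partial>MB) = \<kappa> * (\<integral>r. v r * g r \<partial>lborel)"
proof -
  have [measurable]: "g \<in> borel_measurable borel" "v \<in> borel_measurable borel"
    using g(1) v by (auto intro: borel_measurable_continuous_onI)
  have "(\<integral>x. v (norm x) * (g (norm x) / norm x ^ 2) \<partial>MB)
     = \<kappa> * (\<integral>r. indicator {1..} r * (r ^ 2 * (v r * (g r / r ^ 2))) \<partial>lborel)"
    by (rule integral_MB_radial(1)) measurable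
  also have "(\<lambda>r. indicator {1..} r * (r ^ 2 * (v r * (g r / r ^ 2)))) = (\<lambda>r. v r * g r)"
  proof
    fix r show "indicator {1..} r * (r ^ 2 * (v r * (g r / r ^ 2))) = v r * g r"
      using g(2)[of r] g(3) by (cases "r \<in> {a<..<b}") auto
  qed
  finally show ?thesis .
qed

text \<open>A weight of mean zero has a compactly supported antiderivative, which is admissible in
  the divergence identity; the flux formula then brings in the profile. Such weights do not see
  additive constants, so one constant remains to be excluded later.\<close>

lemma profile_test:
  assumes H: "in_H f G h" and g: "continuous_on UNIV g" "\<And>r. r \<notin> {a<..<b} \<Longrightarrow> g r = 0" "1 < a"
    and int0: "(\<integral>r. g r \<partial>lborel) = 0"
  shows "(\<integral>x. f x * (g (norm x) / norm x ^ 2) \<partial>MB) = \<kappa> * (\<integral>r. rprofile G r * g r \<partial>lborel)"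
proof -
  obtain \<Gamma> where \<Gamma>: "\<And>r. (\<Gamma> has_real_derivative g r) (at r)" using continuous_antiderivative[OF g(1)] by blast
  define \<gamma> where "\<gamma> = (\<lambda>r. \<Gamma> r - \<Gamma> a)"
  have d: "(\<gamma> has_real_derivative g r) (at r)" for r unfolding \<gamma>_def by (auto intro!: derivative_eq_intros \<Gamma>)
  \<comment> \<open>\<open>b\<close> may lie below \<open>a\<close>, in which case \<open>g\<close>
    vanishes identically; the maximum keeps the support interval ordered.\<close>
  define b' where "b' = max a b"
  have below: "\<gamma> r = 0" if r: "r \<le> a" for r
  proof -
    have "(\<integral>x. g x * indicator {r..a} x \<partial>lborel) = \<gamma> a - \<gamma> r" by (rule integral_Icc_FTC(1)[OF r d g(1)])
    moreover have "(\<lambda>x. g x * indicator {r..a} x) = (\<lambda>x. 0)" using g(2) by (auto simp: fun_eq_iff indicator_def)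
    ultimately show ?thesis by (simp add: \<gamma>_def)
  qed
  have above: "\<gamma> r = 0" if r: "b' \<le> r" for r
  proof -
    have ar: "a \<le> r" using r by (simp add: b'_def)
    have "(\<integral>x. g x * indicator {a..r} x \<partial>lborel) = \<gamma> r - \<gamma> a" by (rule integral_Icc_FTC(1)[OF ar d g(1)])
    moreover have "(\<lambda>x. g x * indicator {a..r} x) = g"
    proof
      fix x show "g x * indicator {a..r} x = g x"
        using g(2)[of x] r by (cases "x \<in> {a<..<b}") (auto simp: b'_def)
    qed
    ultimately show ?thesis using int0 by (simp add: \<gamma>_def)
  qed
  have z: "\<gamma> r = 0" "g r = 0" if "r \<notin> {a..b'}" for r
  proof -
    have "r \<le> a \<or> b' \<le> r" using that by auto
    then show "\<gamma> r = 0" using below above by blast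
    show "g r = 0" using that by (intro g(2)) (auto simp: b'_def)
  qed
  have b1: "1 \<le> b'" using g(3) by (simp add: b'_def)
  have wg: "weak_grad Bc_int f G" using H by (simp add: in_H_def)
  have "(\<integral>x. f x * (g (norm x) / norm x ^ 2) \<partial>MB) = - (\<integral>x. (G x \<bullet> x / norm x ^ 3) * \<gamma> (norm x) \<partial>MB)"
    by (rule weak_grad_radial[OF wg d g(1) z g(3)])
  also have "\<dots> = \<kappa> * (\<gamma> 1 * rprofile G 1 + (\<integral>r. indicator {1..b'} r * (g r * rprofile G r) \<partial>lborel))"
    using flux_test(1)[OF in_H_D(1)[OF H] d g(1) above b1] by simp
  also have "(\<lambda>r. indicator {1..b'} r * (g r * rprofile G r)) = (\<lambda>r. rprofile G r * g r)"
  proof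
    fix r show "indicator {1..b'} r * (g r * rprofile G r) = rprofile G r * g r"
      using g(2)[of r] g(3) by (cases "r \<in> {a<..<b}") (auto simp: b'_def)
  qed
  also have "\<gamma> 1 = 0" using below[of 1] g(3) by simp
  finally show ?thesis by simp
qed

lemma integrable_continuous_compact_support:
  fixes g :: "real \<Rightarrow> real"
  assumes "continuous_on UNIV g" "\<And>r. r \<notin> {a..b} \<Longrightarrow> g r = 0"
  shows "integrable lborel g"
proof -
  have "integrable lborel (\<lambda>x. indicator {a..b} x *\<^sub>R g x)"
    by (rule borel_integrable_compact) (use assms(1) in \<open>auto intro: continuous_on_subset\<close>)
  moreover have "(\<lambda>x. indicator {a..b} x *\<^sub>R g x) = g" using assms(2) by (auto simp: fun_eq_iff indicator_def)
  ultimately show ?thesis by simp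
qed

lemma loc_int_continuous:
  assumes "continuous_on UNIV h"
  shows "loc_int h"
  unfolding loc_int_def
proof (intro allI impI)
  fix K :: "R3 set" assume K: "compact K" "K \<subseteq> Bc_int"
  have "integrable lborel (\<lambda>x. indicator K x *\<^sub>R h x)"
    by (rule borel_integrable_compact) (use K assms in \<open>auto intro: continuous_on_subset\<close>)
  then have "integrable lebesgue (\<lambda>x. indicator K x *\<^sub>R h x)"
    by (subst integrable_completion) (use borel_measurable_integrable in auto)
  moreover have "K \<inter> space lebesgue \<in> sets lebesgue"
    using K(1) by (simp add: sets_completionI_sets borel_compact)
  ultimately show "integrable (lebesgue_on K) h" by (simp add: integrable_restrict_space)
qed

lemma loc_int_diff: "loc_int f \<Longrightarrow> loc_int g \<Longrightarrow> loc_int (\<lambda>x. f x - g x)"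
  by (auto simp: loc_int_def)

text \<open>Du Bois-Reymond: \<open>f - rprofile G\<close> is orthogonal to every radial weight of mean zero, hence constant,
  and integrability of \<open>f ^ 6\<close> excludes a nonzero constant.\<close>
theorem in_H_profile:
  assumes H: "in_H f G h"
  shows "AE x in MB. f x = rprofile G (norm x)"
proof -
  note HD = in_H_D[OF H]
  define v where "v = rprofile G"
  have cv: "continuous_on UNIV v" unfolding v_def by (rule continuous_rprofile[OF HD(1)])
  have vb: "v \<in> borel_measurable borel" using cv by (rule borel_measurable_continuous_onI)
  have cvn: "continuous_on UNIV (\<lambda>x::R3. v (norm x))"
    by (intro continuous_on_compose2[OF cv] continuous_intros) auto
  \<comment> \<open>Reference weight of positive mean. Any other weight is brought to mean zero by
    subtracting a multiple of it.\<close>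
  define g0 where "g0 = (\<lambda>r::real. max 0 (1 - \<bar>r - 3\<bar>))"
  have g0: "continuous_on UNIV g0" "\<And>r. r \<notin> {2<..<4} \<Longrightarrow> g0 r = 0" "(1::real) < 2"
    unfolding g0_def by (auto intro!: continuous_intros)
  define I0 where "I0 = (\<integral>r. g0 r \<partial>lborel)"
  have I0: "0 < I0"
  proof -
    have i0: "integrable lborel g0" using g0 by (intro integrable_continuous_compact_support[of _ 2 4]) auto
    have "(\<integral>r. (1/2) * indicator {5/2..7/2::real} r \<partial>lborel) \<le> I0"
      unfolding I0_def
    proof (rule integral_mono[OF _ i0])
      show "integrable lborel (\<lambda>r. (1/2) * indicator {5/2..7/2::real} r :: real)"
        by (intro integrable_mult_right integrable_real_indicator) auto
      show "1 / 2 * indicator {5/2..7/2} r \<le> g0 r" for r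
        by (cases "r \<in> {5/2..7/2}") (auto simp: g0_def abs_if max_def)
    qed
    then show ?thesis by simp
  qed
  define e0 where "e0 = (\<lambda>x. f x - v (norm x))"
  have le0: "loc_int e0" unfolding e0_def by (intro loc_int_diff HD loc_int_continuous cvn)
  have e0_test: "(\<integral>x. e0 x * (g (norm x) / norm x ^ 2) \<partial>MB) = 0"
    if g: "continuous_on UNIV g" "\<And>r. r \<notin> {a<..<b} \<Longrightarrow> g r = 0" "1 < a" and int0: "(\<integral>r. g r \<partial>lborel) = 0" for g a b
  proof -
    have "(\<integral>x. e0 x * (g (norm x) / norm x ^ 2) \<partial>MB)
       = (\<integral>x. f x * (g (norm x) / norm x ^ 2) \<partial>MB) - (\<integral>x. v (norm x) * (g (norm x) / norm x ^ 2) \<partial>MB)"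
      unfolding e0_def left_diff_distrib
      by (intro Bochner_Integration.integral_diff loc_int_radial_weight[OF _ g] HD loc_int_continuous cvn)
    then show ?thesis using profile_test[OF H g int0] weighted_profile[OF g cv] by (simp add: v_def)
  qed
  \<comment> \<open>The undetermined constant, read off from the reference weight.\<close>
  define c where "c = (\<integral>x. e0 x * (g0 (norm x) / norm x ^ 2) \<partial>MB) / (I0 * \<kappa>)"
  have c: "(\<integral>x. e0 x * (g (norm x) / norm x ^ 2) \<partial>MB) = c * \<kappa> * (\<integral>r. g r \<partial>lborel)"
    if g: "continuous_on UNIV g" "\<And>r. r \<notin> {a<..<b} \<Longrightarrow> g r = 0" "1 < a" for g a b
  proof -
    define J where "J = (\<integral>r. g r \<partial>lborel) / I0"
    define k where "k = (\<lambda>r. g r - J * g0 r)"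
    have ig: "integrable lborel g" using g by (intro integrable_continuous_compact_support[of _ a b]) auto
    have i0: "integrable lborel g0" using g0 by (intro integrable_continuous_compact_support[of _ 2 4]) auto
    have i1: "integrable MB (\<lambda>x. e0 x * (g (norm x) / norm x ^ 2))" by (rule loc_int_radial_weight[OF le0 g])
    have i2: "integrable MB (\<lambda>x. e0 x * (g0 (norm x) / norm x ^ 2))" 
      by (rule loc_int_radial_weight[OF le0 g0])
    have "(\<integral>x. e0 x * (k (norm x) / norm x ^ 2) \<partial>MB) = 0"
    proof (rule e0_test)
      show "continuous_on UNIV k" unfolding k_def by (intro continuous_intros g g0)
      show "k r = 0" if "r \<notin> {min a 2<..<max b 4}" for r 
      proof -
        have "r \<notin> {a<..<b}" "r \<notin> {2<..<4}" using that by auto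
        then show ?thesis using g(2) g0(2) by (simp add: k_def)
      qed
      show "1 < min a 2" using g by simp
      show "(\<integral>r. k r \<partial>lborel) = 0" unfolding k_def using ig i0 I0 by (simp add: J_def flip: I0_def)
    qed
    moreover have "(\<integral>x. e0 x * (k (norm x) / norm x ^ 2) \<partial>MB) =
       (\<integral>x. e0 x * (g (norm x) / norm x ^ 2) - J * (e0 x * (g0 (norm x) / norm x ^ 2)) \<partial>MB)"
      by (simp add: k_def algebra_simps diff_divide_distrib)
    moreover have "\<dots> = (\<integral>x. e0 x * (g (norm x) / norm x ^ 2) \<partial>MB) - J * (\<integral>x. e0 x * (g0 (norm x) / norm x ^ 2) \<partial>MB)"
      using Bochner_Integration.integral_diff[OF i1 integrable_mult_right[OF i2, of J]]
      by (simp only: integral_mult_right_zero)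
    ultimately show ?thesis using I0 \<kappa>_pos by (simp add: c_def J_def field_simps)
  qed
  define e where "e = (\<lambda>x. f x - (v (norm x) + c))"
  have le: "loc_int e" unfolding e_def
    by (intro loc_int_diff HD loc_int_continuous continuous_intros cvn)
  have me: "e \<in> borel_measurable MB"
  proof -
    have "(\<lambda>x. v (norm x) + c) \<in> borel_measurable MB"
      by (intro borel_measurable_MB borel_measurable_continuous_onI continuous_intros cvn)
    then show ?thesis unfolding e_def using HD(2) by measurable
  qed
  have re: "radial e"
    unfolding radial_def
  proof (intro allI impI)
    fix x y :: R3 assume xy: "x \<in> Bc" "y \<in> Bc" "norm x = norm y"
    then have "f x = f y" using HD(4) unfolding radial_def by blast
    then show "e x = e y" using xy(3) by (simp add: e_def)
  qed
  have et: "(\<integral>x. e x * (g (norm x) / norm x ^ 2) \<partial>MB) = 0"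
    if g: "continuous_on UNIV g" "\<And>r. r \<notin> {a<..<b} \<Longrightarrow> g r = 0" "1 < a" for g a b
  proof -
    have "(\<integral>x. e x * (g (norm x) / norm x ^ 2) \<partial>MB) =
       (\<integral>x. e0 x * (g (norm x) / norm x ^ 2) - (\<lambda>_. c) x * (g (norm x) / norm x ^ 2) \<partial>MB)"
      by (simp add: e_def e0_def algebra_simps diff_divide_distrib add_divide_distrib)
    also have "\<dots> = (\<integral>x. e0 x * (g (norm x) / norm x ^ 2) \<partial>MB) - (\<integral>x. (\<lambda>_. c) x * (g (norm x) / norm x ^ 2) \<partial>MB)"
      by (intro Bochner_Integration.integral_diff loc_int_radial_weight[OF _ g] le0 loc_int_continuous continuous_on_const)
    also have "(\<integral>x. (\<lambda>_. c) x * (g (norm x) / norm x ^ 2) \<partial>MB) = \<kappa> * (\<integral>r. c * g r \<partial>lborel)"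
      using weighted_profile[OF g, where v = "\<lambda>_. c"] by simp
    finally show ?thesis using c[OF g] by simp
  qed
  have "AE x in MB. e x \<le> 0" by (rule radial_nonpos[OF re me le et])
  moreover have "AE x in MB. - e x \<le> 0"
  proof (rule radial_nonpos)
    show "radial (\<lambda>x. - e x)"
      unfolding radial_def
    proof (intro allI impI)
      fix x y :: R3 assume xy: "x \<in> Bc" "y \<in> Bc" "norm x = norm y"
      then have "e x = e y" using re unfolding radial_def by blast
      then show "- e x = - e y" by simp
    qed
    show "(\<lambda>x. - e x) \<in> borel_measurable MB" using me by simp
    show "loc_int (\<lambda>x. - e x)" using le by (auto simp: loc_int_def)
    show "(\<integral>x. - e x * (g (norm x) / norm x ^ 2) \<partial>MB) = 0"
      if "continuous_on UNIV g" "\<And>r. r \<notin> {a<..<b} \<Longrightarrow> g r = 0" "1 < a" for g a b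
      using et[OF that] by simp
  qed
  ultimately have ae: "AE x in MB. f x = v (norm x) + c" by eventually_elim (simp add: e_def)
  have "c = 0"
  proof (rule ccontr)
    assume "c \<noteq> 0"
    \<comment> \<open>The profile tends to 0 at infinity, so a nonzero constant would keep |f| at
      least |c| / 2 outside a large ball, a set of infinite measure.\<close>
    define C where "C = sqrt (\<integral>x. norm (G x) ^ 2 \<partial>MB) / sqrt \<kappa>"
    have vle: "\<bar>v r\<bar> \<le> C / sqrt r" if "1 \<le> r" for r
    proof -
      have "\<bar>v r\<bar> \<le> sqrt (tail G r) / sqrt (\<kappa> * r)" unfolding v_def by (rule rprofile_bound[OF HD(1) that])
      also have "\<dots> \<le> sqrt (\<integral>x. norm (G x) ^ 2 \<partial>MB) / sqrt (\<kappa> * r)"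
        using that \<kappa>_pos tail_le[OF HD(1)] by (intro divide_right_mono real_sqrt_le_mono) auto
      finally show ?thesis by (simp add: C_def real_sqrt_mult)
    qed
    have "((\<lambda>r. C / sqrt r) \<longlongrightarrow> 0) at_top" by real_asymp
    then have "\<forall>\<^sub>F r in at_top. C / sqrt r < \<bar>c\<bar> / 2" using \<open>c \<noteq> 0\<close> by (intro order_tendstoD) auto
    then obtain R0 where R0: "\<And>r. R0 \<le> r \<Longrightarrow> C / sqrt r < \<bar>c\<bar> / 2" by (auto simp: eventually_at_top_linorder)
    define R where "R = max 1 R0"
    have lb: "\<bar>c\<bar> / 2 \<le> \<bar>v r + c\<bar>" if "R \<le> r" for r
    proof -
      have "C / sqrt r < \<bar>c\<bar> / 2" "\<bar>v r\<bar> \<le> C / sqrt r" using R0[of r] vle[of r] that unfolding R_def by auto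
      then show ?thesis by linarith
    qed
    have [measurable]: "v \<in> borel_measurable borel" by fact
    have [measurable]: "(\<lambda>x. v (norm x) + c) \<in> borel_measurable MB"
      by (intro borel_measurable_MB borel_measurable_continuous_onI continuous_intros cvn)
    have "integrable MB (\<lambda>x. \<bar>v (norm x) + c\<bar> ^ 6)"
      using HD(7) by (rule integrable_cong_AE_imp) (use ae in \<open>auto elim!: eventually_mono\<close>)
    then have "integrable lborel (\<lambda>r. indicator {1..} r * (r ^ 2 * \<bar>v r + c\<bar> ^ 6))"
      by (subst (asm) integral_MB_radial(2)[where h = "\<lambda>r. \<bar>v r + c\<bar> ^ 6"]) auto
    then have "integrable lborel (\<lambda>r. (\<bar>c\<bar> / 2) ^ 6 * indicator {R..} r)"
    proof (rule Bochner_Integration.integrable_bound)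
      show "AE r in lborel. norm ((\<bar>c\<bar> / 2) ^ 6 * indicator {R..} r) \<le> norm (indicator {1..} r * (r ^ 2 * \<bar>v r + c\<bar> ^ 6))"
      proof (rule AE_I2)
        fix r
        show "norm ((\<bar>c\<bar> / 2) ^ 6 * indicator {R..} r) \<le> norm (indicator {1..} r * (r ^ 2 * \<bar>v r + c\<bar> ^ 6))"
        proof (cases "R \<le> r")
          case True
          then have r1: "1 \<le> r" by (simp add: R_def)
          have "1 * (\<bar>c\<bar> / 2) ^ 6 \<le> r ^ 2 * \<bar>v r + c\<bar> ^ 6"
            using r1 lb[OF True] by (intro mult_mono power_mono) (auto simp: one_le_power)
          then show ?thesis using True r1 by simp
        qed simp
      qed
    qed simp
    then have "integrable lborel (indicator {R..} :: real \<Rightarrow> real)" using \<open>c \<noteq> 0\<close> by simp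
    then have "emeasure lborel {R..} < \<infinity>" by (simp add: integrable_indicator_iff)
    moreover have "emeasure lborel {R..} = \<infinity>"
    proof (rule ccontr)
      assume "emeasure lborel {R..} \<noteq> \<infinity>"
      then obtain m where m: "emeasure lborel {R..} = ennreal m" "0 \<le> m" by (cases "emeasure lborel {R..}") auto
      have "emeasure lborel {R..R + (m + 1)} \<le> emeasure lborel {R..}" by (intro emeasure_mono) auto
      then show False using m by simp
    qed
    ultimately show False by simp
  qed
  with ae show ?thesis by (simp add: v_def)
qed

section \<open>Precompact trajectories\<close>

definition L2s :: "(R3 \<Rightarrow> real) \<Rightarrow> bool" where
  "L2s g \<longleftrightarrow> g \<in> borel_measurable MB \<and> integrable MB (\<lambda>x. g x ^ 2)"

definition stail :: "(R3 \<Rightarrow> real) \<Rightarrow> real \<Rightarrow> real" where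
  "stail g r = (\<integral>x. indicator {r<..} (norm x) * g x ^ 2 \<partial>MB)"

lemma stail_integrable:
  assumes g: "L2s g"
  shows "integrable MB (\<lambda>x. indicator {r<..} (norm x) * g x ^ 2)"
proof -
  have [measurable]: "g \<in> borel_measurable MB" using g by (simp add: L2s_def)
  show ?thesis
    by (rule Bochner_Integration.integrable_bound[of _ "\<lambda>x. g x ^ 2"])
      (use g in \<open>auto simp: L2s_def indicator_def\<close>)
qed

lemma stail_nonneg: "0 \<le> stail g r"
  unfolding stail_def by (intro integral_nonneg_AE) auto

lemma stail_mono:
  assumes "L2s g" "r \<le> s"
  shows "stail g s \<le> stail g r"
  unfolding stail_def
  by (rule integral_mono[OF stail_integrable[OF assms(1)] stail_integrable[OF assms(1)]])
    (use assms(2) in \<open>auto simp: indicator_def\<close>)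

lemma indicator_norm_tendsto_0: "((\<lambda>n. indicator {real n<..} (norm x) :: real) \<longlonglongrightarrow> 0)"
proof (rule tendsto_eventually)
  obtain n0 where "norm x \<le> real n0" using real_arch_simple by blast
  have "\<forall>\<^sub>F n in sequentially. n0 \<le> n" by (rule eventually_ge_at_top)
  then show "\<forall>\<^sub>F n in sequentially. indicator {real n<..} (norm x) = (0::real)"
  proof eventually_elim
    case (elim n)
    then have "norm x \<le> real n" using \<open>norm x \<le> real n0\<close> by linarith
    then show ?case by simp
  qed
qed

lemma tail_tendsto_0:
  assumes G: "L2v G"
  shows "(\<lambda>n. tail G (real n)) \<longlonglongrightarrow> 0"
proof -
  have [measurable]: "G \<in> borel_measurable MB" using G by (simp add: L2v_def)
  have "(\<lambda>n. \<integral>x. indicator {real n<..} (norm x) * norm (G x) ^ 2 \<partial>MB) \<longlonglongrightarrow> (\<integral>x. 0 \<partial>MB)"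
  proof (rule integral_dominated_convergence[where w = "\<lambda>x. norm (G x) ^ 2"])
    show "AE x in MB. (\<lambda>n. indicator {real n<..} (norm x) * norm (G x) ^ 2) \<longlonglongrightarrow> 0"
      by (intro AE_I2 tendsto_mult_left_zero indicator_norm_tendsto_0)
  qed (use G tail_integrable[OF G] in \<open>auto simp: L2v_def indicator_def borel_measurable_integrable\<close>)
  then show ?thesis by (simp add: tail_def)
qed

lemma stail_tendsto_0:
  assumes g: "L2s g"
  shows "(\<lambda>n. stail g (real n)) \<longlonglongrightarrow> 0"
proof -
  have [measurable]: "g \<in> borel_measurable MB" using g by (simp add: L2s_def)
  have "(\<lambda>n. \<integral>x. indicator {real n<..} (norm x) * g x ^ 2 \<partial>MB) \<longlonglongrightarrow> (\<integral>x. 0 \<partial>MB)"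
  proof (rule integral_dominated_convergence[where w = "\<lambda>x. g x ^ 2"])
    show "AE x in MB. (\<lambda>n. indicator {real n<..} (norm x) * g x ^ 2) \<longlonglongrightarrow> 0"
      by (intro AE_I2 tendsto_mult_left_zero indicator_norm_tendsto_0)
  qed (use g stail_integrable[OF g] in \<open>auto simp: L2s_def indicator_def borel_measurable_integrable\<close>)
  then show ?thesis by (simp add: stail_def)
qed

lemma L2s_diff:
  assumes "L2s g1" "L2s g2"
  shows "L2s (\<lambda>x. g1 x - g2 x)"
proof -
  have [measurable]: "g1 \<in> borel_measurable MB" "g2 \<in> borel_measurable MB" using assms by (auto simp: L2s_def)
  have le: "(a - b) ^ 2 \<le> 2 * a ^ 2 + 2 * b ^ 2" for a b :: real
    using zero_le_power2[of "a + b"] by (simp add: power2_diff power2_sum)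
  have "integrable MB (\<lambda>x. (g1 x - g2 x) ^ 2)"
    by (rule Bochner_Integration.integrable_bound[of _ "\<lambda>x. 2 * g1 x ^ 2 + 2 * g2 x ^ 2"])
      (use assms le in \<open>auto simp: L2s_def\<close>)
  then show ?thesis by (simp add: L2s_def)
qed

lemma H_dist2_split:
  assumes "L2v G1" "L2v G2" "L2s g1" "L2s g2"
  shows "H_dist2 G1 g1 G2 g2 = (\<integral>x. norm (G1 x - G2 x) ^ 2 \<partial>MB) + (\<integral>x. (g1 x - g2 x) ^ 2 \<partial>MB)"
  unfolding H_dist2_def using L2v_diff[OF assms(1,2)] L2s_diff[OF assms(3,4)]
  by (intro Bochner_Integration.integral_add) (auto simp: L2v_def L2s_def)

lemma H_dist2_bounds:
  assumes "L2v G1" "L2v G2" "L2s g1" "L2s g2"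
  shows "(\<integral>x. norm (G1 x - G2 x) ^ 2 \<partial>MB) \<le> H_dist2 G1 g1 G2 g2"
    and "(\<integral>x. (g1 x - g2 x) ^ 2 \<partial>MB) \<le> H_dist2 G1 g1 G2 g2"
    and "0 \<le> H_dist2 G1 g1 G2 g2"
proof -
  have "0 \<le> (\<integral>x. norm (G1 x - G2 x) ^ 2 \<partial>MB)" "0 \<le> (\<integral>x. (g1 x - g2 x) ^ 2 \<partial>MB)"
    by (intro integral_nonneg_AE; auto)+
  then show "(\<integral>x. norm (G1 x - G2 x) ^ 2 \<partial>MB) \<le> H_dist2 G1 g1 G2 g2"
    "(\<integral>x. (g1 x - g2 x) ^ 2 \<partial>MB) \<le> H_dist2 G1 g1 G2 g2" "0 \<le> H_dist2 G1 g1 G2 g2"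
    unfolding H_dist2_split[OF assms] by linarith+
qed

lemma norm_sq_le: "norm a ^ 2 \<le> 2 * norm (a - b) ^ 2 + 2 * norm b ^ 2" for a b :: "'a::real_normed_vector"
proof -
  have "norm a \<le> norm (a - b) + norm b" by (metis diff_add_cancel norm_triangle_ineq)
  then have "norm a ^ 2 \<le> (norm (a - b) + norm b) ^ 2" by (intro power_mono) auto
  also have "\<dots> \<le> 2 * norm (a - b) ^ 2 + 2 * norm b ^ 2"
    using zero_le_power2[of "norm (a - b) - norm b"] by (simp add: power2_diff power2_sum)
  finally show ?thesis .
qed

text \<open>The distance is not localised, so one estimate serves all radii: closeness in the energy
  norm transfers small tails from a fixed limit to nearby states.\<close>

lemma tail_dist:
  assumes "L2v G1" "L2v G2" "L2s g1" "L2s g2"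
  shows "tail G1 r \<le> 2 * H_dist2 G1 g1 G2 g2 + 2 * tail G2 r"
    and "stail g1 r \<le> 2 * H_dist2 G1 g1 G2 g2 + 2 * stail g2 r"
proof -
  have i: "integrable MB (\<lambda>x. norm (G1 x - G2 x) ^ 2)" using L2v_diff[OF assms(1,2)] by (simp add: L2v_def)
  have "tail G1 r \<le> (\<integral>x. 2 * norm (G1 x - G2 x) ^ 2 + 2 * (indicator {r<..} (norm x) * norm (G2 x) ^ 2) \<partial>MB)"
    unfolding tail_def
  proof (rule integral_mono)
    show "indicator {r<..} (norm x) * norm (G1 x) ^ 2 \<le> 2 * norm (G1 x - G2 x) ^ 2 + 2 * (indicator {r<..} (norm x) * norm (G2 x) ^ 2)" for x
      using norm_sq_le[of "G1 x" "G2 x"] by (auto simp: indicator_def)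
  qed (intro integrable_mult_right Bochner_Integration.integrable_add i tail_integrable assms)+
  also have "\<dots> = 2 * (\<integral>x. norm (G1 x - G2 x) ^ 2 \<partial>MB) + 2 * tail G2 r"
    unfolding tail_def using i tail_integrable[OF assms(2)] by (subst Bochner_Integration.integral_add) auto
  finally show "tail G1 r \<le> 2 * H_dist2 G1 g1 G2 g2 + 2 * tail G2 r" using H_dist2_bounds(1)[OF assms] by linarith
  have j: "integrable MB (\<lambda>x. (g1 x - g2 x) ^ 2)" using L2s_diff[OF assms(3,4)] by (simp add: L2s_def)
  have "stail g1 r \<le> (\<integral>x. 2 * (g1 x - g2 x) ^ 2 + 2 * (indicator {r<..} (norm x) * g2 x ^ 2) \<partial>MB)"
    unfolding stail_def
  proof (rule integral_mono)
    show "indicator {r<..} (norm x) * g1 x ^ 2 \<le> 2 * (g1 x - g2 x) ^ 2 + 2 * (indicator {r<..} (norm x) * g2 x ^ 2)" for x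
      using norm_sq_le[of "g1 x" "g2 x"] by (auto simp: indicator_def)
  qed (intro integrable_mult_right Bochner_Integration.integrable_add j stail_integrable assms)+
  also have "\<dots> = 2 * (\<integral>x. (g1 x - g2 x) ^ 2 \<partial>MB) + 2 * stail g2 r"
    unfolding stail_def using j stail_integrable[OF assms(4)] by (subst Bochner_Integration.integral_add) auto
  finally show "stail g1 r \<le> 2 * H_dist2 G1 g1 G2 g2 + 2 * stail g2 r" using H_dist2_bounds(2)[OF assms] by linarith
qed

section \<open>The trajectory: uniform tails, the profile and its increments\<close>

locale compact_solution =
  fixes u ut :: "real \<Rightarrow> R3 \<Rightarrow> real" and Du :: "real \<Rightarrow> R3 \<Rightarrow> R3" and u0 u1 :: "R3 \<Rightarrow> real"
  assumes sol: "global_neumann_sol u ut Du u0 u1"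
    and cpt: "precompact_traj u ut Du"
begin

lemma H: "in_H (u t) (Du t) (ut t)"
  using sol unfolding global_neumann_sol_def by blast

lemma Lv: "L2v (Du t)"
  using in_H_D(1)[OF H] .

lemma Ls: "L2s (ut t)"
  using in_H_D(5,6)[OF H] by (simp add: L2s_def)

text \<open>Failure would give times and radii q n \<ge> n with large tails. Along a subsequence the
  states converge, the limit has small tails beyond a fixed radius \<open>m\<close>, and tails
  decrease in the radius; so late members of the subsequence have small tails at their radii
  too.\<close>

lemma uniform_tail:
  assumes e: "0 < e"
  shows "\<exists>R. \<forall>t r. R \<le> r \<longrightarrow> tail (Du t) r \<le> e \<and> stail (ut t) r \<le> e"
proof (rule ccontr)
  assume "\<not> ?thesis"
  then have "\<forall>n. \<exists>t r. real n \<le> r \<and> \<not> (tail (Du t) r \<le> e \<and> stail (ut t) r \<le> e)" by blast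
  then obtain s q where s: "\<And>n. real n \<le> q n" "\<And>n. \<not> (tail (Du (s n)) (q n) \<le> e \<and> stail (ut (s n)) (q n) \<le> e)" by metis
  obtain r f G g where r: "strict_mono r" "in_H f G g"
    "(\<lambda>n. H_dist2 (Du (s (r n))) (ut (s (r n))) G g) \<longlonglongrightarrow> 0"
    using cpt unfolding precompact_traj_def by blast
  have G: "L2v G" "L2s g" using in_H_D[OF r(2)] by (auto simp: L2s_def)
  have "\<forall>\<^sub>F n in sequentially. tail G (real n) < e / 4 \<and> stail g (real n) < e / 4"
    using order_tendstoD(2)[OF tail_tendsto_0[OF G(1)], of "e / 4"] order_tendstoD(2)[OF stail_tendsto_0[OF G(2)], of "e / 4"] e
    by (simp add: eventually_conj)
  then obtain m where m: "tail G (real m) < e / 4" "stail g (real m) < e / 4"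
    using eventually_happens'[OF sequentially_bot] by blast
  have "\<forall>\<^sub>F n in sequentially. H_dist2 (Du (s (r n))) (ut (s (r n))) G g < e / 4 \<and> m \<le> n"
    using order_tendstoD(2)[OF r(3), of "e / 4"] e eventually_ge_at_top[of m] by (simp add: eventually_conj)
  then obtain n where n: "H_dist2 (Du (s (r n))) (ut (s (r n))) G g < e / 4" "m \<le> n"
    using eventually_happens'[OF sequentially_bot] by blast
  have "real m \<le> q (r n)"
    using n(2) seq_suble[OF r(1), of n] s(1)[of "r n"] by linarith
  then have "tail (Du (s (r n))) (q (r n)) \<le> e" "stail (ut (s (r n))) (q (r n)) \<le> e"
    using tail_dist[OF Lv G(1) Ls G(2), of "s (r n)" "real m" "s (r n)"] n(1) m
      tail_mono[OF Lv, of "real m" "q (r n)" "s (r n)"] stail_mono[OF Ls, of "real m" "q (r n)" "s (r n)"]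
    by linarith+
  with s(2)[of "r n"] show False by blast
qed

text \<open>States whose energies exceed every bound along a sequence of times admit no convergent
  subsequence.\<close>

lemma uniform_bound: "\<exists>B\<ge>0. \<forall>t r. tail (Du t) r \<le> B"
proof (rule ccontr)
  assume "\<not> ?thesis"
  then have "\<forall>n. \<exists>t r. \<not> tail (Du t) r \<le> real n" by (meson of_nat_0_le_iff)
  then obtain s q where s: "\<And>n. \<not> tail (Du (s n)) (q n) \<le> real n" by metis
  obtain r f G g where r: "strict_mono r" "in_H f G g"
    "(\<lambda>n. H_dist2 (Du (s (r n))) (ut (s (r n))) G g) \<longlonglongrightarrow> 0"
    using cpt unfolding precompact_traj_def by blast
  have G: "L2v G" "L2s g" using in_H_D[OF r(2)] by (auto simp: L2s_def)
  obtain m where m: "2 + 2 * (\<integral>x. norm (G x) ^ 2 \<partial>MB) \<le> real m" using real_arch_simple by blast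
  have "\<forall>\<^sub>F n in sequentially. H_dist2 (Du (s (r n))) (ut (s (r n))) G g < 1 \<and> m \<le> n"
    using order_tendstoD(2)[OF r(3), of 1] eventually_ge_at_top[of m] by (simp add: eventually_conj)
  then obtain n where n: "H_dist2 (Du (s (r n))) (ut (s (r n))) G g < 1" "m \<le> n"
    using eventually_happens'[OF sequentially_bot] by blast
  have "real m \<le> real (r n)" using n(2) seq_suble[OF r(1), of n] by linarith
  then have "tail (Du (s (r n))) (q (r n)) \<le> real (r n)"
    using tail_dist(1)[OF Lv G(1) Ls G(2), of "s (r n)" "q (r n)" "s (r n)"] n(1) m tail_le[OF G(1), of "q (r n)"] by linarith
  with s[of "r n"] show False by blast
qed

definition v :: "real \<Rightarrow> real \<Rightarrow> real" where "v t r = rprofile (Du t) r"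
definition w :: "real \<Rightarrow> real \<Rightarrow> real" where "w t r = r * v t r"

lemma u_eq_v: "AE x in MB. u t x = v t (norm x)"
  unfolding v_def by (rule in_H_profile[OF H])

lemma continuous_v_r: "continuous_on UNIV (v t)"
  unfolding v_def by (rule continuous_rprofile[OF Lv])

lemma dist_tendsto: "((\<lambda>s. H_dist2 (Du s) (ut s) (Du t) (ut t)) \<longlongrightarrow> 0) (at t)"
  using sol unfolding global_neumann_sol_def by blast

text \<open>The profile is linear in the gradient, so the energy distance bounds the difference of
  profiles uniformly in the radius, including radii below 1, where the profile equals its value at
  1.\<close>

lemma v_time: "\<bar>v s r - v t r\<bar> \<le> sqrt (H_dist2 (Du s) (ut s) (Du t) (ut t)) / sqrt \<kappa>"
proof -
  have "\<bar>v s r - v t r\<bar> = \<bar>rprofile (\<lambda>x. Du s x - Du t x) (max 1 r)\<bar>"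
    unfolding v_def rprofile_max by (simp add: rprofile_diff[OF Lv Lv])
  also have "\<dots> \<le> sqrt (tail (\<lambda>x. Du s x - Du t x) (max 1 r)) / sqrt (\<kappa> * max 1 r)"
    by (rule rprofile_bound[OF L2v_diff[OF Lv Lv]]) simp
  also have "\<dots> \<le> sqrt (H_dist2 (Du s) (ut s) (Du t) (ut t)) / sqrt (\<kappa> * 1)"
    using \<kappa>_pos H_dist2_bounds[OF Lv[of s] Lv[of t] Ls[of s] Ls[of t]] tail_le[OF L2v_diff[OF Lv Lv], of s t "max 1 r"]
    by (intro frac_le real_sqrt_le_mono mult_left_mono) auto
  finally show ?thesis by simp
qed

text \<open>Joint continuity follows from continuity in time that is uniform in the radius, together
  with continuity in the radius at one time.\<close>

lemma continuous_v: "continuous_on UNIV (\<lambda>p. v (fst p) (snd p))"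
proof (rule continuous_at_imp_continuous_on, rule ballI)
  fix p :: "real \<times> real"
  obtain t r where p: "p = (t, r)" by (cases p)
  define D where "D = (\<lambda>s. sqrt (H_dist2 (Du s) (ut s) (Du t) (ut t)) / sqrt \<kappa>)"
  have D0: "D t = 0" by (simp add: D_def H_dist2_def)
  have "(D \<longlongrightarrow> sqrt 0 / sqrt \<kappa>) (at t)" unfolding D_def by (intro tendsto_intros dist_tendsto) (use \<kappa>_pos in auto)
  then have "isCont D t" using D0 by (simp add: isCont_def)
  then have "isCont (\<lambda>q. D (fst q)) p" unfolding p
    by (intro isCont_o2[where g = D and f = fst] continuous_intros) simp
  then have l1: "((\<lambda>q. D (fst q)) \<longlongrightarrow> 0) (at p)" using D0 by (simp add: isCont_def p)
  have "isCont (v t) r" using continuous_v_r by (simp add: continuous_on_eq_continuous_at)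
  then have "isCont (\<lambda>q. v t (snd q)) p" unfolding p
    by (intro isCont_o2[where g = "v t" and f = snd] continuous_intros) simp
  then have l2: "((\<lambda>q. v t (snd q)) \<longlongrightarrow> v t r) (at p)" by (simp add: isCont_def p)
  have l3: "((\<lambda>q. v (fst q) (snd q) - v t (snd q)) \<longlongrightarrow> 0) (at p)"
    by (rule Lim_null_comparison[OF _ l1]) (auto simp: D_def intro!: always_eventually v_time)
  from tendsto_add[OF l3 l2] show "isCont (\<lambda>q. v (fst q) (snd q)) p" by (simp add: isCont_def p)
qed

lemma continuous_w: "continuous_on UNIV (\<lambda>p. w (fst p) (snd p))"
  unfolding w_def by (intro continuous_intros continuous_v)

lemma w_bound:
  assumes r: "1 \<le> r"
  shows "\<bar>w t r\<bar> \<le> sqrt (tail (Du t) r / \<kappa>) * sqrt r"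
proof -
  have "\<bar>w t r\<bar> = r * \<bar>rprofile (Du t) r\<bar>" using r by (simp add: w_def v_def abs_mult)
  also have "\<dots> \<le> r * (sqrt (tail (Du t) r) / sqrt (\<kappa> * r))"
    using r by (intro mult_left_mono rprofile_bound[OF Lv]) auto
  also have "\<dots> = sqrt (tail (Du t) r) / sqrt \<kappa> * (r / sqrt r)" by (simp add: real_sqrt_mult)
  also have "\<dots> = sqrt (tail (Du t) r / \<kappa>) * sqrt r" using r by (simp add: real_div_sqrt real_sqrt_divide)
  finally show ?thesis .
qed

lemma w_sqrt_bound: "\<exists>M. \<forall>t r. 1 \<le> r \<longrightarrow> \<bar>w t r\<bar> \<le> M * sqrt r"
proof -
  obtain B where B: "\<And>t r. tail (Du t) r \<le> B" using uniform_bound by blast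
  have "\<bar>w t r\<bar> \<le> sqrt (B / \<kappa>) * sqrt r" if "1 \<le> r" for t r
    by (rule order_trans[OF w_bound[OF that]], intro mult_right_mono real_sqrt_le_mono divide_right_mono B)
      (use \<kappa>_pos that in auto)
  then show ?thesis by blast
qed

lemma w_small:
  assumes e: "0 < e"
  shows "\<exists>R. \<forall>t r. R \<le> r \<longrightarrow> \<bar>w t r\<bar> \<le> e * sqrt r"
proof -
  obtain R where R: "\<And>t r. R \<le> r \<Longrightarrow> tail (Du t) r \<le> e ^ 2 * \<kappa>"
    using uniform_tail[of "e ^ 2 * \<kappa>"] e \<kappa>_pos by auto
  have "\<bar>w t r\<bar> \<le> e * sqrt r" if r: "max 1 R \<le> r" for t r
  proof -
    have "\<bar>w t r\<bar> \<le> sqrt (tail (Du t) r / \<kappa>) * sqrt r" using r by (intro w_bound) auto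
    also have "\<dots> \<le> sqrt (e ^ 2) * sqrt r" using r \<kappa>_pos R[of r t]
      by (intro mult_right_mono real_sqrt_le_mono) (auto simp: pos_divide_le_eq)
    finally show ?thesis using e by simp
  qed
  then show ?thesis by blast
qed

lemma v_space:
  assumes "1 \<le> r" "r \<le> s"
  shows "r * \<bar>v t r - v t s\<bar> \<le> sqrt (tail (Du t) r / \<kappa>) * sqrt (s - r)"
proof -
  have "r * \<bar>v t r - v t s\<bar> \<le> r * (sqrt (tail (Du t) r) * (sqrt (s - r) / (sqrt \<kappa> * r)))"
    unfolding v_def using assms by (intro mult_left_mono rprofile_diff_bound[OF Lv]) auto
  also have "\<dots> = sqrt (tail (Du t) r / \<kappa>) * sqrt (s - r)" using assms by (simp add: real_sqrt_divide)
  finally show ?thesis .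
qed

text \<open>Written as r (v(r) - v(r + d)) - d v(r + d), the increment consists of two terms bounded
  by the square root of the tail, with factors that depend on \<open>d\<close> only. No smallness of
  \<open>w\<close> itself is involved.\<close>

lemma w_space:
  assumes d: "0 \<le> d" and e: "0 < e"
  shows "\<exists>R. \<forall>t r. R \<le> r \<longrightarrow> \<bar>w t r - w t (r + d)\<bar> \<le> e"
proof -
  \<comment> \<open>sqrt d comes from the increment of \<open>v\<close> and d from its size; the 1
    keeps the denominator positive when d = 0.\<close>
  define c where "c = e / (sqrt d + d + 1)"
  have sd: "0 \<le> sqrt d" using d by simp
  have c: "0 < c" using e d sd unfolding c_def by (intro divide_pos_pos add_nonneg_pos add_nonneg_nonneg) auto
  obtain R where R: "\<And>t r. R \<le> r \<Longrightarrow> tail (Du t) r \<le> c ^ 2 * \<kappa>"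
    using uniform_tail[of "c ^ 2 * \<kappa>"] c \<kappa>_pos by auto
  have "\<bar>w t r - w t (r + d)\<bar> \<le> e" if r: "max 1 R \<le> r" for t r
  proof -
    have r1: "1 \<le> r" using r by simp
    have st: "sqrt (tail (Du t) q / \<kappa>) \<le> c" if "r \<le> q" for q
    proof -
      have "tail (Du t) q / \<kappa> \<le> c ^ 2" using R[of q t] r that \<kappa>_pos by (simp add: pos_divide_le_eq)
      then have "sqrt (tail (Du t) q / \<kappa>) \<le> sqrt (c ^ 2)" by (rule real_sqrt_le_mono)
      then show ?thesis using c by simp
    qed
    have "w t r - w t (r + d) = r * (v t r - v t (r + d)) - d * v t (r + d)" by (simp add: w_def algebra_simps)
    then have "\<bar>w t r - w t (r + d)\<bar> \<le> r * \<bar>v t r - v t (r + d)\<bar> + d * \<bar>v t (r + d)\<bar>"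
      using r1 d abs_triangle_ineq4[of "r * (v t r - v t (r + d))" "d * v t (r + d)"] by (simp add: abs_mult)
    also have "r * \<bar>v t r - v t (r + d)\<bar> \<le> c * sqrt d"
      using v_space[OF r1, of "r + d" t] d mult_right_mono[OF st[OF order_refl] sd] by simp
    also have "\<bar>v t (r + d)\<bar> \<le> c"
    proof -
      have "\<bar>v t (r + d)\<bar> * 1 \<le> \<bar>v t (r + d)\<bar> * sqrt (r + d)" using r1 d by (intro mult_left_mono) auto
      also have "\<dots> = \<bar>w t (r + d)\<bar> / sqrt (r + d)"
      proof -
        have "\<bar>w t (r + d)\<bar> / sqrt (r + d) = \<bar>v t (r + d)\<bar> * ((r + d) / sqrt (r + d))"
          using r1 d by (simp add: w_def abs_mult)
        also have "(r + d) / sqrt (r + d) = sqrt (r + d)" using r1 d by (intro real_div_sqrt) auto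
        finally show ?thesis by simp
      qed
      also have "\<dots> \<le> sqrt (tail (Du t) (r + d) / \<kappa>)"
        using w_bound[of "r + d" t] r1 d by (simp add: pos_divide_le_eq)
      also have "\<dots> \<le> c" using st d by simp
      finally show ?thesis by simp
    qed
    also have "c * sqrt d + d * c \<le> e"
    proof -
      have "c * sqrt d + d * c \<le> c * (sqrt d + d + 1)" using c by (simp add: algebra_simps)
      also have "\<dots> = e"
      proof -
        have "sqrt d + d + 1 \<noteq> 0" using sd d by linarith
        then show ?thesis by (simp add: c_def)
      qed
      finally show ?thesis .
    qed
    finally show ?thesis using d by (simp add: mult_left_mono)
  qed
  then show ?thesis by blast
qed

end

section \<open>Radial test functions\<close>

lemma max0_power_deriv:
  "((\<lambda>x::real. (max 0 x) ^ (n + 2)) has_real_derivative real (n + 2) * (max 0 x) ^ (n + 1)) (at x)"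
proof (cases "x = 0")
  case False
  then consider "0 < x" | "x < 0" by linarith
  then show ?thesis
  proof cases
    case 1
    have "((\<lambda>x. x ^ (n + 2)) has_real_derivative real (n + 2) * x ^ (n + 1)) (at x)"
      by (rule derivative_eq_intros | simp)+
    then have "((\<lambda>x::real. (max 0 x) ^ (n + 2)) has_real_derivative real (n + 2) * x ^ (n + 1)) (at x)"
      by (rule has_field_derivative_transform_within_open[where S = "{0<..}"]) (use 1 in auto)
    then show ?thesis using 1 by simp
  next
    case 2
    have "((\<lambda>x::real. 0) has_real_derivative 0) (at x)" by simp
    then have "((\<lambda>x::real. (max 0 x) ^ (n + 2)) has_real_derivative 0) (at x)"
      by (rule has_field_derivative_transform_within_open[where S = "{..<0}"]) (use 2 in auto)
    then show ?thesis using 2 by simp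
  qed
next
  case True
  have "((\<lambda>h::real. (max 0 h) ^ (n + 2) / h) \<longlongrightarrow> 0) (at 0)"
  proof (rule Lim_null_comparison)
    show "\<forall>\<^sub>F h in at 0. norm ((max 0 h) ^ (n + 2) / h) \<le> \<bar>h\<bar> ^ (n + 1)"
    proof (rule always_eventually, rule allI)
      fix h :: real
      show "norm ((max 0 h) ^ (n + 2) / h) \<le> \<bar>h\<bar> ^ (n + 1)"
      proof (cases "0 < h")
        case False
        then have "(max 0 h) ^ (n + 2) / h = 0" by (simp add: max_def)
        then show ?thesis by (simp only: norm_zero zero_le_power[OF abs_ge_zero])
      qed auto
    qed
    have "((\<lambda>h::real. \<bar>h\<bar> ^ (n + 1)) \<longlongrightarrow> \<bar>0\<bar> ^ (n + 1)) (at 0)" by (intro tendsto_intros)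
    then show "((\<lambda>h::real. \<bar>h\<bar> ^ (n + 1)) \<longlongrightarrow> 0) (at 0)" by simp
  qed
  then show ?thesis using True by (simp add: DERIV_def)
qed

text \<open>The square of a positive part is of class C^1, so its normalised antiderivative is C^2.
  This is the regularity that the products of functions of t - r and t + r require below.\<close>

definition bump0 :: "real \<Rightarrow> real" where "bump0 x = (max 0 (x * (1 - x))) ^ 2"
definition bump0' :: "real \<Rightarrow> real" where "bump0' x = 2 * max 0 (x * (1 - x)) * (1 - 2 * x)"

lemma bump0_deriv: "(bump0 has_real_derivative bump0' x) (at x)"
proof -
  have "((\<lambda>x::real. x * (1 - x)) has_real_derivative (1 - 2 * x)) (at x)"
    by (auto intro!: derivative_eq_intros)
  from DERIV_chain2[OF max0_power_deriv[of 0 "x * (1 - x)"] this] show ?thesis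
    by (simp add: bump0_def[abs_def] bump0'_def numeral_2_eq_2)
qed

lemma continuous_bump0: "continuous_on UNIV bump0" "continuous_on UNIV bump0'"
  unfolding bump0_def[abs_def] bump0'_def[abs_def] by (intro continuous_intros)+

lemma bump0_out: "x \<notin> {0<..<1} \<Longrightarrow> bump0 x = 0" "x \<notin> {0<..<1} \<Longrightarrow> bump0' x = 0"
proof -
  assume "x \<notin> {0<..<1}"
  then have "x * (1 - x) \<le> 0" by (auto simp: mult_le_0_iff)
  then show "bump0 x = 0" "bump0' x = 0" by (auto simp: bump0_def bump0'_def max_def)
qed

text \<open>Only differences of values of \<open>bumpA\<close> enter the functions built from it, so
  the additive constant left open by the choice is immaterial.\<close>

definition bumpA :: "real \<Rightarrow> real" where
  "bumpA = (SOME A. \<forall>x. (A has_real_derivative bump0 x) (at x))"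

lemma bumpA_deriv: "(bumpA has_real_derivative bump0 x) (at x)"
  using someI_ex[OF continuous_antiderivative[OF continuous_bump0(1)]] unfolding bumpA_def by blast

definition bump :: "real \<Rightarrow> real" where "bump x = bump0 x / (bumpA 1 - bumpA 0)"
definition bump' :: "real \<Rightarrow> real" where "bump' x = bump0' x / (bumpA 1 - bumpA 0)"
definition smoothstep :: "real \<Rightarrow> real" where "smoothstep x = (bumpA x - bumpA 0) / (bumpA 1 - bumpA 0)"

lemma bumpA_less: "bumpA 0 < bumpA 1"
proof -
  have "\<exists>y. (bumpA has_real_derivative y) (at x) \<and> 0 < y" if "0 < x" "x < 1" for x
    using that bumpA_deriv[of x] by (intro exI[of _ "bump0 x"]) (auto simp: bump0_def)
  moreover have "continuous_on UNIV bumpA"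
    using bumpA_deriv by (meson DERIV_isCont continuous_at_imp_continuous_on)
  then have "continuous_on {0..1} bumpA" by (rule continuous_on_subset) simp
  ultimately show ?thesis
    using DERIV_pos_imp_increasing_open[of 0 1 bumpA] by simp
qed

lemma smoothstep_deriv: "(smoothstep has_real_derivative bump x) (at x)"
  unfolding smoothstep_def[abs_def] bump_def using bumpA_less
  by (auto intro!: derivative_eq_intros bumpA_deriv)

lemma bump_deriv: "(bump has_real_derivative bump' x) (at x)"
  unfolding bump_def[abs_def] bump'_def using bumpA_less
  by (auto intro!: derivative_eq_intros bump0_deriv)

lemma continuous_bump: "continuous_on UNIV bump" "continuous_on UNIV bump'" "continuous_on UNIV smoothstep"
proof -
  show "continuous_on UNIV bump" "continuous_on UNIV bump'"
    unfolding bump_def[abs_def] bump'_def[abs_def] using bumpA_less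
    by (auto intro!: continuous_intros continuous_bump0)
  show "continuous_on UNIV smoothstep"
    using smoothstep_deriv by (meson DERIV_isCont continuous_at_imp_continuous_on)
qed

lemma bump_out: "x \<notin> {0<..<1} \<Longrightarrow> bump x = 0" "x \<notin> {0<..<1} \<Longrightarrow> bump' x = 0"
  using bump0_out by (auto simp: bump_def bump'_def)

lemma bump_nonneg: "0 \<le> bump x"
  using bumpA_less by (simp add: bump_def bump0_def)

lemma bump_bounded: "\<exists>K\<ge>0. \<forall>x. bump x \<le> K"
proof -
  obtain B where B: "\<forall>x\<in>{0..1}. \<bar>bump x\<bar> \<le> B" using continuous_bounded_Icc[OF continuous_bump(1)] by blast
  then have "0 \<le> B" by (meson abs_ge_zero atLeastAtMost_iff order_refl order_trans zero_le_one)
  moreover have "bump x \<le> B" for x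
  proof (cases "x \<in> {0<..<1}")
    case True
    then have "\<bar>bump x\<bar> \<le> B" using B by auto
    then show ?thesis by linarith
  qed (use \<open>0 \<le> B\<close> bump_out in simp)
  ultimately show ?thesis by blast
qed

lemma smoothstep_mono: "x \<le> y \<Longrightarrow> smoothstep x \<le> smoothstep y"
  by (rule DERIV_nonneg_imp_nondecreasing) (use smoothstep_deriv bump_nonneg in blast)+

lemma smoothstep_0: "x \<le> 0 \<Longrightarrow> smoothstep x = 0"
proof -
  assume x: "x \<le> 0"
  have "(\<integral>y. bump y * indicator {x..0} y \<partial>lborel) = smoothstep 0 - smoothstep x"
    by (rule integral_Icc_FTC(1)[OF x smoothstep_deriv continuous_bump(1)])
  moreover have "(\<lambda>y. bump y * indicator {x..0} y) = (\<lambda>y. 0)"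
    by (auto simp: fun_eq_iff indicator_def bump_out)
  ultimately show ?thesis by (simp add: smoothstep_def)
qed

lemma smoothstep_1: "1 \<le> x \<Longrightarrow> smoothstep x = 1"
proof -
  assume x: "1 \<le> x"
  have "(\<integral>y. bump y * indicator {1..x} y \<partial>lborel) = smoothstep x - smoothstep 1"
    by (rule integral_Icc_FTC(1)[OF x smoothstep_deriv continuous_bump(1)])
  moreover have "(\<lambda>y. bump y * indicator {1..x} y) = (\<lambda>y. 0)"
    by (auto simp: fun_eq_iff indicator_def bump_out)
  ultimately show ?thesis using bumpA_less by (simp add: smoothstep_def)
qed

lemma smoothstep_bounds: "0 \<le> smoothstep x" "smoothstep x \<le> 1"
  using smoothstep_mono[of "min 0 x" x] smoothstep_0[of "min 0 x"]
    smoothstep_mono[of x "max 1 x"] smoothstep_1[of "max 1 x"] by auto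

lemma integrable_bump: "integrable lborel bump"
  by (rule integrable_continuous_compact_support[OF continuous_bump(1), of 0 1]) (auto intro: bump_out)

lemma integral_bump: "(\<integral>x. bump x \<partial>lborel) = 1"
proof -
  have "(\<integral>y. bump y * indicator {0..1} y \<partial>lborel) = smoothstep 1 - smoothstep 0"
    by (rule integral_Icc_FTC(1)[OF _ smoothstep_deriv continuous_bump(1)]) simp
  moreover have "(\<lambda>y. bump y * indicator {0..1} y) = bump"
  proof
    fix y show "bump y * indicator {0..1} y = bump y" by (cases "y \<in> {0<..<1}") (auto simp: bump_out)
  qed
  ultimately show ?thesis by (simp add: smoothstep_0 smoothstep_1)
qed

text \<open>A test function \<open>\<Phi>(t, |x|)\<close> with its two partial derivatives.  Being constant for \<open>r \<le> 1\<close> makes it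
  \<open>C\<^sup>1\<close> at the origin and makes its normal derivative vanish at the boundary, so that no boundary values
  of the solution enter the weak formulation.\<close>
definition rtest :: "(real \<Rightarrow> real \<Rightarrow> real) \<Rightarrow> (real \<Rightarrow> real \<Rightarrow> real) \<Rightarrow> (real \<Rightarrow> real \<Rightarrow> real) \<Rightarrow> bool" where
  "rtest \<Phi> \<Phi>1 \<Phi>2 \<longleftrightarrow>
     (\<forall>t r. 1 \<le> r \<longrightarrow> ((\<lambda>p. \<Phi> (fst p) (snd p)) has_derivative (\<lambda>d. \<Phi>1 t r * fst d + \<Phi>2 t r * snd d)) (at (t, r))) \<and>
     continuous_on (UNIV \<times> {1..}) (\<lambda>p. \<Phi>1 (fst p) (snd p)) \<and>
     continuous_on (UNIV \<times> {1..}) (\<lambda>p. \<Phi>2 (fst p) (snd p)) \<and>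
     (\<forall>t r. r \<le> 1 \<longrightarrow> \<Phi> t r = \<Phi> t 1 \<and> \<Phi>1 t r = \<Phi>1 t 1 \<and> \<Phi>2 t r = 0) \<and>
     (\<exists>T R. \<forall>t r. \<bar>t\<bar> > T \<or> r > R \<longrightarrow> \<Phi> t r = 0 \<and> \<Phi>1 t r = 0 \<and> \<Phi>2 t r = 0)"

text \<open>From the sphere outwards this is the chain rule with the gradient x / |x| of the norm.
  Inside the unit ball the function depends on time alone, so the norm, which is not differentiable
  at the origin, drops out.\<close>

lemma rtest_st_test:
  assumes "rtest \<Phi> \<Phi>1 \<Phi>2"
  shows "st_test (\<lambda>t x. \<Phi> t (norm x)) (\<lambda>t x. \<Phi>1 t (norm x)) (\<lambda>t x. (\<Phi>2 t (norm x) / norm x) *\<^sub>R x)"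
proof -
  have d: "\<And>t r. 1 \<le> r \<Longrightarrow> ((\<lambda>p. \<Phi> (fst p) (snd p)) has_derivative (\<lambda>d. \<Phi>1 t r * fst d + \<Phi>2 t r * snd d)) (at (t, r))"
    and c1: "continuous_on (UNIV \<times> {1..}) (\<lambda>p. \<Phi>1 (fst p) (snd p))"
    and c2: "continuous_on (UNIV \<times> {1..}) (\<lambda>p. \<Phi>2 (fst p) (snd p))"
    and b: "\<And>t r. r \<le> 1 \<Longrightarrow> \<Phi> t r = \<Phi> t 1" "\<And>t r. r \<le> 1 \<Longrightarrow> \<Phi>1 t r = \<Phi>1 t 1" "\<And>t r. r \<le> 1 \<Longrightarrow> \<Phi>2 t r = 0"
    and s: "\<exists>T R. \<forall>t r. \<bar>t\<bar> > T \<or> r > R \<longrightarrow> \<Phi> t r = 0 \<and> \<Phi>1 t r = 0 \<and> \<Phi>2 t r = 0"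
    using assms unfolding rtest_def by blast+
  have cm: "continuous_on UNIV (\<lambda>p::real \<times> R3. \<Psi> (fst p) (max 1 (norm (snd p))))"
    if "continuous_on (UNIV \<times> {1..}) (\<lambda>p. \<Psi> (fst p) (snd p))" for \<Psi> :: "real \<Rightarrow> real \<Rightarrow> real"
  proof -
    have "continuous_on UNIV (\<lambda>p::real \<times> R3. (\<lambda>p. \<Psi> (fst p) (snd p)) (fst p, max 1 (norm (snd p))))"
      by (rule continuous_on_compose2[OF that]) (auto intro!: continuous_intros)
    then show ?thesis by simp
  qed
  have e1: "\<Phi>1 t (max 1 r) = \<Phi>1 t r" for t r using b(2)[of r t] by (simp add: max_def)
  have e2: "(\<Phi>2 t (max 1 r) / max 1 r) = \<Phi>2 t r / r" for t r using b(3)[of r t] b(3)[of 1 t] by (simp add: max_def)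
  show ?thesis
    unfolding st_test_def
  proof (intro conjI allI)
    fix t and x :: R3
    have "((\<lambda>p. \<Phi> (fst p) (norm (snd p))) has_derivative (\<lambda>h. \<Phi>1 t (norm x) * fst h + ((\<Phi>2 t (norm x) / norm x) *\<^sub>R x) \<bullet> snd h)) (at (t, x))"
    proof (cases "1 \<le> norm x")
      case True
      then have x0: "x \<noteq> 0" by auto
      have n: "((\<lambda>p. norm (snd p)) has_derivative (\<lambda>h. snd h \<bullet> sgn x)) (at (t, x))"
        by (rule has_derivative_compose[OF has_derivative_snd[OF has_derivative_ident], of norm "\<lambda>h. h \<bullet> sgn x"])
          (use has_derivative_norm[OF x0] in \<open>simp add: inner_commute\<close>)
      have p: "((\<lambda>p. (fst p, norm (snd p))) has_derivative (\<lambda>h. (fst h, snd h \<bullet> sgn x))) (at (t, x))"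
        by (rule has_derivative_Pair[OF has_derivative_fst[OF has_derivative_ident] n])
      have "((\<lambda>p. (\<lambda>p. \<Phi> (fst p) (snd p)) (fst p, norm (snd p))) has_derivative
          (\<lambda>h. (\<lambda>d. \<Phi>1 t (norm x) * fst d + \<Phi>2 t (norm x) * snd d) (fst h, snd h \<bullet> sgn x))) (at (t, x))"
        by (rule has_derivative_compose[OF p]) (use d[OF True] in simp)
      then show ?thesis by (simp add: sgn_div_norm inner_commute divide_inverse mult_ac)
    next
      case False
      have p: "((\<lambda>p::real \<times> R3. (fst p, 1::real)) has_derivative (\<lambda>h. (fst h, 0))) (at (t, x))"
        by (rule has_derivative_Pair[OF has_derivative_fst[OF has_derivative_ident] has_derivative_const])
      have "((\<lambda>p. (\<lambda>p. \<Phi> (fst p) (snd p)) (fst p, 1)) has_derivative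
          (\<lambda>h. (\<lambda>d. \<Phi>1 t 1 * fst d + \<Phi>2 t 1 * snd d) (fst h, 0))) (at (t, x))"
        by (rule has_derivative_compose[OF p]) (use d[of 1] in simp)
      then have "((\<lambda>p. \<Phi> (fst p) 1) has_derivative (\<lambda>h. \<Phi>1 t (norm x) * fst h + ((\<Phi>2 t (norm x) / norm x) *\<^sub>R x) \<bullet> snd h)) (at (t, x))"
        using b(2)[of "norm x" t] b(3)[of "norm x" t] False by simp
      then show ?thesis
      proof (rule has_derivative_transform_within_open[where s = "UNIV \<times> ball 0 1"])
        show "\<Phi> (fst p) 1 = \<Phi> (fst p) (norm (snd p))" if "p \<in> UNIV \<times> ball (0::R3) 1" for p :: "real \<times> R3"
          using that b(1)[of "norm (snd p)" "fst p"] by auto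
      qed (use False in \<open>auto intro!: open_Times\<close>)
    qed
    then show "((\<lambda>(s, y). \<Phi> s (norm y)) has_derivative (\<lambda>(ds, dy). \<Phi>1 t (norm x) * ds + ((\<Phi>2 t (norm x) / norm x) *\<^sub>R x) \<bullet> dy)) (at (t, x))"
      by (simp add: case_prod_unfold)
  next
    show "continuous_on UNIV (\<lambda>(t, x::R3). \<Phi>1 t (norm x))"
      using cm[OF c1] unfolding e1 by (simp add: case_prod_unfold)
    have "continuous_on UNIV (\<lambda>p::real \<times> R3. (\<Phi>2 (fst p) (max 1 (norm (snd p))) / max 1 (norm (snd p))) *\<^sub>R snd p)"
      by (intro continuous_intros cm[OF c2]) (auto simp: max_def)
    then show "continuous_on UNIV (\<lambda>(t, x::R3). (\<Phi>2 t (norm x) / norm x) *\<^sub>R x)"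
      unfolding e2 by (simp add: case_prod_unfold)
    show "\<exists>T R. \<forall>t x. \<bar>t\<bar> > T \<or> norm x > R \<longrightarrow> \<Phi> t (norm x) = 0" using s by meson
  qed
qed

lemma rtest_continuous:
  assumes "rtest \<Phi> \<Phi>1 \<Phi>2"
  shows "continuous_on (UNIV \<times> {1..}) (\<lambda>p. \<Phi> (fst p) (snd p))"
proof (rule continuous_at_imp_continuous_on, rule ballI)
  fix p :: "real \<times> real" assume p: "p \<in> UNIV \<times> {1..}"
  have "\<forall>t r. 1 \<le> r \<longrightarrow> ((\<lambda>p. \<Phi> (fst p) (snd p)) has_derivative (\<lambda>d. \<Phi>1 t r * fst d + \<Phi>2 t r * snd d)) (at (t, r))"
    using assms unfolding rtest_def by blast
  then have "((\<lambda>p. \<Phi> (fst p) (snd p)) has_derivative (\<lambda>d. \<Phi>1 (fst p) (snd p) * fst d + \<Phi>2 (fst p) (snd p) * snd d)) (at (fst p, snd p))"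
    using p by (auto simp only: mem_Times_iff atLeast_iff)
  then have "isCont (\<lambda>p. \<Phi> (fst p) (snd p)) (fst p, snd p)" by (rule has_derivative_continuous)
  then show "isCont (\<lambda>p. \<Phi> (fst p) (snd p)) p" by simp
qed

section \<open>Pairing the solution with compactly supported weights\<close>

lemma integrable_pair_continuous:
  fixes K :: "real \<Rightarrow> real \<Rightarrow> real"
  assumes c: "continuous_on (UNIV \<times> {1..}) (\<lambda>p. K (fst p) (snd p))"
    and s: "\<And>t r. \<bar>t\<bar> > T \<or> r > R \<Longrightarrow> K t r = 0"
  shows "integrable (lborel \<Otimes>\<^sub>M lborel) (\<lambda>(t, r). indicator {1..} r * K t r)"
proof -
  have "integrable lborel (\<lambda>p::real \<times> real. indicator ({-T..T} \<times> {1..R}) p *\<^sub>R K (fst p) (snd p))"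
    by (rule borel_integrable_compact) (auto intro!: compact_Times continuous_on_subset[OF c])
  moreover have "(\<lambda>p::real \<times> real. indicator ({-T..T} \<times> {1..R}) p *\<^sub>R K (fst p) (snd p)) = (\<lambda>(t, r). indicator {1..} r * K t r)"
  proof
    fix p :: "real \<times> real"
    obtain t r where p: "p = (t, r)" by (cases p)
    show "indicator ({-T..T} \<times> {1..R}) p *\<^sub>R K (fst p) (snd p) = (\<lambda>(t, r). indicator {1..} r * K t r) p"
      unfolding p using s[of t r] by (cases "\<bar>t\<bar> > T \<or> r > R") (auto simp: indicator_def)
  qed
  ultimately show ?thesis by (simp add: lborel_prod)
qed

text \<open>The weight vanishes on \<open>{1..r0}\<close>, so only the part of \<open>g\<close>
  beyond \<open>r0\<close> is paired with it; this is how small tails enter. With r0 = 0 the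
  vanishing condition is empty and the full norm of \<open>g\<close> appears.\<close>

lemma L2s_weight:
  assumes g: "L2s g" and c: "continuous_on {1..} h" and z: "\<And>r. R < r \<Longrightarrow> h r = 0"
    and z0: "\<And>r. 1 \<le> r \<Longrightarrow> r \<le> r0 \<Longrightarrow> h r = 0"
  shows "integrable MB (\<lambda>x. g x * h (norm x))"
    and "integrable MB (\<lambda>x. h (norm x) ^ 2)"
    and "\<bar>\<integral>x. g x * h (norm x) \<partial>MB\<bar> \<le> sqrt (stail g r0) * sqrt (\<integral>x. h (norm x) ^ 2 \<partial>MB)"
proof -
  have [measurable]: "g \<in> borel_measurable MB" using g by (simp add: L2s_def)
  define h' where "h' = (\<lambda>r. h (max 1 r))"
  have ch: "continuous_on UNIV h'" unfolding h'_def
    by (rule continuous_on_compose2[OF c]) (auto intro!: continuous_intros)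
  then have [measurable]: "h' \<in> borel_measurable borel" by (rule borel_measurable_continuous_onI)
  have hh: "h (norm x) = h' (norm x)" if "x \<in> Bc" for x using that by (simp add: h'_def Bc_def max_def)
  have hm [measurable]: "(\<lambda>x. h (norm x)) \<in> borel_measurable MB"
  proof -
    have "(\<lambda>x. h' (norm x)) \<in> borel_measurable MB" by measurable
    then show ?thesis by (rule measurable_cong[THEN iffD1, rotated]) (simp add: hh)
  qed
  have "integrable lborel (\<lambda>r. indicator {1..R} r *\<^sub>R (r ^ 2 * h' r ^ 2))"
    by (rule borel_integrable_compact) (auto intro!: continuous_intros continuous_on_subset[OF ch])
  moreover have "(\<lambda>r. indicator {1..R} r *\<^sub>R (r ^ 2 * h' r ^ 2)) = (\<lambda>r. indicator {1..} r * (r ^ 2 * h' r ^ 2))"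
  proof
    fix r show "indicator {1..R} r *\<^sub>R (r ^ 2 * h' r ^ 2) = indicator {1..} r * (r ^ 2 * h' r ^ 2)"
      using z[of r] by (cases "R < r") (auto simp: indicator_def h'_def max_def)
  qed
  ultimately have "integrable MB (\<lambda>x. h' (norm x) ^ 2)"
    by (subst integral_MB_radial(2)[where h = "\<lambda>r. h' r ^ 2"]) auto
  then show h2: "integrable MB (\<lambda>x. h (norm x) ^ 2)"
    by (rule Bochner_Integration.integrable_cong[THEN iffD1, rotated 2]) (auto simp: hh)
  define gi where "gi = (\<lambda>x. indicator {r0<..} (norm x) * g x)"
  have [measurable]: "gi \<in> borel_measurable MB" unfolding gi_def by measurable
  have gi2: "gi x ^ 2 = indicator {r0<..} (norm x) * g x ^ 2" for x by (simp add: gi_def power_mult_distrib indicator_def)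
  have igi: "integrable MB (\<lambda>x. gi x ^ 2)" unfolding gi2 by (rule stail_integrable[OF g])
  note CS = Cauchy_Schwarz_integral[of gi MB "\<lambda>x. h (norm x)", OF _ _ igi h2]
  have eq: "gi x * h (norm x) = g x * h (norm x)" if "x \<in> space MB" for x
    using that z0[of "norm x"] by (cases "norm x \<le> r0") (auto simp: gi_def Bc_def)
  have "integrable MB (\<lambda>x. gi x * h (norm x))" by (rule CS(1)) auto
  then show "integrable MB (\<lambda>x. g x * h (norm x))"
    by (rule Bochner_Integration.integrable_cong[THEN iffD1, rotated 2]) (auto simp: eq)
  have "(\<integral>x. g x * h (norm x) \<partial>MB) = (\<integral>x. gi x * h (norm x) \<partial>MB)"
    by (rule Bochner_Integration.integral_cong[OF refl]) (simp only: eq)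
  then have "\<bar>\<integral>x. g x * h (norm x) \<partial>MB\<bar> \<le> (\<integral>x. \<bar>gi x * h (norm x)\<bar> \<partial>MB)" by simp
  also have "\<dots> \<le> sqrt (\<integral>x. gi x ^ 2 \<partial>MB) * sqrt (\<integral>x. h (norm x) ^ 2 \<partial>MB)" by (rule CS(2)) auto
  finally show "\<bar>\<integral>x. g x * h (norm x) \<partial>MB\<bar> \<le> sqrt (stail g r0) * sqrt (\<integral>x. h (norm x) ^ 2 \<partial>MB)"
    unfolding gi2 stail_def .
qed

lemma continuous_slice:
  assumes "continuous_on (UNIV \<times> {1..}) (\<lambda>p. \<Psi> (fst p) (snd p))"
  shows "continuous_on {1..} (\<Psi> t)"
proof -
  have "continuous_on {1..} (\<lambda>r. (\<lambda>p. \<Psi> (fst p) (snd p)) (t, r))"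
    by (rule continuous_on_compose2[OF assms]) (auto intro!: continuous_intros)
  then show ?thesis by simp
qed

lemma bounded_compact_support:
  fixes \<Psi> :: "real \<Rightarrow> real \<Rightarrow> real"
  assumes c: "continuous_on (UNIV \<times> {1..}) (\<lambda>p. \<Psi> (fst p) (snd p))"
    and s: "\<And>t r. \<bar>t\<bar> > T \<or> r > R \<Longrightarrow> \<Psi> t r = 0"
  shows "\<exists>C\<ge>0. \<forall>t r. 1 \<le> r \<longrightarrow> \<bar>\<Psi> t r\<bar> \<le> C"
proof -
  have "compact ((\<lambda>p. \<Psi> (fst p) (snd p)) ` ({-T..T} \<times> {1..R}))"
    by (intro compact_continuous_image compact_Times continuous_on_subset[OF c]) auto
  then have "bounded ((\<lambda>p. \<Psi> (fst p) (snd p)) ` ({-T..T} \<times> {1..R}))" by (rule compact_imp_bounded)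
  then obtain C where C: "\<And>t r. t \<in> {-T..T} \<Longrightarrow> r \<in> {1..R} \<Longrightarrow> \<bar>\<Psi> t r\<bar> \<le> C"
    unfolding bounded_iff by fastforce
  have "\<bar>\<Psi> t r\<bar> \<le> max 0 C" if "1 \<le> r" for t r
  proof (cases "\<bar>t\<bar> > T \<or> r > R")
    case True
    then show ?thesis using s by simp
  next
    case False
    then show ?thesis using C[of t r] that by (simp add: abs_le_iff not_less le_max_iff_disj)
  qed
  then show ?thesis by (intro exI[of _ "max 0 C"]) auto
qed

context compact_solution
begin

text \<open>The continuous representative \<open>v t\<close> replaces \<open>u t\<close>, so every
  power is bounded on the support of the weight and integrability is immediate. The powers 1 and 5
  are the ones that occur in the equation.\<close>

lemma u_weight:
  assumes c: "continuous_on {1..} h" and z: "\<And>r. R < r \<Longrightarrow> h r = 0"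
  shows "integrable MB (\<lambda>x. u t x ^ n * h (norm x))"
    and "(\<integral>x. u t x ^ n * h (norm x) \<partial>MB) = \<kappa> * (\<integral>r. indicator {1..} r * (v t r ^ n * (r ^ 2 * h r)) \<partial>lborel)"
proof -
  define h' where "h' = (\<lambda>r. h (max 1 r))"
  have ch: "continuous_on UNIV h'" unfolding h'_def
    by (rule continuous_on_compose2[OF c]) (auto intro!: continuous_intros)
  then have [measurable]: "h' \<in> borel_measurable borel" by (rule borel_measurable_continuous_onI)
  have [measurable]: "v t \<in> borel_measurable borel" using continuous_v_r by (rule borel_measurable_continuous_onI)
  have [measurable]: "u t \<in> borel_measurable MB" using in_H_D(2)[OF H] .
  have hh: "h (norm x) = h' (norm x)" if "x \<in> Bc" for x using that by (simp add: h'_def Bc_def max_def)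
  have hm [measurable]: "(\<lambda>x. h (norm x)) \<in> borel_measurable MB"
  proof -
    have "(\<lambda>x. h' (norm x)) \<in> borel_measurable MB" by measurable
    then show ?thesis by (rule measurable_cong[THEN iffD1, rotated]) (simp add: hh)
  qed
  have ae: "AE x in MB. v t (norm x) ^ n * h' (norm x) = u t x ^ n * h (norm x)"
    using u_eq_v[of t] AE_space[of MB] by eventually_elim (simp add: hh)
  have eq1: "indicator {1..R} r *\<^sub>R (r ^ 2 * (v t r ^ n * h' r)) = indicator {1..} r * (r ^ 2 * (v t r ^ n * h' r))" for r
    using z[of r] by (cases "R < r") (auto simp: indicator_def h'_def max_def)
  have "integrable lborel (\<lambda>r. indicator {1..R} r *\<^sub>R (r ^ 2 * (v t r ^ n * h' r)))"
    by (rule borel_integrable_compact)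
      (auto intro!: continuous_intros continuous_on_subset[OF ch] continuous_on_subset[OF continuous_v_r])
  then have "integrable MB (\<lambda>x. v t (norm x) ^ n * h' (norm x))"
    unfolding eq1 by (subst integral_MB_radial(2)[where h = "\<lambda>r. v t r ^ n * h' r"]) auto
  then show "integrable MB (\<lambda>x. u t x ^ n * h (norm x))"
    by (rule integrable_cong_AE_imp) (use ae in \<open>auto elim: eventually_mono\<close>)
  have "(\<integral>x. u t x ^ n * h (norm x) \<partial>MB) = (\<integral>x. v t (norm x) ^ n * h' (norm x) \<partial>MB)"
    by (rule integral_cong_AE[symmetric, OF _ _ ae]) measurable
  also have "\<dots> = \<kappa> * (\<integral>r. indicator {1..} r * (r ^ 2 * (v t r ^ n * h' r)) \<partial>lborel)"
    by (rule integral_MB_radial(1)) measurable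
  also have "(\<lambda>r. indicator {1..} r * (r ^ 2 * (v t r ^ n * h' r))) = (\<lambda>r. indicator {1..} r * (v t r ^ n * (r ^ 2 * h r)))"
    by (auto simp: fun_eq_iff indicator_def h'_def max_def)
  finally show "(\<integral>x. u t x ^ n * h (norm x) \<partial>MB) = \<kappa> * (\<integral>r. indicator {1..} r * (v t r ^ n * (r ^ 2 * h r)) \<partial>lborel)" .
qed

text \<open>Both factors move with \<open>t\<close>. The change of \<open>ut\<close> is controlled
  by the energy distance and a uniform bound on the weight; the change of the weight, at a fixed
  state, by dominated convergence. Continuity makes the pairing integrable in time, so that it can
  be cancelled between the two weak equations.\<close>

lemma continuous_ut_weight:
  assumes c: "continuous_on (UNIV \<times> {1..}) (\<lambda>p. \<Psi> (fst p) (snd p))"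
    and s: "\<And>t r. \<bar>t\<bar> > T \<or> r > R \<Longrightarrow> \<Psi> t r = 0"
  shows "continuous_on UNIV (\<lambda>t. \<integral>x. ut t x * \<Psi> t (norm x) \<partial>MB)"
proof (rule continuous_at_imp_continuous_on, rule ballI)
  fix t0 :: real
  obtain C where C: "0 \<le> C" "\<And>t r. 1 \<le> r \<Longrightarrow> \<bar>\<Psi> t r\<bar> \<le> C" using bounded_compact_support[OF c s] by blast
  note cs = continuous_slice[OF c]
  have zs: "\<Psi> t r = 0" if "R < r" for t r using s that by blast
  define m :: real where "m = (\<integral>x. indicator {1..R} (norm x) \<partial>MB)"
  have im: "integrable MB (\<lambda>x. indicator {1..R} (norm x) :: real)"
  proof -
    have "integrable lborel (\<lambda>r::real. indicator {1..R} r *\<^sub>R r ^ 2)"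
      by (rule borel_integrable_compact) (auto intro!: continuous_intros)
    moreover have "(\<lambda>r::real. indicator {1..R} r *\<^sub>R r ^ 2) = (\<lambda>r. indicator {1..} r * (r ^ 2 * indicator {1..R} r))"
      by (auto simp: fun_eq_iff indicator_def)
    ultimately show ?thesis by (subst integral_MB_radial(2)[where h = "indicator {1..R}"]) auto
  qed
  have sq: "(\<integral>x. \<Psi> t (norm x) ^ 2 \<partial>MB) \<le> C ^ 2 * m" for t
  proof -
    have "(\<integral>x. \<Psi> t (norm x) ^ 2 \<partial>MB) \<le> (\<integral>x. C ^ 2 * indicator {1..R} (norm x) \<partial>MB)"
    proof (rule integral_mono)
      show "integrable MB (\<lambda>x. \<Psi> t (norm x) ^ 2)" by (rule L2s_weight(2)[OF Ls cs zs, where ?r0.0 = 0]) auto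
      show "integrable MB (\<lambda>x. C ^ 2 * indicator {1..R} (norm x))" using im by simp
      fix x assume "x \<in> space MB"
      then have "1 \<le> norm x" by (simp add: Bc_def)
      then have "\<Psi> t (norm x) ^ 2 \<le> C ^ 2" using C by (simp add: abs_le_square_iff[symmetric])
      then show "\<Psi> t (norm x) ^ 2 \<le> C ^ 2 * indicator {1..R} (norm x)"
        using zs[of "norm x" t] \<open>1 \<le> norm x\<close> by (cases "R < norm x") auto
    qed
    then show ?thesis by (simp add: m_def)
  qed
  show "isCont (\<lambda>t. \<integral>x. ut t x * \<Psi> t (norm x) \<partial>MB) t0"
    unfolding continuous_at_sequentially comp_def
  proof (intro allI impI)
    fix X :: "nat \<Rightarrow> real" assume X: "X \<longlonglongrightarrow> t0"
    define D where "D = (\<lambda>s. H_dist2 (Du s) (ut s) (Du t0) (ut t0))"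
    have "isCont D t0" using dist_tendsto[of t0] by (simp add: D_def isCont_def H_dist2_def)
    then have DX: "(\<lambda>n. D (X n)) \<longlonglongrightarrow> 0" using isCont_tendsto_compose[OF _ X, of D] by (simp add: D_def H_dist2_def)
    define a where "a = (\<lambda>n. \<integral>x. (ut (X n) x - ut t0 x) * \<Psi> (X n) (norm x) \<partial>MB)"
    define b where "b = (\<lambda>n. \<integral>x. ut t0 x * \<Psi> (X n) (norm x) \<partial>MB)"
    have ab: "(\<integral>x. ut (X n) x * \<Psi> (X n) (norm x) \<partial>MB) = a n + b n" for n
    proof -
      have "a n = (\<integral>x. ut (X n) x * \<Psi> (X n) (norm x) \<partial>MB) - b n"
        unfolding a_def b_def left_diff_distrib
        by (intro Bochner_Integration.integral_diff L2s_weight(1)[OF Ls cs zs, where ?r0.0 = 0]) auto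
      then show ?thesis by simp
    qed
    have "a \<longlonglongrightarrow> 0"
    proof (rule Lim_null_comparison)
      show "\<forall>\<^sub>F n in sequentially. norm (a n) \<le> sqrt (D (X n)) * sqrt (C ^ 2 * m)"
      proof (rule always_eventually, rule allI)
        fix n
        have "\<bar>a n\<bar> \<le> sqrt (stail (\<lambda>x. ut (X n) x - ut t0 x) 0) * sqrt (\<integral>x. \<Psi> (X n) (norm x) ^ 2 \<partial>MB)"
          unfolding a_def by (rule L2s_weight(3)[OF L2s_diff[OF Ls Ls] cs zs]) auto
        also have "\<dots> \<le> sqrt (D (X n)) * sqrt (C ^ 2 * m)"
        proof (intro mult_mono real_sqrt_le_mono sq)
          have "stail (\<lambda>x. ut (X n) x - ut t0 x) 0 \<le> (\<integral>x. (ut (X n) x - ut t0 x) ^ 2 \<partial>MB)"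
            unfolding stail_def
            by (intro integral_mono stail_integrable L2s_diff Ls)
              (use L2s_diff[OF Ls Ls, of "X n" t0] in \<open>auto simp: L2s_def indicator_def\<close>)
          also have "\<dots> \<le> D (X n)" unfolding D_def by (rule H_dist2_bounds(2)[OF Lv Lv Ls Ls])
          finally show "stail (\<lambda>x. ut (X n) x - ut t0 x) 0 \<le> D (X n)" .
        qed (auto simp: D_def intro!: H_dist2_bounds(3) Lv Ls integral_nonneg_AE)
        finally show "norm (a n) \<le> sqrt (D (X n)) * sqrt (C ^ 2 * m)" by simp
      qed
      have "(\<lambda>n. sqrt (D (X n)) * sqrt (C ^ 2 * m)) \<longlonglongrightarrow> sqrt 0 * sqrt (C ^ 2 * m)" by (intro tendsto_intros DX)
      then show "(\<lambda>n. sqrt (D (X n)) * sqrt (C ^ 2 * m)) \<longlonglongrightarrow> 0" by simp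
    qed
    moreover have "b \<longlonglongrightarrow> (\<integral>x. ut t0 x * \<Psi> t0 (norm x) \<partial>MB)"
      unfolding b_def
    proof (rule integral_dominated_convergence[where w = "\<lambda>x. C * \<bar>ut t0 x * indicator {1..R} (norm x)\<bar>"])
      have "integrable MB (\<lambda>x. ut t0 x * indicator {1..R} (norm x))"
      proof (rule Cauchy_Schwarz_integral(1))
        show "integrable MB (\<lambda>x. indicator {1..R} (norm x) ^ 2 :: real)" using im
          by (simp add: power2_eq_square flip: indicator_inter_arith)
      qed (use Ls[of t0] im in \<open>auto simp: L2s_def\<close>)
      then show "integrable MB (\<lambda>x. C * \<bar>ut t0 x * indicator {1..R} (norm x)\<bar>)" by simp
      show "AE x in MB. (\<lambda>n. ut t0 x * \<Psi> (X n) (norm x)) \<longlonglongrightarrow> ut t0 x * \<Psi> t0 (norm x)"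
      proof (rule AE_I2, intro tendsto_intros)
        fix x assume "x \<in> space MB"
        then have x: "1 \<le> norm x" by (simp add: Bc_def)
        have "continuous_on UNIV (\<lambda>t. (\<lambda>p. \<Psi> (fst p) (snd p)) (t, norm x))"
          by (rule continuous_on_compose2[OF c]) (use x in \<open>auto intro!: continuous_intros\<close>)
        then have "isCont (\<lambda>t. \<Psi> t (norm x)) t0" by (simp add: continuous_on_eq_continuous_at)
        then show "(\<lambda>n. \<Psi> (X n) (norm x)) \<longlonglongrightarrow> \<Psi> t0 (norm x)" by (rule isCont_tendsto_compose[OF _ X])
      qed
      show "AE x in MB. norm (ut t0 x * \<Psi> (X n) (norm x)) \<le> C * \<bar>ut t0 x * indicator {1..R} (norm x)\<bar>" for n
      proof (rule AE_I2)
        fix x assume "x \<in> space MB"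
        then have x: "1 \<le> norm x" by (simp add: Bc_def)
        show "norm (ut t0 x * \<Psi> (X n) (norm x)) \<le> C * \<bar>ut t0 x * indicator {1..R} (norm x)\<bar>"
          using mult_right_mono[OF C(2)[OF x, of "X n"], of "\<bar>ut t0 x\<bar>"] zs[of "norm x" "X n"] x C(1)
          by (cases "R < norm x") (auto simp: abs_mult mult_ac)
      qed
      show "(\<lambda>x. ut t0 x * \<Psi> (X n) (norm x)) \<in> borel_measurable MB" for n
        using L2s_weight(1)[OF Ls cs zs, where ?r0.0 = 0] by (intro borel_measurable_integrable) auto
      show "(\<lambda>x. ut t0 x * \<Psi> t0 (norm x)) \<in> borel_measurable MB"
        using L2s_weight(1)[OF Ls cs zs, where ?r0.0 = 0] by (intro borel_measurable_integrable) auto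
    qed
    ultimately have "(\<lambda>n. a n + b n) \<longlonglongrightarrow> 0 + (\<integral>x. ut t0 x * \<Psi> t0 (norm x) \<partial>MB)" by (rule tendsto_add)
    then show "(\<lambda>n. \<integral>x. ut (X n) x * \<Psi> (X n) (norm x) \<partial>MB) \<longlonglongrightarrow> (\<integral>x. ut t0 x * \<Psi> t0 (norm x) \<partial>MB)"
      by (simp add: ab)
  qed
qed

end

lemma continuous_slice_integral:
  fixes K :: "real \<Rightarrow> real \<Rightarrow> real"
  assumes c: "continuous_on (UNIV \<times> {1..}) (\<lambda>p. K (fst p) (snd p))"
    and s: "\<And>t r. R < r \<Longrightarrow> K t r = 0"
  shows "continuous_on UNIV (\<lambda>t. \<integral>r. indicator {1..} r * K t r \<partial>lborel)"
proof -
  have eq: "(\<integral>r. indicator {1..} r * K t r \<partial>lborel) = integral (cbox 1 R) (K t)" for t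
  proof -
    have ct: "continuous_on {1..R} (K t)" using continuous_slice[OF c] by (rule continuous_on_subset) auto
    have "(\<integral>r. indicator {1..} r * K t r \<partial>lborel) = (LINT r:{1..R}|lborel. K t r)"
      unfolding set_lebesgue_integral_def
    proof (rule Bochner_Integration.integral_cong[OF refl])
      fix r show "indicator {1..} r * K t r = indicator {1..R} r *\<^sub>R K t r"
        using s[of r t] by (cases "R < r") (auto simp: indicator_def)
    qed
    also have "\<dots> = integral {1..R} (K t)"
      by (rule set_borel_integral_eq_integral(2)) (use borel_integrable_compact[OF compact_Icc ct] in \<open>simp add: set_integrable_def\<close>)
    finally show ?thesis by simp
  qed
  have "continuous_on UNIV (\<lambda>t. integral (cbox 1 R) (K t))"
  proof (rule integral_continuous_on_param)
    show "continuous_on (UNIV \<times> cbox 1 R) (\<lambda>(t, r). K t r)"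
      unfolding case_prod_unfold by (rule continuous_on_subset[OF c]) auto
  qed
  then show ?thesis unfolding eq .
qed

lemma rtest_prod:
  assumes \<alpha>: "\<And>t. (\<alpha> has_real_derivative \<alpha>' t) (at t)" "continuous_on UNIV \<alpha>'"
      "\<And>t. \<bar>t\<bar> > T \<Longrightarrow> \<alpha> t = 0" "\<And>t. \<bar>t\<bar> > T \<Longrightarrow> \<alpha>' t = 0"
    and \<zeta>: "\<And>r. 1 \<le> r \<Longrightarrow> (\<zeta> has_real_derivative \<zeta>' r) (at r)" "continuous_on {1..} \<zeta>'"
      "\<And>r. r \<le> 1 \<Longrightarrow> \<zeta> r = \<zeta> 1" "\<And>r. r \<le> 1 \<Longrightarrow> \<zeta>' r = 0"
      "\<And>r. r > R \<Longrightarrow> \<zeta> r = 0" "\<And>r. r > R \<Longrightarrow> \<zeta>' r = 0"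
  shows "rtest (\<lambda>t r. \<alpha> t * \<zeta> r) (\<lambda>t r. \<alpha>' t * \<zeta> r) (\<lambda>t r. \<alpha> t * \<zeta>' r)"
  unfolding rtest_def
proof (intro conjI allI impI)
  fix t r :: real assume r: "1 \<le> r"
  have "((\<lambda>p. \<alpha> (fst p)) has_derivative (\<lambda>h. fst h * \<alpha>' t)) (at (t, r))"
    by (rule DERIV_compose_FDERIV[where g = fst and g' = fst]) (use \<alpha>(1) in \<open>auto intro!: derivative_intros\<close>)
  moreover have "((\<lambda>p. \<zeta> (snd p)) has_derivative (\<lambda>h. snd h * \<zeta>' r)) (at (t, r))"
    by (rule DERIV_compose_FDERIV[where g = snd and g' = snd]) (use \<zeta>(1)[OF r] in \<open>auto intro!: derivative_intros\<close>)
  ultimately have "((\<lambda>p. \<alpha> (fst p) * \<zeta> (snd p)) has_derivative (\<lambda>h. \<alpha> (fst (t, r)) * (snd h * \<zeta>' r) + (fst h * \<alpha>' t) * \<zeta> (snd (t, r)))) (at (t, r))"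
    by (rule has_derivative_mult)
  then show "((\<lambda>p. \<alpha> (fst p) * \<zeta> (snd p)) has_derivative (\<lambda>d. \<alpha>' t * \<zeta> r * fst d + \<alpha> t * \<zeta>' r * snd d)) (at (t, r))"
    by (simp add: mult_ac add.commute)
next
  have c\<alpha>: "continuous_on UNIV \<alpha>" using \<alpha>(1) by (meson DERIV_isCont continuous_at_imp_continuous_on)
  have c\<zeta>: "continuous_on {1..} \<zeta>"
  proof (rule continuous_at_imp_continuous_on, rule ballI)
    fix r assume "r \<in> {1::real..}"
    then show "isCont \<zeta> r" using DERIV_isCont[OF \<zeta>(1)[of r]] by simp
  qed
  show "continuous_on (UNIV \<times> {1..}) (\<lambda>p. \<alpha>' (fst p) * \<zeta> (snd p))"
    by (intro continuous_intros continuous_on_compose2[OF \<alpha>(2)] continuous_on_compose2[OF c\<zeta>]) auto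
  show "continuous_on (UNIV \<times> {1..}) (\<lambda>p. \<alpha> (fst p) * \<zeta>' (snd p))"
    by (intro continuous_intros continuous_on_compose2[OF c\<alpha>] continuous_on_compose2[OF \<zeta>(2)]) auto
  show "\<exists>T R. \<forall>t r. \<bar>t\<bar> > T \<or> r > R \<longrightarrow> \<alpha> t * \<zeta> r = 0 \<and> \<alpha>' t * \<zeta> r = 0 \<and> \<alpha> t * \<zeta>' r = 0"
    using \<alpha>(3,4) \<zeta>(5,6) by (intro exI[of _ T] exI[of _ R]) auto
next
  fix t r :: real assume r: "r \<le> 1"
  show "\<alpha> t * \<zeta> r = \<alpha> t * \<zeta> 1" "\<alpha>' t * \<zeta> r = \<alpha>' t * \<zeta> 1" by (simp_all only: \<zeta>(3)[OF r])
  show "\<alpha> t * \<zeta>' r = 0" by (simp only: \<zeta>(4)[OF r] mult_zero_right)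
qed

section \<open>Approximate identities and weak derivatives in time\<close>

lemma integral_scaled_bump:
  assumes N: "0 < N"
  shows "(\<integral>t. N * bump (N * (t - a) + s) * y t \<partial>lborel) = (\<integral>z. bump z * y (a + (z - s) / N) \<partial>lborel)"
proof -
  have "(\<integral>t. N * bump (N * (t - a) + s) * y t \<partial>lborel)
     = \<bar>1 / N\<bar> *\<^sub>R (\<integral>z. N * bump (N * ((a - s / N) + 1 / N * z - a) + s) * y ((a - s / N) + 1 / N * z) \<partial>lborel)"
    by (rule lborel_integral_real_affine) (use N in simp)
  also have "\<dots> = (\<integral>z. \<bar>1 / N\<bar> * (N * bump (N * ((a - s / N) + 1 / N * z - a) + s) * y ((a - s / N) + 1 / N * z)) \<partial>lborel)"
    by simp
  also have "\<dots> = (\<integral>z. bump z * y (a + (z - s) / N) \<partial>lborel)"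
    using N by (intro Bochner_Integration.integral_cong) (auto simp: field_simps)
  finally show ?thesis .
qed

text \<open>With N = n + 1 the kernel is supported between a - s / N and a + (1 - s) / N: to the
  right of \<open>a\<close> for s = 0, to the left for s = 1. The limit is the same for every
  offset.\<close>

lemma approx_identity:
  assumes y: "continuous_on UNIV (y :: real \<Rightarrow> real)"
  shows "(\<lambda>n. \<integral>t. real (Suc n) * bump (real (Suc n) * (t - a) + s) * y t \<partial>lborel) \<longlonglongrightarrow> y a"
proof -
  have [measurable]: "y \<in> borel_measurable borel" using y by (rule borel_measurable_continuous_onI)
  have [measurable]: "bump \<in> borel_measurable borel" using continuous_bump(1) by (rule borel_measurable_continuous_onI)
  obtain B where B: "\<forall>t\<in>{a - (1 + \<bar>s\<bar>)..a + (1 + \<bar>s\<bar>)}. \<bar>y t\<bar> \<le> B" using continuous_bounded_Icc[OF y] by blast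
  have "(\<lambda>n. \<integral>z. bump z * y (a + (z - s) / real (Suc n)) \<partial>lborel) \<longlonglongrightarrow> (\<integral>z. bump z * y a \<partial>lborel)"
  proof (rule integral_dominated_convergence[where w = "\<lambda>z. bump z * \<bar>B\<bar>"])
    show "integrable lborel (\<lambda>z. bump z * \<bar>B\<bar>)" using integrable_bump by simp
    show "AE z in lborel. (\<lambda>n. bump z * y (a + (z - s) / real (Suc n))) \<longlonglongrightarrow> bump z * y a"
    proof (rule AE_I2, intro tendsto_intros)
      fix z
      have "(\<lambda>n. a + (z - s) / real (Suc n)) \<longlonglongrightarrow> a" by real_asymp
      moreover have "isCont y a" using y by (simp add: continuous_on_eq_continuous_at)
      ultimately show "(\<lambda>n. y (a + (z - s) / real (Suc n))) \<longlonglongrightarrow> y a" by (rule isCont_tendsto_compose[rotated])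
    qed
    show "AE z in lborel. norm (bump z * y (a + (z - s) / real (Suc n))) \<le> bump z * \<bar>B\<bar>" for n
    proof (rule AE_I2)
      fix z
      show "norm (bump z * y (a + (z - s) / real (Suc n))) \<le> bump z * \<bar>B\<bar>"
      proof (cases "z \<in> {0<..<1}")
        case True
        have "\<bar>(z - s) / real (Suc n)\<bar> \<le> \<bar>z - s\<bar> / 1" unfolding abs_divide by (intro divide_left_mono) auto
        also have "\<dots> \<le> 1 + \<bar>s\<bar>" using True by auto
        finally have "\<bar>(z - s) / real (Suc n)\<bar> \<le> 1 + \<bar>s\<bar>" .
        then have "a + (z - s) / real (Suc n) \<in> {a - (1 + \<bar>s\<bar>)..a + (1 + \<bar>s\<bar>)}"
          unfolding abs_le_iff atLeastAtMost_iff by linarith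
        then have "\<bar>y (a + (z - s) / real (Suc n))\<bar> \<le> \<bar>B\<bar>" using B by fastforce
        then show ?thesis using bump_nonneg[of z] by (simp add: abs_mult mult_left_mono)
      qed (simp add: bump_out)
    qed
  qed measurable
  then show ?thesis using integral_bump by (simp add: integral_scaled_bump)
qed

text \<open>The hypothesis \<open>weak\<close> states y' = z in the sense of distributions. A
  smoothed indicator of \<open>{a..b}\<close> has as derivative the difference of kernels at
  \<open>a\<close> and \<open>b\<close>. One side of the tested equation tends to y a - y b, the
  other is at most \<open>Z\<close> times the length of the support.\<close>

lemma mean_value_from_weak:
  fixes y z :: "real \<Rightarrow> real"
  assumes y: "continuous_on UNIV y" and z: "continuous_on UNIV z" and Z: "\<And>t. \<bar>z t\<bar> \<le> Z"
    and weak: "\<And>\<alpha> \<alpha>' T. (\<And>t. (\<alpha> has_real_derivative \<alpha>' t) (at t)) \<Longrightarrow> continuous_on UNIV \<alpha>' \<Longrightarrow>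
       (\<And>t. \<bar>t\<bar> > T \<Longrightarrow> \<alpha> t = 0) \<Longrightarrow> (\<And>t. \<bar>t\<bar> > T \<Longrightarrow> \<alpha>' t = 0) \<Longrightarrow>
       (\<integral>t. \<alpha>' t * y t + \<alpha> t * z t \<partial>lborel) = 0"
    and ab: "a \<le> b"
  shows "\<bar>y b - y a\<bar> \<le> Z * (b - a)"
proof -
  define k where "k = (\<lambda>n c t. real (Suc n) * bump (real (Suc n) * (t - c) + 0))"
  define S where "S = (\<lambda>n c t. smoothstep (real (Suc n) * (t - c) + 0))"
  have dS: "(S n c has_real_derivative k n c t) (at t)" for n c t
    unfolding S_def k_def by (auto intro!: derivative_eq_intros DERIV_chain2[OF smoothstep_deriv, THEN DERIV_cong])
  have ck: "continuous_on UNIV (k n c)" for n c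
    unfolding k_def by (intro continuous_intros continuous_on_compose2[OF continuous_bump(1)]) auto
  have cS: "continuous_on UNIV (S n c)" for n c
    using dS by (meson DERIV_isCont continuous_at_imp_continuous_on)
  have k0: "k n c t = 0" if "t \<notin> {c..c + 1}" for n c t
  proof -
    have "real (Suc n) * (t - c) + 0 \<notin> {0<..<1}"
    proof (cases "t < c")
      case True
      then show ?thesis by (simp add: mult_less_0_iff zero_less_mult_iff)
    next
      case False
      then have "1 \<le> t - c" using that by auto
      then have "1 * 1 \<le> real (Suc n) * (t - c)" by (intro mult_mono) auto
      then show ?thesis by simp
    qed
    then show ?thesis by (simp add: k_def bump_out)
  qed
  have S0: "S n c t = 0" if "t \<le> c" for n c t
    unfolding S_def by (rule smoothstep_0) (use that in \<open>simp add: mult_le_0_iff\<close>)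
  have S1: "S n c t = 1" if "c + 1 / real (Suc n) \<le> t" for n c t
    unfolding S_def by (rule smoothstep_1) (use that in \<open>simp add: field_simps\<close>)
  have Sb: "0 \<le> S n c t" "S n c t \<le> 1" for n c t unfolding S_def by (rule smoothstep_bounds)+
  have inv1: "1 / real (Suc n) \<le> 1" for n by simp
  define \<alpha> where "\<alpha> = (\<lambda>n t. S n a t - S n b t)"
  define \<alpha>' where "\<alpha>' = (\<lambda>n t. k n a t - k n b t)"
  have \<alpha>0: "\<alpha> n t = 0" if "t \<notin> {a..b + 1 / real (Suc n)}" for n t
  proof (cases "t < a")
    case True
    then show ?thesis using ab by (simp add: \<alpha>_def S0)
  next
    case False
    then have "b + 1 / real (Suc n) \<le> t" using that by auto
    then show ?thesis using ab S1[of b n t] S1[of a n t] by (simp add: \<alpha>_def)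
  qed
  have w: "(\<integral>t. \<alpha>' n t * y t + \<alpha> n t * z t \<partial>lborel) = 0" for n
  proof (rule weak[where T = "\<bar>a\<bar> + \<bar>b\<bar> + 1"])
    show "(\<alpha> n has_real_derivative \<alpha>' n t) (at t)" for t
      unfolding \<alpha>_def \<alpha>'_def by (intro derivative_intros dS)
    show "continuous_on UNIV (\<alpha>' n)" unfolding \<alpha>'_def by (intro continuous_intros ck)
    fix t :: real assume t: "\<bar>a\<bar> + \<bar>b\<bar> + 1 < \<bar>t\<bar>"
    have "t \<notin> {a..b + 1 / real (Suc n)}"
    proof
      assume "t \<in> {a..b + 1 / real (Suc n)}"
      then have "a \<le> t" "t \<le> b + 1 / real (Suc n)" by auto
      then show False using t inv1[of n] by linarith
    qed
    then show "\<alpha> n t = 0" by (rule \<alpha>0)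
    have "t \<notin> {a..a + 1}" "t \<notin> {b..b + 1}" using t by auto
    then show "\<alpha>' n t = 0" by (simp add: \<alpha>'_def k0)
  qed
  have iky: "integrable lborel (\<lambda>t. k n c t * y t)" for n c
    by (rule integrable_continuous_compact_support[of _ c "c + 1"]) (auto intro!: continuous_intros ck y simp: k0)
  have c\<alpha>: "continuous_on UNIV (\<alpha> n)" for n unfolding \<alpha>_def by (intro continuous_intros cS)
  have i\<alpha>z: "integrable lborel (\<lambda>t. \<alpha> n t * z t)" for n
    by (rule integrable_continuous_compact_support[of _ a "b + 1 / real (Suc n)"])
      (use \<alpha>0 in \<open>auto intro!: continuous_intros c\<alpha> z\<close>)
  have e: "(\<integral>t. k n a t * y t \<partial>lborel) - (\<integral>t. k n b t * y t \<partial>lborel) = - (\<integral>t. \<alpha> n t * z t \<partial>lborel)" for n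
  proof -
    have "0 = (\<integral>t. (k n a t * y t - k n b t * y t) + \<alpha> n t * z t \<partial>lborel)"
      using w[of n] by (simp add: \<alpha>'_def left_diff_distrib)
    also have "\<dots> = ((\<integral>t. k n a t * y t \<partial>lborel) - (\<integral>t. k n b t * y t \<partial>lborel)) + (\<integral>t. \<alpha> n t * z t \<partial>lborel)"
      using iky i\<alpha>z by simp
    finally show ?thesis by simp
  qed
  have le: "\<bar>(\<integral>t. k n a t * y t \<partial>lborel) - (\<integral>t. k n b t * y t \<partial>lborel)\<bar> \<le> Z * (b - a + 1 / real (Suc n))" for n
  proof -
    have "\<bar>\<integral>t. \<alpha> n t * z t \<partial>lborel\<bar> \<le> (\<integral>t. \<bar>\<alpha> n t * z t\<bar> \<partial>lborel)" by simp
    also have "\<dots> \<le> (\<integral>t. Z * indicator {a..b + 1 / real (Suc n)} t \<partial>lborel)"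
    proof (rule integral_mono)
      show "integrable lborel (\<lambda>t. \<bar>\<alpha> n t * z t\<bar>)" using i\<alpha>z by simp
      show "integrable lborel (\<lambda>t. Z * indicator {a..b + 1 / real (Suc n)} t)"
        by (intro integrable_mult_right integrable_real_indicator) (auto simp: emeasure_lborel_Icc_eq)
      fix t
      show "\<bar>\<alpha> n t * z t\<bar> \<le> Z * indicator {a..b + 1 / real (Suc n)} t"
      proof (cases "t \<in> {a..b + 1 / real (Suc n)}")
        case True
        have "\<bar>\<alpha> n t\<bar> \<le> 1" using Sb[of n a t] Sb[of n b t] by (auto simp: \<alpha>_def)
        then have "\<bar>\<alpha> n t\<bar> * \<bar>z t\<bar> \<le> 1 * Z" using Z[of t] by (intro mult_mono) auto
        then show ?thesis using True by (simp add: abs_mult)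
      qed (simp add: \<alpha>0)
    qed
    also have "\<dots> = Z * (b + 1 / real (Suc n) - a)"
    proof -
      have "0 \<le> 1 / real (Suc n)" by simp
      then have "a \<le> b + 1 / real (Suc n)" using ab by linarith
      then show ?thesis by simp
    qed
    finally show ?thesis unfolding e by (simp add: algebra_simps)
  qed
  have "(\<lambda>n. \<bar>(\<integral>t. k n a t * y t \<partial>lborel) - (\<integral>t. k n b t * y t \<partial>lborel)\<bar>) \<longlonglongrightarrow> \<bar>y a - y b\<bar>"
    unfolding k_def by (intro tendsto_intros approx_identity y)
  moreover have "(\<lambda>n. Z * (b - a + 1 / real (Suc n))) \<longlonglongrightarrow> Z * (b - a + 0)"
    by (intro tendsto_intros) real_asymp
  ultimately have "\<bar>y a - y b\<bar> \<le> Z * (b - a + 0)"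
    by (rule LIMSEQ_le) (use le in blast)
  then show ?thesis by (simp add: abs_minus_commute)
qed

section \<open>The weak equation in radial form\<close>

context compact_solution
begin

lemma weak1:
  assumes "rtest \<Phi> \<Phi>1 \<Phi>2"
  shows "(\<integral>t. (\<integral>x. u t x * \<Phi>1 t (norm x) + ut t x * \<Phi> t (norm x) \<partial>MB) \<partial>lborel) = 0"
  using sol rtest_st_test[OF assms] unfolding global_neumann_sol_def by blast

lemma weak2:
  assumes "rtest \<Phi> \<Phi>1 \<Phi>2"
  shows "(\<integral>t. (\<integral>x. - ut t x * \<Phi>1 t (norm x) + Du t x \<bullet> ((\<Phi>2 t (norm x) / norm x) *\<^sub>R x) + (u t x) ^ 5 * \<Phi> t (norm x) \<partial>MB) \<partial>lborel) = 0"
  using sol rtest_st_test[OF assms] unfolding global_neumann_sol_def by blast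

text \<open>\<open>ut\<close> is eliminated between the two weak equations: the first is tested with
  \<Phi>1, the second with \<Phi>, and the pairings of \<open>ut\<close> with \<Phi>1 cancel. The
  gradient term passes through the flux formula with \<gamma> = r^2 \<Phi>2, which trades
  \<open>Du\<close> for \<open>v\<close>. \<gamma> is a separate parameter because the flux formula
  asks for a function differentiable on the whole line, while the relation to \<Phi>2 is imposed
  only for r \<ge> 1.\<close>

lemma weak_form_radial:
  assumes r0: "rtest \<Phi> \<Phi>1 \<Phi>2" and r1: "rtest \<Phi>1 \<Phi>11 \<Phi>12"
    and \<gamma>: "\<And>t r. 1 \<le> r \<Longrightarrow> \<gamma> t r = r ^ 2 * \<Phi>2 t r"
    and d: "\<And>t r. (\<gamma> t has_real_derivative \<gamma>' t r) (at r)"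
    and c: "continuous_on UNIV (\<lambda>p. \<gamma>' (fst p) (snd p))"
    and s: "\<And>t r. \<bar>t\<bar> > T0 \<or> r > R0 \<Longrightarrow> \<gamma>' t r = 0"
  shows "(\<integral>(t, r). indicator {1..} r * (v t r * (r ^ 2 * \<Phi>11 t r - \<gamma>' t r) + v t r ^ 5 * (r ^ 2 * \<Phi> t r)) \<partial>(lborel \<Otimes>\<^sub>M lborel)) = 0"
    and "integrable (lborel \<Otimes>\<^sub>M lborel) (\<lambda>(t, r). indicator {1..} r * (v t r * (r ^ 2 * \<Phi>11 t r - \<gamma>' t r) + v t r ^ 5 * (r ^ 2 * \<Phi> t r)))"
proof -
  obtain T1 R1 where s0: "\<And>t r. \<bar>t\<bar> > T1 \<or> r > R1 \<Longrightarrow> \<Phi> t r = 0 \<and> \<Phi>1 t r = 0 \<and> \<Phi>2 t r = 0"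
    using r0 unfolding rtest_def by blast
  obtain T2 R2 where s1: "\<And>t r. \<bar>t\<bar> > T2 \<or> r > R2 \<Longrightarrow> \<Phi>1 t r = 0 \<and> \<Phi>11 t r = 0 \<and> \<Phi>12 t r = 0"
    using r1 unfolding rtest_def by blast
  define T where "T = max T0 (max T1 T2)"
  define R where "R = max (max 1 R0) (max R1 R2)"
  have S: "\<Phi> t r = 0" "\<Phi>1 t r = 0" "\<Phi>2 t r = 0" "\<Phi>11 t r = 0" "\<gamma>' t r = 0" if "\<bar>t\<bar> > T \<or> r > R" for t r
    using that s0[of t r] s1[of t r] s[of t r] unfolding T_def R_def by auto
  have R1: "1 \<le> R" by (simp add: R_def)
  have c\<Phi>: "continuous_on (UNIV \<times> {1..}) (\<lambda>p. \<Phi> (fst p) (snd p))" by (rule rtest_continuous[OF r0])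
  have c\<Phi>1: "continuous_on (UNIV \<times> {1..}) (\<lambda>p. \<Phi>1 (fst p) (snd p))" by (rule rtest_continuous[OF r1])
  have c\<Phi>11: "continuous_on (UNIV \<times> {1..}) (\<lambda>p. \<Phi>11 (fst p) (snd p))" using r1 unfolding rtest_def by blast
  have c\<gamma>: "continuous_on UNIV (\<gamma>' t)" for t
  proof -
    have "continuous_on UNIV (\<lambda>r. (\<lambda>p. \<gamma>' (fst p) (snd p)) (t, r))"
      by (rule continuous_on_compose2[OF c]) (auto intro!: continuous_intros)
    then show ?thesis by simp
  qed
  have cv: "continuous_on (UNIV \<times> {1..}) (\<lambda>p. v (fst p) (snd p))" using continuous_v by (rule continuous_on_subset) simp
  define K1 where "K1 = (\<lambda>t r. v t r * (r ^ 2 * \<Phi>11 t r))"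
  define K2 where "K2 = (\<lambda>t r. - (\<gamma>' t r * v t r) + v t r ^ 5 * (r ^ 2 * \<Phi> t r))"
  have cK1: "continuous_on (UNIV \<times> {1..}) (\<lambda>p. K1 (fst p) (snd p))"
    unfolding K1_def by (intro continuous_intros cv c\<Phi>11)
  have cK2: "continuous_on (UNIV \<times> {1..}) (\<lambda>p. K2 (fst p) (snd p))"
    unfolding K2_def by (intro continuous_intros cv c\<Phi> continuous_on_subset[OF c]) simp
  have sK: "K1 t r = 0" "K2 t r = 0" if "\<bar>t\<bar> > T \<or> r > R" for t r
    unfolding K1_def K2_def by (simp_all add: S[OF that])
  have i1: "integrable (lborel \<Otimes>\<^sub>M lborel) (\<lambda>(t, r). indicator {1..} r * K1 t r)"
    by (rule integrable_pair_continuous[OF cK1 sK(1)])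
  have i2: "integrable (lborel \<Otimes>\<^sub>M lborel) (\<lambda>(t, r). indicator {1..} r * K2 t r)"
    by (rule integrable_pair_continuous[OF cK2 sK(2)])
  define I1 where "I1 = (\<lambda>t. \<integral>r. indicator {1..} r * K1 t r \<partial>lborel)"
  define I2 where "I2 = (\<lambda>t. \<integral>r. indicator {1..} r * K2 t r \<partial>lborel)"
  have I1: "integrable lborel I1" "(\<integral>t. I1 t \<partial>lborel) = (\<integral>(t, r). indicator {1..} r * K1 t r \<partial>(lborel \<Otimes>\<^sub>M lborel))"
    unfolding I1_def using lborel_pair.integrable_fst[OF i1] lborel_pair.integral_fst[OF i1] by simp_all
  have I2: "integrable lborel I2" "(\<integral>t. I2 t \<partial>lborel) = (\<integral>(t, r). indicator {1..} r * K2 t r \<partial>(lborel \<Otimes>\<^sub>M lborel))"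
    unfolding I2_def using lborel_pair.integrable_fst[OF i2] lborel_pair.integral_fst[OF i2] by simp_all
  \<comment> \<open>The common pairing with \<open>ut\<close>. It has to be integrable in time by
    itself for its two occurrences to cancel.\<close>
  define \<tau> where "\<tau> = (\<lambda>t. \<integral>x. ut t x * \<Phi>1 t (norm x) \<partial>MB)"
  have i\<tau>: "integrable lborel \<tau>"
  proof (rule integrable_continuous_compact_support[of _ "-T" T])
    show "continuous_on UNIV \<tau>" unfolding \<tau>_def by (rule continuous_ut_weight[OF c\<Phi>1, of T R]) (rule S(2))
    show "\<tau> t = 0" if "t \<notin> {-T..T}" for t
    proof -
      have "\<bar>t\<bar> > T" using that by auto
      then show ?thesis by (simp add: \<tau>_def S(2))
    qed
  qed
  have inner1: "(\<integral>x. u t x * \<Phi>11 t (norm x) + ut t x * \<Phi>1 t (norm x) \<partial>MB) = \<kappa> * I1 t + \<tau> t" for t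
  proof -
    have z: "\<Phi>11 t r = 0" "\<Phi>1 t r = 0" if "R < r" for r using S that by blast+
    have a: "integrable MB (\<lambda>x. u t x ^ 1 * \<Phi>11 t (norm x))"
      "(\<integral>x. u t x ^ 1 * \<Phi>11 t (norm x) \<partial>MB) = \<kappa> * (\<integral>r. indicator {1..} r * (v t r ^ 1 * (r ^ 2 * \<Phi>11 t r)) \<partial>lborel)"
      using u_weight[OF continuous_slice[OF c\<Phi>11] z(1)] by blast+
    have b: "integrable MB (\<lambda>x. ut t x * \<Phi>1 t (norm x))"
      by (rule L2s_weight(1)[OF Ls continuous_slice[OF c\<Phi>1] z(2), where ?r0.0 = 0]) auto
    show ?thesis using Bochner_Integration.integral_add[OF a(1) b] a(2) by (simp add: I1_def \<tau>_def K1_def)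
  qed
  have inner2: "(\<integral>x. - ut t x * \<Phi>1 t (norm x) + Du t x \<bullet> ((\<Phi>2 t (norm x) / norm x) *\<^sub>R x) + (u t x) ^ 5 * \<Phi> t (norm x) \<partial>MB)
     = - \<tau> t + \<kappa> * I2 t" for t
  proof -
    have z: "\<Phi> t r = 0" "\<Phi>1 t r = 0" if "R < r" for r using S that by blast+
    have a: "integrable MB (\<lambda>x. u t x ^ 5 * \<Phi> t (norm x))"
      "(\<integral>x. u t x ^ 5 * \<Phi> t (norm x) \<partial>MB) = \<kappa> * (\<integral>r. indicator {1..} r * (v t r ^ 5 * (r ^ 2 * \<Phi> t r)) \<partial>lborel)"
      using u_weight[OF continuous_slice[OF c\<Phi>] z(1)] by blast+
    have b: "integrable MB (\<lambda>x. ut t x * \<Phi>1 t (norm x))"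
      by (rule L2s_weight(1)[OF Ls continuous_slice[OF c\<Phi>1] z(2), where ?r0.0 = 0]) auto
    \<comment> \<open>\<Phi>2 vanishes at r = 1, so the flux formula leaves no boundary
      term.\<close>
    have g1: "\<gamma> t 1 = 0" using \<gamma>[of 1 t] r0 unfolding rtest_def by auto
    have gz: "\<gamma> t r = 0" if "R + 1 \<le> r" for r using \<gamma>[of r t] S(3)[of t r] that R1 by simp
    have RR: "1 \<le> R + 1" using R1 by simp
    have e: "Du t x \<bullet> ((\<Phi>2 t (norm x) / norm x) *\<^sub>R x) = (Du t x \<bullet> x / norm x ^ 3) * \<gamma> t (norm x)" if "x \<in> space MB" for x
      using that \<gamma>[of "norm x" t] by (simp add: Bc_def field_simps eval_nat_numeral)
    have f: "integrable MB (\<lambda>x. (Du t x \<bullet> x / norm x ^ 3) * \<gamma> t (norm x))"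
      "(\<integral>x. (Du t x \<bullet> x / norm x ^ 3) * \<gamma> t (norm x) \<partial>MB) = - \<kappa> * (\<integral>r. indicator {1..R + 1} r * (\<gamma>' t r * v t r) \<partial>lborel)"
      using flux_test[OF Lv[of t] d c\<gamma> gz RR] by (simp_all add: g1 v_def)
    have "(\<lambda>r. indicator {1..R + 1} r * (\<gamma>' t r * v t r)) = (\<lambda>r. indicator {1..} r * (\<gamma>' t r * v t r))"
    proof
      fix r show "indicator {1..R + 1} r * (\<gamma>' t r * v t r) = indicator {1..} r * (\<gamma>' t r * v t r)"
        using S(5)[of t r] by (cases "r > R") (auto simp: indicator_def)
    qed
    note f2 = f(2)[unfolded this]
    have "(\<integral>x. - ut t x * \<Phi>1 t (norm x) + Du t x \<bullet> ((\<Phi>2 t (norm x) / norm x) *\<^sub>R x) + (u t x) ^ 5 * \<Phi> t (norm x) \<partial>MB)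
      = (\<integral>x. (- (ut t x * \<Phi>1 t (norm x)) + (Du t x \<bullet> x / norm x ^ 3) * \<gamma> t (norm x)) + (u t x) ^ 5 * \<Phi> t (norm x) \<partial>MB)"
      by (rule Bochner_Integration.integral_cong[OF refl]) (simp only: e mult_minus_left)
    also have "\<dots> = (- \<tau> t + - \<kappa> * (\<integral>r. indicator {1..} r * (\<gamma>' t r * v t r) \<partial>lborel)) + \<kappa> * (\<integral>r. indicator {1..} r * (v t r ^ 5 * (r ^ 2 * \<Phi> t r)) \<partial>lborel)"
      using a b f(1) f2 by (simp add: \<tau>_def)
    also have "\<dots> = - \<tau> t + \<kappa> * (- (\<integral>r. indicator {1..} r * (\<gamma>' t r * v t r) \<partial>lborel) + (\<integral>r. indicator {1..} r * (v t r ^ 5 * (r ^ 2 * \<Phi> t r)) \<partial>lborel))"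
      by (simp add: algebra_simps)
    also have "- (\<integral>r. indicator {1..} r * (\<gamma>' t r * v t r) \<partial>lborel) + (\<integral>r. indicator {1..} r * (v t r ^ 5 * (r ^ 2 * \<Phi> t r)) \<partial>lborel) = I2 t"
    proof -
      have sl: "integrable lborel (\<lambda>r. indicator {1..} r * k r)"
        if "continuous_on {1..} k" "\<And>r. r > R \<Longrightarrow> k r = 0" for k :: "real \<Rightarrow> real"
      proof -
        have "integrable lborel (\<lambda>r. indicator {1..R} r *\<^sub>R k r)"
          by (rule borel_integrable_compact) (auto intro: continuous_on_subset[OF that(1)])
        moreover have "(\<lambda>r. indicator {1..R} r *\<^sub>R k r) = (\<lambda>r. indicator {1..} r * k r)"
        proof
          fix r show "indicator {1..R} r *\<^sub>R k r = indicator {1..} r * k r"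
            using that(2)[of r] by (cases "r > R") (auto simp: indicator_def)
        qed
        ultimately show ?thesis by simp
      qed
      have j1: "integrable lborel (\<lambda>r. indicator {1..} r * (\<gamma>' t r * v t r))"
        by (rule sl) (auto intro!: continuous_intros continuous_on_subset[OF c\<gamma>] continuous_on_subset[OF continuous_v_r] simp: S)
      have j2: "integrable lborel (\<lambda>r. indicator {1..} r * (v t r ^ 5 * (r ^ 2 * \<Phi> t r)))"
        by (rule sl) (auto intro!: continuous_intros continuous_slice[OF c\<Phi>] continuous_on_subset[OF continuous_v_r] simp: S)
      have "I2 t = (\<integral>r. - (indicator {1..} r * (\<gamma>' t r * v t r)) + indicator {1..} r * (v t r ^ 5 * (r ^ 2 * \<Phi> t r)) \<partial>lborel)"
        unfolding I2_def K2_def by (intro Bochner_Integration.integral_cong) (auto simp: algebra_simps)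
      then show ?thesis using j1 j2 by simp
    qed
    finally show ?thesis .
  qed
  have "(\<integral>t. \<kappa> * I1 t + \<tau> t \<partial>lborel) = 0" using weak1[OF r1] unfolding inner1 .
  moreover have "(\<integral>t. - \<tau> t + \<kappa> * I2 t \<partial>lborel) = 0" using weak2[OF r0] unfolding inner2 .
  ultimately have "\<kappa> * ((\<integral>t. I1 t \<partial>lborel) + (\<integral>t. I2 t \<partial>lborel)) = 0"
    using i\<tau> I1(1) I2(1) by (simp add: distrib_left)
  then have sum0: "(\<integral>t. I1 t \<partial>lborel) + (\<integral>t. I2 t \<partial>lborel) = 0" using \<kappa>_pos by simp
  have eq: "(\<lambda>(t, r). indicator {1..} r * (v t r * (r ^ 2 * \<Phi>11 t r - \<gamma>' t r) + v t r ^ 5 * (r ^ 2 * \<Phi> t r)))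
     = (\<lambda>p. (\<lambda>(t, r). indicator {1..} r * K1 t r) p + (\<lambda>(t, r). indicator {1..} r * K2 t r) p)"
    by (auto simp: fun_eq_iff K1_def K2_def algebra_simps)
  show "integrable (lborel \<Otimes>\<^sub>M lborel) (\<lambda>(t, r). indicator {1..} r * (v t r * (r ^ 2 * \<Phi>11 t r - \<gamma>' t r) + v t r ^ 5 * (r ^ 2 * \<Phi> t r)))"
    unfolding eq using i1 i2 by (rule Bochner_Integration.integrable_add)
  show "(\<integral>(t, r). indicator {1..} r * (v t r * (r ^ 2 * \<Phi>11 t r - \<gamma>' t r) + v t r ^ 5 * (r ^ 2 * \<Phi> t r)) \<partial>(lborel \<Otimes>\<^sub>M lborel)) = 0"
    unfolding eq Bochner_Integration.integral_add[OF i1 i2] using sum0 I1(2) I2(2) by simp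
qed

text \<open>Continuity of the trajectory gives no gain at large radii, so \<open>v\<close> is
  compared with its mean over the shell from r to r + 1. By the first weak equation the time
  derivative of that mean is a mean of \<open>ut\<close>, which Cauchy-Schwarz bounds by the tail.
  Mean and value differ by the spatial modulus of continuity. Every contribution carries a factor 1
  / r, which compensates the factor \<open>r\<close> on the left.\<close>

lemma v_time_increment:
  assumes r: "1 \<le> r" and ab: "a \<le> b" and K: "\<And>x. bump x \<le> K"
    and tail: "\<And>t. tail (Du t) r \<le> \<delta>" "\<And>t. stail (ut t) r \<le> \<delta>"
  shows "r * \<bar>v b r - v a r\<bar> \<le> 2 * sqrt (\<delta> / \<kappa>) + sqrt (\<delta> / \<kappa>) * K * (b - a)"
proof -
  have [measurable]: "bump \<in> borel_measurable borel" using continuous_bump(1) by (rule borel_measurable_continuous_onI)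
  have K0: "0 \<le> K" using K bump_nonneg order_trans by blast
  \<comment> \<open>The division by \<rho>^2 cancels the volume factor, so \<open>y\<close> below is
    \<kappa> times a weighted mean of \<open>v\<close> over the shell.\<close>
  define \<zeta> where "\<zeta> = (\<lambda>\<rho>::real. bump (\<rho> - r) / \<rho> ^ 2)"
  define \<zeta>' where "\<zeta>' = (\<lambda>\<rho>::real. bump' (\<rho> - r) / \<rho> ^ 2 - 2 * bump (\<rho> - r) / \<rho> ^ 3)"
  have d\<zeta>: "(\<zeta> has_real_derivative \<zeta>' \<rho>) (at \<rho>)" if "1 \<le> \<rho>" for \<rho>
    unfolding \<zeta>_def \<zeta>'_def using that
    by (auto intro!: derivative_eq_intros DERIV_chain2[OF bump_deriv, THEN DERIV_cong] simp: field_simps eval_nat_numeral)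
  have c\<zeta>': "continuous_on {1..} \<zeta>'" unfolding \<zeta>'_def
    by (intro continuous_intros continuous_on_compose2[OF continuous_bump(1)] continuous_on_compose2[OF continuous_bump(2)]) auto
  have c\<zeta>: "continuous_on {1..} \<zeta>" unfolding \<zeta>_def
    by (intro continuous_intros continuous_on_compose2[OF continuous_bump(1)]) auto
  have out: "\<zeta> \<rho> = 0" "\<zeta>' \<rho> = 0" if "\<rho> \<le> r \<or> r + 1 \<le> \<rho>" for \<rho>
    using that bump_out[of "\<rho> - r"] unfolding \<zeta>_def \<zeta>'_def by auto
  have zR: "\<zeta> \<rho> = 0" if "r + 1 < \<rho>" for \<rho> using out that by simp
  define y where "y = (\<lambda>t. \<integral>x. u t x ^ 1 * \<zeta> (norm x) \<partial>MB)"
  define z where "z = (\<lambda>t. \<integral>x. ut t x * \<zeta> (norm x) \<partial>MB)"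
  note uw = u_weight[OF c\<zeta> zR, where n = 1]
  have y_form: "y t = \<kappa> * (\<integral>\<rho>. indicator {1..} \<rho> * (v t \<rho> ^ 1 * (\<rho> ^ 2 * \<zeta> \<rho>)) \<partial>lborel)" for t
    unfolding y_def by (rule uw(2))
  have y_eq: "y t = \<kappa> * (\<integral>\<rho>. bump (\<rho> - r) * v t \<rho> \<partial>lborel)" for t
  proof -
    have "(\<lambda>\<rho>. indicator {1..} \<rho> * (v t \<rho> ^ 1 * (\<rho> ^ 2 * \<zeta> \<rho>))) = (\<lambda>\<rho>. bump (\<rho> - r) * v t \<rho>)"
    proof
      fix \<rho>
      show "indicator {1..} \<rho> * (v t \<rho> ^ 1 * (\<rho> ^ 2 * \<zeta> \<rho>)) = bump (\<rho> - r) * v t \<rho>"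
        using r bump_out(1)[of "\<rho> - r"] by (cases "1 \<le> \<rho>") (auto simp: \<zeta>_def)
    qed
    then show ?thesis unfolding y_form by (simp only:)
  qed
  have z_le: "\<bar>z t\<bar> \<le> sqrt (\<delta> * \<kappa>) * K / r" for t
  proof -
    have z0: "\<zeta> \<rho> = 0" if "1 \<le> \<rho>" "\<rho> \<le> r" for \<rho> using out that by simp
    \<comment> \<open>After the volume factor is included, the squared weight is at most (K / r)^2
      on a shell of width 1; this is the source of the gain 1 / r.\<close>
    have chi2: "(\<integral>x. \<zeta> (norm x) ^ 2 \<partial>MB) \<le> \<kappa> * (K / r) ^ 2"
    proof -
      have "(\<integral>x. \<zeta> (norm x) ^ 2 \<partial>MB) = \<kappa> * (\<integral>\<rho>. indicator {1..} \<rho> * (\<rho> ^ 2 * \<zeta> \<rho> ^ 2) \<partial>lborel)"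
        by (rule integral_MB_radial(1)) (simp add: \<zeta>_def)
      also have "\<dots> \<le> \<kappa> * (\<integral>\<rho>. (K / r) ^ 2 * indicator {r..r + 1} \<rho> \<partial>lborel)"
      proof (intro mult_left_mono)
        show "(\<integral>\<rho>. indicator {1..} \<rho> * (\<rho> ^ 2 * \<zeta> \<rho> ^ 2) \<partial>lborel) \<le> (\<integral>\<rho>. (K / r) ^ 2 * indicator {r..r + 1} \<rho> \<partial>lborel)"
        proof (rule integral_mono_AE')
          show "integrable lborel (\<lambda>\<rho>. (K / r) ^ 2 * indicator {r..r + 1} \<rho>)"
            by (intro integrable_mult_right integrable_real_indicator) auto
          show "AE \<rho> in lborel. indicator {1..} \<rho> * (\<rho> ^ 2 * \<zeta> \<rho> ^ 2) \<le> (K / r) ^ 2 * indicator {r..r + 1} \<rho>"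
          proof (rule AE_I2)
            fix \<rho>
            show "indicator {1..} \<rho> * (\<rho> ^ 2 * \<zeta> \<rho> ^ 2) \<le> (K / r) ^ 2 * indicator {r..r + 1} \<rho>"
            proof (cases "\<rho> \<in> {r..r + 1}")
              case True
              have "\<rho> ^ 2 * \<zeta> \<rho> ^ 2 = (bump (\<rho> - r) / \<rho>) ^ 2"
                using True r by (simp add: \<zeta>_def power_divide power_mult_distrib eval_nat_numeral)
              also have "\<dots> \<le> (K / r) ^ 2" using True r K K0 bump_nonneg by (intro power_mono frac_le) auto
              finally show ?thesis using True r by simp
            next
              case False
              then have "\<rho> \<le> r \<or> r + 1 \<le> \<rho>" by auto
              then show ?thesis using False by (simp add: out)
            qed
          qed
        qed (auto simp: indicator_def)
      qed (use \<kappa>_pos in simp)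
      finally show ?thesis by simp
    qed
    have "\<bar>z t\<bar> \<le> sqrt (stail (ut t) r) * sqrt (\<integral>x. \<zeta> (norm x) ^ 2 \<partial>MB)"
      unfolding z_def by (rule L2s_weight(3)[OF Ls c\<zeta> zR z0])
    also have "\<dots> \<le> sqrt \<delta> * sqrt (\<kappa> * (K / r) ^ 2)"
      using tail(2) stail_nonneg[of "ut t" r] chi2 order_trans[OF stail_nonneg tail(2)]
      by (intro mult_mono real_sqrt_le_mono) (auto intro!: integral_nonneg_AE)
    also have "\<dots> = sqrt (\<delta> * \<kappa>) * K / r" using K0 r by (simp add: real_sqrt_mult)
    finally show ?thesis .
  qed
  have "continuous_on UNIV (\<lambda>t. \<integral>\<rho>. indicator {1..} \<rho> * (v t \<rho> ^ 1 * (\<rho> ^ 2 * \<zeta> \<rho>)) \<partial>lborel)"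
  proof (rule continuous_slice_integral[where R = "r + 1"])
    show "continuous_on (UNIV \<times> {1..}) (\<lambda>p. v (fst p) (snd p) ^ 1 * ((snd p) ^ 2 * \<zeta> (snd p)))"
      by (intro continuous_intros continuous_on_subset[OF continuous_v] continuous_on_compose2[OF c\<zeta>]) auto
  qed (simp add: zR)
  then have cy: "continuous_on UNIV y"
    unfolding y_form[abs_def] by (rule continuous_on_mult_left)
  have zt: "\<bar>z b' - z a'\<bar> \<le> sqrt (H_dist2 (Du b') (ut b') (Du a') (ut a')) * sqrt (\<integral>x. \<zeta> (norm x) ^ 2 \<partial>MB)" for a' b'
  proof -
    have "z b' - z a' = (\<integral>x. (ut b' x - ut a' x) * \<zeta> (norm x) \<partial>MB)"
      unfolding z_def left_diff_distrib
      by (rule Bochner_Integration.integral_diff[symmetric]; rule L2s_weight(1)[OF Ls c\<zeta> zR, where ?r0.0 = 0]; simp)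
    then have "\<bar>z b' - z a'\<bar> = \<bar>\<integral>x. (ut b' x - ut a' x) * \<zeta> (norm x) \<partial>MB\<bar>" by simp
    also have "\<dots> \<le> sqrt (stail (\<lambda>x. ut b' x - ut a' x) 0) * sqrt (\<integral>x. \<zeta> (norm x) ^ 2 \<partial>MB)"
      by (rule L2s_weight(3)[OF L2s_diff[OF Ls Ls] c\<zeta> zR]) auto
    also have "\<dots> \<le> sqrt (H_dist2 (Du b') (ut b') (Du a') (ut a')) * sqrt (\<integral>x. \<zeta> (norm x) ^ 2 \<partial>MB)"
    proof (intro mult_right_mono real_sqrt_le_mono)
      have "stail (\<lambda>x. ut b' x - ut a' x) 0 \<le> (\<integral>x. (ut b' x - ut a' x) ^ 2 \<partial>MB)"
        unfolding stail_def
        by (intro integral_mono stail_integrable L2s_diff Ls)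
          (use L2s_diff[OF Ls Ls, of b' a'] in \<open>auto simp: L2s_def indicator_def\<close>)
      also have "\<dots> \<le> H_dist2 (Du b') (ut b') (Du a') (ut a')" by (rule H_dist2_bounds(2)[OF Lv Lv Ls Ls])
      finally show "stail (\<lambda>x. ut b' x - ut a' x) 0 \<le> H_dist2 (Du b') (ut b') (Du a') (ut a')" .
    qed (auto intro!: integral_nonneg_AE)
    finally show ?thesis .
  qed
  have cz: "continuous_on UNIV z"
  proof (rule continuous_at_imp_continuous_on, rule ballI)
    fix t
    have "((\<lambda>s. sqrt (H_dist2 (Du s) (ut s) (Du t) (ut t)) * sqrt (\<integral>x. \<zeta> (norm x) ^ 2 \<partial>MB)) \<longlongrightarrow> sqrt 0 * sqrt (\<integral>x. \<zeta> (norm x) ^ 2 \<partial>MB)) (at t)"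
      by (intro tendsto_intros dist_tendsto)
    then have "((\<lambda>s. sqrt (H_dist2 (Du s) (ut s) (Du t) (ut t)) * sqrt (\<integral>x. \<zeta> (norm x) ^ 2 \<partial>MB)) \<longlongrightarrow> 0) (at t)" by simp
    then have "((\<lambda>s. z s - z t) \<longlongrightarrow> 0) (at t)"
      by (rule Lim_null_comparison[rotated]) (auto intro!: always_eventually zt)
    then show "isCont z t" unfolding isCont_def using LIM_zero_iff by blast
  qed
  have "\<bar>y b - y a\<bar> \<le> sqrt (\<delta> * \<kappa>) * K / r * (b - a)"
  proof (rule mean_value_from_weak[OF cy cz z_le _ ab])
    fix \<alpha> \<alpha>' and T :: real
    assume \<alpha>: "\<And>t. (\<alpha> has_real_derivative \<alpha>' t) (at t)" "continuous_on UNIV \<alpha>'"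
      "\<And>t. \<bar>t\<bar> > T \<Longrightarrow> \<alpha> t = 0" "\<And>t. \<bar>t\<bar> > T \<Longrightarrow> \<alpha>' t = 0"
    have rt: "rtest (\<lambda>t r. \<alpha> t * \<zeta> r) (\<lambda>t r. \<alpha>' t * \<zeta> r) (\<lambda>t r. \<alpha> t * \<zeta>' r)"
      by (rule rtest_prod[OF \<alpha> d\<zeta> c\<zeta>', where R = "r + 1"]) (use r in \<open>auto simp: out\<close>)
    have "(\<integral>x. u t x * (\<alpha>' t * \<zeta> (norm x)) + ut t x * (\<alpha> t * \<zeta> (norm x)) \<partial>MB) = \<alpha>' t * y t + \<alpha> t * z t" for t
    proof -
      have i1: "integrable MB (\<lambda>x. u t x ^ 1 * \<zeta> (norm x))" by (rule uw(1))
      have i2: "integrable MB (\<lambda>x. ut t x * \<zeta> (norm x))"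
        by (rule L2s_weight(1)[OF Ls c\<zeta> zR, where ?r0.0 = 0]) auto
      have "(\<integral>x. u t x * (\<alpha>' t * \<zeta> (norm x)) + ut t x * (\<alpha> t * \<zeta> (norm x)) \<partial>MB)
        = (\<integral>x. \<alpha>' t * (u t x ^ 1 * \<zeta> (norm x)) + \<alpha> t * (ut t x * \<zeta> (norm x)) \<partial>MB)" by (simp add: mult_ac)
      also have "\<dots> = \<alpha>' t * y t + \<alpha> t * z t" unfolding y_def z_def
        by (subst Bochner_Integration.integral_add[OF integrable_mult_right[OF i1] integrable_mult_right[OF i2]])
          (simp only: integral_mult_right_zero)
      finally show ?thesis .
    qed
    with weak1[OF rt] show "(\<integral>t. \<alpha>' t * y t + \<alpha> t * z t \<partial>lborel) = 0" by simp
  qed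
  then have "\<bar>y b - y a\<bar> * (r / \<kappa>) \<le> sqrt (\<delta> * \<kappa>) * K / r * (b - a) * (r / \<kappa>)"
    using r \<kappa>_pos by (intro mult_right_mono) auto
  also have "\<dots> = (sqrt (\<delta> * \<kappa>) / \<kappa>) * K * (b - a)" using r by simp
  also have "sqrt (\<delta> * \<kappa>) / \<kappa> = sqrt (\<delta> / \<kappa>)"
  proof -
    have "sqrt (\<delta> * \<kappa>) / \<kappa> = sqrt \<delta> * (sqrt \<kappa> / \<kappa>)" by (simp add: real_sqrt_mult)
    also have "sqrt \<kappa> / \<kappa> = inverse (\<kappa> / sqrt \<kappa>)" by simp
    also have "\<kappa> / sqrt \<kappa> = sqrt \<kappa>" using \<kappa>_pos by (intro real_div_sqrt) auto
    finally show ?thesis by (simp only: real_sqrt_divide divide_inverse[symmetric])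
  qed
  finally have y1: "r * (\<bar>y b - y a\<bar> / \<kappa>) \<le> sqrt (\<delta> / \<kappa>) * K * (b - a)" by (simp add: mult.commute)
  have near: "r * \<bar>v t r - y t / \<kappa>\<bar> \<le> sqrt (\<delta> / \<kappa>)" for t
  proof -
    have ib: "integrable lborel (\<lambda>\<rho>. bump (\<rho> - r))"
      using lborel_integrable_real_affine[OF integrable_bump, of 1 "-r"] by simp
    have ib1: "(\<integral>\<rho>. bump (\<rho> - r) \<partial>lborel) = 1"
      using lborel_integral_real_affine[of 1 bump "-r"] integral_bump by simp
    have iv: "integrable lborel (\<lambda>\<rho>. bump (\<rho> - r) * v t \<rho>)"
      by (rule integrable_continuous_compact_support[of _ r "r + 1"])
        (auto intro!: continuous_intros continuous_on_compose2[OF continuous_bump(1)] continuous_v_r simp: bump_out)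
    have "v t r - y t / \<kappa> = (\<integral>\<rho>. bump (\<rho> - r) * v t r \<partial>lborel) - (\<integral>\<rho>. bump (\<rho> - r) * v t \<rho> \<partial>lborel)"
      using ib1 \<kappa>_pos by (simp add: y_eq)
    also have "\<dots> = (\<integral>\<rho>. bump (\<rho> - r) * v t r - bump (\<rho> - r) * v t \<rho> \<partial>lborel)"
      using ib iv by simp
    finally have "\<bar>v t r - y t / \<kappa>\<bar> \<le> (\<integral>\<rho>. \<bar>bump (\<rho> - r) * v t r - bump (\<rho> - r) * v t \<rho>\<bar> \<partial>lborel)"
      by (simp only: integral_abs_bound)
    also have "\<dots> \<le> (\<integral>\<rho>. bump (\<rho> - r) * (sqrt (\<delta> / \<kappa>) / r) \<partial>lborel)"
    proof (rule integral_mono)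
      show "integrable lborel (\<lambda>\<rho>. \<bar>bump (\<rho> - r) * v t r - bump (\<rho> - r) * v t \<rho>\<bar>)" using ib iv by simp
      show "integrable lborel (\<lambda>\<rho>. bump (\<rho> - r) * (sqrt (\<delta> / \<kappa>) / r))" using ib by simp
      fix \<rho>
      show "\<bar>bump (\<rho> - r) * v t r - bump (\<rho> - r) * v t \<rho>\<bar> \<le> bump (\<rho> - r) * (sqrt (\<delta> / \<kappa>) / r)"
      proof (cases "\<rho> - r \<in> {0<..<1}")
        case True
        have "r * \<bar>v t r - v t \<rho>\<bar> \<le> sqrt (tail (Du t) r / \<kappa>) * sqrt (\<rho> - r)"
          using True r by (intro v_space) auto
        also have "\<dots> \<le> sqrt (\<delta> / \<kappa>) * 1"
          using True tail(1)[of t] \<kappa>_pos tail_nonneg[of "Du t" r]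
          by (intro mult_mono real_sqrt_le_mono divide_right_mono) auto
        finally have "\<bar>v t r - v t \<rho>\<bar> \<le> sqrt (\<delta> / \<kappa>) / r" using r by (simp add: pos_le_divide_eq mult.commute)
        from mult_left_mono[OF this bump_nonneg[of "\<rho> - r"]] show ?thesis
          using bump_nonneg[of "\<rho> - r"] by (simp add: abs_mult flip: right_diff_distrib)
      qed (simp add: bump_out)
    qed
    also have "\<dots> = sqrt (\<delta> / \<kappa>) / r" using ib1 by simp
    finally show ?thesis using r by (simp add: pos_le_divide_eq mult.commute)
  qed
  have "v b r - v a r = (v b r - y b / \<kappa>) - (v a r - y a / \<kappa>) + (y b - y a) / \<kappa>"
    unfolding diff_divide_distrib by linarith
  moreover have "\<bar>(y b - y a) / \<kappa>\<bar> = \<bar>y b - y a\<bar> / \<kappa>" using \<kappa>_pos by (simp add: abs_divide)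
  ultimately have "\<bar>v b r - v a r\<bar> \<le> \<bar>v b r - y b / \<kappa>\<bar> + \<bar>v a r - y a / \<kappa>\<bar> + \<bar>y b - y a\<bar> / \<kappa>"
    by linarith
  then have "r * \<bar>v b r - v a r\<bar> \<le> r * (\<bar>v b r - y b / \<kappa>\<bar> + \<bar>v a r - y a / \<kappa>\<bar> + \<bar>y b - y a\<bar> / \<kappa>)"
    using r by (intro mult_left_mono) auto
  also have "\<dots> \<le> 2 * sqrt (\<delta> / \<kappa>) + sqrt (\<delta> / \<kappa>) * K * (b - a)"
    using near[of a] near[of b] y1 unfolding distrib_left by linarith
  finally show ?thesis .
qed

lemma w_time:
  assumes e: "0 < e"
  shows "\<exists>R. \<forall>t r. R \<le> r \<longrightarrow> \<bar>w (t + h) r - w t r\<bar> \<le> e"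
proof -
  obtain K where K: "0 \<le> K" "\<And>x. bump x \<le> K" using bump_bounded by blast
  \<comment> \<open>The 2 accounts for replacing \<open>v\<close> by its shell mean at both times,
    and K |h| for the motion of the mean in between.\<close>
  define c where "c = e / (2 + K * \<bar>h\<bar>)"
  have d: "0 < 2 + K * \<bar>h\<bar>" using K(1) by (simp add: add_pos_nonneg)
  have c: "0 < c" unfolding c_def using e d by (rule divide_pos_pos)
  obtain R where R: "\<And>t r. R \<le> r \<Longrightarrow> tail (Du t) r \<le> c ^ 2 * \<kappa>" "\<And>t r. R \<le> r \<Longrightarrow> stail (ut t) r \<le> c ^ 2 * \<kappa>"
    using uniform_tail[of "c ^ 2 * \<kappa>"] c \<kappa>_pos by auto
  have "\<bar>w (t + h) r - w t r\<bar> \<le> e" if r: "max 1 R \<le> r" for t r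
  proof -
    have r1: "1 \<le> r" "R \<le> r" using r by auto
    have s: "sqrt (c ^ 2 * \<kappa> / \<kappa>) = c" using c \<kappa>_pos by simp
    have inc: "r * \<bar>v b r - v a r\<bar> \<le> 2 * c + c * K * (b - a)" if "a \<le> b" for a b
      using v_time_increment[OF r1(1) that K(2) R(1)[OF r1(2)] R(2)[OF r1(2)]] unfolding s .
    have "\<bar>w (t + h) r - w t r\<bar> = r * \<bar>v (t + h) r - v t r\<bar>"
      using r1 by (simp add: w_def abs_mult flip: right_diff_distrib)
    also have "\<dots> \<le> 2 * c + c * K * \<bar>h\<bar>"
      using inc[of t "t + h"] inc[of "t + h" t] by (cases "0 \<le> h") (auto simp: abs_minus_commute)
    also have "\<dots> = c * (2 + K * \<bar>h\<bar>)" by (simp add: algebra_simps)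
    also have "\<dots> = e" using d by (simp add: c_def)
    finally show ?thesis .
  qed
  then show ?thesis by blast
qed

end

section \<open>The diamond identity\<close>

lemma integrable_R2:
  fixes f :: "real \<Rightarrow> real \<Rightarrow> real"
  assumes c: "continuous_on UNIV (\<lambda>p. f (fst p) (snd p))"
    and s: "\<And>x y. \<bar>x\<bar> > T \<or> \<bar>y\<bar> > T \<Longrightarrow> f x y = 0"
  shows "integrable (lborel \<Otimes>\<^sub>M lborel) (\<lambda>(x, y). f x y)"
proof -
  have "integrable lborel (\<lambda>p::real \<times> real. indicator ({-T..T} \<times> {-T..T}) p *\<^sub>R f (fst p) (snd p))"
    by (rule borel_integrable_compact) (auto intro!: compact_Times continuous_on_subset[OF c])
  moreover have "(\<lambda>p::real \<times> real. indicator ({-T..T} \<times> {-T..T}) p *\<^sub>R f (fst p) (snd p)) = (\<lambda>(x, y). f x y)"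
  proof
    fix p :: "real \<times> real"
    obtain x y where p: "p = (x, y)" by (cases p)
    show "indicator ({-T..T} \<times> {-T..T}) p *\<^sub>R f (fst p) (snd p) = (\<lambda>(x, y). f x y) p"
      unfolding p using s[of x y] by (cases "\<bar>x\<bar> > T \<or> \<bar>y\<bar> > T") (auto simp: indicator_def)
  qed
  ultimately show ?thesis by (simp add: lborel_prod)
qed

text \<open>The coordinates \<xi> = t - r and \<eta> = t + r are introduced by two one-dimensional
  substitutions, a translation in \<open>t\<close> and an affine change in \<open>r\<close>, with
  Fubini in between. The second contributes the Jacobian 1/2.\<close>

lemma integral_characteristic_coordinates:
  fixes g :: "real \<Rightarrow> real \<Rightarrow> real"
  assumes c: "continuous_on UNIV (\<lambda>p. g (fst p) (snd p))"
    and s: "\<And>t r. \<bar>t\<bar> > T \<or> \<bar>r\<bar> > T \<Longrightarrow> g t r = 0"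
  shows "(\<integral>(t, r). g t r \<partial>(lborel \<Otimes>\<^sub>M lborel)) = 1 / 2 * (\<integral>(\<xi>, \<eta>). g ((\<xi> + \<eta>) / 2) ((\<eta> - \<xi>) / 2) \<partial>(lborel \<Otimes>\<^sub>M lborel))"
proof -
  have i1: "integrable (lborel \<Otimes>\<^sub>M lborel) (\<lambda>(t, r). g t r)" by (rule integrable_R2[OF c s])
  have i2: "integrable (lborel \<Otimes>\<^sub>M lborel) (\<lambda>(\<xi>, r). g (\<xi> + r) r)"
  proof (rule integrable_R2[where T = "2 * \<bar>T\<bar>"])
    have "continuous_on UNIV (\<lambda>p::real \<times> real. (\<lambda>p. g (fst p) (snd p)) (fst p + snd p, snd p))"
      by (rule continuous_on_compose2[OF c]) (auto intro!: continuous_intros)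
    then show "continuous_on UNIV (\<lambda>p::real \<times> real. g (fst p + snd p) (snd p))" by simp
    fix x y :: real assume "\<bar>x\<bar> > 2 * \<bar>T\<bar> \<or> \<bar>y\<bar> > 2 * \<bar>T\<bar>"
    then have "\<bar>x + y\<bar> > T \<or> \<bar>y\<bar> > T" by linarith
    then show "g (x + y) y = 0" by (rule s)
  qed
  have i3: "integrable (lborel \<Otimes>\<^sub>M lborel) (\<lambda>(\<xi>, \<eta>). g ((\<xi> + \<eta>) / 2) ((\<eta> - \<xi>) / 2))"
  proof (rule integrable_R2[where T = "2 * \<bar>T\<bar>"])
    have "continuous_on UNIV (\<lambda>p::real \<times> real. (\<lambda>p. g (fst p) (snd p)) ((fst p + snd p) / 2, (snd p - fst p) / 2))"
      by (rule continuous_on_compose2[OF c]) (auto intro!: continuous_intros)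
    then show "continuous_on UNIV (\<lambda>p::real \<times> real. g ((fst p + snd p) / 2) ((snd p - fst p) / 2))" by simp
    fix x y :: real assume "\<bar>x\<bar> > 2 * \<bar>T\<bar> \<or> \<bar>y\<bar> > 2 * \<bar>T\<bar>"
    then have far: "2 * T < \<bar>x\<bar> \<or> 2 * T < \<bar>y\<bar>" by linarith
    have "\<bar>(x + y) / 2\<bar> > T \<or> \<bar>(y - x) / 2\<bar> > T"
    proof (rule ccontr)
      assume "\<not> ?thesis"
      then have "\<bar>(x + y) / 2\<bar> \<le> T" "\<bar>(y - x) / 2\<bar> \<le> T" by auto
      then have "x + y \<le> 2 * T" "- (x + y) \<le> 2 * T" "y - x \<le> 2 * T" "- (y - x) \<le> 2 * T"
        unfolding abs_le_iff by (auto simp: field_simps)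
      then have "\<bar>x\<bar> \<le> 2 * T" "\<bar>y\<bar> \<le> 2 * T" unfolding abs_le_iff by linarith+
      with far show False by linarith
    qed
    then show "g ((x + y) / 2) ((y - x) / 2) = 0" by (rule s)
  qed
  have "(\<integral>(t, r). g t r \<partial>(lborel \<Otimes>\<^sub>M lborel)) = (\<integral>r. (\<integral>t. g t r \<partial>lborel) \<partial>lborel)"
    by (rule lborel_pair.integral_snd[OF i1, symmetric])
  also have "\<dots> = (\<integral>r. (\<integral>\<xi>. g (\<xi> + r) r \<partial>lborel) \<partial>lborel)"
  proof (rule Bochner_Integration.integral_cong[OF refl])
    fix r
    show "(\<integral>t. g t r \<partial>lborel) = (\<integral>\<xi>. g (\<xi> + r) r \<partial>lborel)"
      using lborel_integral_real_affine[of 1 "\<lambda>t. g t r" r] by (simp add: add.commute)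
  qed
  also have "\<dots> = (\<integral>\<xi>. (\<integral>r. g (\<xi> + r) r \<partial>lborel) \<partial>lborel)"
    by (rule lborel_pair.Fubini_integral[OF i2])
  also have "\<dots> = (\<integral>\<xi>. 1 / 2 * (\<integral>\<eta>. g ((\<xi> + \<eta>) / 2) ((\<eta> - \<xi>) / 2) \<partial>lborel) \<partial>lborel)"
  proof (rule Bochner_Integration.integral_cong[OF refl])
    fix \<xi>
    have "(\<integral>r. g (\<xi> + r) r \<partial>lborel) = \<bar>1 / 2\<bar> *\<^sub>R (\<integral>\<eta>. g (\<xi> + (- \<xi> / 2 + 1 / 2 * \<eta>)) (- \<xi> / 2 + 1 / 2 * \<eta>) \<partial>lborel)"
      by (rule lborel_integral_real_affine) simp
    also have "(\<lambda>\<eta>. g (\<xi> + (- \<xi> / 2 + 1 / 2 * \<eta>)) (- \<xi> / 2 + 1 / 2 * \<eta>)) = (\<lambda>\<eta>. g ((\<xi> + \<eta>) / 2) ((\<eta> - \<xi>) / 2))"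
    proof
      fix \<eta>
      have "\<xi> + (- \<xi> / 2 + 1 / 2 * \<eta>) = (\<xi> + \<eta>) / 2" "- \<xi> / 2 + 1 / 2 * \<eta> = (\<eta> - \<xi>) / 2" by (simp_all add: field_simps)
      then show "g (\<xi> + (- \<xi> / 2 + 1 / 2 * \<eta>)) (- \<xi> / 2 + 1 / 2 * \<eta>) = g ((\<xi> + \<eta>) / 2) ((\<eta> - \<xi>) / 2)" by (simp only:)
    qed
    finally show "(\<integral>r. g (\<xi> + r) r \<partial>lborel) = 1 / 2 * (\<integral>\<eta>. g ((\<xi> + \<eta>) / 2) ((\<eta> - \<xi>) / 2) \<partial>lborel)" by simp
  qed
  also have "\<dots> = 1 / 2 * (\<integral>\<xi>. (\<integral>\<eta>. g ((\<xi> + \<eta>) / 2) ((\<eta> - \<xi>) / 2) \<partial>lborel) \<partial>lborel)"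
    by (rule integral_mult_right_zero)
  also have "(\<integral>\<xi>. (\<integral>\<eta>. g ((\<xi> + \<eta>) / 2) ((\<eta> - \<xi>) / 2) \<partial>lborel) \<partial>lborel) = (\<integral>(\<xi>, \<eta>). g ((\<xi> + \<eta>) / 2) ((\<eta> - \<xi>) / 2) \<partial>(lborel \<Otimes>\<^sub>M lborel))"
    by (rule lborel_pair.integral_fst[OF i3])
  finally show ?thesis .
qed

text \<open>The offset \<open>s\<close> is carried along because smoothing on a prescribed side of
  \<open>a\<close> is needed when a rectangle touches the sphere.\<close>

definition sbump :: "nat \<Rightarrow> real \<Rightarrow> real \<Rightarrow> real \<Rightarrow> real" where
  "sbump n s a t = real (Suc n) * bump (real (Suc n) * (t - a) + s)"

definition sstep :: "nat \<Rightarrow> real \<Rightarrow> real \<Rightarrow> real \<Rightarrow> real" where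
  "sstep n s a t = smoothstep (real (Suc n) * (t - a) + s)"

definition sbump' :: "nat \<Rightarrow> real \<Rightarrow> real \<Rightarrow> real \<Rightarrow> real" where
  "sbump' n s a t = real (Suc n) * (real (Suc n) * bump' (real (Suc n) * (t - a) + s))"

lemma sstep_deriv: "(sstep n s a has_real_derivative sbump n s a t) (at t)"
  unfolding sstep_def[abs_def] sbump_def
  by (auto intro!: derivative_eq_intros DERIV_chain2[OF smoothstep_deriv, THEN DERIV_cong])

lemma sbump_deriv: "(sbump n s a has_real_derivative sbump' n s a t) (at t)"
  unfolding sbump_def[abs_def] sbump'_def
  by (auto intro!: derivative_eq_intros DERIV_chain2[OF bump_deriv, THEN DERIV_cong])

lemma continuous_sbump: "continuous_on UNIV (sbump n s a)" "continuous_on UNIV (sbump' n s a)" "continuous_on UNIV (sstep n s a)"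
proof -
  show "continuous_on UNIV (sbump n s a)" "continuous_on UNIV (sbump' n s a)"
    unfolding sbump_def[abs_def] sbump'_def[abs_def]
    by (intro continuous_intros continuous_on_compose2[OF continuous_bump(1)] continuous_on_compose2[OF continuous_bump(2)]; auto)+
  show "continuous_on UNIV (sstep n s a)"
    unfolding sstep_def[abs_def]
    by (intro continuous_intros continuous_on_compose2[OF continuous_bump(3)]; auto)
qed

lemma sbump_out:
  assumes "t \<le> a - s / real (Suc n) \<or> a + (1 - s) / real (Suc n) \<le> t"
  shows "sbump n s a t = 0" "sbump' n s a t = 0"
proof -
  have "real (Suc n) * (t - a) + s \<le> 0 \<or> 1 \<le> real (Suc n) * (t - a) + s"
    using assms by (auto simp: field_simps)
  then have "real (Suc n) * (t - a) + s \<notin> {0<..<1}" by auto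
  then show "sbump n s a t = 0" "sbump' n s a t = 0" by (simp_all add: sbump_def sbump'_def bump_out)
qed

lemma sstep_0: "t \<le> a - s / real (Suc n) \<Longrightarrow> sstep n s a t = 0"
  unfolding sstep_def by (rule smoothstep_0) (simp add: field_simps)

lemma sstep_1: "a + (1 - s) / real (Suc n) \<le> t \<Longrightarrow> sstep n s a t = 1"
  unfolding sstep_def by (rule smoothstep_1) (simp add: field_simps)

lemma sstep_bounds: "0 \<le> sstep n s a t" "sstep n s a t \<le> 1"
  unfolding sstep_def by (rule smoothstep_bounds)+

lemma sstep_tendsto:
  assumes s: "0 \<le> s" "s \<le> 1" "t \<noteq> a"
  shows "(\<lambda>n. sstep n s a t) \<longlonglongrightarrow> (if a < t then 1 else 0)"
proof (rule tendsto_eventually)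
  obtain n0 where n0: "1 / \<bar>t - a\<bar> \<le> real n0" using real_arch_simple by blast
  show "\<forall>\<^sub>F n in sequentially. sstep n s a t = (if a < t then 1 else 0)"
    using eventually_ge_at_top[of n0]
  proof eventually_elim
    case (elim n)
    have p: "0 < \<bar>t - a\<bar>" using s by simp
    have "1 / \<bar>t - a\<bar> \<le> real (Suc n)" using n0 elim by linarith
    then have q: "1 \<le> real (Suc n) * \<bar>t - a\<bar>" using p by (simp add: pos_divide_le_eq)
    show ?case
    proof (cases "a < t")
      case True
      then show ?thesis using q s unfolding sstep_def by (subst smoothstep_1) auto
    next
      case False
      then have "\<bar>t - a\<bar> = - (t - a)" by simp
      then have "real (Suc n) * (t - a) = - (real (Suc n) * \<bar>t - a\<bar>)"
        by (simp only: mult_minus_right minus_minus)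
      then have "real (Suc n) * (t - a) \<le> -1" using q by linarith
      then show ?thesis using False s unfolding sstep_def by (subst smoothstep_0) auto
    qed
  qed
qed

text \<open>Scaling each variable separately turns both kernels into the fixed \<open>bump\<close>
  and leaves arguments of \<open>W\<close> that converge to (a, c). The two offsets may
  differ.\<close>

lemma approx_identity_2d:
  fixes W :: "real \<Rightarrow> real \<Rightarrow> real"
  assumes W: "continuous_on UNIV (\<lambda>p. W (fst p) (snd p))"
  shows "(\<lambda>n. \<integral>(x, y). sbump n s a x * sbump n s' c y * W x y \<partial>(lborel \<Otimes>\<^sub>M lborel)) \<longlonglongrightarrow> W a c"
    and "integrable (lborel \<Otimes>\<^sub>M lborel) (\<lambda>(x, y). sbump n s a x * sbump n s' c y * W x y)"
proof -
  have [measurable]: "bump \<in> borel_measurable borel" using continuous_bump(1) by (rule borel_measurable_continuous_onI)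
  have cc: "continuous_on UNIV (\<lambda>p::real \<times> real. W (f p) (g p))"
    if "continuous_on UNIV f" "continuous_on UNIV g" for f g :: "real \<times> real \<Rightarrow> real"
  proof -
    have "continuous_on UNIV (\<lambda>p::real \<times> real. (\<lambda>p. W (fst p) (snd p)) (f p, g p))"
      by (rule continuous_on_compose2[OF W]) (auto intro!: continuous_intros that)
    then show ?thesis by simp
  qed
  have cb: "continuous_on UNIV (\<lambda>p::real \<times> real. bump (f p))" if "continuous_on UNIV f" for f :: "real \<times> real \<Rightarrow> real"
    by (rule continuous_on_compose2[OF continuous_bump(1) that]) simp
  show int: "integrable (lborel \<Otimes>\<^sub>M lborel) (\<lambda>(x, y). sbump n s a x * sbump n s' c y * W x y)" for n
  proof (rule integrable_R2[where T = "\<bar>a\<bar> + \<bar>c\<bar> + (\<bar>s\<bar> + \<bar>s'\<bar> + 1)"])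
    show "continuous_on UNIV (\<lambda>p. sbump n s a (fst p) * sbump n s' c (snd p) * W (fst p) (snd p))"
      by (intro continuous_intros W continuous_on_compose2[OF continuous_sbump(1)]) auto
    have far: "sbump n q d z = 0" if "\<bar>d\<bar> + (\<bar>q\<bar> + 1) < \<bar>z\<bar>" for q d z
    proof (rule sbump_out(1))
      have "\<bar>q / real (Suc n)\<bar> \<le> \<bar>q\<bar>" "\<bar>(1 - q) / real (Suc n)\<bar> \<le> \<bar>1 - q\<bar>"
        by (simp_all add: abs_divide divide_le_eq mult_left_le_one_le[THEN order_trans] distrib_left)
      then show "z \<le> d - q / real (Suc n) \<or> d + (1 - q) / real (Suc n) \<le> z" using that by linarith
    qed
    fix x y assume "\<bar>x\<bar> > \<bar>a\<bar> + \<bar>c\<bar> + (\<bar>s\<bar> + \<bar>s'\<bar> + 1) \<or> \<bar>y\<bar> > \<bar>a\<bar> + \<bar>c\<bar> + (\<bar>s\<bar> + \<bar>s'\<bar> + 1)"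
    then have "\<bar>a\<bar> + (\<bar>s\<bar> + 1) < \<bar>x\<bar> \<or> \<bar>c\<bar> + (\<bar>s'\<bar> + 1) < \<bar>y\<bar>" by linarith
    then show "sbump n s a x * sbump n s' c y * W x y = 0" using far[of a s x] far[of c s' y] by auto
  qed
  have int2: "integrable (lborel \<Otimes>\<^sub>M lborel) (\<lambda>(x, y). bump x * bump y * W (a + (x - s) / real (Suc n)) (c + (y - s') / real (Suc n)))" for n
  proof (rule integrable_R2[where T = 1])
    show "continuous_on UNIV (\<lambda>p. bump (fst p) * bump (snd p) * W (a + (fst p - s) / real (Suc n)) (c + (snd p - s') / real (Suc n)))"
      by (intro continuous_intros cc cb) auto
    show "bump x * bump y * W (a + (x - s) / real (Suc n)) (c + (y - s') / real (Suc n)) = 0" if "\<bar>x\<bar> > 1 \<or> \<bar>y\<bar> > 1" for x y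
    proof -
      have "x \<notin> {0<..<1} \<or> y \<notin> {0<..<1}" using that by auto
      then show ?thesis using bump_out(1)[of x] bump_out(1)[of y] by auto
    qed
  qed
  have eq: "(\<integral>(x, y). sbump n s a x * sbump n s' c y * W x y \<partial>(lborel \<Otimes>\<^sub>M lborel))
    = (\<integral>(x, y). bump x * bump y * W (a + (x - s) / real (Suc n)) (c + (y - s') / real (Suc n)) \<partial>(lborel \<Otimes>\<^sub>M lborel))" for n
  proof -
    have N: "0 < real (Suc n)" by simp
    have "(\<integral>(x, y). sbump n s a x * sbump n s' c y * W x y \<partial>(lborel \<Otimes>\<^sub>M lborel))
      = (\<integral>x. (\<integral>y. sbump n s a x * sbump n s' c y * W x y \<partial>lborel) \<partial>lborel)"
      by (rule lborel_pair.integral_fst[OF int, symmetric])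
    also have "\<dots> = (\<integral>x. real (Suc n) * bump (real (Suc n) * (x - a) + s) * (\<integral>y. bump y * W x (c + (y - s') / real (Suc n)) \<partial>lborel) \<partial>lborel)"
    proof (rule Bochner_Integration.integral_cong[OF refl])
      fix x
      have "(\<integral>y. sbump n s a x * sbump n s' c y * W x y \<partial>lborel) = sbump n s a x * (\<integral>y. sbump n s' c y * W x y \<partial>lborel)"
        unfolding mult.assoc by (rule integral_mult_right_zero)
      also have "(\<integral>y. sbump n s' c y * W x y \<partial>lborel) = (\<integral>y. bump y * W x (c + (y - s') / real (Suc n)) \<partial>lborel)"
        unfolding sbump_def by (rule integral_scaled_bump[OF N])
      finally show "(\<integral>y. sbump n s a x * sbump n s' c y * W x y \<partial>lborel) =
        real (Suc n) * bump (real (Suc n) * (x - a) + s) * (\<integral>y. bump y * W x (c + (y - s') / real (Suc n)) \<partial>lborel)"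
        by (simp only: sbump_def)
    qed
    also have "\<dots> = (\<integral>x. bump x * (\<integral>y. bump y * W (a + (x - s) / real (Suc n)) (c + (y - s') / real (Suc n)) \<partial>lborel) \<partial>lborel)"
      by (rule integral_scaled_bump[OF N])
    also have "\<dots> = (\<integral>x. (\<integral>y. bump x * bump y * W (a + (x - s) / real (Suc n)) (c + (y - s') / real (Suc n)) \<partial>lborel) \<partial>lborel)"
      unfolding mult.assoc by (simp only: integral_mult_right_zero)
    also have "\<dots> = (\<integral>(x, y). bump x * bump y * W (a + (x - s) / real (Suc n)) (c + (y - s') / real (Suc n)) \<partial>(lborel \<Otimes>\<^sub>M lborel))"
      by (rule lborel_pair.integral_fst[OF int2])
    finally show ?thesis .
  qed
  have bb: "integrable (lborel \<Otimes>\<^sub>M lborel) (\<lambda>(x, y). bump x * bump y)"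
  proof (rule integrable_R2[where T = 1])
    show "continuous_on UNIV (\<lambda>p. bump (fst p) * bump (snd p))" by (intro continuous_intros cb)
    show "bump x * bump y = 0" if "\<bar>x\<bar> > 1 \<or> \<bar>y\<bar> > 1" for x y
    proof -
      have "x \<notin> {0<..<1} \<or> y \<notin> {0<..<1}" using that by auto
      then show ?thesis using bump_out(1)[of x] bump_out(1)[of y] by auto
    qed
  qed
  have bb1: "(\<integral>(x, y). bump x * bump y \<partial>(lborel \<Otimes>\<^sub>M lborel)) = 1"
    using lborel_pair.integral_fst[OF bb] integral_bump by simp
  define m where "m = 1 + \<bar>s\<bar> + \<bar>s'\<bar>"
  have "compact ((\<lambda>p. W (fst p) (snd p)) ` ({a - m..a + m} \<times> {c - m..c + m}))"
    by (intro compact_continuous_image compact_Times continuous_on_subset[OF W]) auto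
  then have "bounded ((\<lambda>p. W (fst p) (snd p)) ` ({a - m..a + m} \<times> {c - m..c + m}))" by (rule compact_imp_bounded)
  then obtain B where B: "\<And>x y. x \<in> {a - m..a + m} \<Longrightarrow> y \<in> {c - m..c + m} \<Longrightarrow> \<bar>W x y\<bar> \<le> B"
    unfolding bounded_iff by fastforce
  have near: "d + (z - q) / real (Suc n) \<in> {d - m..d + m}" if "z \<in> {0<..<1}" "\<bar>q\<bar> \<le> \<bar>s\<bar> + \<bar>s'\<bar>" for d z q n
  proof -
    have "\<bar>(z - q) / real (Suc n)\<bar> \<le> \<bar>z - q\<bar> / 1" unfolding abs_divide by (intro divide_left_mono) auto
    also have "\<dots> \<le> m" using that by (auto simp: m_def)
    finally show ?thesis unfolding abs_le_iff atLeastAtMost_iff by linarith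
  qed
  have "(\<lambda>n. \<integral>(x, y). bump x * bump y * W (a + (x - s) / real (Suc n)) (c + (y - s') / real (Suc n)) \<partial>(lborel \<Otimes>\<^sub>M lborel))
     \<longlonglongrightarrow> (\<integral>(x, y). bump x * bump y * W a c \<partial>(lborel \<Otimes>\<^sub>M lborel))"
  proof (rule integral_dominated_convergence[where w = "\<lambda>(x, y). bump x * bump y * \<bar>B\<bar>"])
    show "integrable (lborel \<Otimes>\<^sub>M lborel) (\<lambda>(x, y). bump x * bump y * \<bar>B\<bar>)"
      using integrable_mult_left[OF bb, of "\<bar>B\<bar>"] by (simp add: case_prod_unfold)
    have "integrable (lborel \<Otimes>\<^sub>M lborel) (\<lambda>(x, y). bump x * bump y * W a c)"
      using integrable_mult_left[OF bb, of "W a c"] by (simp add: case_prod_unfold)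
    then show "(\<lambda>(x, y). bump x * bump y * W a c) \<in> borel_measurable (lborel \<Otimes>\<^sub>M lborel)" by (rule borel_measurable_integrable)
    show "(\<lambda>(x, y). bump x * bump y * W (a + (x - s) / real (Suc n)) (c + (y - s') / real (Suc n))) \<in> borel_measurable (lborel \<Otimes>\<^sub>M lborel)" for n
      using int2 by (rule borel_measurable_integrable)
    show "AE p in lborel \<Otimes>\<^sub>M lborel. (\<lambda>n. case p of (x, y) \<Rightarrow> bump x * bump y * W (a + (x - s) / real (Suc n)) (c + (y - s') / real (Suc n)))
       \<longlonglongrightarrow> (case p of (x, y) \<Rightarrow> bump x * bump y * W a c)"
    proof (rule AE_I2)
      fix p :: "real \<times> real"
      obtain x y where p: "p = (x, y)" by (cases p)
      have "(\<lambda>n. (a + (x - s) / real (Suc n), c + (y - s') / real (Suc n))) \<longlonglongrightarrow> (a, c)"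
        by (rule tendsto_Pair) real_asymp+
      moreover have "isCont (\<lambda>p. W (fst p) (snd p)) (a, c)" using W by (simp add: continuous_on_eq_continuous_at)
      ultimately have "(\<lambda>n. (\<lambda>p. W (fst p) (snd p)) (a + (x - s) / real (Suc n), c + (y - s') / real (Suc n))) \<longlonglongrightarrow> (\<lambda>p. W (fst p) (snd p)) (a, c)"
        by (rule isCont_tendsto_compose[rotated])
      then show "(\<lambda>n. case p of (x, y) \<Rightarrow> bump x * bump y * W (a + (x - s) / real (Suc n)) (c + (y - s') / real (Suc n)))
       \<longlonglongrightarrow> (case p of (x, y) \<Rightarrow> bump x * bump y * W a c)"
        unfolding p by (auto intro!: tendsto_intros)
    qed
    show "AE p in lborel \<Otimes>\<^sub>M lborel. norm (case p of (x, y) \<Rightarrow> bump x * bump y * W (a + (x - s) / real (Suc n)) (c + (y - s') / real (Suc n)))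
      \<le> (case p of (x, y) \<Rightarrow> bump x * bump y * \<bar>B\<bar>)" for n
    proof (rule AE_I2)
      fix p :: "real \<times> real"
      obtain x y where p: "p = (x, y)" by (cases p)
      have "norm (bump x * bump y * W (a + (x - s) / real (Suc n)) (c + (y - s') / real (Suc n))) \<le> bump x * bump y * \<bar>B\<bar>"
      proof (cases "x \<in> {0<..<1} \<and> y \<in> {0<..<1}")
        case True
        then have "\<bar>W (a + (x - s) / real (Suc n)) (c + (y - s') / real (Suc n))\<bar> \<le> B"
          by (intro B near) auto
        then have "\<bar>W (a + (x - s) / real (Suc n)) (c + (y - s') / real (Suc n))\<bar> \<le> \<bar>B\<bar>" by linarith
        then show ?thesis using bump_nonneg[of x] bump_nonneg[of y] by (simp add: abs_mult mult_left_mono)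
      qed (auto simp: bump_out)
      then show "norm (case p of (x, y) \<Rightarrow> bump x * bump y * W (a + (x - s) / real (Suc n)) (c + (y - s') / real (Suc n)))
        \<le> (case p of (x, y) \<Rightarrow> bump x * bump y * \<bar>B\<bar>)" unfolding p by simp
    qed
  qed
  moreover have "(\<integral>(x, y). bump x * bump y * W a c \<partial>(lborel \<Otimes>\<^sub>M lborel)) = W a c"
    using bb1 integral_mult_left_zero[of "lborel \<Otimes>\<^sub>M lborel" "\<lambda>(x, y). bump x * bump y" "W a c"]
    by (simp add: case_prod_unfold)
  ultimately show "(\<lambda>n. \<integral>(x, y). sbump n s a x * sbump n s' c y * W x y \<partial>(lborel \<Otimes>\<^sub>M lborel)) \<longlonglongrightarrow> W a c"
    unfolding eq by simp
qed

section \<open>Test functions in characteristic variables\<close>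

lemma rtest_add:
  assumes "rtest \<Phi> \<Phi>1 \<Phi>2" "rtest \<Psi> \<Psi>1 \<Psi>2"
  shows "rtest (\<lambda>t r. \<Phi> t r + \<Psi> t r) (\<lambda>t r. \<Phi>1 t r + \<Psi>1 t r) (\<lambda>t r. \<Phi>2 t r + \<Psi>2 t r)"
proof -
  obtain T R T' R' where s: "\<And>t r. \<bar>t\<bar> > T \<or> r > R \<Longrightarrow> \<Phi> t r = 0 \<and> \<Phi>1 t r = 0 \<and> \<Phi>2 t r = 0"
    "\<And>t r. \<bar>t\<bar> > T' \<or> r > R' \<Longrightarrow> \<Psi> t r = 0 \<and> \<Psi>1 t r = 0 \<and> \<Psi>2 t r = 0"
    using assms unfolding rtest_def by blast
  have d: "\<And>t r. 1 \<le> r \<Longrightarrow> ((\<lambda>p. \<Phi> (fst p) (snd p)) has_derivative (\<lambda>d. \<Phi>1 t r * fst d + \<Phi>2 t r * snd d)) (at (t, r))"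
    "\<And>t r. 1 \<le> r \<Longrightarrow> ((\<lambda>p. \<Psi> (fst p) (snd p)) has_derivative (\<lambda>d. \<Psi>1 t r * fst d + \<Psi>2 t r * snd d)) (at (t, r))"
    and c: "continuous_on (UNIV \<times> {1..}) (\<lambda>p. \<Phi>1 (fst p) (snd p))" "continuous_on (UNIV \<times> {1..}) (\<lambda>p. \<Phi>2 (fst p) (snd p))"
      "continuous_on (UNIV \<times> {1..}) (\<lambda>p. \<Psi>1 (fst p) (snd p))" "continuous_on (UNIV \<times> {1..}) (\<lambda>p. \<Psi>2 (fst p) (snd p))"
    and b: "\<And>t r. r \<le> 1 \<Longrightarrow> \<Phi> t r = \<Phi> t 1 \<and> \<Phi>1 t r = \<Phi>1 t 1 \<and> \<Phi>2 t r = 0"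
      "\<And>t r. r \<le> 1 \<Longrightarrow> \<Psi> t r = \<Psi> t 1 \<and> \<Psi>1 t r = \<Psi>1 t 1 \<and> \<Psi>2 t r = 0"
    using assms unfolding rtest_def by blast+
  show ?thesis
    unfolding rtest_def
  proof (intro conjI allI impI)
    fix t r :: real assume "1 \<le> r"
    from has_derivative_add[OF d(1)[OF this] d(2)[OF this]]
    show "((\<lambda>p. \<Phi> (fst p) (snd p) + \<Psi> (fst p) (snd p)) has_derivative (\<lambda>d. (\<Phi>1 t r + \<Psi>1 t r) * fst d + (\<Phi>2 t r + \<Psi>2 t r) * snd d)) (at (t, r))"
      by (simp add: algebra_simps)
  next
    fix t r :: real assume r: "r \<le> 1"
    note b' = b(1)[OF r, of t] b(2)[OF r, of t]
    show "\<Phi> t r + \<Psi> t r = \<Phi> t 1 + \<Psi> t 1" "\<Phi>1 t r + \<Psi>1 t r = \<Phi>1 t 1 + \<Psi>1 t 1" "\<Phi>2 t r + \<Psi>2 t r = 0"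
      using b' by linarith+
  next
    show "\<exists>T R. \<forall>t r. \<bar>t\<bar> > T \<or> r > R \<longrightarrow> \<Phi> t r + \<Psi> t r = 0 \<and> \<Phi>1 t r + \<Psi>1 t r = 0 \<and> \<Phi>2 t r + \<Psi>2 t r = 0"
      using s by (intro exI[of _ "max T T'"] exI[of _ "max R R'"]) auto
  qed (intro continuous_intros c)+
qed

text \<open>Against the volume factor r^2 the test function Q / r acts on w = r v as
  \<open>Q\<close> does, so the division passes to the one-dimensional equation. The vanishing of
  \<open>Q\<close> for r \<le> 1 secures that the quotient is still constant there.\<close>

lemma rtest_divide:
  assumes Q: "rtest Q Q1 Q2" and z: "\<And>t r. r \<le> 1 \<Longrightarrow> Q t r = 0 \<and> Q1 t r = 0 \<and> Q2 t r = 0"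
  shows "rtest (\<lambda>t r. Q t r / r) (\<lambda>t r. Q1 t r / r) (\<lambda>t r. Q2 t r / r - Q t r / r ^ 2)"
  unfolding rtest_def
proof (intro conjI allI impI)
  fix t r :: real assume r: "1 \<le> r"
  have dQ: "((\<lambda>p. Q (fst p) (snd p)) has_derivative (\<lambda>d. Q1 t r * fst d + Q2 t r * snd d)) (at (t, r))"
    using Q r unfolding rtest_def by blast
  have ds: "(snd has_derivative snd) (at (t, r))" by (auto intro!: derivative_intros)
  have "((\<lambda>p. Q (fst p) (snd p) / snd p) has_derivative
     (\<lambda>h. - Q (fst (t, r)) (snd (t, r)) * (inverse (snd (t, r)) * snd h * inverse (snd (t, r))) + (Q1 t r * fst h + Q2 t r * snd h) / snd (t, r))) (at (t, r))"
    by (rule has_derivative_divide[OF dQ ds]) (use r in auto)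
  moreover have "(\<lambda>h. - Q (fst (t, r)) (snd (t, r)) * (inverse (snd (t, r)) * snd h * inverse (snd (t, r))) + (Q1 t r * fst h + Q2 t r * snd h) / snd (t, r))
    = (\<lambda>d. Q1 t r / r * fst d + (Q2 t r / r - Q t r / r ^ 2) * snd d)"
    using r by (auto simp: fun_eq_iff field_simps power2_eq_square)
  ultimately show "((\<lambda>p. Q (fst p) (snd p) / snd p) has_derivative (\<lambda>d. Q1 t r / r * fst d + (Q2 t r / r - Q t r / r ^ 2) * snd d)) (at (t, r))"
    by simp
next
  have c: "continuous_on (UNIV \<times> {1..}) (\<lambda>p. Q1 (fst p) (snd p))" "continuous_on (UNIV \<times> {1..}) (\<lambda>p. Q2 (fst p) (snd p))"
    using Q unfolding rtest_def by blast+
  show "continuous_on (UNIV \<times> {1..}) (\<lambda>p. Q1 (fst p) (snd p) / snd p)" by (intro continuous_intros c) auto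
  show "continuous_on (UNIV \<times> {1..}) (\<lambda>p. Q2 (fst p) (snd p) / snd p - Q (fst p) (snd p) / snd p ^ 2)"
    by (intro continuous_intros c rtest_continuous[OF Q]) auto
  obtain T R where s: "\<And>t r. \<bar>t\<bar> > T \<or> r > R \<Longrightarrow> Q t r = 0 \<and> Q1 t r = 0 \<and> Q2 t r = 0"
    using Q unfolding rtest_def by blast
  show "\<exists>T R. \<forall>t r. \<bar>t\<bar> > T \<or> r > R \<longrightarrow> Q t r / r = 0 \<and> Q1 t r / r = 0 \<and> Q2 t r / r - Q t r / r ^ 2 = 0"
    using s by (intro exI[of _ T] exI[of _ R]) auto
next
  fix t r :: real assume r: "r \<le> 1"
  show "Q t r / r = Q t 1 / 1" "Q1 t r / r = Q1 t 1 / 1" "Q2 t r / r - Q t r / r ^ 2 = 0"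
    using z[OF r, of t] z[of 1 t] by auto
qed

text \<open>On the support 2 r = (t + r) - (t - r) exceeds c - b \<ge> 2. The intervals are open, so
  the inequality is strict and r = 1 itself is excluded.\<close>

lemma char_zero:
  fixes A B :: "real \<Rightarrow> real"
  assumes "\<forall>x. x \<notin> {a<..<b} \<longrightarrow> A x = 0" "\<forall>y. y \<notin> {c<..<d} \<longrightarrow> B y = 0" "b + 2 \<le> c"
  shows "r \<le> 1 \<Longrightarrow> A (t - r) * B (t + r) = 0"
    and "\<bar>t\<bar> > \<bar>a\<bar> + \<bar>b\<bar> + \<bar>c\<bar> + \<bar>d\<bar> \<or> \<bar>r\<bar> > \<bar>a\<bar> + \<bar>b\<bar> + \<bar>c\<bar> + \<bar>d\<bar> \<Longrightarrow> A (t - r) * B (t + r) = 0"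
proof -
  have *: "A (t - r) * B (t + r) = 0" if "\<not> (a < t - r \<and> t - r < b \<and> c < t + r \<and> t + r < d)"
  proof -
    have "t - r \<notin> {a<..<b} \<or> t + r \<notin> {c<..<d}" using that by auto
    then show ?thesis using assms(1)[rule_format, of "t - r"] assms(2)[rule_format, of "t + r"] by auto
  qed
  show "r \<le> 1 \<Longrightarrow> A (t - r) * B (t + r) = 0" by (rule *) (use assms(3) in linarith)
  show "\<bar>t\<bar> > \<bar>a\<bar> + \<bar>b\<bar> + \<bar>c\<bar> + \<bar>d\<bar> \<or> \<bar>r\<bar> > \<bar>a\<bar> + \<bar>b\<bar> + \<bar>c\<bar> + \<bar>d\<bar> \<Longrightarrow> A (t - r) * B (t + r) = 0"
    by (rule *) linarith
qed

lemma continuous_char: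
  fixes A B :: "real \<Rightarrow> real"
  assumes "continuous_on UNIV A" "continuous_on UNIV B"
  shows "continuous_on S (\<lambda>p::real \<times> real. A (fst p - snd p) * B (fst p + snd p))"
  by (intro continuous_intros continuous_on_compose2[OF assms(1)] continuous_on_compose2[OF assms(2)]) auto

lemma rtest_char:
  fixes A A1 B B1 :: "real \<Rightarrow> real"
  assumes dA: "\<And>x. (A has_real_derivative A1 x) (at x)" and dB: "\<And>x. (B has_real_derivative B1 x) (at x)"
    and c: "continuous_on UNIV A1" "continuous_on UNIV B1"
    and zA: "\<forall>x. x \<notin> {a<..<b} \<longrightarrow> A x = 0" "\<forall>x. x \<notin> {a<..<b} \<longrightarrow> A1 x = 0"
    and zB: "\<forall>x. x \<notin> {c<..<d} \<longrightarrow> B x = 0" "\<forall>x. x \<notin> {c<..<d} \<longrightarrow> B1 x = 0" and bc: "b + 2 \<le> c"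
  shows "rtest (\<lambda>t r. A (t - r) * B (t + r)) (\<lambda>t r. A1 (t - r) * B (t + r) + A (t - r) * B1 (t + r))
     (\<lambda>t r. - (A1 (t - r) * B (t + r)) + A (t - r) * B1 (t + r))"
proof -
  have cA: "continuous_on UNIV A" "continuous_on UNIV B"
    using dA dB by (meson DERIV_isCont continuous_at_imp_continuous_on)+
  note z1 = char_zero[of a b A c d B, OF zA(1) zB(1) bc] char_zero[of a b A1 c d B, OF zA(2) zB(1) bc]
    char_zero[of a b A c d B1, OF zA(1) zB(2) bc]
  show ?thesis
    unfolding rtest_def
  proof (intro conjI allI impI)
    fix t r :: real
    have "((\<lambda>p::real \<times> real. A (fst p - snd p)) has_derivative (\<lambda>h. (fst h - snd h) * A1 (t - r))) (at (t, r))"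
      by (rule DERIV_compose_FDERIV[where g = "\<lambda>p. fst p - snd p"]) (use dA in \<open>auto intro!: derivative_intros\<close>)
    moreover have "((\<lambda>p::real \<times> real. B (fst p + snd p)) has_derivative (\<lambda>h. (fst h + snd h) * B1 (t + r))) (at (t, r))"
      by (rule DERIV_compose_FDERIV[where g = "\<lambda>p. fst p + snd p"]) (use dB in \<open>auto intro!: derivative_intros\<close>)
    ultimately have "((\<lambda>p. A (fst p - snd p) * B (fst p + snd p)) has_derivative
       (\<lambda>h. A (fst (t, r) - snd (t, r)) * ((fst h + snd h) * B1 (t + r)) + ((fst h - snd h) * A1 (t - r)) * B (fst (t, r) + snd (t, r)))) (at (t, r))"
      by (rule has_derivative_mult)
    then show "((\<lambda>p. A (fst p - snd p) * B (fst p + snd p)) has_derivative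
       (\<lambda>h. (A1 (t - r) * B (t + r) + A (t - r) * B1 (t + r)) * fst h + (- (A1 (t - r) * B (t + r)) + A (t - r) * B1 (t + r)) * snd h)) (at (t, r))"
      by (simp add: algebra_simps)
  next
    show "continuous_on (UNIV \<times> {1..}) (\<lambda>p. A1 (fst p - snd p) * B (fst p + snd p) + A (fst p - snd p) * B1 (fst p + snd p))"
      "continuous_on (UNIV \<times> {1..}) (\<lambda>p. - (A1 (fst p - snd p) * B (fst p + snd p)) + A (fst p - snd p) * B1 (fst p + snd p))"
      by (intro continuous_on_add continuous_on_minus continuous_char c cA)+
    show "\<exists>T R. \<forall>t r. \<bar>t\<bar> > T \<or> r > R \<longrightarrow> A (t - r) * B (t + r) = 0 \<and> A1 (t - r) * B (t + r) + A (t - r) * B1 (t + r) = 0 \<and>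
       - (A1 (t - r) * B (t + r)) + A (t - r) * B1 (t + r) = 0"
    proof (intro exI[of _ "\<bar>a\<bar> + \<bar>b\<bar> + \<bar>c\<bar> + \<bar>d\<bar>"] allI impI)
      fix t r :: real assume "\<bar>t\<bar> > \<bar>a\<bar> + \<bar>b\<bar> + \<bar>c\<bar> + \<bar>d\<bar> \<or> r > \<bar>a\<bar> + \<bar>b\<bar> + \<bar>c\<bar> + \<bar>d\<bar>"
      then have "\<bar>t\<bar> > \<bar>a\<bar> + \<bar>b\<bar> + \<bar>c\<bar> + \<bar>d\<bar> \<or> \<bar>r\<bar> > \<bar>a\<bar> + \<bar>b\<bar> + \<bar>c\<bar> + \<bar>d\<bar>" by linarith
      then show "A (t - r) * B (t + r) = 0 \<and> A1 (t - r) * B (t + r) + A (t - r) * B1 (t + r) = 0 \<and>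
       - (A1 (t - r) * B (t + r)) + A (t - r) * B1 (t + r) = 0"
        by (simp only: z1(2,4,6) add_0_right minus_zero simp_thms)
    qed
  next
    fix t r :: real assume r: "r \<le> 1"
    note z = z1(1)[OF r, of t] z1(3)[OF r, of t] z1(5)[OF r, of t] z1(1)[OF order_refl, of t] z1(3)[OF order_refl, of t] z1(5)[OF order_refl, of t]
    show "A (t - r) * B (t + r) = A (t - 1) * B (t + 1)"
      "A1 (t - r) * B (t + r) + A (t - r) * B1 (t + r) = A1 (t - 1) * B (t + 1) + A (t - 1) * B1 (t + 1)"
      "- (A1 (t - r) * B (t + r)) + A (t - r) * B1 (t + r) = 0"
      by (simp_all only: z)
  qed
qed

context compact_solution
begin

text \<open>Agrees with w^5 / r^4 for r \<ge> 1; the truncated denominator keeps it continuous on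
  the whole plane, as the change of variables demands.\<close>

definition F :: "real \<Rightarrow> real \<Rightarrow> real" where "F t r = w t r ^ 5 / (max 1 r) ^ 4"

lemma continuous_F: "continuous_on UNIV (\<lambda>p. F (fst p) (snd p))"
  unfolding F_def by (intro continuous_intros continuous_w) auto

text \<open>For Q = A(t - r) B(t + r) the one-dimensional wave operator gives Q_tt - Q_rr = 4 A' B'.
  Testing with Q / r therefore pairs \<open>w\<close> with 4 A' B' and \<open>F\<close> with A B.
  All derivatives sit on the test functions and split between the two characteristic
  variables.\<close>

lemma char_weak:
  assumes dA: "\<And>x. (A has_real_derivative A1 x) (at x)" "\<And>x. (A1 has_real_derivative A2 x) (at x)"
    and dB: "\<And>x. (B has_real_derivative B1 x) (at x)" "\<And>x. (B1 has_real_derivative B2 x) (at x)"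
    and c: "continuous_on UNIV A2" "continuous_on UNIV B2"
    and zA: "\<forall>x. x \<notin> {a<..<b} \<longrightarrow> A x = 0" "\<forall>x. x \<notin> {a<..<b} \<longrightarrow> A1 x = 0" "\<forall>x. x \<notin> {a<..<b} \<longrightarrow> A2 x = 0"
    and zB: "\<forall>x. x \<notin> {c<..<d} \<longrightarrow> B x = 0" "\<forall>x. x \<notin> {c<..<d} \<longrightarrow> B1 x = 0" "\<forall>x. x \<notin> {c<..<d} \<longrightarrow> B2 x = 0"
    and bc: "b + 2 \<le> c"
  shows "(\<integral>(\<xi>, \<eta>). 4 * (A1 \<xi> * B1 \<eta> * w ((\<xi> + \<eta>) / 2) ((\<eta> - \<xi>) / 2)) + A \<xi> * B \<eta> * F ((\<xi> + \<eta>) / 2) ((\<eta> - \<xi>) / 2) \<partial>(lborel \<Otimes>\<^sub>M lborel)) = 0"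
proof -
  have cA: "continuous_on UNIV A" "continuous_on UNIV A1" "continuous_on UNIV B" "continuous_on UNIV B1"
    using dA dB by (meson DERIV_isCont continuous_at_imp_continuous_on)+
  note zz = char_zero[OF zA(1) zB(1) bc] char_zero[OF zA(2) zB(1) bc] char_zero[OF zA(1) zB(2) bc]
    char_zero[OF zA(2) zB(2) bc] char_zero[OF zA(3) zB(1) bc] char_zero[OF zA(1) zB(3) bc]
  note q = rtest_char[OF dA(1) dB(1) cA(2,4) zA(1,2) zB(1,2) bc]
  note q1 = rtest_add[OF rtest_char[OF dA(2) dB(1) c(1) cA(4) zA(2,3) zB(1,2) bc] rtest_char[OF dA(1) dB(2) cA(2) c(2) zA(1,2) zB(2,3) bc]]
  have r0: "rtest (\<lambda>t r. A (t - r) * B (t + r) / r) (\<lambda>t r. (A1 (t - r) * B (t + r) + A (t - r) * B1 (t + r)) / r)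
    (\<lambda>t r. (- (A1 (t - r) * B (t + r)) + A (t - r) * B1 (t + r)) / r - A (t - r) * B (t + r) / r ^ 2)"
    by (rule rtest_divide[OF q]) (simp only: zz add_0_right minus_zero simp_thms)
  have r1: "rtest (\<lambda>t r. (A1 (t - r) * B (t + r) + A (t - r) * B1 (t + r)) / r)
    (\<lambda>t r. ((A2 (t - r) * B (t + r) + A1 (t - r) * B1 (t + r)) + (A1 (t - r) * B1 (t + r) + A (t - r) * B2 (t + r))) / r)
    (\<lambda>t r. ((- (A2 (t - r) * B (t + r)) + A1 (t - r) * B1 (t + r)) + (- (A1 (t - r) * B1 (t + r)) + A (t - r) * B2 (t + r))) / r
       - (A1 (t - r) * B (t + r) + A (t - r) * B1 (t + r)) / r ^ 2)"
    by (rule rtest_divide[OF q1]) (simp only: zz add_0_right minus_zero simp_thms)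
  \<comment> \<open>r^2 times the radial derivative of Q / r is r Q_r - Q, whose derivative is r
    Q_rr: the first-order terms cancel.\<close>
  define \<gamma> where "\<gamma> = (\<lambda>t r. r * (- (A1 (t - r) * B (t + r)) + A (t - r) * B1 (t + r)) - A (t - r) * B (t + r))"
  define \<gamma>' where "\<gamma>' = (\<lambda>t r. r * (A2 (t - r) * B (t + r) - 2 * (A1 (t - r) * B1 (t + r)) + A (t - r) * B2 (t + r)))"
  have d\<gamma>: "(\<gamma> t has_real_derivative \<gamma>' t r) (at r)" for t r
  proof -
    have dm: "((\<lambda>r. h (t - r)) has_real_derivative - h' (t - r)) (at r)" if "\<And>x. (h has_real_derivative h' x) (at x)" for h h' :: "real \<Rightarrow> real"
      by (auto intro!: derivative_eq_intros DERIV_chain2[OF that, THEN DERIV_cong])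
    have dp: "((\<lambda>r. h (t + r)) has_real_derivative h' (t + r)) (at r)" if "\<And>x. (h has_real_derivative h' x) (at x)" for h h' :: "real \<Rightarrow> real"
      by (auto intro!: derivative_eq_intros DERIV_chain2[OF that, THEN DERIV_cong])
    show ?thesis unfolding \<gamma>_def \<gamma>'_def
      by (rule derivative_eq_intros dm[OF dA(1)] dm[OF dA(2)] dp[OF dB(1)] dp[OF dB(2)] refl)+ (simp add: algebra_simps)
  qed
  have c\<gamma>': "continuous_on UNIV (\<lambda>p. \<gamma>' (fst p) (snd p))"
    unfolding \<gamma>'_def
    by (intro continuous_on_add continuous_on_diff continuous_on_mult continuous_on_const continuous_char continuous_on_snd continuous_on_id cA c)
  have s\<gamma>': "\<gamma>' t r = 0" if "\<bar>t\<bar> > \<bar>a\<bar> + \<bar>b\<bar> + \<bar>c\<bar> + \<bar>d\<bar> \<or> r > \<bar>a\<bar> + \<bar>b\<bar> + \<bar>c\<bar> + \<bar>d\<bar>" for t r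
  proof -
    have "\<bar>t\<bar> > \<bar>a\<bar> + \<bar>b\<bar> + \<bar>c\<bar> + \<bar>d\<bar> \<or> \<bar>r\<bar> > \<bar>a\<bar> + \<bar>b\<bar> + \<bar>c\<bar> + \<bar>d\<bar>" using that by linarith
    then show ?thesis by (simp only: \<gamma>'_def zz(8,10,12) mult_zero_right diff_self add_0_right)
  qed
  have \<gamma>eq: "\<gamma> t r = r ^ 2 * ((- (A1 (t - r) * B (t + r)) + A (t - r) * B1 (t + r)) / r - A (t - r) * B (t + r) / r ^ 2)"
    if "1 \<le> r" for t r
  proof -
    have "r ^ 2 * (X / r - Y / r ^ 2) = r * X - Y" for X Y :: real
      using that by (simp add: field_simps power2_eq_square)
    then show ?thesis by (simp only: \<gamma>_def)
  qed
  have wf: "(\<integral>(t, r). indicator {1..} r * (v t r * (r ^ 2 * (((A2 (t - r) * B (t + r) + A1 (t - r) * B1 (t + r)) + (A1 (t - r) * B1 (t + r) + A (t - r) * B2 (t + r))) / r) - \<gamma>' t r)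
      + v t r ^ 5 * (r ^ 2 * (A (t - r) * B (t + r) / r))) \<partial>(lborel \<Otimes>\<^sub>M lborel)) = 0"
    by (rule weak_form_radial(1)[OF r0 r1 \<gamma>eq d\<gamma> c\<gamma>' s\<gamma>'])
  define g where "g = (\<lambda>t r. 4 * (A1 (t - r) * B1 (t + r) * w t r) + A (t - r) * B (t + r) * F t r)"
  have "(\<lambda>(t, r). indicator {1..} r * (v t r * (r ^ 2 * (((A2 (t - r) * B (t + r) + A1 (t - r) * B1 (t + r)) + (A1 (t - r) * B1 (t + r) + A (t - r) * B2 (t + r))) / r) - \<gamma>' t r)
      + v t r ^ 5 * (r ^ 2 * (A (t - r) * B (t + r) / r)))) = (\<lambda>(t, r). g t r)"
  proof (rule ext, clarify)
    fix t r :: real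
    show "indicator {1..} r * (v t r * (r ^ 2 * (((A2 (t - r) * B (t + r) + A1 (t - r) * B1 (t + r)) + (A1 (t - r) * B1 (t + r) + A (t - r) * B2 (t + r))) / r) - \<gamma>' t r)
      + v t r ^ 5 * (r ^ 2 * (A (t - r) * B (t + r) / r))) = g t r"
    proof (cases "1 \<le> r")
      case True
      define X where "X = A (t - r) * B (t + r)"
      define Y where "Y = A1 (t - r) * B1 (t + r)"
      define Z1 where "Z1 = A2 (t - r) * B (t + r)"
      define Z2 where "Z2 = A (t - r) * B2 (t + r)"
      have F: "X * F t r = v t r ^ 5 * (r * X)"
        using True by (simp add: F_def w_def max_def power_mult_distrib eval_nat_numeral)
      have "v t r * (r ^ 2 * (((Z1 + Y) + (Y + Z2)) / r) - r * (Z1 - 2 * Y + Z2)) + v t r ^ 5 * (r ^ 2 * (X / r)) = 4 * (Y * (r * v t r)) + v t r ^ 5 * (r * X)"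
      proof -
        have "r ^ 2 * (K / r) = r * K" for K using True by (simp add: power2_eq_square)
        then show ?thesis by (simp only:) (simp add: algebra_simps)
      qed
      then show ?thesis using True F
        by (simp only: g_def \<gamma>'_def w_def flip: X_def Y_def Z1_def Z2_def) simp
    next
      case False
      then have "r \<le> 1" by simp
      then have "A (t - r) * B (t + r) = 0" "A1 (t - r) * B1 (t + r) = 0" by (simp_all only: zz)
      then have "g t r = 0" by (simp only: g_def mult_zero_left mult_zero_right add_0_right)
      then show ?thesis using False by (simp only:) simp
    qed
  qed
  with wf have "(\<integral>(t, r). g t r \<partial>(lborel \<Otimes>\<^sub>M lborel)) = 0" by (simp only:)
  moreover have "(\<integral>(t, r). g t r \<partial>(lborel \<Otimes>\<^sub>M lborel)) = 1 / 2 * (\<integral>(\<xi>, \<eta>). g ((\<xi> + \<eta>) / 2) ((\<eta> - \<xi>) / 2) \<partial>(lborel \<Otimes>\<^sub>M lborel))"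
  proof (rule integral_characteristic_coordinates)
    show "continuous_on UNIV (\<lambda>p. g (fst p) (snd p))"
      unfolding g_def by (intro continuous_on_add continuous_on_mult continuous_on_const continuous_char cA continuous_w continuous_F)
    show "g t r = 0" if "\<bar>t\<bar> > \<bar>a\<bar> + \<bar>b\<bar> + \<bar>c\<bar> + \<bar>d\<bar> \<or> \<bar>r\<bar> > \<bar>a\<bar> + \<bar>b\<bar> + \<bar>c\<bar> + \<bar>d\<bar>" for t r
      by (simp only: g_def zz(2)[OF that] zz(8)[OF that] mult_zero_left mult_zero_right add_0_right)
  qed
  moreover have "g ((\<xi> + \<eta>) / 2) ((\<eta> - \<xi>) / 2) = 4 * (A1 \<xi> * B1 \<eta> * w ((\<xi> + \<eta>) / 2) ((\<eta> - \<xi>) / 2)) + A \<xi> * B \<eta> * F ((\<xi> + \<eta>) / 2) ((\<eta> - \<xi>) / 2)" for \<xi> \<eta>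
  proof -
    have e: "(\<xi> + \<eta>) / 2 - (\<eta> - \<xi>) / 2 = \<xi>" "(\<xi> + \<eta>) / 2 + (\<eta> - \<xi>) / 2 = \<eta>" by (simp_all add: field_simps)
    show ?thesis unfolding g_def e ..
  qed
  ultimately show ?thesis by simp
qed

end

section \<open>From smoothed to sharp rectangles\<close>

lemma integral_half_open:
  fixes f :: "real \<Rightarrow> real"
  assumes f: "continuous_on {a..b} f" and m: "f \<in> borel_measurable borel"
    and S: "{a<..<b} \<subseteq> S" "S \<subseteq> {a..b}" "S \<in> sets borel"
  shows "(\<integral>x. indicator S x * f x \<partial>lborel) = integral {a..b} f"
proof -
  note [measurable] = m S(3)
  have "(\<integral>x. indicator S x * f x \<partial>lborel) = (\<integral>x. indicator {a..b} x *\<^sub>R f x \<partial>lborel)"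
  proof (rule integral_cong_AE)
    show "AE x in lborel. indicator S x * f x = indicator {a..b} x *\<^sub>R f x"
      using AE_lborel_singleton[of a] AE_lborel_singleton[of b]
    proof eventually_elim
      case (elim x)
      then have "x \<in> S \<longleftrightarrow> x \<in> {a..b}" using S(1,2) by force
      then show ?case by (simp add: indicator_def)
    qed
  qed measurable
  also have "\<dots> = (LINT x:{a..b}|lborel. f x)" by (simp add: set_lebesgue_integral_def)
  also have "\<dots> = integral {a..b} f"
    by (rule set_borel_integral_eq_integral(2)) (use borel_integrable_compact[OF compact_Icc f] in \<open>simp add: set_integrable_def\<close>)
  finally show ?thesis .
qed

text \<open>The substitutions \<xi> = t - r - 2 b and \<eta> = t + r + 2 a have Jacobian 2 each. The
  half-open intervals are the limits of one-sided smoothed steps; the choice of endpoints does not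
  affect the integral.\<close>

lemma integral_characteristic_rectangle:
  fixes G :: "real \<Rightarrow> real \<Rightarrow> real"
  assumes G: "continuous_on UNIV (\<lambda>p. G (fst p) (snd p))" and \<delta>: "0 \<le> \<delta>" and \<sigma>: "0 \<le> \<sigma>"
  shows "(\<integral>(\<xi>, \<eta>). indicator {t - r - 2 * \<delta>..<t - r} \<xi> * indicator {t + r<..t + r + 2 * \<sigma>} \<eta> * G ((\<xi> + \<eta>) / 2) ((\<eta> - \<xi>) / 2) \<partial>(lborel \<Otimes>\<^sub>M lborel))
    = 4 * integral {0..\<delta>} (\<lambda>b. integral {0..\<sigma>} (\<lambda>a. G (t + a - b) (r + a + b)))"
    and "integrable (lborel \<Otimes>\<^sub>M lborel) (\<lambda>(\<xi>, \<eta>). indicator {t - r - 2 * \<delta>..<t - r} \<xi> * indicator {t + r<..t + r + 2 * \<sigma>} \<eta> * G ((\<xi> + \<eta>) / 2) ((\<eta> - \<xi>) / 2))"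
proof -
  define H where "H = (\<lambda>\<xi> \<eta>. G ((\<xi> + \<eta>) / 2) ((\<eta> - \<xi>) / 2))"
  have comp: "continuous_on S (\<lambda>p. G (f p) (g p))" if "continuous_on S f" "continuous_on S g" for S :: "'z::topological_space set" and f g
  proof -
    have "continuous_on S (\<lambda>p. (\<lambda>p. G (fst p) (snd p)) (f p, g p))"
      by (rule continuous_on_compose2[OF G]) (auto intro!: continuous_intros that)
    then show ?thesis by simp
  qed
  have cH: "continuous_on UNIV (\<lambda>p. H (fst p) (snd p))"
    unfolding H_def by (intro comp continuous_intros) auto
  define I where "I = {t - r - 2 * \<delta>..<t - r}"
  define J where "J = {t + r<..t + r + 2 * \<sigma>}"
  have [measurable]: "I \<in> sets borel" "J \<in> sets borel" by (auto simp: I_def J_def)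
  have Hm: "(\<lambda>p. H (fst p) (snd p)) \<in> borel_measurable (lborel \<Otimes>\<^sub>M lborel)"
    using borel_measurable_continuous_onI[OF cH] by (simp add: lborel_prod)
  show int: "integrable (lborel \<Otimes>\<^sub>M lborel) (\<lambda>(\<xi>, \<eta>). indicator {t - r - 2 * \<delta>..<t - r} \<xi> * indicator {t + r<..t + r + 2 * \<sigma>} \<eta> * G ((\<xi> + \<eta>) / 2) ((\<eta> - \<xi>) / 2))"
    unfolding I_def[symmetric] J_def[symmetric] H_def[symmetric, THEN fun_cong, THEN fun_cong]
  proof (rule Bochner_Integration.integrable_bound)
    have "integrable lborel (\<lambda>p::real \<times> real. indicator ({t - r - 2 * \<delta>..t - r} \<times> {t + r..t + r + 2 * \<sigma>}) p *\<^sub>R H (fst p) (snd p))"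
      by (rule borel_integrable_compact) (auto intro!: compact_Times continuous_on_subset[OF cH])
    then show "integrable (lborel \<Otimes>\<^sub>M lborel) (\<lambda>p::real \<times> real. indicator ({t - r - 2 * \<delta>..t - r} \<times> {t + r..t + r + 2 * \<sigma>}) p *\<^sub>R H (fst p) (snd p))"
      by (simp add: lborel_prod)
    show "(\<lambda>(\<xi>, \<eta>). indicator I \<xi> * indicator J \<eta> * H \<xi> \<eta>) \<in> borel_measurable (lborel \<Otimes>\<^sub>M lborel)"
      unfolding case_prod_unfold using Hm by measurable
    show "AE p in lborel \<Otimes>\<^sub>M lborel. norm (case p of (\<xi>, \<eta>) \<Rightarrow> indicator I \<xi> * indicator J \<eta> * H \<xi> \<eta>)
      \<le> norm (indicator ({t - r - 2 * \<delta>..t - r} \<times> {t + r..t + r + 2 * \<sigma>}) p *\<^sub>R H (fst p) (snd p))"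
      by (rule AE_I2) (auto simp: indicator_def I_def J_def split: prod.splits)
  qed
  have cslice: "continuous_on UNIV (H \<xi>)" for \<xi> unfolding H_def by (intro comp continuous_intros) auto
  have inner: "(\<integral>\<eta>. indicator J \<eta> * H \<xi> \<eta> \<partial>lborel) = 2 * integral {0..\<sigma>} (\<lambda>a. H \<xi> (t + r + 2 * a))" for \<xi>
  proof -
    have "(\<integral>\<eta>. indicator J \<eta> * H \<xi> \<eta> \<partial>lborel) = \<bar>2\<bar> *\<^sub>R (\<integral>a. indicator J (t + r + 2 * a) * H \<xi> (t + r + 2 * a) \<partial>lborel)"
      by (rule lborel_integral_real_affine) simp
    also have "(\<lambda>a. indicator J (t + r + 2 * a) * H \<xi> (t + r + 2 * a)) = (\<lambda>a. indicator {0<..\<sigma>} a * H \<xi> (t + r + 2 * a))"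
      by (auto simp: fun_eq_iff indicator_def J_def)
    also have "(\<integral>a. indicator {0<..\<sigma>} a * H \<xi> (t + r + 2 * a) \<partial>lborel) = integral {0..\<sigma>} (\<lambda>a. H \<xi> (t + r + 2 * a))"
    proof (rule integral_half_open)
      have "continuous_on UNIV (\<lambda>a. H \<xi> (t + r + 2 * a))"
        by (rule continuous_on_compose2[OF cslice]) (auto intro!: continuous_intros)
      then show "continuous_on {0..\<sigma>} (\<lambda>a. H \<xi> (t + r + 2 * a))" "(\<lambda>a. H \<xi> (t + r + 2 * a)) \<in> borel_measurable borel"
        by (auto intro: continuous_on_subset borel_measurable_continuous_onI)
    qed auto
    finally show ?thesis by simp
  qed
  define L where "L = (\<lambda>\<xi>. integral {0..\<sigma>} (\<lambda>a. H \<xi> (t + r + 2 * a)))"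
  have cL: "continuous_on UNIV L"
  proof -
    have "continuous_on UNIV (\<lambda>\<xi>. integral (cbox 0 \<sigma>) (\<lambda>a. H \<xi> (t + r + 2 * a)))"
    proof (rule integral_continuous_on_param)
      show "continuous_on (UNIV \<times> cbox 0 \<sigma>) (\<lambda>(\<xi>, a). H \<xi> (t + r + 2 * a))"
        unfolding H_def case_prod_unfold by (intro comp continuous_intros) auto
    qed
    then show ?thesis by (simp add: L_def)
  qed
  have "(\<integral>(\<xi>, \<eta>). indicator I \<xi> * indicator J \<eta> * H \<xi> \<eta> \<partial>(lborel \<Otimes>\<^sub>M lborel)) = (\<integral>\<xi>. (\<integral>\<eta>. indicator I \<xi> * indicator J \<eta> * H \<xi> \<eta> \<partial>lborel) \<partial>lborel)"
    by (rule lborel_pair.integral_fst[symmetric]) (use int in \<open>simp add: I_def J_def H_def\<close>)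
  also have "\<dots> = (\<integral>\<xi>. indicator I \<xi> * (2 * L \<xi>) \<partial>lborel)"
    unfolding mult.assoc by (simp only: integral_mult_right_zero inner L_def)
  also have "\<dots> = \<bar>- 2\<bar> *\<^sub>R (\<integral>b. indicator I (t - r + (- 2) * b) * (2 * L (t - r + (- 2) * b)) \<partial>lborel)"
    by (rule lborel_integral_real_affine) simp
  also have "(\<lambda>b. indicator I (t - r + (- 2) * b) * (2 * L (t - r + (- 2) * b))) = (\<lambda>b. 2 * (indicator {0<..\<delta>} b * L (t - r - 2 * b)))"
    by (auto simp: fun_eq_iff indicator_def I_def)
  also have "(\<integral>b. 2 * (indicator {0<..\<delta>} b * L (t - r - 2 * b)) \<partial>lborel) = 2 * integral {0..\<delta>} (\<lambda>b. L (t - r - 2 * b))"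
  proof -
    have "continuous_on UNIV (\<lambda>b. L (t - r - 2 * b))"
      by (rule continuous_on_compose2[OF cL]) (auto intro!: continuous_intros)
    then have "continuous_on {0..\<delta>} (\<lambda>b. L (t - r - 2 * b))" "(\<lambda>b. L (t - r - 2 * b)) \<in> borel_measurable borel"
      by (auto intro: continuous_on_subset borel_measurable_continuous_onI)
    note c = this
    have "{0<..<\<delta>} \<subseteq> {0<..\<delta>}" "{0<..\<delta>} \<subseteq> {0..\<delta>}" "{0<..\<delta>} \<in> sets borel" by auto
    from integral_half_open[OF c this] show ?thesis by simp
  qed
  also have "integral {0..\<delta>} (\<lambda>b. L (t - r - 2 * b)) = integral {0..\<delta>} (\<lambda>b. integral {0..\<sigma>} (\<lambda>a. G (t + a - b) (r + a + b)))"
  proof -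
    have "H (t - r - 2 * b) (t + r + 2 * a) = G (t + a - b) (r + a + b)" for a b
    proof -
      have "(t - r - 2 * b + (t + r + 2 * a)) / 2 = t + a - b" "(t + r + 2 * a - (t - r - 2 * b)) / 2 = r + a + b"
        by (simp_all add: field_simps)
      then show ?thesis by (simp only: H_def)
    qed
    then show ?thesis by (simp only: L_def)
  qed
  finally show "(\<integral>(\<xi>, \<eta>). indicator {t - r - 2 * \<delta>..<t - r} \<xi> * indicator {t + r<..t + r + 2 * \<sigma>} \<eta> * G ((\<xi> + \<eta>) / 2) ((\<eta> - \<xi>) / 2) \<partial>(lborel \<Otimes>\<^sub>M lborel))
    = 4 * integral {0..\<delta>} (\<lambda>b. integral {0..\<sigma>} (\<lambda>a. G (t + a - b) (r + a + b)))"
    by (simp add: I_def J_def H_def)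
qed

lemma sstep_difference:
  fixes a b :: real
  assumes "a \<le> b" "0 \<le> s" "s \<le> 1"
  shows "\<bar>sstep n s a x - sstep n s b x\<bar> \<le> 1"
    and "x \<notin> {a - s<..<b + (1 - s)} \<Longrightarrow> sstep n s a x - sstep n s b x = 0"
proof -
  show "\<bar>sstep n s a x - sstep n s b x\<bar> \<le> 1"
    using sstep_bounds[of n s a x] sstep_bounds[of n s b x] by (simp add: abs_le_iff)
  have q: "q / real (Suc n) \<le> q" if "0 \<le> q" for q :: real
    using that divide_left_mono[of 1 "real (Suc n)" q] by simp
  show "sstep n s a x - sstep n s b x = 0" if "x \<notin> {a - s<..<b + (1 - s)}"
  proof (cases "x \<le> a - s")
    case True
    then have "x \<le> a - s / real (Suc n)" "x \<le> b - s / real (Suc n)" using q[OF assms(2)] assms(1) by linarith+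
    then show ?thesis by (simp add: sstep_0)
  next
    case False
    then have "b + (1 - s) \<le> x" using that by auto
    then have "a + (1 - s) / real (Suc n) \<le> x" "b + (1 - s) / real (Suc n) \<le> x" using q[of "1 - s"] assms by linarith+
    then show ?thesis by (simp add: sstep_1)
  qed
qed

text \<open>Smoothing to the left (s = 1) gives the step the value 1 at the jump for every
  \<open>n\<close>, smoothing to the right (s = 0) the value 0. Hence convergence holds at every
  point, endpoints included.\<close>

lemma sstep_difference_tendsto:
  fixes a b :: real
  assumes ab: "a \<le> b"
  shows "(\<lambda>n. sstep n 1 a x - sstep n 1 b x) \<longlonglongrightarrow> indicator {a..<b} x"
    and "(\<lambda>n. sstep n 0 a x - sstep n 0 b x) \<longlonglongrightarrow> indicator {a<..b} x"
proof -
  have l1: "(\<lambda>n. sstep n 1 a x) \<longlonglongrightarrow> (if a \<le> x then 1 else 0)" for a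
  proof (cases "x = a")
    case True
    then show ?thesis by (simp add: sstep_def smoothstep_1)
  next
    case False
    then show ?thesis using sstep_tendsto[of 1 x a] by (simp add: less_le)
  qed
  have l0: "(\<lambda>n. sstep n 0 a x) \<longlonglongrightarrow> (if a < x then 1 else 0)" for a
  proof (cases "x = a")
    case True
    then show ?thesis by (simp add: sstep_def smoothstep_0)
  next
    case False
    then show ?thesis using sstep_tendsto[of 0 x a] by simp
  qed
  have "(if a \<le> x then 1 else 0) - (if b \<le> x then 1 else (0::real)) = indicator {a..<b} x"
    using ab by (auto simp: indicator_def)
  then show "(\<lambda>n. sstep n 1 a x - sstep n 1 b x) \<longlonglongrightarrow> indicator {a..<b} x"
    using tendsto_diff[OF l1[of a] l1[of b]] by simp
  have "(if a < x then 1 else 0) - (if b < x then 1 else (0::real)) = indicator {a<..b} x"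
    using ab by (auto simp: indicator_def)
  then show "(\<lambda>n. sstep n 0 a x - sstep n 0 b x) \<longlonglongrightarrow> indicator {a<..b} x"
    using tendsto_diff[OF l0[of a] l0[of b]] by simp
qed

context compact_solution
begin

text \<open>\<open>A\<close> and \<open>B\<close> approximate the indicators of
  \<open>{a..<b}\<close> and \<open>{c<..d}\<close>, so A' B' approximates four signed point masses
  at the corners, and the identity for product test functions passes to the limit. \<open>A\<close>
  is smoothed to the left and \<open>B\<close> to the right, so their supports never exceed
  \<open>b\<close> or fall below \<open>c\<close>. The gap condition b + 2 \<le> c, an equality at r
  = 1, thus survives the smoothing, and rectangles touching the sphere are included.\<close>

lemma diamond_F:
  assumes r: "1 \<le> r" and \<sigma>: "0 \<le> \<sigma>" and \<delta>: "0 \<le> \<delta>"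
  shows "w t r - w (t + \<sigma>) (r + \<sigma>) - w (t - \<delta>) (r + \<delta>) + w (t + \<sigma> - \<delta>) (r + \<sigma> + \<delta>)
    = integral {0..\<delta>} (\<lambda>b. integral {0..\<sigma>} (\<lambda>a. F (t + a - b) (r + a + b)))"
proof -
  define a where "a = t - r - 2 * \<delta>"
  define b where "b = t - r"
  define c where "c = t + r"
  define d where "d = t + r + 2 * \<sigma>"
  have ab: "a \<le> b" and cd: "c \<le> d" and bc: "b + 2 \<le> c" using assms by (auto simp: a_def b_def c_def d_def)
  define W where "W = (\<lambda>x y. w ((x + y) / 2) ((y - x) / 2))"
  define G where "G = (\<lambda>x y. F ((x + y) / 2) ((y - x) / 2))"
  have cW: "continuous_on UNIV (\<lambda>p. W (fst p) (snd p))"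
  proof -
    have "continuous_on UNIV (\<lambda>p::real \<times> real. (\<lambda>p. w (fst p) (snd p)) ((fst p + snd p) / 2, (snd p - fst p) / 2))"
      by (rule continuous_on_compose2[OF continuous_w]) (auto intro!: continuous_intros)
    then show ?thesis by (simp add: W_def)
  qed
  have cG: "continuous_on UNIV (\<lambda>p. G (fst p) (snd p))"
  proof -
    have "continuous_on UNIV (\<lambda>p::real \<times> real. (\<lambda>p. F (fst p) (snd p)) ((fst p + snd p) / 2, (snd p - fst p) / 2))"
      by (rule continuous_on_compose2[OF continuous_F]) (auto intro!: continuous_intros)
    then show ?thesis by (simp add: G_def)
  qed
  define A where "A = (\<lambda>n x. sstep n 1 a x - sstep n 1 b x)"
  define A1 where "A1 = (\<lambda>n x. sbump n 1 a x - sbump n 1 b x)"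
  define A2 where "A2 = (\<lambda>n x. sbump' n 1 a x - sbump' n 1 b x)"
  define B where "B = (\<lambda>n x. sstep n 0 c x - sstep n 0 d x)"
  define B1 where "B1 = (\<lambda>n x. sbump n 0 c x - sbump n 0 d x)"
  define B2 where "B2 = (\<lambda>n x. sbump' n 0 c x - sbump' n 0 d x)"
  have dA: "(A n has_real_derivative A1 n x) (at x)" "(A1 n has_real_derivative A2 n x) (at x)" for n x
    unfolding A_def A1_def A2_def by (intro derivative_intros sstep_deriv sbump_deriv)+
  have dB: "(B n has_real_derivative B1 n x) (at x)" "(B1 n has_real_derivative B2 n x) (at x)" for n x
    unfolding B_def B1_def B2_def by (intro derivative_intros sstep_deriv sbump_deriv)+
  have cAB: "continuous_on UNIV (A n)" "continuous_on UNIV (B n)" "continuous_on UNIV (A2 n)" "continuous_on UNIV (B2 n)" for n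
    unfolding A_def A2_def B_def B2_def by (intro continuous_intros continuous_sbump)+
  have inv: "1 / real (Suc n) \<le> 1" for n by simp
  have zA: "\<forall>x. x \<notin> {a - 1<..<b} \<longrightarrow> A n x = 0" "\<forall>x. x \<notin> {a - 1<..<b} \<longrightarrow> A1 n x = 0"
    "\<forall>x. x \<notin> {a - 1<..<b} \<longrightarrow> A2 n x = 0" for n
  proof -
    show "\<forall>x. x \<notin> {a - 1<..<b} \<longrightarrow> A n x = 0" using sstep_difference(2)[OF ab, of 1] by (simp add: A_def)
    have o: "x \<le> q - 1 / real (Suc n) \<or> q + (1 - 1) / real (Suc n) \<le> x" if "x \<notin> {a - 1<..<b}" "a \<le> q" "q \<le> b" for x q
    proof (cases "x \<le> a - 1")
      case True
      then have "x \<le> q - 1 / real (Suc n)" using that inv[of n] by linarith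
      then show ?thesis ..
    next
      case False
      then show ?thesis using that by auto
    qed
    show "\<forall>x. x \<notin> {a - 1<..<b} \<longrightarrow> A1 n x = 0" "\<forall>x. x \<notin> {a - 1<..<b} \<longrightarrow> A2 n x = 0"
      unfolding A1_def A2_def using sbump_out[OF o[of _ a]] sbump_out[OF o[of _ b]] ab by simp_all
  qed
  have zB: "\<forall>x. x \<notin> {c<..<d + 1} \<longrightarrow> B n x = 0" "\<forall>x. x \<notin> {c<..<d + 1} \<longrightarrow> B1 n x = 0"
    "\<forall>x. x \<notin> {c<..<d + 1} \<longrightarrow> B2 n x = 0" for n
  proof -
    show "\<forall>x. x \<notin> {c<..<d + 1} \<longrightarrow> B n x = 0" using sstep_difference(2)[OF cd, of 0] by (simp add: B_def)
    have o: "x \<le> q - 0 / real (Suc n) \<or> q + (1 - 0) / real (Suc n) \<le> x" if "x \<notin> {c<..<d + 1}" "c \<le> q" "q \<le> d" for x q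
    proof (cases "x \<le> c")
      case True
      then show ?thesis using that by auto
    next
      case False
      then have "d + 1 \<le> x" using that by auto
      then have "q + 1 / real (Suc n) \<le> x" using that inv[of n] by linarith
      then show ?thesis by simp
    qed
    show "\<forall>x. x \<notin> {c<..<d + 1} \<longrightarrow> B1 n x = 0" "\<forall>x. x \<notin> {c<..<d + 1} \<longrightarrow> B2 n x = 0"
      unfolding B1_def B2_def using sbump_out[OF o[of _ c]] sbump_out[OF o[of _ d]] cd by simp_all
  qed
  let ?P = "lborel \<Otimes>\<^sub>M lborel :: (real \<times> real) measure"
  \<comment> \<open>One approximate point evaluation of \<open>W\<close> per corner; expanding the
    product of \<open>A1\<close> and \<open>B1\<close> yields the four of them with their
    signs.\<close>
  define s where "s = (\<lambda>n p q. \<integral>(x, y). sbump n 1 p x * sbump n 0 q y * W x y \<partial>?P)"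
  have sl: "(\<lambda>n. s n p q) \<longlonglongrightarrow> W p q" for p q unfolding s_def by (rule approx_identity_2d(1)[OF cW])
  have si: "integrable ?P (\<lambda>(x, y). sbump n 1 p x * sbump n 0 q y * W x y)" for n p q by (rule approx_identity_2d(2)[OF cW])
  have i1: "integrable ?P (\<lambda>(x, y). A1 n x * B1 n y * W x y)"
    and I1: "(\<integral>(x, y). A1 n x * B1 n y * W x y \<partial>?P) = s n a c - s n b c - s n a d + s n b d" for n
  proof -
    define h where "h = (\<lambda>p q (x, y). sbump n 1 p x * sbump n 0 q y * W x y)"
    have hi: "integrable ?P (h p q)" for p q using si by (simp add: h_def)
    have e: "(\<lambda>(x, y). A1 n x * B1 n y * W x y) = (\<lambda>z. h a c z - h b c z - h a d z + h b d z)"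
      by (auto simp: fun_eq_iff A1_def B1_def h_def algebra_simps)
    show "integrable ?P (\<lambda>(x, y). A1 n x * B1 n y * W x y)"
      unfolding e by (intro Bochner_Integration.integrable_add Bochner_Integration.integrable_diff hi)
    have "(\<integral>(x, y). A1 n x * B1 n y * W x y \<partial>?P) = (\<integral>z. h a c z \<partial>?P) - (\<integral>z. h b c z \<partial>?P) - (\<integral>z. h a d z \<partial>?P) + (\<integral>z. h b d z \<partial>?P)"
      unfolding e by (simp add: hi)
    then show "(\<integral>(x, y). A1 n x * B1 n y * W x y \<partial>?P) = s n a c - s n b c - s n a d + s n b d"
      by (simp add: s_def h_def)
  qed
  define T where "T = \<bar>a\<bar> + \<bar>b\<bar> + \<bar>c\<bar> + \<bar>d\<bar> + 1"
  have i2: "integrable ?P (\<lambda>(x, y). A n x * B n y * G x y)" for n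
  proof (rule integrable_R2[where T = T])
    show "continuous_on UNIV (\<lambda>p. A n (fst p) * B n (snd p) * G (fst p) (snd p))"
      by (intro continuous_intros cG continuous_on_compose2[OF cAB(1)] continuous_on_compose2[OF cAB(2)]) auto
    fix x y assume xy: "\<bar>x\<bar> > T \<or> \<bar>y\<bar> > T"
    have "x \<notin> {a - 1<..<b} \<or> y \<notin> {c<..<d + 1}"
      using xy unfolding T_def greaterThanLessThan_iff by linarith
    then show "A n x * B n y * G x y = 0" using zA(1) zB(1) by auto
  qed
  have lim2: "(\<lambda>n. \<integral>(x, y). A n x * B n y * G x y \<partial>?P) \<longlonglongrightarrow> (\<integral>(x, y). indicator {a..<b} x * indicator {c<..d} y * G x y \<partial>?P)"
  proof (rule integral_dominated_convergence[where w = "\<lambda>p. \<bar>indicator ({a - 1..b} \<times> {c..d + 1}) p *\<^sub>R G (fst p) (snd p)\<bar>"])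
    show "(\<lambda>(x, y). indicator {a..<b} x * indicator {c<..d} y * G x y) \<in> borel_measurable ?P"
      using integral_characteristic_rectangle(2)[OF continuous_F \<delta> \<sigma>, of t r]
      unfolding a_def b_def c_def d_def G_def by (rule borel_measurable_integrable)
    show "(\<lambda>(x, y). A n x * B n y * G x y) \<in> borel_measurable ?P" for n using i2 by (rule borel_measurable_integrable)
    have "integrable lborel (\<lambda>p::real \<times> real. indicator ({a - 1..b} \<times> {c..d + 1}) p *\<^sub>R G (fst p) (snd p))"
      by (rule borel_integrable_compact) (auto intro!: compact_Times continuous_on_subset[OF cG])
    then show "integrable ?P (\<lambda>p. \<bar>indicator ({a - 1..b} \<times> {c..d + 1}) p *\<^sub>R G (fst p) (snd p)\<bar>)"
      unfolding lborel_prod by (rule integrable_abs)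
    show "AE p in ?P. (\<lambda>n. case p of (x, y) \<Rightarrow> A n x * B n y * G x y) \<longlonglongrightarrow> (case p of (x, y) \<Rightarrow> indicator {a..<b} x * indicator {c<..d} y * G x y)"
      unfolding A_def B_def case_prod_unfold
      by (intro AE_I2 tendsto_intros sstep_difference_tendsto ab cd)
    show "AE p in ?P. norm (case p of (x, y) \<Rightarrow> A n x * B n y * G x y) \<le> \<bar>indicator ({a - 1..b} \<times> {c..d + 1}) p *\<^sub>R G (fst p) (snd p)\<bar>" for n
    proof (rule AE_I2)
      fix p :: "real \<times> real"
      obtain x y where p: "p = (x, y)" by (cases p)
      have "\<bar>A n x\<bar> * \<bar>B n y\<bar> * \<bar>G x y\<bar> \<le> indicator ({a - 1..b} \<times> {c..d + 1}) (x, y) * \<bar>G x y\<bar>"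
      proof (cases "x \<in> {a - 1<..<b} \<and> y \<in> {c<..<d + 1}")
        case True
        have "\<bar>A n x\<bar> \<le> 1" "\<bar>B n y\<bar> \<le> 1"
          unfolding A_def B_def by (rule sstep_difference(1)[OF ab] sstep_difference(1)[OF cd]; simp)+
        then have "\<bar>A n x\<bar> * \<bar>B n y\<bar> * \<bar>G x y\<bar> \<le> 1 * 1 * \<bar>G x y\<bar>"
          by (intro mult_right_mono mult_mono) auto
        then show ?thesis using True by simp
      next
        case False
        then have "A n x = 0 \<or> B n y = 0" using zA(1) zB(1) by blast
        then show ?thesis by auto
      qed
      then show "norm (case p of (x, y) \<Rightarrow> A n x * B n y * G x y) \<le> \<bar>indicator ({a - 1..b} \<times> {c..d + 1}) p *\<^sub>R G (fst p) (snd p)\<bar>"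
        unfolding p by (simp add: abs_mult)
    qed
  qed
  have eqn: "4 * (s n a c - s n b c - s n a d + s n b d) + (\<integral>(x, y). A n x * B n y * G x y \<partial>?P) = 0" for n
  proof -
    have "0 = (\<integral>(x, y). 4 * (A1 n x * B1 n y * W x y) + A n x * B n y * G x y \<partial>?P)"
      unfolding W_def G_def by (rule char_weak[OF dA dB cAB(3,4) zA zB bc, symmetric])
    also have "(\<lambda>(x, y). 4 * (A1 n x * B1 n y * W x y) + A n x * B n y * G x y)
      = (\<lambda>z. 4 * (case z of (x, y) \<Rightarrow> A1 n x * B1 n y * W x y) + (case z of (x, y) \<Rightarrow> A n x * B n y * G x y))"
      by (auto simp: fun_eq_iff)
    also have "integral\<^sup>L ?P \<dots> = 4 * (\<integral>(x, y). A1 n x * B1 n y * W x y \<partial>?P) + (\<integral>(x, y). A n x * B n y * G x y \<partial>?P)"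
      by (subst Bochner_Integration.integral_add[OF integrable_mult_right[OF i1] i2]) (simp only: integral_mult_right_zero)
    finally show ?thesis unfolding I1 by simp
  qed
  have "(\<lambda>n. 4 * (s n a c - s n b c - s n a d + s n b d) + (\<integral>(x, y). A n x * B n y * G x y \<partial>?P))
     \<longlonglongrightarrow> 4 * (W a c - W b c - W a d + W b d) + (\<integral>(x, y). indicator {a..<b} x * indicator {c<..d} y * G x y \<partial>?P)"
    by (intro tendsto_intros sl lim2)
  then have e1: "4 * (W a c - W b c - W a d + W b d) + (\<integral>(x, y). indicator {a..<b} x * indicator {c<..d} y * G x y \<partial>?P) = 0"
    unfolding eqn by (simp add: LIMSEQ_const_iff)
  have e2: "(\<integral>(x, y). indicator {a..<b} x * indicator {c<..d} y * G x y \<partial>?P)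
     = 4 * integral {0..\<delta>} (\<lambda>b. integral {0..\<sigma>} (\<lambda>a. F (t + a - b) (r + a + b)))"
    unfolding a_def b_def c_def d_def G_def by (rule integral_characteristic_rectangle(1)[OF continuous_F \<delta> \<sigma>])
  have e3: "W a c = w (t - \<delta>) (r + \<delta>)" "W b c = w t r" "W a d = w (t + \<sigma> - \<delta>) (r + \<sigma> + \<delta>)" "W b d = w (t + \<sigma>) (r + \<sigma>)"
    unfolding W_def a_def b_def c_def d_def by (rule arg_cong2[where f = w]; simp add: field_simps)+
  define J where "J = integral {0..\<delta>} (\<lambda>b. integral {0..\<sigma>} (\<lambda>a. F (t + a - b) (r + a + b)))"
  have arith: "q2 - q4 - q1 + q3 = j" if "4 * (q1 - q2 - q3 + q4) + 4 * j = 0" for q1 q2 q3 q4 j :: real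
    using that by (simp add: algebra_simps)
  have "4 * (w (t - \<delta>) (r + \<delta>) - w t r - w (t + \<sigma> - \<delta>) (r + \<sigma> + \<delta>) + w (t + \<sigma>) (r + \<sigma>)) + 4 * J = 0"
    using e1 unfolding e2 e3 J_def .
  then show ?thesis unfolding J_def[symmetric] by (rule arith)
qed

lemma diamond_w: "diamond_identity w (\<lambda>t r. w t r ^ 5 / r ^ 4)"
  unfolding diamond_identity_def
proof (intro allI impI)
  fix t r \<sigma> \<delta> :: real assume h: "1 \<le> r" "0 \<le> \<sigma>" "0 \<le> \<delta>"
  have "integral {0..\<delta>} (\<lambda>b. integral {0..\<sigma>} (\<lambda>a. F (t + a - b) (r + a + b)))
    = integral {0..\<delta>} (\<lambda>b. integral {0..\<sigma>} (\<lambda>a. w (t + a - b) (r + a + b) ^ 5 / (r + a + b) ^ 4))"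
    using h by (intro Henstock_Kurzweil_Integration.integral_cong) (simp add: F_def max_def)
  with diamond_F[OF h] show "w t r - w (t + \<sigma>) (r + \<sigma>) - w (t - \<delta>) (r + \<delta>) + w (t + \<sigma> - \<delta>) (r + \<sigma> + \<delta>)
    = integral {0..\<delta>} (\<lambda>b. integral {0..\<sigma>} (\<lambda>a. w (t + a - b) (r + a + b) ^ 5 / (r + a + b) ^ 4))"
    by (simp only:)
qed

end

section \<open>Rigidity\<close>

context compact_solution
begin

lemma continuous_w_ext: "continuous_on (UNIV \<times> {1..}) (\<lambda>(t, r). w t r)"
  using continuous_on_subset[OF continuous_w] by (simp add: case_prod_unfold)

text \<open>A step along the characteristic splits into a step in the radius and a step in time, and
  both increments are uniformly small at large radii.\<close>

lemma w_outgoing: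
  assumes d: "0 \<le> \<delta>" and e: "0 < e"
  shows "\<exists>R. \<forall>t r. R \<le> r \<longrightarrow> \<bar>w t r - w (t - \<delta>) (r + \<delta>)\<bar> \<le> e"
proof -
  obtain R1 where R1: "\<And>t r. R1 \<le> r \<Longrightarrow> \<bar>w t r - w t (r + \<delta>)\<bar> \<le> e / 2"
    using w_space[OF d, of "e / 2"] e by auto
  obtain R2 where R2: "\<And>t r. R2 \<le> r \<Longrightarrow> \<bar>w (t + - \<delta>) r - w t r\<bar> \<le> e / 2"
    using w_time[of "e / 2" "- \<delta>"] e by auto
  have "\<bar>w t r - w (t - \<delta>) (r + \<delta>)\<bar> \<le> e" if "max R1 R2 \<le> r" for t r
  proof -
    have "R2 \<le> r + \<delta>" "R1 \<le> r" using that d by auto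
    then have "\<bar>w t r - w t (r + \<delta>)\<bar> \<le> e / 2" "\<bar>w (t - \<delta>) (r + \<delta>) - w t (r + \<delta>)\<bar> \<le> e / 2"
      using R1[of r t] R2[of "r + \<delta>" t] by simp_all
    then show ?thesis by linarith
  qed
  then show ?thesis by blast
qed

lemma w_quarter: "\<exists>C\<ge>0. \<forall>t r. 1 \<le> r \<longrightarrow> \<bar>w t r\<bar> \<le> C * r powr (1/4)"
proof -
  obtain M where M: "\<And>t r. 1 \<le> r \<Longrightarrow> \<bar>w t r\<bar> \<le> M * sqrt r" using w_sqrt_bound by blast
  show ?thesis by (rule growth_quarter[OF continuous_w_ext diamond_w M w_small w_outgoing])
qed

lemma w_stationary:
  assumes r: "1 \<le> r"
  shows "w t r = w 0 r"
proof -
  obtain C where C: "0 \<le> C" "\<And>t r. 1 \<le> r \<Longrightarrow> \<bar>w t r\<bar> \<le> C * r powr (1/4)" using w_quarter by blast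
  show ?thesis by (rule stationary[OF continuous_w_ext diamond_w C w_time r])
qed

text \<open>The cut-off \<beta>, with \<phi> = r \<beta>, equals 1 at the sphere, so the test sees
  the boundary condition encoded in the weak formulation. For a stationary profile the double
  integral factors: \<alpha>'' integrates to 0 and \<alpha> to a positive number, which leaves the
  radial identity. \<phi>2 is the second derivative of \<phi>.\<close>

lemma weak_neumann:
  fixes \<phi> \<phi>2 :: "real \<Rightarrow> real"
  defines "\<phi> \<equiv> \<lambda>r. r * (1 - smoothstep (r - 1))" and "\<phi>2 \<equiv> \<lambda>r. - 2 * bump (r - 1) - r * bump' (r - 1)"
  shows "integral {1..2} (\<lambda>r. w 0 r ^ 5 / r ^ 4 * \<phi> r - w 0 r * \<phi>2 r) = 0"
proof -
  \<comment> \<open>The cube makes \<alpha> twice continuously differentiable across |t| =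
    1.\<close>
  define \<alpha> where "\<alpha> = (\<lambda>t::real. (max 0 (1 - t ^ 2)) ^ 3)"
  define \<alpha>1 where "\<alpha>1 = (\<lambda>t::real. - 6 * t * (max 0 (1 - t ^ 2)) ^ 2)"
  define \<alpha>2 where "\<alpha>2 = (\<lambda>t::real. - 6 * (max 0 (1 - t ^ 2)) ^ 2 + 24 * t ^ 2 * max 0 (1 - t ^ 2))"
  have dt: "((\<lambda>t::real. 1 - t ^ 2) has_real_derivative (- 2 * t)) (at t)" for t
    by (auto intro!: derivative_eq_intros)
  have d3: "((\<lambda>t::real. (max 0 (1 - t ^ 2)) ^ 3) has_real_derivative 3 * (max 0 (1 - t ^ 2)) ^ 2 * (- 2 * t)) (at t)" for t
    using DERIV_chain2[OF max0_power_deriv[of 1 "1 - t ^ 2"] dt] by (simp add: eval_nat_numeral)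
  have d2: "((\<lambda>t::real. (max 0 (1 - t ^ 2)) ^ 2) has_real_derivative 2 * max 0 (1 - t ^ 2) * (- 2 * t)) (at t)" for t
    using DERIV_chain2[OF max0_power_deriv[of 0 "1 - t ^ 2"] dt] by (simp add: eval_nat_numeral)
  have d\<alpha>: "(\<alpha> has_real_derivative \<alpha>1 t) (at t)" for t
    unfolding \<alpha>_def \<alpha>1_def by (rule DERIV_cong[OF d3]) (simp add: algebra_simps)
  have d\<alpha>1: "(\<alpha>1 has_real_derivative \<alpha>2 t) (at t)" for t
  proof -
    have "((\<lambda>t::real. - 6 * t) has_real_derivative - 6) (at t)" by (auto intro!: derivative_eq_intros)
    from DERIV_mult[OF this d2] show ?thesis
      unfolding \<alpha>1_def \<alpha>2_def by (rule DERIV_cong) (simp add: power2_eq_square)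
  qed
  have c\<alpha>: "continuous_on UNIV \<alpha>" "continuous_on UNIV \<alpha>1" "continuous_on UNIV \<alpha>2"
    unfolding \<alpha>_def \<alpha>1_def \<alpha>2_def by (intro continuous_intros)+
  have m0: "max 0 (1 - t ^ 2) = 0" if "\<bar>t\<bar> > 1" for t :: real
  proof -
    have "1 ^ 2 \<le> \<bar>t\<bar> ^ 2" using that by (intro power_mono) auto
    then show ?thesis by simp
  qed
  have z\<alpha>: "\<alpha> t = 0" "\<alpha>1 t = 0" "\<alpha>2 t = 0" if "\<bar>t\<bar> > 1" for t
    unfolding \<alpha>_def \<alpha>1_def \<alpha>2_def by (simp_all add: m0[OF that] del: max.absorb_iff1 max.absorb_iff2)
  define \<beta> where "\<beta> = (\<lambda>r::real. 1 - smoothstep (r - 1))"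
  define \<beta>1 where "\<beta>1 = (\<lambda>r::real. - bump (r - 1))"
  define \<beta>2 where "\<beta>2 = (\<lambda>r::real. - bump' (r - 1))"
  have d\<beta>: "(\<beta> has_real_derivative \<beta>1 r) (at r)" "(\<beta>1 has_real_derivative \<beta>2 r) (at r)" for r
    unfolding \<beta>_def \<beta>1_def \<beta>2_def
    by (auto intro!: derivative_eq_intros DERIV_chain2[OF smoothstep_deriv, THEN DERIV_cong] DERIV_chain2[OF bump_deriv, THEN DERIV_cong])
  have c\<beta>: "continuous_on S \<beta>" "continuous_on S \<beta>1" "continuous_on S \<beta>2" for S
    unfolding \<beta>_def \<beta>1_def \<beta>2_def
    by (intro continuous_intros continuous_on_compose2[OF continuous_bump(1)] continuous_on_compose2[OF continuous_bump(2)] continuous_on_compose2[OF continuous_bump(3)]; simp)+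
  have \<beta>in: "\<beta> r = 1" "\<beta>1 r = 0" "\<beta>2 r = 0" if "r \<le> 1" for r
    using that by (simp_all add: \<beta>_def \<beta>1_def \<beta>2_def smoothstep_0 bump_out)
  have \<beta>out: "\<beta> r = 0" "\<beta>1 r = 0" "\<beta>2 r = 0" if "2 \<le> r" for r
    using that by (simp_all add: \<beta>_def \<beta>1_def \<beta>2_def smoothstep_1 bump_out)
  have r0: "rtest (\<lambda>t r. \<alpha> t * \<beta> r) (\<lambda>t r. \<alpha>1 t * \<beta> r) (\<lambda>t r. \<alpha> t * \<beta>1 r)"
    by (rule rtest_prod[OF d\<alpha> c\<alpha>(2) z\<alpha>(1,2) d\<beta>(1) c\<beta>(2), where R = 2]) (simp_all add: \<beta>in \<beta>out)
  have r1: "rtest (\<lambda>t r. \<alpha>1 t * \<beta> r) (\<lambda>t r. \<alpha>2 t * \<beta> r) (\<lambda>t r. \<alpha>1 t * \<beta>1 r)"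
    by (rule rtest_prod[OF d\<alpha>1 c\<alpha>(3) z\<alpha>(2,3) d\<beta>(1) c\<beta>(2), where R = 2]) (simp_all add: \<beta>in \<beta>out)
  define \<gamma> where "\<gamma> = (\<lambda>t r. r ^ 2 * (\<alpha> t * \<beta>1 r))"
  define \<gamma>' where "\<gamma>' = (\<lambda>t r. \<alpha> t * (2 * r * \<beta>1 r + r ^ 2 * \<beta>2 r))"
  have d\<gamma>: "(\<gamma> t has_real_derivative \<gamma>' t r) (at r)" for t r
    unfolding \<gamma>_def \<gamma>'_def by (auto intro!: derivative_eq_intros d\<beta>(2)) (simp add: algebra_simps)
  have c\<gamma>': "continuous_on UNIV (\<lambda>p. \<gamma>' (fst p) (snd p))"
    unfolding \<gamma>'_def
    by (intro continuous_intros continuous_on_compose2[OF c\<alpha>(1)] continuous_on_compose2[OF c\<beta>(2)[of UNIV]] continuous_on_compose2[OF c\<beta>(3)[of UNIV]]; simp)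
  have s\<gamma>': "\<gamma>' t r = 0" if "\<bar>t\<bar> > 1 \<or> r > 2" for t r
    using that z\<alpha>(1)[of t] \<beta>out[of r] by (auto simp: \<gamma>'_def)
  have \<gamma>eq: "\<gamma> t r = r ^ 2 * (\<alpha> t * \<beta>1 r)" for t r by (simp add: \<gamma>_def)
  define q1 where "q1 = (\<lambda>r. v 0 r * (r ^ 2 * \<beta> r))"
  define q2 where "q2 = (\<lambda>r. - (v 0 r * (2 * r * \<beta>1 r + r ^ 2 * \<beta>2 r)) + v 0 r ^ 5 * (r ^ 2 * \<beta> r))"
  have vst: "v t r = v 0 r" if "1 \<le> r" for t r using w_stationary[OF that, of t] that by (simp add: w_def)
  have eq: "(\<lambda>(t, r). indicator {1..} r * (v t r * (r ^ 2 * (\<alpha>2 t * \<beta> r) - \<gamma>' t r) + v t r ^ 5 * (r ^ 2 * (\<alpha> t * \<beta> r))))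
     = (\<lambda>(t, r). \<alpha>2 t * (indicator {1..} r * q1 r) + \<alpha> t * (indicator {1..} r * q2 r))"
  proof (rule ext, clarify)
    fix t r
    show "indicator {1..} r * (v t r * (r ^ 2 * (\<alpha>2 t * \<beta> r) - \<gamma>' t r) + v t r ^ 5 * (r ^ 2 * (\<alpha> t * \<beta> r)))
       = \<alpha>2 t * (indicator {1..} r * q1 r) + \<alpha> t * (indicator {1..} r * q2 r)"
    proof (cases "1 \<le> r")
      case True
      then show ?thesis using vst[OF True, of t]
        by (simp add: q1_def q2_def \<gamma>'_def algebra_simps)
    qed simp
  qed
  have int: "(\<integral>(t, r). \<alpha>2 t * (indicator {1..} r * q1 r) + \<alpha> t * (indicator {1..} r * q2 r) \<partial>(lborel \<Otimes>\<^sub>M lborel)) = 0"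
    and intg: "integrable (lborel \<Otimes>\<^sub>M lborel) (\<lambda>(t, r). \<alpha>2 t * (indicator {1..} r * q1 r) + \<alpha> t * (indicator {1..} r * q2 r))"
    using weak_form_radial[OF r0 r1 \<gamma>eq d\<gamma> c\<gamma>' s\<gamma>'] unfolding eq by simp_all
  have cq: "continuous_on UNIV q1" "continuous_on UNIV q2"
    unfolding q1_def q2_def by (intro continuous_intros continuous_v_r c\<beta>)+
  have qout: "q1 r = 0" "q2 r = 0" if "2 \<le> r" for r using \<beta>out[OF that] by (simp_all add: q1_def q2_def)
  have Iq: "(\<integral>r. indicator {1..} r * q r \<partial>lborel) = integral {1..2} q" "integrable lborel (\<lambda>r. indicator {1..} r * q r)"
    if "continuous_on UNIV q" "\<And>r. 2 \<le> r \<Longrightarrow> q r = 0" for q :: "real \<Rightarrow> real"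
  proof -
    have e: "(\<lambda>r. indicator {1..} r * q r) = (\<lambda>r. indicator {1..2} r *\<^sub>R q r)"
    proof
      fix r show "indicator {1..} r * q r = indicator {1..2} r *\<^sub>R q r"
        using that(2)[of r] by (cases "2 \<le> r") (auto simp: indicator_def)
    qed
    have i: "integrable lborel (\<lambda>r. indicator {1..2} r *\<^sub>R q r)"
      by (rule borel_integrable_compact) (auto intro: continuous_on_subset[OF that(1)])
    then show "integrable lborel (\<lambda>r. indicator {1..} r * q r)" unfolding e .
    show "(\<integral>r. indicator {1..} r * q r \<partial>lborel) = integral {1..2} q"
      unfolding e using set_borel_integral_eq_integral(2)[of "{1..2}" q] i
      by (simp add: set_integrable_def set_lebesgue_integral_def)
  qed
  define c1 where "c1 = integral {1..2} q1"
  define c2 where "c2 = integral {1..2} q2"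
  have i1: "integrable lborel \<alpha>2"
    by (rule integrable_continuous_compact_support[OF c\<alpha>(3), of "-1" 1]) (rule z\<alpha>(3), auto)
  have i0: "integrable lborel \<alpha>"
    by (rule integrable_continuous_compact_support[OF c\<alpha>(1), of "-1" 1]) (rule z\<alpha>(1), auto)
  have "(\<integral>t. (\<integral>r. \<alpha>2 t * (indicator {1..} r * q1 r) + \<alpha> t * (indicator {1..} r * q2 r) \<partial>lborel) \<partial>lborel) = 0"
    using lborel_pair.integral_fst[OF intg] int by simp
  moreover have "(\<integral>r. \<alpha>2 t * (indicator {1..} r * q1 r) + \<alpha> t * (indicator {1..} r * q2 r) \<partial>lborel) = \<alpha>2 t * c1 + \<alpha> t * c2" for t
    using Iq[OF cq(1) qout(1)] Iq[OF cq(2) qout(2)] by (simp add: c1_def c2_def)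
  ultimately have "(\<integral>t. \<alpha>2 t * c1 + \<alpha> t * c2 \<partial>lborel) = 0" by simp
  then have sum: "(\<integral>t. \<alpha>2 t \<partial>lborel) * c1 + (\<integral>t. \<alpha> t \<partial>lborel) * c2 = 0" using i0 i1 by simp
  have "(\<integral>t. \<alpha>2 t \<partial>lborel) = 0"
  proof -
    have "(\<integral>x. \<alpha>2 x * indicator {- 2..2} x \<partial>lborel) = \<alpha>1 2 - \<alpha>1 (- 2)"
      by (rule integral_Icc_FTC(1)[OF _ d\<alpha>1 c\<alpha>(3)]) simp
    moreover have "(\<lambda>x. \<alpha>2 x * indicator {- 2..2} x) = \<alpha>2"
    proof
      fix x show "\<alpha>2 x * indicator {- 2..2} x = \<alpha>2 x"
        using z\<alpha>(3)[of x] by (cases "\<bar>x\<bar> > 1") (auto simp: indicator_def abs_le_iff not_less)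
    qed
    ultimately show ?thesis using z\<alpha>(2)[of 2] z\<alpha>(2)[of "-2"] by simp
  qed
  moreover have "0 < (\<integral>t. \<alpha> t \<partial>lborel)"
  proof -
    have "(\<integral>t. (3/4) ^ 3 * indicator {- (1/2)..1/2::real} t \<partial>lborel) \<le> (\<integral>t. \<alpha> t \<partial>lborel)"
    proof (rule integral_mono[OF _ i0])
      show "integrable lborel (\<lambda>t. (3/4) ^ 3 * indicator {- (1/2)..1/2::real} t :: real)"
        by (intro integrable_mult_right integrable_real_indicator) auto
      show "(3/4) ^ 3 * indicator {- (1/2)..1/2} t \<le> \<alpha> t" for t
      proof (cases "t \<in> {- (1/2)..1/2}")
        case True
        then have "\<bar>t\<bar> ^ 2 \<le> (1/2) ^ 2" by (intro power_mono) (auto simp: abs_le_iff)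
        then have "3/4 \<le> max 0 (1 - t ^ 2)" by (simp add: power2_eq_square)
        then have "(3/4) ^ 3 \<le> max 0 (1 - t ^ 2) ^ 3" by (rule power_mono) simp
        moreover have "indicator {- (1/2)..1/2} t = (1::real)" using True by simp
        ultimately show ?thesis by (simp only: \<alpha>_def mult_1_right)
      qed (simp add: \<alpha>_def)
    qed
    then have "(3/4) ^ 3 \<le> (\<integral>t. \<alpha> t \<partial>lborel)" by simp
    moreover have "(0::real) < (3/4) ^ 3" by simp
    ultimately show ?thesis by linarith
  qed
  ultimately have "c2 = 0" using sum by simp
  moreover have "c2 = integral {1..2} (\<lambda>r. w 0 r ^ 5 / r ^ 4 * \<phi> r - w 0 r * \<phi>2 r)"
    unfolding c2_def
  proof (rule Henstock_Kurzweil_Integration.integral_cong)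
    fix r :: real assume "r \<in> {1..2}"
    then have r: "r \<noteq> 0" by auto
    have "w 0 r ^ 5 / r ^ 4 * \<phi> r = v 0 r ^ 5 * (r ^ 2 * \<beta> r)"
      using r by (simp add: w_def \<phi>_def \<beta>_def power_mult_distrib eval_nat_numeral)
    moreover have "w 0 r * \<phi>2 r = v 0 r * (2 * r * \<beta>1 r + r ^ 2 * \<beta>2 r)"
      by (simp add: w_def \<phi>2_def \<beta>1_def \<beta>2_def power2_eq_square algebra_simps)
    ultimately show "q2 r = w 0 r ^ 5 / r ^ 4 * \<phi> r - w 0 r * \<phi>2 r" by (simp add: q2_def)
  qed
  ultimately show ?thesis by simp
qed

lemma w_zero:
  assumes r: "1 \<le> r"
  shows "w t r = 0"
proof -
  obtain C where C: "0 \<le> C" "\<And>t r. 1 \<le> r \<Longrightarrow> \<bar>w t r\<bar> \<le> C * r powr (1/4)" using w_quarter by blast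
  define g where "g = (\<lambda>r. w 0 r ^ 5 / r ^ 4)"
  have cw: "continuous_on {1..} (w 0)" unfolding w_def
    by (intro continuous_intros continuous_on_subset[OF continuous_v_r]) auto
  have cg: "continuous_on {1..} g" unfolding g_def by (intro continuous_intros cw) auto
  have dia: "diamond_identity (\<lambda>_. w 0) (\<lambda>_. g)"
    unfolding diamond_identity_def
  proof (intro allI impI)
    fix t r \<sigma> \<delta> :: real assume h: "1 \<le> r" "0 \<le> \<sigma>" "0 \<le> \<delta>"
    have "integral {0..\<delta>} (\<lambda>b. integral {0..\<sigma>} (\<lambda>a. w (t + a - b) (r + a + b) ^ 5 / (r + a + b) ^ 4))
      = integral {0..\<delta>} (\<lambda>b. integral {0..\<sigma>} (\<lambda>a. g (r + a + b)))"
    proof (intro Henstock_Kurzweil_Integration.integral_cong)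
      fix a b assume "b \<in> {0..\<delta>}" "a \<in> {0..\<sigma>}"
      then have "1 \<le> r + a + b" using h by auto
      then show "w (t + a - b) (r + a + b) ^ 5 / (r + a + b) ^ 4 = g (r + a + b)"
        using w_stationary[of "r + a + b" "t + a - b"] by (simp add: g_def)
    qed
    moreover have "w t r = w 0 r" "w (t + \<sigma>) (r + \<sigma>) = w 0 (r + \<sigma>)" "w (t - \<delta>) (r + \<delta>) = w 0 (r + \<delta>)"
      "w (t + \<sigma> - \<delta>) (r + \<sigma> + \<delta>) = w 0 (r + \<sigma> + \<delta>)"
      using h by (intro w_stationary; simp)+
    ultimately show "w 0 r - w 0 (r + \<sigma>) - w 0 (r + \<delta>) + w 0 (r + \<sigma> + \<delta>) = integral {0..\<delta>} (\<lambda>b. integral {0..\<sigma>} (\<lambda>a. g (r + a + b)))"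
      using diamond_w[unfolded diamond_identity_def, rule_format, OF h, of t] by (simp only:)
  qed
  \<comment> \<open>\<open>Y\<close> takes the place of \<open>w 0\<close> because it has two-sided
    derivatives at the radius 1, where \<open>w 0\<close> is continued by the constant boundary
    value of \<open>v\<close>.\<close>
  obtain Y Y1 where Y: "\<And>x. 1 \<le> x \<Longrightarrow> Y x = w 0 x" "\<And>x. 1 \<le> x \<Longrightarrow> (Y has_real_derivative Y1 x) (at x)"
    "\<And>x. 1 \<le> x \<Longrightarrow> (Y1 has_real_derivative g x) (at x)"
    using stationary_twice_differentiable[OF cw cg dia] by blast
  define \<phi> where "\<phi> = (\<lambda>r. r * (1 - smoothstep (r - 1)))"
  define \<phi>1 where "\<phi>1 = (\<lambda>r. (1 - smoothstep (r - 1)) - r * bump (r - 1))"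
  define \<phi>2 where "\<phi>2 = (\<lambda>r. - 2 * bump (r - 1) - r * bump' (r - 1))"
  have d\<phi>: "(\<phi> has_real_derivative \<phi>1 x) (at x)" "(\<phi>1 has_real_derivative \<phi>2 x) (at x)" for x
    unfolding \<phi>_def \<phi>1_def \<phi>2_def
    by (auto intro!: derivative_eq_intros DERIV_chain2[OF smoothstep_deriv, THEN DERIV_cong] DERIV_chain2[OF bump_deriv, THEN DERIV_cong])
  have neumann: "Y1 1 = Y 1"
  proof (rule neumann_from_test[where b = 2 and Y = Y and ?Y1.0 = Y1 and g = g and \<phi> = \<phi> and ?\<phi>1.0 = \<phi>1 and ?\<phi>2.0 = \<phi>2])
    have "integral {1..2} (\<lambda>x. g x * \<phi> x - Y x * \<phi>2 x) = integral {1..2} (\<lambda>r. w 0 r ^ 5 / r ^ 4 * \<phi> r - w 0 r * \<phi>2 r)"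
      by (intro Henstock_Kurzweil_Integration.integral_cong) (simp add: g_def Y(1))
    also have "\<dots> = 0" unfolding \<phi>_def \<phi>2_def by (rule weak_neumann)
    finally show "integral {1..2} (\<lambda>x. g x * \<phi> x - Y x * \<phi>2 x) = 0" .
    show "\<phi> 1 = 1" "\<phi>1 1 = 1" "\<phi> 2 = 0" "\<phi>1 2 = 0"
      by (simp_all add: \<phi>_def \<phi>1_def smoothstep_0 smoothstep_1 bump_out)
  qed (simp_all add: Y(2,3) d\<phi>)
  have "Y r = 0"
  proof (rule stationary_neumann_zero[OF Y(2) _ neumann _ r])
    show "(Y1 has_real_derivative Y x ^ 5 / x ^ 4) (at x)" if "1 \<le> x" for x
      using Y(3)[OF that] Y(1)[OF that] by (simp add: g_def)
    show "\<bar>Y x\<bar> \<le> C * x powr (1/4)" if "1 \<le> x" for x using C(2)[OF that, of 0] Y(1)[OF that] by simp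
  qed
  then show ?thesis using Y(1)[OF r] w_stationary[OF r, of t] by simp
qed

lemma u_zero: "AE x in MB. u t x = 0"
  using u_eq_v[of t] AE_space[of MB]
proof eventually_elim
  case (elim x)
  then have "1 \<le> norm x" by (simp add: Bc_def)
  then have "v t (norm x) = 0" using w_zero[of "norm x" t] by (auto simp: w_def)
  with elim show ?case by simp
qed

end

theorem theorem6p1:
  fixes u0 u1 :: "R3 \<Rightarrow> real" and U0 :: "R3 \<Rightarrow> R3"
    and u ut :: "real \<Rightarrow> R3 \<Rightarrow> real" and Du :: "real \<Rightarrow> R3 \<Rightarrow> R3"
  assumes data: "in_H u0 U0 u1"
    and sol: "global_neumann_sol u ut Du u0 u1"
    and cpt: "precompact_traj u ut Du"
  shows "\<forall>t. AE x in lebesgue_on Bc. u t x = 0"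
proof -
  interpret compact_solution u ut Du u0 u1 by unfold_locales (rule sol cpt)+
  show ?thesis using u_zero by blast
qed

end
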